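(* Let $\mathcal A$ be a unital Noetherian domain that is a $\mathcal Z$-algebra. Let $M$ be an object in $\mathcal X=\mathcal X_{\mathcal A}$. Then there exists a unique $U_{\mathcal A}$-module structure on $M$ such that the following holds. - The $X$-grading $M=\bigoplus_{\mu\in X}M_\mu$ is the weight decomposition. - For all $\mu\in X$, $\alpha\in\Pi$, $n>0$, the homomorphisms $E_{\mu,\alpha,n}$ and $F_{\mu,\alpha,n}$ are the action maps of $e_\alpha^{[n]}$ on $M_\mu$ and of $f_\alpha^{[n]}$ on $M_{\mu+n\alpha}$, respectively. From this one obtains a fully faithful functor $\mathsf R\colon\mathcal X\to\mathcal O$, and $\mathsf S\circ\mathsf R\cong\mathrm{id}_{\mathcal X}$.
   Context: Ground data. $\mathcal Z:=\mathbb Z[v,v^{-1}]$; for $n\in\mathbb Z$, $d>0$: $[n]_d:=\frac{v^{dn}-v^{-dn}}{v^d-v^{-d}}\in\mathcal Z$, $[n]_d^!:=[1]_d\cdots[n]_d$ for $n\ge1$, $\left[{n\atop 0}\right]_d:=1$, $\left[{n\atop r}\right]_d:=\frac{[n]_d[n-1]_d\cdots[n-r+1]_d}{[1]_d\cdots[r]_d}\in\mathcal Z$ for $r\ge1$. $R$ is a finite (reduced, crystallographic) root system in a real vector space $V$ with simple roots $\Pi$, coroots $\alpha^\vee$, weight lattice $X=\{\lambda\in V\mid\langle\lambda,\alpha^\vee\rangle\in\mathbb Z\ \forall\alpha\in R\}$; $\mu\le\lambda$ iff $\lambda-\mu$ is a sum of elements of $\Pi$. $(d_\alpha)_{\alpha\in\Pi}$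 has entries in $\{1,2,3\}$, $(d_\alpha\langle\beta,\alpha^\vee\rangle)_{\alpha,\beta\in\Pi}$ is symmetric, and each irreducible component of $R$ contains a simple root $\alpha$ with $d_\alpha=1$. A subset $S\subset X$ is quasi-bounded if for every $\mu\in X$ the set $\{\lambda\in S\mid\mu\le\lambda\}$ is finite. The category $\mathcal X=\mathcal X_{\mathcal A}$. Consider $X$-graded $\mathcal A$-modules $M=\bigoplus_{\mu\in X}M_\mu$ with $\mathcal A$-linear maps $E_{\mu,\alpha,n}\colon M_\mu\to M_{\mu+n\alpha}$, $F_{\mu,\alpha,n}\colon M_{\mu+n\alpha}\to M_\mu$ ($\mu\in X,\alpha\in\Pi,n>0$; the index $\mu$ is often dropped; $E_{\alpha,0}=F_{\alpha,0}=\mathrm{id}$). A weight of $M$ is a $\mu$ with $M_\mu\ne0$. Conditions: (X1) The set of weights is quasi-bounded and each $M_\mu$ is a finitely generated $\mathcal A$-module. (X2) For $\mu\in X$, $\alpha,\beta\in\Pi$, $m,n>0$, $x\in M_{\mu+n\beta}$: $E_{\alpha,m}F_{\beta,n}(x)=F_{\beta,n}E_{\alpha,m}(x)$ if $\alpha\neq\beta$, and $E_{\alpha,m}F_{\alpha,n}(x)=\sum_{r=0}^{\min(m,n)}\left[{\langle\mu,\alpha^\vee\rangle+m+n\atop r}\right]_{d_\alpha}F_{\alpha,n-r}E_{\alpha,m-r}(x)$ if $\alpha=\beta$. (X3) With $M_{\delta\mu}:=\bigoplus_{\alpha\in\Pi,n>0}M_{\mu+n\alpha}$, $E_\mu\colon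 M_\mu\to M_{\delta\mu}$ the column vector with entries $E_{\mu,\alpha,n}$, $F_\mu\colon M_{\delta\mu}\to M_\mu$ the row vector with entries $F_{\mu,\alpha,n}$, $M_{\{\mu\}}:=E_\mu(\operatorname{im}F_\mu)$, $M_{\langle\mu\rangle}:=E_\mu(M_\mu)$, for all $\mu$: (a) $E_\mu|_{\operatorname{im}F_\mu}$ is injective; (b) $M_{\langle\mu\rangle}/M_{\{\mu\}}$ is a torsion $\mathcal A$-module; (c) $M_\mu/\operatorname{im}F_\mu$ is a free $\mathcal A$-module. $\mathcal X$ is the category of such data satisfying (X1)–(X3), $\mathcal X^{\mathrm{pre}}$ the category of such data satisfying (X1), (X2); morphisms are degree-preserving $\mathcal A$-linear maps commuting with all $E$- and $F$-maps. $\mathcal X$ is a full subcategory of $\mathcal X^{\mathrm{pre}}$. Quantum group. Over $\mathbb Q(v)$ take the algebra with generators $e_\alpha,f_\alpha,k_\alpha^{\pm1}$ ($\alpha\in\Pi$) and relations: the $k_\alpha^{\pm1}$ commute, $k_\alpha k_\alpha^{-1}=1$, $k_\alpha e_\beta k_\alpha^{-1}=v^{d_\alpha\langle\beta,\alpha^\vee\rangle}e_\beta$, $k_\alpha f_\beta k_\alpha^{-1}=v^{-d_\alpha\langle\beta,\alpha^\vee\rangle}f_\beta$, $e_\alpha f_\beta-f_\beta e_\alpha=\delta_{\alpha\beta}\frac{k_\alpha-k_\alpha^{-1}}{v^{d_\alpha}-v^{-d_\alpha}}$, and for $\alpha\ne\beta$ the quantum Serre relations $\sum_{r+s=1-\langle\beta,\alpha^\vee\rangle}(-1)^se_\alpha^{[r]}e_\beta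 e_\alpha^{[s]}=0$ and the same for $f$, where $e_\alpha^{[n]}=e_\alpha^n/[n]^!_{d_\alpha}$, $f_\alpha^{[n]}=f_\alpha^n/[n]^!_{d_\alpha}$. $U_{\mathcal Z}$ is the $\mathcal Z$-subalgebra generated by all $e_\alpha^{[n]},f_\alpha^{[n]},k_\alpha^{\pm1}$ (Lusztig's form). It contains $\left[{k_\alpha\atop n}\right]_\alpha=\prod_{s=1}^n\frac{k_\alpha v_\alpha^{-s+1}-k_\alpha^{-1}v_\alpha^{s-1}}{v_\alpha^s-v_\alpha^{-s}}$, $v_\alpha=v^{d_\alpha}$. $U^0_{\mathcal Z}$ is the unital subalgebra generated by the $k_\alpha^{\pm1},\left[{k_\alpha\atop n}\right]_\alpha$; $U_{\mathcal A}=U_{\mathcal Z}\otimes_{\mathcal Z}\mathcal A$, $U^0_{\mathcal A}=U^0_{\mathcal Z}\otimes_{\mathcal Z}\mathcal A$. For $\mu\in X$, $\chi_\mu\colon U^0_{\mathcal A}\to\mathcal A$ is the character with $k_\alpha^{\pm1}\mapsto v_\alpha^{\pm\langle\mu,\alpha^\vee\rangle}$, $\left[{k_\alpha\atop r}\right]_\alpha\mapsto\left[{\langle\mu,\alpha^\vee\rangle\atop r}\right]_{d_\alpha}$. For a $U_{\mathcal A}$-module $M$, $M_\mu=\{m\mid Hm=\chi_\mu(H)m\ \forall H\in U^0_{\mathcal A}\}$; $M$ is a weight module if $M=\bigoplus_{\mu\in X}M_\mu$ (the weight decomposition). $\mathcal O=\mathcal O_{\mathcal A}$ is the full subcategory of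 $U_{\mathcal A}$-modules that are weight modules with quasi-bounded set of weights and with every $M_\mu$ a finitely generated torsion free $\mathcal A$-module. The functor $\mathsf S\colon\mathcal O\to\mathcal X^{\mathrm{pre}}$ sends $M$ to its weight decomposition together with the maps $E_{\mu,\alpha,n}$, $F_{\mu,\alpha,n}$ given by the actions of $e_\alpha^{[n]}$ on $M_\mu$ and $f_\alpha^{[n]}$ on $M_{\mu+n\alpha}$. *)

theory Defs
  imports
    "HOL-Algebra.Algebra"
    "HOL-Algebra.Algebraic_Closure_Type"
    "HOL-Computational_Algebra.Polynomial"
    "HOL-Computational_Algebra.Fraction_Field"
begin

section \<open>Quantum integers\<close>

text \<open>The field of rational functions \<open>\<rat>(v)\<close>, with \<open>\<int>[v, v\<^sup>-\<^sup>1]\<close> as a subring of it, so that the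
  quotients defining quantum integers and quantum binomial coefficients can be written down
  literally; they lie in \<open>\<int>[v, v\<^sup>-\<^sup>1]\<close>.\<close>

type_synonym qrat = "rat poly fract"

definition qv :: qrat where
  "qv = Fract [:0, 1:] 1"

definition Qv :: "qrat ring" where
  "Qv = ring_of_type_algebra"

definition Laurent :: "qrat ring" where
  "Laurent = Qv\<lparr>carrier := generate_ring Qv {qv, inverse qv}\<rparr>"

definition qint :: "nat \<Rightarrow> int \<Rightarrow> qrat" where
  "qint d n = (qv powi (int d * n) - qv powi (- (int d * n))) / (qv powi int d - qv powi (- int d))"

definition qfact :: "nat \<Rightarrow> nat \<Rightarrow> qrat" where
  "qfact d n = (\<Prod>i=1..n. qint d (int i))"

definition qbinom :: "nat \<Rightarrow> int \<Rightarrow> nat \<Rightarrow> qrat" where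
  "qbinom d n r = (\<Prod>i<r. qint d (n - int i)) / (\<Prod>i=1..r. qint d (int i))"

section \<open>Root data\<close>

text \<open>\<open>coroot D \<alpha>\<close> is the linear form \<open>\<langle>_, \<alpha>\<^sup>\<or>\<rangle>\<close>. The ambient vector space is the whole type and is
  spanned by the roots.\<close>

record 'v root_datum =
  roots :: "'v set"
  simples :: "'v set"
  coroot :: "'v \<Rightarrow> 'v \<Rightarrow> real"
  dnum :: "'v \<Rightarrow> nat"

definition root_system :: "'v::real_vector set \<Rightarrow> ('v \<Rightarrow> 'v \<Rightarrow> real) \<Rightarrow> bool" where
  "root_system R cr \<longleftrightarrow>
     finite R \<and> span R = UNIV \<and> 0 \<notin> R \<and>
     (\<forall>\<alpha>\<in>R. linear (cr \<alpha>) \<and> cr \<alpha> \<alpha> = 2 \<and>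
        (\<forall>\<beta>\<in>R. \<beta> - cr \<alpha> \<beta> *\<^sub>R \<alpha> \<in> R \<and> cr \<alpha> \<beta> \<in> \<int>) \<and>
        (\<forall>c. c *\<^sub>R \<alpha> \<in> R \<longrightarrow> c = 1 \<or> c = -1))"

definition root_base :: "'v::real_vector set \<Rightarrow> 'v set \<Rightarrow> bool" where
  "root_base R P \<longleftrightarrow>
     P \<subseteq> R \<and> independent P \<and>
     (\<forall>\<beta>\<in>R. \<exists>c :: 'v \<Rightarrow> nat.
        \<beta> = (\<Sum>\<alpha>\<in>P. real (c \<alpha>) *\<^sub>R \<alpha>) \<or> \<beta> = - (\<Sum>\<alpha>\<in>P. real (c \<alpha>) *\<^sub>R \<alpha>))"

definition irreducible_roots :: "('v \<Rightarrow> 'v \<Rightarrow> real) \<Rightarrow> 'v set \<Rightarrow> bool" where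
  "irreducible_roots cr C \<longleftrightarrow>
     C \<noteq> {} \<and>
     \<not> (\<exists>C1 C2. C1 \<noteq> {} \<and> C2 \<noteq> {} \<and> C1 \<inter> C2 = {} \<and> C1 \<union> C2 = C \<and>
          (\<forall>\<alpha>\<in>C1. \<forall>\<beta>\<in>C2. cr \<alpha> \<beta> = 0 \<and> cr \<beta> \<alpha> = 0))"

definition irreducible_component :: "'v set \<Rightarrow> ('v \<Rightarrow> 'v \<Rightarrow> real) \<Rightarrow> 'v set \<Rightarrow> bool" where
  "irreducible_component R cr C \<longleftrightarrow>
     C \<subseteq> R \<and> irreducible_roots cr C \<and> (\<forall>\<alpha>\<in>C. \<forall>\<beta>\<in>R - C. cr \<alpha> \<beta> = 0 \<and> cr \<beta> \<alpha> = 0)"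

definition root_datum :: "'v::real_vector root_datum \<Rightarrow> bool" where
  "root_datum D \<longleftrightarrow>
     root_system (roots D) (coroot D) \<and>
     root_base (roots D) (simples D) \<and>
     (\<forall>\<alpha>\<in>simples D. dnum D \<alpha> \<in> {1, 2, 3}) \<and>
     (\<forall>\<alpha>\<in>simples D. \<forall>\<beta>\<in>simples D.
        real (dnum D \<alpha>) * coroot D \<alpha> \<beta> = real (dnum D \<beta>) * coroot D \<beta> \<alpha>) \<and>
     (\<forall>C. irreducible_component (roots D) (coroot D) C \<longrightarrow>
        (\<exists>\<alpha>\<in>C \<inter> simples D. dnum D \<alpha> = 1))"

definition weights :: "'v::real_vector root_datum \<Rightarrow> 'v set" where
  "weights D = {\<nu>. \<forall>\<alpha>\<in>roots D. coroot D \<alpha> \<nu> \<in> \<int>}"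

text \<open>\<open>pr D \<nu> \<alpha>\<close> is \<open>\<langle>\<nu>, \<alpha>\<^sup>\<or>\<rangle>\<close> as an integer, for \<open>\<nu>\<close> in the weight lattice.\<close>

definition pr :: "'v root_datum \<Rightarrow> 'v \<Rightarrow> 'v \<Rightarrow> int" where
  "pr D \<nu> \<alpha> = \<lfloor>coroot D \<alpha> \<nu>\<rfloor>"

definition wle :: "'v::real_vector root_datum \<Rightarrow> 'v \<Rightarrow> 'v \<Rightarrow> bool" where
  "wle D \<mu> \<nu> \<longleftrightarrow> (\<exists>c :: 'v \<Rightarrow> nat. \<nu> - \<mu> = (\<Sum>\<alpha>\<in>simples D. real (c \<alpha>) *\<^sub>R \<alpha>))"

definition quasi_bounded :: "'v::real_vector root_datum \<Rightarrow> 'v set \<Rightarrow> bool" where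
  "quasi_bounded D S \<longleftrightarrow> S \<subseteq> weights D \<and> (\<forall>\<mu>\<in>weights D. finite {\<nu>\<in>S. wle D \<mu> \<nu>})"

abbreviation wshift :: "'v::real_vector \<Rightarrow> nat \<Rightarrow> 'v \<Rightarrow> 'v" where
  "wshift \<mu> n \<alpha> \<equiv> \<mu> + real n *\<^sub>R \<alpha>"

section \<open>Monoid rings and tensor products of algebras\<close>

definition monoid_ring :: "('k, 'p) ring_scheme \<Rightarrow> ('g, 'q) monoid_scheme \<Rightarrow> ('g \<Rightarrow> 'k) ring" where
  "monoid_ring K G =
    \<lparr>carrier = {f \<in> carrier G \<rightarrow>\<^sub>E carrier K. finite {g \<in> carrier G. f g \<noteq> \<zero>\<^bsub>K\<^esub>}},
     monoid.mult = (\<lambda>f h. \<lambda>x\<in>carrier G.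
       finsum K (\<lambda>(y, z). f y \<otimes>\<^bsub>K\<^esub> h z)
         {(y, z). y \<in> carrier G \<and> z \<in> carrier G \<and> f y \<noteq> \<zero>\<^bsub>K\<^esub> \<and> h z \<noteq> \<zero>\<^bsub>K\<^esub> \<and> y \<otimes>\<^bsub>G\<^esub> z = x}),
     one = (\<lambda>x\<in>carrier G. if x = \<one>\<^bsub>G\<^esub> then \<one>\<^bsub>K\<^esub> else \<zero>\<^bsub>K\<^esub>),
     ring.zero = (\<lambda>x\<in>carrier G. \<zero>\<^bsub>K\<^esub>),
     add = (\<lambda>f h. \<lambda>x\<in>carrier G. f x \<oplus>\<^bsub>K\<^esub> h x)\<rparr>"

definition single :: "('k, 'p) ring_scheme \<Rightarrow> ('g, 'q) monoid_scheme \<Rightarrow> 'g \<Rightarrow> 'k \<Rightarrow> 'g \<Rightarrow> 'k" where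
  "single K G g c = (\<lambda>x\<in>carrier G. if x = g then c else \<zero>\<^bsub>K\<^esub>)"

definition free_monoid :: "'g set \<Rightarrow> 'g list monoid" where
  "free_monoid S = \<lparr>carrier = lists S, monoid.mult = (@), one = []\<rparr>"

text \<open>The tensor product \<open>U \<otimes>\<^bsub>Z\<^esub> A\<close> of rings \<open>U\<close>, \<open>A\<close> along (central) ring homomorphisms
  \<open>s : Z \<rightarrow> U\<close> and \<open>\<phi> : Z \<rightarrow> A\<close>: the free abelian group on \<open>U \<times> A\<close>, with multiplication
  \<open>(u, a)(u', a') = (u u', a a')\<close>, modulo the bilinearity relations. The additive subgroup spanned by
  these relations is already an ideal: as the image of \<open>Z\<close> is central on both sides, the set of
  relations is stable under multiplication by basis elements.\<close>

definition tensor_rels ::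
  "('z, 'p) ring_scheme \<Rightarrow> ('u, 'q) ring_scheme \<Rightarrow> ('z \<Rightarrow> 'u) \<Rightarrow> ('a, 'r) ring_scheme \<Rightarrow> ('z \<Rightarrow> 'a)
    \<Rightarrow> ('u \<times> 'a \<Rightarrow> int) set" where
  "tensor_rels Z U s A \<phi> =
    (let T = monoid_ring \<Z> (U \<times>\<times> A); b = (\<lambda>u a. single \<Z> (U \<times>\<times> A) (u, a) 1) in
      {b (u \<oplus>\<^bsub>U\<^esub> u') a \<ominus>\<^bsub>T\<^esub> (b u a \<oplus>\<^bsub>T\<^esub> b u' a) | u u' a.
         u \<in> carrier U \<and> u' \<in> carrier U \<and> a \<in> carrier A} \<union>
      {b u (a \<oplus>\<^bsub>A\<^esub> a') \<ominus>\<^bsub>T\<^esub> (b u a \<oplus>\<^bsub>T\<^esub> b u a') | u a a'.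
         u \<in> carrier U \<and> a \<in> carrier A \<and> a' \<in> carrier A} \<union>
      {b (s z \<otimes>\<^bsub>U\<^esub> u) a \<ominus>\<^bsub>T\<^esub> b u (\<phi> z \<otimes>\<^bsub>A\<^esub> a) | z u a.
         z \<in> carrier Z \<and> u \<in> carrier U \<and> a \<in> carrier A})"

definition tensor_ideal ::
  "('z, 'p) ring_scheme \<Rightarrow> ('u, 'q) ring_scheme \<Rightarrow> ('z \<Rightarrow> 'u) \<Rightarrow> ('a, 'r) ring_scheme \<Rightarrow> ('z \<Rightarrow> 'a)
    \<Rightarrow> ('u \<times> 'a \<Rightarrow> int) set" where
  "tensor_ideal Z U s A \<phi> = genideal (monoid_ring \<Z> (U \<times>\<times> A)) (tensor_rels Z U s A \<phi>)"

definition tensor_ring ::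
  "('z, 'p) ring_scheme \<Rightarrow> ('u, 'q) ring_scheme \<Rightarrow> ('z \<Rightarrow> 'u) \<Rightarrow> ('a, 'r) ring_scheme \<Rightarrow> ('z \<Rightarrow> 'a)
    \<Rightarrow> ('u \<times> 'a \<Rightarrow> int) set ring" where
  "tensor_ring Z U s A \<phi> = monoid_ring \<Z> (U \<times>\<times> A) Quot tensor_ideal Z U s A \<phi>"

definition tensor_elt ::
  "('z, 'p) ring_scheme \<Rightarrow> ('u, 'q) ring_scheme \<Rightarrow> ('z \<Rightarrow> 'u) \<Rightarrow> ('a, 'r) ring_scheme \<Rightarrow> ('z \<Rightarrow> 'a)
    \<Rightarrow> 'u \<Rightarrow> 'a \<Rightarrow> ('u \<times> 'a \<Rightarrow> int) set" where
  "tensor_elt Z U s A \<phi> u a =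
    tensor_ideal Z U s A \<phi> +>\<^bsub>monoid_ring \<Z> (U \<times>\<times> A)\<^esub> single \<Z> (U \<times>\<times> A) (u, a) 1"

section \<open>The quantum group over \<open>\<rat>(v)\<close>\<close>

text \<open>\<open>GK \<alpha>\<close> and \<open>GL \<alpha>\<close> stand for \<open>k\<^sub>\<alpha>\<close> and \<open>k\<^sub>\<alpha>\<^sup>-\<^sup>1\<close>.\<close>

datatype 'v qgen = GE 'v | GF 'v | GK 'v | GL 'v

definition qgens :: "'v root_datum \<Rightarrow> 'v qgen set" where
  "qgens D = GE ` simples D \<union> GF ` simples D \<union> GK ` simples D \<union> GL ` simples D"

type_synonym 'v qfree = "'v qgen list \<Rightarrow> qrat"

definition Free :: "'v root_datum \<Rightarrow> 'v qfree ring" where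
  "Free D = monoid_ring Qv (free_monoid (qgens D))"

definition fscal :: "'v root_datum \<Rightarrow> qrat \<Rightarrow> 'v qfree" where
  "fscal D c = single Qv (free_monoid (qgens D)) [] c"

definition fgen :: "'v root_datum \<Rightarrow> 'v qgen \<Rightarrow> 'v qfree" where
  "fgen D x = single Qv (free_monoid (qgens D)) [x] 1"

abbreviation "fK D \<alpha> \<equiv> fgen D (GK \<alpha>)"
abbreviation "fL D \<alpha> \<equiv> fgen D (GL \<alpha>)"

text \<open>Divided powers: \<open>fdiv D GE \<alpha> n\<close> is \<open>e\<^sub>\<alpha>\<^sup>[\<^sup>n\<^sup>]\<close> and \<open>fdiv D GF \<alpha> n\<close> is \<open>f\<^sub>\<alpha>\<^sup>[\<^sup>n\<^sup>]\<close>.\<close>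

definition fdiv :: "'v root_datum \<Rightarrow> ('v \<Rightarrow> 'v qgen) \<Rightarrow> 'v \<Rightarrow> nat \<Rightarrow> 'v qfree" where
  "fdiv D g \<alpha> n =
    fscal D (1 / qfact (dnum D \<alpha>) n) \<otimes>\<^bsub>Free D\<^esub> (fgen D (g \<alpha>) [^]\<^bsub>Free D\<^esub> n)"

primrec fkbin :: "'v root_datum \<Rightarrow> 'v \<Rightarrow> nat \<Rightarrow> 'v qfree" where
  "fkbin D \<alpha> 0 = \<one>\<^bsub>Free D\<^esub>"
| "fkbin D \<alpha> (Suc n) =
    (let d = int (dnum D \<alpha>); s = int (Suc n); c = 1 / (qv powi (d * s) - qv powi (- (d * s))) in
      fkbin D \<alpha> n \<otimes>\<^bsub>Free D\<^esub>
        (fscal D (c * qv powi (d * (1 - s))) \<otimes>\<^bsub>Free D\<^esub> fK D \<alpha> \<ominus>\<^bsub>Free D\<^esub>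
         fscal D (c * qv powi (d * (s - 1))) \<otimes>\<^bsub>Free D\<^esub> fL D \<alpha>))"

definition serre :: "'v root_datum \<Rightarrow> ('v \<Rightarrow> 'v qgen) \<Rightarrow> 'v \<Rightarrow> 'v \<Rightarrow> 'v qfree" where
  "serre D g \<alpha> \<beta> =
    (let N = nat (1 - pr D \<beta> \<alpha>) in
      finsum (Free D)
        (\<lambda>s. fscal D ((-1) ^ s) \<otimes>\<^bsub>Free D\<^esub>
          (fdiv D g \<alpha> (N - s) \<otimes>\<^bsub>Free D\<^esub> fgen D (g \<beta>) \<otimes>\<^bsub>Free D\<^esub> fdiv D g \<alpha> s)) {0..N})"

definition qrels :: "'v root_datum \<Rightarrow> 'v qfree set" where
  "qrels D =
    (let F = Free D; P = simples D; q = (\<lambda>\<alpha> \<beta>. qv powi (int (dnum D \<alpha>) * pr D \<beta> \<alpha>)) in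
      {fgen D x \<otimes>\<^bsub>F\<^esub> fgen D y \<ominus>\<^bsub>F\<^esub> fgen D y \<otimes>\<^bsub>F\<^esub> fgen D x | x y.
         x \<in> GK ` P \<union> GL ` P \<and> y \<in> GK ` P \<union> GL ` P} \<union>
      {fK D \<alpha> \<otimes>\<^bsub>F\<^esub> fL D \<alpha> \<ominus>\<^bsub>F\<^esub> \<one>\<^bsub>F\<^esub> | \<alpha>. \<alpha> \<in> P} \<union>
      {fK D \<alpha> \<otimes>\<^bsub>F\<^esub> fgen D (GE \<beta>) \<otimes>\<^bsub>F\<^esub> fL D \<alpha>
         \<ominus>\<^bsub>F\<^esub> fscal D (q \<alpha> \<beta>) \<otimes>\<^bsub>F\<^esub> fgen D (GE \<beta>) | \<alpha> \<beta>. \<alpha> \<in> P \<and> \<beta> \<in> P} \<union>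
      {fK D \<alpha> \<otimes>\<^bsub>F\<^esub> fgen D (GF \<beta>) \<otimes>\<^bsub>F\<^esub> fL D \<alpha>
         \<ominus>\<^bsub>F\<^esub> fscal D (inverse (q \<alpha> \<beta>)) \<otimes>\<^bsub>F\<^esub> fgen D (GF \<beta>) | \<alpha> \<beta>. \<alpha> \<in> P \<and> \<beta> \<in> P} \<union>
      {fgen D (GE \<alpha>) \<otimes>\<^bsub>F\<^esub> fgen D (GF \<beta>) \<ominus>\<^bsub>F\<^esub> fgen D (GF \<beta>) \<otimes>\<^bsub>F\<^esub> fgen D (GE \<alpha>) | \<alpha> \<beta>.
         \<alpha> \<in> P \<and> \<beta> \<in> P \<and> \<alpha> \<noteq> \<beta>} \<union>
      {(fgen D (GE \<alpha>) \<otimes>\<^bsub>F\<^esub> fgen D (GF \<alpha>) \<ominus>\<^bsub>F\<^esub> fgen D (GF \<alpha>) \<otimes>\<^bsub>F\<^esub> fgen D (GE \<alpha>))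
         \<ominus>\<^bsub>F\<^esub> fscal D (1 / (qv powi int (dnum D \<alpha>) - qv powi (- int (dnum D \<alpha>))))
               \<otimes>\<^bsub>F\<^esub> (fK D \<alpha> \<ominus>\<^bsub>F\<^esub> fL D \<alpha>) | \<alpha>. \<alpha> \<in> P} \<union>
      {serre D g \<alpha> \<beta> | g \<alpha> \<beta>. g \<in> {GE, GF} \<and> \<alpha> \<in> P \<and> \<beta> \<in> P \<and> \<alpha> \<noteq> \<beta>})"

definition qideal :: "'v root_datum \<Rightarrow> 'v qfree set" where
  "qideal D = genideal (Free D) (qrels D)"

definition UQ :: "'v root_datum \<Rightarrow> 'v qfree set ring" where
  "UQ D = Free D Quot qideal D"

definition qcls :: "'v root_datum \<Rightarrow> 'v qfree \<Rightarrow> 'v qfree set" where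
  "qcls D x = qideal D +>\<^bsub>Free D\<^esub> x"

section \<open>Lusztig's form and base change\<close>

definition U0_gens :: "'v root_datum \<Rightarrow> 'v qfree set" where
  "U0_gens D =
    fK D ` simples D \<union> fL D ` simples D \<union> {fkbin D \<alpha> n | \<alpha> n. \<alpha> \<in> simples D}"

definition U_gens :: "'v root_datum \<Rightarrow> 'v qfree set" where
  "U_gens D =
    fK D ` simples D \<union> fL D ` simples D \<union> {fdiv D g \<alpha> n | g \<alpha> n. g \<in> {GE, GF} \<and> \<alpha> \<in> simples D}"

definition qscal :: "'v root_datum \<Rightarrow> qrat \<Rightarrow> 'v qfree set" where
  "qscal D c = qcls D (fscal D c)"

definition UZ :: "'v root_datum \<Rightarrow> 'v qfree set ring" where
  "UZ D = (UQ D)\<lparr>carrier :=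
    generate_ring (UQ D) (qscal D ` carrier Laurent \<union> qcls D ` U_gens D)\<rparr>"

definition UZ0 :: "'v root_datum \<Rightarrow> 'v qfree set ring" where
  "UZ0 D = (UQ D)\<lparr>carrier :=
    generate_ring (UQ D) (qscal D ` carrier Laurent \<union> qcls D ` U0_gens D)\<rparr>"

type_synonym ('v, 'a) ualg = "('v qfree set \<times> 'a \<Rightarrow> int) set"

definition UA :: "'v root_datum \<Rightarrow> 'a ring \<Rightarrow> (qrat \<Rightarrow> 'a) \<Rightarrow> ('v, 'a) ualg ring" where
  "UA D A \<phi> = tensor_ring Laurent (UZ D) (qscal D) A \<phi>"

definition UA0 :: "'v root_datum \<Rightarrow> 'a ring \<Rightarrow> (qrat \<Rightarrow> 'a) \<Rightarrow> ('v, 'a) ualg ring" where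
  "UA0 D A \<phi> = tensor_ring Laurent (UZ0 D) (qscal D) A \<phi>"

abbreviation ua_elt ::
  "'v root_datum \<Rightarrow> 'a ring \<Rightarrow> (qrat \<Rightarrow> 'a) \<Rightarrow> 'v qfree set \<Rightarrow> 'a \<Rightarrow> ('v, 'a) ualg" where
  "ua_elt D A \<phi> \<equiv> tensor_elt Laurent (UZ D) (qscal D) A \<phi>"

abbreviation ua0_elt ::
  "'v root_datum \<Rightarrow> 'a ring \<Rightarrow> (qrat \<Rightarrow> 'a) \<Rightarrow> 'v qfree set \<Rightarrow> 'a \<Rightarrow> ('v, 'a) ualg" where
  "ua0_elt D A \<phi> \<equiv> tensor_elt Laurent (UZ0 D) (qscal D) A \<phi>"

definition ua_scal :: "'v root_datum \<Rightarrow> 'a ring \<Rightarrow> (qrat \<Rightarrow> 'a) \<Rightarrow> 'a \<Rightarrow> ('v, 'a) ualg" where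
  "ua_scal D A \<phi> a = ua_elt D A \<phi> \<one>\<^bsub>UZ D\<^esub> a"

definition ua_div ::
  "'v root_datum \<Rightarrow> 'a ring \<Rightarrow> (qrat \<Rightarrow> 'a) \<Rightarrow> ('v \<Rightarrow> 'v qgen) \<Rightarrow> 'v \<Rightarrow> nat \<Rightarrow> ('v, 'a) ualg" where
  "ua_div D A \<phi> g \<alpha> n = ua_elt D A \<phi> (qcls D (fdiv D g \<alpha> n)) \<one>\<^bsub>A\<^esub>"

text \<open>The homomorphism \<open>U\<^sup>0\<^bsub>A\<^esub> \<rightarrow> U\<^bsub>A\<^esub>\<close> induced by the inclusion of the integral forms, through which
  \<open>U\<^sup>0\<^bsub>A\<^esub>\<close> acts on \<open>U\<^bsub>A\<^esub>\<close>-modules.\<close>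

definition ua0_incl ::
  "'v root_datum \<Rightarrow> 'a ring \<Rightarrow> (qrat \<Rightarrow> 'a) \<Rightarrow> ('v, 'a) ualg \<Rightarrow> ('v, 'a) ualg" where
  "ua0_incl D A \<phi> =
    (THE j. j \<in> ring_hom (UA0 D A \<phi>) (UA D A \<phi>) \<and> j \<in> extensional (carrier (UA0 D A \<phi>)) \<and>
      (\<forall>u\<in>carrier (UZ0 D). \<forall>a\<in>carrier A. j (ua0_elt D A \<phi> u a) = ua_elt D A \<phi> u a))"

definition chi ::
  "'v root_datum \<Rightarrow> 'a ring \<Rightarrow> (qrat \<Rightarrow> 'a) \<Rightarrow> 'v \<Rightarrow> ('v, 'a) ualg \<Rightarrow> 'a" where
  "chi D A \<phi> \<mu> =
    (THE c. c \<in> ring_hom (UA0 D A \<phi>) A \<and> c \<in> extensional (carrier (UA0 D A \<phi>)) \<and>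
      (\<forall>a\<in>carrier A. c (ua0_elt D A \<phi> \<one>\<^bsub>UZ0 D\<^esub> a) = a) \<and>
      (\<forall>\<alpha>\<in>simples D.
        c (ua0_elt D A \<phi> (qcls D (fK D \<alpha>)) \<one>\<^bsub>A\<^esub>) = \<phi> (qv powi (int (dnum D \<alpha>) * pr D \<mu> \<alpha>)) \<and>
        c (ua0_elt D A \<phi> (qcls D (fL D \<alpha>)) \<one>\<^bsub>A\<^esub>) = \<phi> (qv powi (- (int (dnum D \<alpha>) * pr D \<mu> \<alpha>))) \<and>
        (\<forall>r. c (ua0_elt D A \<phi> (qcls D (fkbin D \<alpha> r)) \<one>\<^bsub>A\<^esub>) = \<phi> (qbinom (dnum D \<alpha>) (pr D \<mu> \<alpha>) r))))"

section \<open>Modules\<close>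

text \<open>The library's \<^locale>\<open>module\<close> is restricted to commutative coefficient rings. As there, the
  multiplicative part of the record of a module carries no information.\<close>

locale left_module = R?: ring R + M?: abelian_group M
  for R :: "('a, 'p) ring_scheme" (structure) and M :: "('a, 'm, 'q) module_scheme" (structure) +
  assumes smult_closed:
      "\<lbrakk>a \<in> carrier R; x \<in> carrier M\<rbrakk> \<Longrightarrow> a \<odot>\<^bsub>M\<^esub> x \<in> carrier M"
    and smult_l_distr:
      "\<lbrakk>a \<in> carrier R; b \<in> carrier R; x \<in> carrier M\<rbrakk> \<Longrightarrow>
        (a \<oplus> b) \<odot>\<^bsub>M\<^esub> x = a \<odot>\<^bsub>M\<^esub> x \<oplus>\<^bsub>M\<^esub> b \<odot>\<^bsub>M\<^esub> x"
    and smult_r_distr: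
      "\<lbrakk>a \<in> carrier R; x \<in> carrier M; y \<in> carrier M\<rbrakk> \<Longrightarrow>
        a \<odot>\<^bsub>M\<^esub> (x \<oplus>\<^bsub>M\<^esub> y) = a \<odot>\<^bsub>M\<^esub> x \<oplus>\<^bsub>M\<^esub> a \<odot>\<^bsub>M\<^esub> y"
    and smult_assoc:
      "\<lbrakk>a \<in> carrier R; b \<in> carrier R; x \<in> carrier M\<rbrakk> \<Longrightarrow>
        (a \<otimes> b) \<odot>\<^bsub>M\<^esub> x = a \<odot>\<^bsub>M\<^esub> (b \<odot>\<^bsub>M\<^esub> x)"
    and smult_one:
      "x \<in> carrier M \<Longrightarrow> \<one> \<odot>\<^bsub>M\<^esub> x = x"

definition lin_maps ::
  "('a, 'p) ring_scheme \<Rightarrow> ('a, 'm, 'q) module_scheme \<Rightarrow> ('a, 'n, 'r) module_scheme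
    \<Rightarrow> ('m \<Rightarrow> 'n) set" where
  "lin_maps A M N =
    {f \<in> carrier M \<rightarrow> carrier N.
      (\<forall>x\<in>carrier M. \<forall>y\<in>carrier M. f (x \<oplus>\<^bsub>M\<^esub> y) = f x \<oplus>\<^bsub>N\<^esub> f y) \<and>
      (\<forall>a\<in>carrier A. \<forall>x\<in>carrier M. f (a \<odot>\<^bsub>M\<^esub> x) = a \<odot>\<^bsub>N\<^esub> f x)}"

definition fg_module :: "('a, 'p) ring_scheme \<Rightarrow> ('a, 'm, 'q) module_scheme \<Rightarrow> bool" where
  "fg_module A M \<longleftrightarrow>
    (\<exists>S\<subseteq>carrier M. finite S \<and>
      (\<forall>x\<in>carrier M. \<exists>c\<in>S \<rightarrow> carrier A. x = finsum M (\<lambda>s. c s \<odot>\<^bsub>M\<^esub> s) S))"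

definition free_module :: "('a, 'p) ring_scheme \<Rightarrow> ('a, 'm, 'q) module_scheme \<Rightarrow> bool" where
  "free_module A M \<longleftrightarrow>
    (\<exists>B\<subseteq>carrier M. \<forall>x\<in>carrier M. \<exists>!c. c \<in> B \<rightarrow>\<^sub>E carrier A \<and> finite {b\<in>B. c b \<noteq> \<zero>\<^bsub>A\<^esub>} \<and>
      x = finsum M (\<lambda>b. c b \<odot>\<^bsub>M\<^esub> b) {b\<in>B. c b \<noteq> \<zero>\<^bsub>A\<^esub>})"

definition torsion_module :: "('a, 'p) ring_scheme \<Rightarrow> ('a, 'm, 'q) module_scheme \<Rightarrow> bool" where
  "torsion_module A M \<longleftrightarrow>
    (\<forall>x\<in>carrier M. \<exists>a\<in>carrier A. a \<noteq> \<zero>\<^bsub>A\<^esub> \<and> a \<odot>\<^bsub>M\<^esub> x = \<zero>\<^bsub>M\<^esub>)"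

definition torsion_free_module :: "('a, 'p) ring_scheme \<Rightarrow> ('a, 'm, 'q) module_scheme \<Rightarrow> bool" where
  "torsion_free_module A M \<longleftrightarrow>
    (\<forall>a\<in>carrier A. \<forall>x\<in>carrier M. a \<odot>\<^bsub>M\<^esub> x = \<zero>\<^bsub>M\<^esub> \<longrightarrow> a = \<zero>\<^bsub>A\<^esub> \<or> x = \<zero>\<^bsub>M\<^esub>)"

definition quot_module :: "('a, 'm, 'q) module_scheme \<Rightarrow> 'm set \<Rightarrow> ('a, 'm set) module" where
  "quot_module M N =
    \<lparr>carrier = a_rcosets\<^bsub>M\<^esub> N, monoid.mult = undefined, one = undefined, ring.zero = N, add = set_add M,
     module.smult = (\<lambda>a C. \<Union>x\<in>C. N +>\<^bsub>M\<^esub> (a \<odot>\<^bsub>M\<^esub> x))\<rparr>"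

definition dsum_module ::
  "'i set \<Rightarrow> ('i \<Rightarrow> ('a, 'm, 'q) module_scheme) \<Rightarrow> ('a, 'i \<Rightarrow> 'm) module" where
  "dsum_module I N =
    \<lparr>carrier = {g \<in> (\<Pi>\<^sub>E i\<in>I. carrier (N i)). finite {i\<in>I. g i \<noteq> \<zero>\<^bsub>N i\<^esub>}},
     monoid.mult = undefined, one = undefined,
     ring.zero = (\<lambda>i\<in>I. \<zero>\<^bsub>N i\<^esub>),
     add = (\<lambda>g h. \<lambda>i\<in>I. g i \<oplus>\<^bsub>N i\<^esub> h i),
     module.smult = (\<lambda>a g. \<lambda>i\<in>I. a \<odot>\<^bsub>N i\<^esub> g i)\<rparr>"

definition internal_direct_sum ::
  "('a, 'p) ring_scheme \<Rightarrow> ('a, 'm, 'q) module_scheme \<Rightarrow> 'i set \<Rightarrow> ('i \<Rightarrow> 'm set) \<Rightarrow> bool" where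
  "internal_direct_sum A M I W \<longleftrightarrow>
    (\<forall>i\<in>I. submodule (W i) A M) \<and>
    (\<forall>x\<in>carrier M. \<exists>!g. g \<in> (\<Pi>\<^sub>E i\<in>I. W i) \<and> finite {i\<in>I. g i \<noteq> \<zero>\<^bsub>M\<^esub>} \<and>
      x = finsum M g {i\<in>I. g i \<noteq> \<zero>\<^bsub>M\<^esub>})"

section \<open>Categories\<close>

record ('o, 'f) cat =
  Ob :: "'o set"
  Hom :: "'o \<Rightarrow> 'o \<Rightarrow> 'f set"
  Id_mor :: "'o \<Rightarrow> 'f"
  Comp :: "'o \<Rightarrow> 'o \<Rightarrow> 'o \<Rightarrow> 'f \<Rightarrow> 'f \<Rightarrow> 'f"  \<comment> \<open>\<open>Comp C x y z g f\<close> for \<open>f : x \<rightarrow> y\<close> and \<open>g : y \<rightarrow> z\<close>\<close>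

definition is_cat :: "('o, 'f) cat \<Rightarrow> bool" where
  "is_cat C \<longleftrightarrow>
    (\<forall>x\<in>Ob C. Id_mor C x \<in> Hom C x x) \<and>
    (\<forall>x\<in>Ob C. \<forall>y\<in>Ob C. \<forall>z\<in>Ob C. \<forall>f\<in>Hom C x y. \<forall>g\<in>Hom C y z. Comp C x y z g f \<in> Hom C x z) \<and>
    (\<forall>x\<in>Ob C. \<forall>y\<in>Ob C. \<forall>f\<in>Hom C x y.
      Comp C x x y f (Id_mor C x) = f \<and> Comp C x y y (Id_mor C y) f = f) \<and>
    (\<forall>w\<in>Ob C. \<forall>x\<in>Ob C. \<forall>y\<in>Ob C. \<forall>z\<in>Ob C.
      \<forall>f\<in>Hom C w x. \<forall>g\<in>Hom C x y. \<forall>h\<in>Hom C y z.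
        Comp C w x z (Comp C x y z h g) f = Comp C w y z h (Comp C w x y g f))"

record ('o, 'f, 'p, 'g) fun_data =
  fob :: "'o \<Rightarrow> 'p"
  fmor :: "'o \<Rightarrow> 'o \<Rightarrow> 'f \<Rightarrow> 'g"

definition is_functor :: "('o, 'f) cat \<Rightarrow> ('p, 'g) cat \<Rightarrow> ('o, 'f, 'p, 'g) fun_data \<Rightarrow> bool" where
  "is_functor C D F \<longleftrightarrow>
    is_cat C \<and> is_cat D \<and>
    (\<forall>x\<in>Ob C. fob F x \<in> Ob D) \<and>
    (\<forall>x\<in>Ob C. \<forall>y\<in>Ob C. \<forall>f\<in>Hom C x y. fmor F x y f \<in> Hom D (fob F x) (fob F y)) \<and>
    (\<forall>x\<in>Ob C. fmor F x x (Id_mor C x) = Id_mor D (fob F x)) \<and>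
    (\<forall>x\<in>Ob C. \<forall>y\<in>Ob C. \<forall>z\<in>Ob C. \<forall>f\<in>Hom C x y. \<forall>g\<in>Hom C y z.
      fmor F x z (Comp C x y z g f)
        = Comp D (fob F x) (fob F y) (fob F z) (fmor F y z g) (fmor F x y f))"

definition fully_faithful :: "('o, 'f) cat \<Rightarrow> ('p, 'g) cat \<Rightarrow> ('o, 'f, 'p, 'g) fun_data \<Rightarrow> bool" where
  "fully_faithful C D F \<longleftrightarrow>
    (\<forall>x\<in>Ob C. \<forall>y\<in>Ob C. bij_betw (fmor F x y) (Hom C x y) (Hom D (fob F x) (fob F y)))"

definition id_fun :: "('o, 'f, 'o, 'f) fun_data" where
  "id_fun = \<lparr>fob = (\<lambda>x. x), fmor = (\<lambda>x y f. f)\<rparr>"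

definition comp_fun ::
  "('p, 'g, 'q, 'h) fun_data \<Rightarrow> ('o, 'f, 'p, 'g) fun_data \<Rightarrow> ('o, 'f, 'q, 'h) fun_data" where
  "comp_fun G F =
    \<lparr>fob = (\<lambda>x. fob G (fob F x)), fmor = (\<lambda>x y f. fmor G (fob F x) (fob F y) (fmor F x y f))\<rparr>"

definition cat_iso :: "('o, 'f) cat \<Rightarrow> 'o \<Rightarrow> 'o \<Rightarrow> 'f \<Rightarrow> bool" where
  "cat_iso C x y f \<longleftrightarrow>
    f \<in> Hom C x y \<and>
    (\<exists>g\<in>Hom C y x. Comp C x y x g f = Id_mor C x \<and> Comp C y x y f g = Id_mor C y)"

definition nat_isomorphic ::
  "('o, 'f) cat \<Rightarrow> ('p, 'g) cat \<Rightarrow> ('o, 'f, 'p, 'g) fun_data \<Rightarrow> ('o, 'f, 'p, 'g) fun_data \<Rightarrow> bool" where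
  "nat_isomorphic C D F G \<longleftrightarrow>
    is_functor C D F \<and> is_functor C D G \<and>
    (\<exists>\<eta>. (\<forall>x\<in>Ob C. cat_iso D (fob F x) (fob G x) (\<eta> x)) \<and>
      (\<forall>x\<in>Ob C. \<forall>y\<in>Ob C. \<forall>f\<in>Hom C x y.
        Comp D (fob F x) (fob F y) (fob G y) (\<eta> y) (fmor F x y f)
          = Comp D (fob F x) (fob G x) (fob G y) (fmor G x y f) (\<eta> x)))"

section \<open>The categories \<open>\<X>\<^sup>p\<^sup>r\<^sup>e\<close> and \<open>\<X>\<close>\<close>

text \<open>Gradings are internal: \<open>wt M \<mu>\<close> is the homogeneous component \<open>M\<^sub>\<mu>\<close> of the \<open>A\<close>-module \<open>M\<close>. The
  values of the structure maps outside their domains, and for indices outside of the weight lattice,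
  the simple roots and the positive integers, are irrelevant.\<close>

record ('a, 'm, 'v) xobj = "('a, 'm) module" +
  wt :: "'v \<Rightarrow> 'm set"
  Emap :: "'v \<Rightarrow> 'v \<Rightarrow> nat \<Rightarrow> 'm \<Rightarrow> 'm"
  Fmap :: "'v \<Rightarrow> 'v \<Rightarrow> nat \<Rightarrow> 'm \<Rightarrow> 'm"

abbreviation wspace :: "('a, 'm, 'v) xobj \<Rightarrow> 'v \<Rightarrow> ('a, 'm, 'v) xobj" where
  "wspace M \<mu> \<equiv> M\<lparr>carrier := wt M \<mu>\<rparr>"

definition graded_data :: "'v::real_vector root_datum \<Rightarrow> 'a ring \<Rightarrow> ('a, 'm, 'v) xobj \<Rightarrow> bool" where
  "graded_data D A M \<longleftrightarrow>
    module A M \<and> internal_direct_sum A M (weights D) (wt M) \<and>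
    (\<forall>\<mu>\<in>weights D. \<forall>\<alpha>\<in>simples D. \<forall>n>0.
      Emap M \<mu> \<alpha> n \<in> lin_maps A (wspace M \<mu>) (wspace M (wshift \<mu> n \<alpha>)) \<and>
      Fmap M \<mu> \<alpha> n \<in> lin_maps A (wspace M (wshift \<mu> n \<alpha>)) (wspace M \<mu>))"

definition X1 :: "'v::real_vector root_datum \<Rightarrow> 'a ring \<Rightarrow> ('a, 'm, 'v) xobj \<Rightarrow> bool" where
  "X1 D A M \<longleftrightarrow>
    quasi_bounded D {\<mu>\<in>weights D. wt M \<mu> \<noteq> {\<zero>\<^bsub>M\<^esub>}} \<and>
    (\<forall>\<mu>\<in>weights D. fg_module A (wspace M \<mu>))"

definition Emap0 :: "('a, 'm, 'v) xobj \<Rightarrow> 'v \<Rightarrow> 'v \<Rightarrow> nat \<Rightarrow> 'm \<Rightarrow> 'm" where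
  "Emap0 M \<mu> \<alpha> n x = (if n = 0 then x else Emap M \<mu> \<alpha> n x)"

definition Fmap0 :: "('a, 'm, 'v) xobj \<Rightarrow> 'v \<Rightarrow> 'v \<Rightarrow> nat \<Rightarrow> 'm \<Rightarrow> 'm" where
  "Fmap0 M \<mu> \<alpha> n x = (if n = 0 then x else Fmap M \<mu> \<alpha> n x)"

definition X2 ::
  "'v::real_vector root_datum \<Rightarrow> (qrat \<Rightarrow> 'a) \<Rightarrow> ('a, 'm, 'v) xobj \<Rightarrow> bool" where
  "X2 D \<phi> M \<longleftrightarrow>
    (\<forall>\<mu>\<in>weights D. \<forall>\<alpha>\<in>simples D. \<forall>\<beta>\<in>simples D. \<forall>m>0. \<forall>n>0. \<forall>x\<in>wt M (wshift \<mu> n \<beta>).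
      (\<alpha> \<noteq> \<beta> \<longrightarrow>
        Emap M \<mu> \<alpha> m (Fmap M \<mu> \<beta> n x)
          = Fmap M (wshift \<mu> m \<alpha>) \<beta> n (Emap M (wshift \<mu> n \<beta>) \<alpha> m x)) \<and>
      (\<alpha> = \<beta> \<longrightarrow>
        Emap M \<mu> \<alpha> m (Fmap M \<mu> \<alpha> n x)
          = finsum M
              (\<lambda>r. \<phi> (qbinom (dnum D \<alpha>) (pr D \<mu> \<alpha> + int m + int n) r) \<odot>\<^bsub>M\<^esub>
                Fmap0 M (wshift \<mu> m \<alpha>) \<alpha> (n - r) (Emap0 M (wshift \<mu> n \<alpha>) \<alpha> (m - r) x))
              {0..min m n}))"

definition didx :: "'v root_datum \<Rightarrow> ('v \<times> nat) set" where
  "didx D = simples D \<times> {0<..}"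

definition Mdelta ::
  "'v::real_vector root_datum \<Rightarrow> ('a, 'm, 'v) xobj \<Rightarrow> 'v \<Rightarrow> ('a, 'v \<times> nat \<Rightarrow> 'm) module" where
  "Mdelta D M \<mu> = dsum_module (didx D) (\<lambda>(\<alpha>, n). wspace M (wshift \<mu> n \<alpha>))"

definition Ecol ::
  "'v root_datum \<Rightarrow> ('a, 'm, 'v) xobj \<Rightarrow> 'v \<Rightarrow> 'm \<Rightarrow> 'v \<times> nat \<Rightarrow> 'm" where
  "Ecol D M \<mu> x = (\<lambda>(\<alpha>, n)\<in>didx D. Emap M \<mu> \<alpha> n x)"

definition Frow ::
  "'v root_datum \<Rightarrow> ('a, 'm, 'v) xobj \<Rightarrow> 'v \<Rightarrow> ('v \<times> nat \<Rightarrow> 'm) \<Rightarrow> 'm" where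
  "Frow D M \<mu> g =
    finsum M (\<lambda>(\<alpha>, n). Fmap M \<mu> \<alpha> n (g (\<alpha>, n))) {i\<in>didx D. g i \<noteq> \<zero>\<^bsub>M\<^esub>}"

definition imF :: "'v::real_vector root_datum \<Rightarrow> ('a, 'm, 'v) xobj \<Rightarrow> 'v \<Rightarrow> 'm set" where
  "imF D M \<mu> = Frow D M \<mu> ` carrier (Mdelta D M \<mu>)"

definition X3 :: "'v::real_vector root_datum \<Rightarrow> 'a ring \<Rightarrow> ('a, 'm, 'v) xobj \<Rightarrow> bool" where
  "X3 D A M \<longleftrightarrow>
    (\<forall>\<mu>\<in>weights D.
      inj_on (Ecol D M \<mu>) (imF D M \<mu>) \<and>
      torsion_module A
        (quot_module ((Mdelta D M \<mu>)\<lparr>carrier := Ecol D M \<mu> ` wt M \<mu>\<rparr>) (Ecol D M \<mu> ` imF D M \<mu>)) \<and>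
      free_module A (quot_module (wspace M \<mu>) (imF D M \<mu>)))"

text \<open>Morphisms are extensional functions, so that their equality is equality on the carrier.\<close>

definition xhom ::
  "'v::real_vector root_datum \<Rightarrow> 'a ring \<Rightarrow> ('a, 'm, 'v) xobj \<Rightarrow> ('a, 'm, 'v) xobj \<Rightarrow> ('m \<Rightarrow> 'm) set" where
  "xhom D A M N =
    {f \<in> lin_maps A M N \<inter> extensional (carrier M).
      (\<forall>\<mu>\<in>weights D. f ` wt M \<mu> \<subseteq> wt N \<mu>) \<and>
      (\<forall>\<mu>\<in>weights D. \<forall>\<alpha>\<in>simples D. \<forall>n>0.
        (\<forall>x\<in>wt M \<mu>. f (Emap M \<mu> \<alpha> n x) = Emap N \<mu> \<alpha> n (f x)) \<and>
        (\<forall>x\<in>wt M (wshift \<mu> n \<alpha>). f (Fmap M \<mu> \<alpha> n x) = Fmap N \<mu> \<alpha> n (f x)))}"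

definition Xpre_cat ::
  "'v::real_vector root_datum \<Rightarrow> 'a ring \<Rightarrow> (qrat \<Rightarrow> 'a) \<Rightarrow> (('a, 'm, 'v) xobj, 'm \<Rightarrow> 'm) cat" where
  "Xpre_cat D A \<phi> =
    \<lparr>Ob = {M. graded_data D A M \<and> X1 D A M \<and> X2 D \<phi> M},
     Hom = xhom D A,
     Id_mor = (\<lambda>M. \<lambda>x\<in>carrier M. x),
     Comp = (\<lambda>L M N g f. compose (carrier L) g f)\<rparr>"

definition X_cat ::
  "'v::real_vector root_datum \<Rightarrow> 'a ring \<Rightarrow> (qrat \<Rightarrow> 'a) \<Rightarrow> (('a, 'm, 'v) xobj, 'm \<Rightarrow> 'm) cat" where
  "X_cat D A \<phi> = (Xpre_cat D A \<phi>)\<lparr>Ob := {M \<in> Ob (Xpre_cat D A \<phi>). X3 D A M}\<rparr>"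

section \<open>The category \<open>\<O>\<close> and the functor \<open>S\<close>\<close>

type_synonym ('v, 'a, 'm) umod = "(('v, 'a) ualg, 'm) module"

definition restr_scal ::
  "'v root_datum \<Rightarrow> 'a ring \<Rightarrow> (qrat \<Rightarrow> 'a) \<Rightarrow> ('v, 'a, 'm) umod \<Rightarrow> ('a, 'm) module" where
  "restr_scal D A \<phi> N =
    \<lparr>carrier = carrier N, monoid.mult = monoid.mult N, one = one N, ring.zero = ring.zero N, add = add N,
     module.smult = (\<lambda>a x. ua_scal D A \<phi> a \<odot>\<^bsub>N\<^esub> x)\<rparr>"

definition uweight ::
  "'v root_datum \<Rightarrow> 'a ring \<Rightarrow> (qrat \<Rightarrow> 'a) \<Rightarrow> ('v, 'a, 'm) umod \<Rightarrow> 'v \<Rightarrow> 'm set" where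
  "uweight D A \<phi> N \<mu> =
    {x \<in> carrier N. \<forall>H\<in>carrier (UA0 D A \<phi>).
      ua0_incl D A \<phi> H \<odot>\<^bsub>N\<^esub> x = ua_scal D A \<phi> (chi D A \<phi> \<mu> H) \<odot>\<^bsub>N\<^esub> x}"

definition O_cat ::
  "'v::real_vector root_datum \<Rightarrow> 'a ring \<Rightarrow> (qrat \<Rightarrow> 'a) \<Rightarrow> (('v, 'a, 'm) umod, 'm \<Rightarrow> 'm) cat" where
  "O_cat D A \<phi> =
    \<lparr>Ob = {N. left_module (UA D A \<phi>) N \<and>
       internal_direct_sum A (restr_scal D A \<phi> N) (weights D) (uweight D A \<phi> N) \<and>
       quasi_bounded D {\<mu>\<in>weights D. uweight D A \<phi> N \<mu> \<noteq> {\<zero>\<^bsub>N\<^esub>}} \<and>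
       (\<forall>\<mu>\<in>weights D.
         fg_module A ((restr_scal D A \<phi> N)\<lparr>carrier := uweight D A \<phi> N \<mu>\<rparr>) \<and>
         torsion_free_module A ((restr_scal D A \<phi> N)\<lparr>carrier := uweight D A \<phi> N \<mu>\<rparr>))},
     Hom = (\<lambda>M N. lin_maps (UA D A \<phi>) M N \<inter> extensional (carrier M)),
     Id_mor = (\<lambda>M. \<lambda>x\<in>carrier M. x),
     Comp = (\<lambda>L M N g f. compose (carrier L) g f)\<rparr>"

definition S_ob ::
  "'v root_datum \<Rightarrow> 'a ring \<Rightarrow> (qrat \<Rightarrow> 'a) \<Rightarrow> ('v, 'a, 'm) umod \<Rightarrow> ('a, 'm, 'v) xobj" where
  "S_ob D A \<phi> N = module.extend (restr_scal D A \<phi> N)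
    \<lparr>wt = uweight D A \<phi> N,
     Emap = (\<lambda>\<mu> \<alpha> n x. ua_div D A \<phi> GE \<alpha> n \<odot>\<^bsub>N\<^esub> x),
     Fmap = (\<lambda>\<mu> \<alpha> n x. ua_div D A \<phi> GF \<alpha> n \<odot>\<^bsub>N\<^esub> x)\<rparr>"

definition S_fun ::
  "'v root_datum \<Rightarrow> 'a ring \<Rightarrow> (qrat \<Rightarrow> 'a) \<Rightarrow>
    (('v, 'a, 'm) umod, 'm \<Rightarrow> 'm, ('a, 'm, 'v) xobj, 'm \<Rightarrow> 'm) fun_data" where
  "S_fun D A \<phi> = \<lparr>fob = S_ob D A \<phi>, fmor = (\<lambda>M N f. f)\<rparr>"

section \<open>\<open>U\<^bsub>A\<^esub>\<close>-module structures on objects of \<open>\<X>\<close>\<close>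

definition with_action :: "('a, 'm, 'v) xobj \<Rightarrow> ('u \<Rightarrow> 'm \<Rightarrow> 'm) \<Rightarrow> ('u, 'm) module" where
  "with_action M act =
    \<lparr>carrier = carrier M, monoid.mult = monoid.mult M, one = one M, ring.zero = ring.zero M, add = add M, module.smult = act\<rparr>"

text \<open>A \<open>U\<^bsub>A\<^esub>\<close>-module structure on the \<open>A\<close>-module \<open>M\<close>, i.e. one inducing the given addition and
  \<open>A\<close>-action. Actions are extensional, so that uniqueness has its intended meaning.\<close>

definition U_structure ::
  "'v root_datum \<Rightarrow> 'a ring \<Rightarrow> (qrat \<Rightarrow> 'a) \<Rightarrow> ('a, 'm, 'v) xobj \<Rightarrow>
    (('v, 'a) ualg \<Rightarrow> 'm \<Rightarrow> 'm) \<Rightarrow> bool" where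
  "U_structure D A \<phi> M act \<longleftrightarrow>
    act \<in> carrier (UA D A \<phi>) \<rightarrow>\<^sub>E (carrier M \<rightarrow>\<^sub>E carrier M) \<and>
    left_module (UA D A \<phi>) (with_action M act) \<and>
    (\<forall>a\<in>carrier A. \<forall>x\<in>carrier M. act (ua_scal D A \<phi> a) x = a \<odot>\<^bsub>M\<^esub> x)"

definition adapted ::
  "'v::real_vector root_datum \<Rightarrow> 'a ring \<Rightarrow> (qrat \<Rightarrow> 'a) \<Rightarrow> ('a, 'm, 'v) xobj \<Rightarrow>
    (('v, 'a) ualg \<Rightarrow> 'm \<Rightarrow> 'm) \<Rightarrow> bool" where
  "adapted D A \<phi> M act \<longleftrightarrow>
    (\<forall>\<mu>\<in>weights D. wt M \<mu> = uweight D A \<phi> (with_action M act) \<mu>) \<and>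
    (\<forall>\<mu>\<in>weights D. \<forall>\<alpha>\<in>simples D. \<forall>n>0.
      (\<forall>x\<in>wt M \<mu>. Emap M \<mu> \<alpha> n x = act (ua_div D A \<phi> GE \<alpha> n) x) \<and>
      (\<forall>x\<in>wt M (wshift \<mu> n \<alpha>). Fmap M \<mu> \<alpha> n x = act (ua_div D A \<phi> GF \<alpha> n) x))"

end

theory Submission imports Defs "HOL-Library.Function_Algebras"
begin

text \<open>An object \<open>M\<close> of \<open>\<X>\<close> carries operators \<open>E\<close> and \<open>F\<close>, and \<open>k\<^sub>\<alpha>\<close> acts on \<open>M\<^sub>\<mu>\<close> by a power of \<open>v\<close>.
Only the commutation rules between the \<open>E\<close>'s and the \<open>F\<close>'s are imposed, but all relations of the quantum
group hold, the Serre relations included. The reason is that \<open>M\<close> looks, up to torsion, like a sum of simple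
highest weight modules, and in these the relations hold over \<open>\<rat>(v)\<close>.

The simple module of highest weight \<open>\<kappa>\<close> is realised inside the functions on words in the simple roots
(\<open>hw\<close>): \<open>e\<^sub>\<alpha>\<close> appends a letter to the argument, and the highest weight vector \<open>hwv\<close> is the indicator
function of the empty word. A function killed by all \<open>e\<^sub>\<alpha>\<close> is a multiple of \<open>hwv\<close>. The Serre elements
in the \<open>f\<close>'s commute with all \<open>e\<^sub>\<alpha>\<close>, those in the \<open>e\<close>'s with all \<open>f\<^sub>\<alpha>\<close>; therefore both act by zero on the
submodule generated by \<open>hwv\<close>.

Let \<open>z \<in> M\<^sub>\<kappa>\<close> be primitive, i.e. killed by all \<open>E\<close>. Applying the same strings of divided powers
\<open>f\<^sub>\<alpha>\<^sup>[\<^sup>n\<^sup>]\<close> to \<open>hwv\<close> and to \<open>z\<close> produces pairs \<open>(y, x)\<close> of a vector of the highest weight module and a vector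
of \<open>M\<close> (\<open>W\<close>). The commutation formula has the same coefficients on both sides, so these pairs are stable under
the divided powers of \<open>e\<^sub>\<alpha>\<close> as well (\<open>W_E\<close>). If \<open>y = 0\<close>, then \<open>x = 0\<close>: by induction on the height all \<open>E\<close>
kill \<open>x\<close>, which lies in \<open>im F\<close>, where the column vector of the \<open>E\<close>'s is injective (\<open>W_inj\<close>). So an element of
the free algebra that vanishes in the quantum group kills every such \<open>x\<close>, because it kills \<open>y\<close>.

These vectors suffice. The torsion condition in \<open>X3\<close> writes a nonzero multiple of a given \<open>x \<in> M\<^sub>\<mu>\<close> as the
sum of an element of \<open>im F\<close> and a primitive vector (\<open>primitive_decomposition\<close>), so by downward induction on
weights a nonzero multiple of \<open>x\<close> is a sum of second components (\<open>Gen_all\<close>). The freeness condition makes \<open>M\<close>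
torsion free (\<open>torsion_free\<close>), so that this nonzero multiple can be cancelled. Hence the operator on \<open>M\<close>
assigned to an element of Lusztig's form depends only on this element (\<open>Rel_unique\<close>), and the universal property
of the tensor product extends the resulting representation \<open>rho\<close> to \<open>U\<^bsub>A\<^esub>\<close>.

The torus acts on \<open>M\<^sub>\<mu>\<close> through \<open>\<chi>\<^sub>\<mu>\<close>, again by comparison with highest weight modules (\<open>rho_fkbin\<close>).
Different weights have different characters over any domain (\<open>qbinom_separates\<close>), so the grading is the weight
decomposition. The generators of \<open>U\<^bsub>A\<^esub>\<close> act by prescribed maps, which gives uniqueness, and a map is
\<open>U\<^bsub>A\<^esub>\<close>-linear if and only if it is a morphism of \<open>\<X>\<close>. Finally \<open>S (R M)\<close> and \<open>M\<close> differ at most in values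
outside of the domains of scalar multiplication, grading and structure maps.\<close>

section \<open>Monoid rings\<close>

abbreviation type_ring :: "'k::comm_ring_1 ring" where
  "type_ring \<equiv> ring_of_type_algebra"

lemma type_ring_simps [simp]:
  "carrier (type_ring :: 'k::comm_ring_1 ring) = UNIV"
  "x \<otimes>\<^bsub>type_ring\<^esub> y = x * (y :: 'k)"
  "x \<oplus>\<^bsub>type_ring\<^esub> y = x + (y :: 'k)"
  "\<one>\<^bsub>type_ring\<^esub> = (1 :: 'k)"
  "\<zero>\<^bsub>type_ring\<^esub> = (0 :: 'k)"
  by (simp_all add: ring_of_type_algebra_def)

lemma int_type_ring: "\<Z> = type_ring"
  by (simp add: ring_of_type_algebra_def)

lemma type_ring_ring: "ring (type_ring :: 'k::comm_ring_1 ring)"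
  by (rule cring.axioms(1)[OF cring_from_type_algebra])

lemma type_ring_minus [simp]:
  "\<ominus>\<^bsub>type_ring\<^esub> x = - (x :: 'k::comm_ring_1)" "x \<ominus>\<^bsub>type_ring\<^esub> y = x - (y :: 'k)"
proof -
  interpret T: ring "type_ring :: 'k ring" by (rule type_ring_ring)
  show n: "\<ominus>\<^bsub>type_ring\<^esub> x = - (x :: 'k::comm_ring_1)" for x
    by (rule T.minus_equality) auto
  show "x \<ominus>\<^bsub>type_ring\<^esub> y = x - (y :: 'k)"
    unfolding a_minus_def n by simp
qed

lemma finsum_type_ring: "finite A ==> finsum type_ring f A = sum (f :: 'b => 'k::comm_ring_1) A"
proof (induction rule: finite_induct)
  interpret T: ring "type_ring :: 'k ring" by (rule type_ring_ring)
  case empty show ?case by simp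
next
  interpret T: ring "type_ring :: 'k ring" by (rule type_ring_ring)
  case (insert x F) then show ?case by simp
qed

text \<open>Elements of a monoid ring are tested on arbitrary functions \<open>t\<close> on the monoid: \<open>pairing t f\<close> is the value at
\<open>f\<close> of the linear functional extending \<open>t\<close>. Products become iterated pairings, and the ring axioms reduce to
rearrangements of finite sums of scalars.\<close>

locale monring = G: monoid G for G :: "('g, 'q) monoid_scheme" (structure)
begin

abbreviation "MR \<equiv> monoid_ring (type_ring :: 'k::comm_ring_1 ring) G"
abbreviation "sg \<equiv> single (type_ring :: 'k::comm_ring_1 ring) G"

definition supp :: "('g => 'k::comm_ring_1) => 'g set" where
  "supp f = {x \<in> carrier G. f x \<noteq> 0}"

definition pairing :: "('g => 'k::comm_ring_1) => ('g => 'k) => 'k" where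
  "pairing t f = (\<Sum>x\<in>supp f. f x * t x)"

lemma carrier_MR:
  "f \<in> carrier MR \<longleftrightarrow> f \<in> extensional (carrier G) \<and> finite (supp (f :: 'g => 'k::comm_ring_1))"
  by (simp add: monoid_ring_def supp_def PiE_def)

lemma supp_sub: "supp f \<subseteq> carrier G"
  by (auto simp: supp_def)

lemma pairing_superset:
  "finite S ==> S \<subseteq> carrier G ==> supp f \<subseteq> S ==> pairing t f = (\<Sum>x\<in>S. f x * t x)"
  unfolding pairing_def by (rule sum.mono_neutral_left) (auto simp: supp_def)

lemma MR_eqI:
  assumes "f \<in> carrier MR" "h \<in> carrier MR"
    and "\<And>t. pairing t f = pairing t (h :: 'g => 'k::comm_ring_1)"
  shows "f = h"
proof (rule extensionalityI[where A = "carrier G"])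
  show "f \<in> extensional (carrier G)" "h \<in> extensional (carrier G)"
    using assms by (auto simp: carrier_MR)
next
  fix x assume x: "x \<in> carrier G"
  have *: "pairing (\<lambda>y. if y = x then 1 else 0) f = f x" if "f \<in> carrier MR" for f :: "'g => 'k"
  proof -
    have "pairing (\<lambda>y. if y = x then 1 else 0) f
      = (\<Sum>y\<in>insert x (supp f). f y * (if y = x then 1 else 0))"
      using that x by (intro pairing_superset) (auto simp: carrier_MR supp_def)
    also have "\<dots> = (\<Sum>y\<in>{x}. f y * (if y = x then 1 else 0))"
      using that x by (intro sum.mono_neutral_right) (auto simp: carrier_MR)
    finally show ?thesis by simp
  qed
  show "f x = h x" using *[OF assms(1)] *[OF assms(2)] assms(3) by metis
qed

lemma MR_zero_apply: "\<zero>\<^bsub>MR\<^esub> = (\<lambda>x\<in>carrier G. 0)"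
  by (simp add: monoid_ring_def)

lemma MR_add_apply: "f \<oplus>\<^bsub>MR\<^esub> h = (\<lambda>x\<in>carrier G. f x + h x)"
  by (simp add: monoid_ring_def)

lemma MR_zero_closed: "\<zero>\<^bsub>MR\<^esub> \<in> carrier MR"
  by (auto simp: carrier_MR MR_zero_apply supp_def)

lemma supp_add: "supp (f \<oplus>\<^bsub>MR\<^esub> h) \<subseteq> supp f \<union> supp (h :: 'g => 'k::comm_ring_1)"
  by (auto simp: supp_def MR_add_apply)

lemma MR_add_closed:
  "f \<in> carrier MR ==> h \<in> carrier MR ==> f \<oplus>\<^bsub>MR\<^esub> (h :: 'g => 'k::comm_ring_1) \<in> carrier MR"
  using finite_subset[OF supp_add] by (auto simp: carrier_MR MR_add_apply)

lemma pairing_zero [simp]: "pairing t \<zero>\<^bsub>MR\<^esub> = 0"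
  by (simp add: pairing_def supp_def MR_zero_apply)

lemma pairing_add:
  assumes "f \<in> carrier MR" "h \<in> carrier MR"
  shows "pairing t (f \<oplus>\<^bsub>MR\<^esub> h) = pairing t f + pairing t (h :: 'g => 'k::comm_ring_1)"
proof -
  let ?S = "supp f \<union> supp h"
  have S: "finite ?S" "?S \<subseteq> carrier G" using assms by (auto simp: carrier_MR supp_def)
  have "pairing t (f \<oplus>\<^bsub>MR\<^esub> h) = (\<Sum>x\<in>?S. (f \<oplus>\<^bsub>MR\<^esub> h) x * t x)"
    by (rule pairing_superset[OF S supp_add])
  also have "\<dots> = (\<Sum>x\<in>?S. f x * t x + h x * t x)"
    using S by (intro sum.cong) (auto simp: MR_add_apply algebra_simps)
  also have "\<dots> = pairing t f + pairing t h"
    using pairing_superset[OF S, of f t] pairing_superset[OF S, of h t] by (simp add: sum.distrib)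
  finally show ?thesis .
qed

lemma pairing_cong: "(\<And>x. x \<in> carrier G ==> t x = t' x) ==> pairing t f = pairing t' f"
  unfolding pairing_def by (rule sum.cong) (auto simp: supp_def)

lemma pairing_lin:
  "pairing (\<lambda>x. t x + t' x) f = pairing t f + pairing t' (f :: 'g => 'k::comm_ring_1)"
  "pairing (\<lambda>x. c * t x) f = c * pairing t f"
  "pairing (\<lambda>x. 0) f = 0"
  by (simp_all add: pairing_def algebra_simps sum.distrib sum_distrib_left)

lemma MR_mult_apply:
  assumes "f \<in> carrier MR" "h \<in> carrier MR" "x \<in> carrier G"
  shows "(f \<otimes>\<^bsub>MR\<^esub> h) x
    = (\<Sum>y\<in>supp f. \<Sum>z\<in>supp h. if y \<otimes> z = x then f y * h z else (0 :: 'k::comm_ring_1))"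
proof -
  have S: "finite (supp f)" "finite (supp h)" using assms by (auto simp: carrier_MR)
  have eq: "{(y, z). y \<in> carrier G \<and> z \<in> carrier G \<and> f y \<noteq> 0 \<and> h z \<noteq> 0 \<and> y \<otimes> z = x}
     = {p \<in> supp f \<times> supp h. fst p \<otimes> snd p = x}"
    by (auto simp: supp_def)
  have "(f \<otimes>\<^bsub>MR\<^esub> h) x = (\<Sum>p\<in>{p \<in> supp f \<times> supp h. fst p \<otimes> snd p = x}. f (fst p) * h (snd p))"
    using assms S by (simp add: monoid_ring_def eq finsum_type_ring case_prod_beta)
  also have "\<dots> = (\<Sum>p\<in>supp f \<times> supp h. if fst p \<otimes> snd p = x then f (fst p) * h (snd p) else 0)"
    using S by (simp add: sum.inter_filter)
  also have "\<dots> = (\<Sum>y\<in>supp f. \<Sum>z\<in>supp h. if y \<otimes> z = x then f y * h z else 0)"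
    by (simp add: sum.cartesian_product case_prod_beta)
  finally show ?thesis .
qed

lemma supp_mult:
  assumes "f \<in> carrier MR" "h \<in> carrier MR"
  shows "supp (f \<otimes>\<^bsub>MR\<^esub> h) \<subseteq> (\<lambda>p. fst p \<otimes> snd p) ` (supp f \<times> supp (h :: 'g => 'k::comm_ring_1))"
proof
  fix x assume x: "x \<in> supp (f \<otimes>\<^bsub>MR\<^esub> h)"
  then have "(\<Sum>y\<in>supp f. \<Sum>z\<in>supp h. if y \<otimes> z = x then f y * h z else 0) \<noteq> 0"
    using MR_mult_apply[OF assms] by (auto simp: supp_def)
  then obtain y where y: "y \<in> supp f"
      and "(\<Sum>z\<in>supp h. if y \<otimes> z = x then f y * h z else 0) \<noteq> 0"
    by (rule sum.not_neutral_contains_not_neutral)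
  then obtain z where "z \<in> supp h" "(if y \<otimes> z = x then f y * h z else 0) \<noteq> 0"
    by (elim sum.not_neutral_contains_not_neutral)
  then have "y \<in> supp f" "z \<in> supp h" "y \<otimes> z = x"
    using y by (simp_all split: if_splits)
  then show "x \<in> (\<lambda>p. fst p \<otimes> snd p) ` (supp f \<times> supp h)" 
    by (intro image_eqI[of _ _ "(y, z)"]) simp_all
qed

lemma MR_mult_closed:
  assumes "f \<in> carrier MR" "h \<in> carrier MR"
  shows "f \<otimes>\<^bsub>MR\<^esub> (h :: 'g => 'k::comm_ring_1) \<in> carrier MR"
proof -
  have "finite (supp (f \<otimes>\<^bsub>MR\<^esub> h))"
    by (rule finite_subset[OF supp_mult[OF assms]]) (use assms in \<open>auto simp: carrier_MR\<close>)
  moreover have "f \<otimes>\<^bsub>MR\<^esub> h \<in> extensional (carrier G)"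
    by (simp add: monoid_ring_def)
  ultimately show ?thesis by (simp add: carrier_MR)
qed

lemma pairing_mult:
  assumes "f \<in> carrier MR" "h \<in> carrier MR"
  shows "pairing t (f \<otimes>\<^bsub>MR\<^esub> h)
    = pairing (\<lambda>y. pairing (\<lambda>z. t (y \<otimes> z)) h) (f :: 'g => 'k::comm_ring_1)"
proof -
  let ?S = "(\<lambda>p. fst p \<otimes> snd p) ` (supp f \<times> supp h)"
  have fin: "finite (supp f)" "finite (supp h)" using assms by (auto simp: carrier_MR)
  have S: "finite ?S" "?S \<subseteq> carrier G"
    using fin supp_sub by (simp, force simp: image_subset_iff subset_iff)
  have "pairing t (f \<otimes>\<^bsub>MR\<^esub> h) = (\<Sum>x\<in>?S. (f \<otimes>\<^bsub>MR\<^esub> h) x * t x)"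
    by (rule pairing_superset[OF S supp_mult[OF assms]])
  also have "\<dots> = (\<Sum>x\<in>?S. \<Sum>y\<in>supp f. \<Sum>z\<in>supp h. if x = y \<otimes> z then f y * h z * t x else 0)"
  proof (intro sum.cong refl)
    fix x assume "x \<in> ?S"
    then have x: "x \<in> carrier G" using S by auto
    show "(f \<otimes>\<^bsub>MR\<^esub> h) x * t x
      = (\<Sum>y\<in>supp f. \<Sum>z\<in>supp h. if x = y \<otimes> z then f y * h z * t x else 0)"
      unfolding MR_mult_apply[OF assms x] sum_distrib_right
      by (intro sum.cong refl) (simp split: if_split)
  qed
  also have "\<dots> = (\<Sum>y\<in>supp f. \<Sum>x\<in>?S. \<Sum>z\<in>supp h. if x = y \<otimes> z then f y * h z * t x else 0)"
    by (rule sum.swap)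
  also have "\<dots> = (\<Sum>y\<in>supp f. \<Sum>z\<in>supp h. \<Sum>x\<in>?S. if x = y \<otimes> z then f y * h z * t x else 0)"
    by (rule sum.cong[OF refl], rule sum.swap)
  also have "\<dots> = (\<Sum>y\<in>supp f. \<Sum>z\<in>supp h. f y * (h z * t (y \<otimes> z)))"
  proof (intro sum.cong refl)
    fix y z assume "y \<in> supp f" "z \<in> supp h"
    then have "(y, z) \<in> supp f \<times> supp h" by simp
    then have "y \<otimes> z \<in> ?S" 
      by (intro image_eqI[of _ _ "(y, z)"]) simp_all
    then show "(\<Sum>x\<in>?S. if x = y \<otimes> z then f y * h z * t x else 0) = f y * (h z * t (y \<otimes> z))"
      using S(1) by (simp only: sum.delta) (simp add: mult.assoc)
  qed
  also have "\<dots> = pairing (\<lambda>y. pairing (\<lambda>z. t (y \<otimes> z)) h) f"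
    by (simp add: pairing_def sum_distrib_left)
  finally show ?thesis .
qed

lemma single_closed: "sg g (c :: 'k::comm_ring_1) \<in> carrier MR"
proof -
  have "supp (sg g c) \<subseteq> {g}" by (auto simp: supp_def single_def split: if_splits)
  then have "finite (supp (sg g c))" by (rule finite_subset) simp
  then show ?thesis by (simp add: carrier_MR single_def)
qed

lemma pairing_single: "g \<in> carrier G ==> pairing t (sg g c) = (c :: 'k::comm_ring_1) * t g"
proof -
  assume "g \<in> carrier G"
  moreover have "supp (sg g c) \<subseteq> {g}" by (auto simp: supp_def single_def split: if_splits)
  ultimately have "pairing t (sg g c) = (\<Sum>x\<in>{g}. sg g c x * t x)"
    by (intro pairing_superset) auto
  then show ?thesis using \<open>g \<in> carrier G\<close> by (simp add: single_def)
qed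

lemma MR_one: "\<one>\<^bsub>MR\<^esub> = sg \<one> (1 :: 'k::comm_ring_1)"
  by (simp add: monoid_ring_def single_def cong: if_cong)

lemmas MR_closed = MR_add_closed MR_zero_closed MR_mult_closed single_closed
lemmas MR_pairing = pairing_add pairing_zero pairing_mult pairing_single

lemma MR_abelian: "abelian_group (MR :: ('g => 'k::comm_ring_1) ring)"
proof (rule abelian_groupI)
  fix x y z :: "'g => 'k" assume x: "x \<in> carrier MR"
  show "\<zero>\<^bsub>MR\<^esub> \<oplus>\<^bsub>MR\<^esub> x = x"
    by (rule MR_eqI) (simp_all add: x MR_closed MR_pairing)
  let ?y = "\<lambda>g\<in>carrier G. - x g"
  have "supp ?y = supp x" by (auto simp: supp_def)
  then have "?y \<in> carrier MR" using x by (simp add: carrier_MR)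
  moreover have "?y \<oplus>\<^bsub>MR\<^esub> x = \<zero>\<^bsub>MR\<^esub>"
    by (simp add: MR_add_apply MR_zero_apply restrict_def fun_eq_iff)
  ultimately show "\<exists>y\<in>carrier MR. y \<oplus>\<^bsub>MR\<^esub> x = \<zero>\<^bsub>MR\<^esub>" by blast
  assume y: "y \<in> carrier MR"
  show "x \<oplus>\<^bsub>MR\<^esub> y \<in> carrier MR" by (rule MR_add_closed[OF x y])
  show "x \<oplus>\<^bsub>MR\<^esub> y = y \<oplus>\<^bsub>MR\<^esub> x"
    by (rule MR_eqI) (simp_all add: x y MR_closed MR_pairing add.commute)
  assume z: "z \<in> carrier MR"
  show "(x \<oplus>\<^bsub>MR\<^esub> y) \<oplus>\<^bsub>MR\<^esub> z = x \<oplus>\<^bsub>MR\<^esub> (y \<oplus>\<^bsub>MR\<^esub> z)"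
    by (rule MR_eqI) (simp_all add: x y z MR_closed MR_pairing add.assoc)
qed (rule MR_zero_closed)

lemma MR_monoid: "Group.monoid (MR :: ('g => 'k::comm_ring_1) ring)"
proof (rule monoidI)
  fix x y z :: "'g => 'k" assume x: "x \<in> carrier MR"
  show "\<one>\<^bsub>MR\<^esub> \<otimes>\<^bsub>MR\<^esub> x = x"
    unfolding MR_one
    by (rule MR_eqI) (simp_all add: x MR_closed MR_pairing cong: pairing_cong)
  show "x \<otimes>\<^bsub>MR\<^esub> \<one>\<^bsub>MR\<^esub> = x"
    unfolding MR_one
    by (rule MR_eqI) (simp_all add: x MR_closed MR_pairing cong: pairing_cong)
  assume y: "y \<in> carrier MR"
  show "x \<otimes>\<^bsub>MR\<^esub> y \<in> carrier MR" by (rule MR_mult_closed[OF x y])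
  assume z: "z \<in> carrier MR"
  show "(x \<otimes>\<^bsub>MR\<^esub> y) \<otimes>\<^bsub>MR\<^esub> z = x \<otimes>\<^bsub>MR\<^esub> (y \<otimes>\<^bsub>MR\<^esub> z)"
    by (rule MR_eqI) (simp_all add: x y z MR_closed MR_pairing G.m_assoc cong: pairing_cong)
qed (simp add: MR_one MR_closed)

lemma MR_ring: "ring (MR :: ('g => 'k::comm_ring_1) ring)"
proof (rule ringI[OF MR_abelian MR_monoid])
  fix x y z :: "'g => 'k" assume x: "x \<in> carrier MR" and y: "y \<in> carrier MR" and z: "z \<in> carrier MR"
  show "(x \<oplus>\<^bsub>MR\<^esub> y) \<otimes>\<^bsub>MR\<^esub> z = x \<otimes>\<^bsub>MR\<^esub> z \<oplus>\<^bsub>MR\<^esub> y \<otimes>\<^bsub>MR\<^esub> z"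
    by (rule MR_eqI) (simp_all add: x y z MR_closed MR_pairing)
  show "z \<otimes>\<^bsub>MR\<^esub> (x \<oplus>\<^bsub>MR\<^esub> y) = z \<otimes>\<^bsub>MR\<^esub> x \<oplus>\<^bsub>MR\<^esub> z \<otimes>\<^bsub>MR\<^esub> y"
    by (rule MR_eqI) (simp_all add: x y z MR_closed MR_pairing pairing_lin)
qed

lemma single_mult:
  assumes "g \<in> carrier G" "h \<in> carrier G"
  shows "sg g c \<otimes>\<^bsub>MR\<^esub> sg h d = sg (g \<otimes> h) (c * d :: 'k::comm_ring_1)"
  by (rule MR_eqI) (simp_all add: assms MR_closed MR_pairing mult.assoc cong: pairing_cong)

lemma single_add:
  assumes "g \<in> carrier G"
  shows "sg g c \<oplus>\<^bsub>MR\<^esub> sg g d = sg g (c + d :: 'k::comm_ring_1)"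
  by (rule MR_eqI) (simp_all add: assms MR_closed MR_pairing distrib_right)

lemma MR_induct [consumes 1, case_names zero add]:
  fixes f :: "'g => 'k::comm_ring_1"
  assumes f: "f \<in> carrier MR" and z: "P \<zero>\<^bsub>MR\<^esub>"
    and a: "\<And>g c h. g \<in> carrier G ==> h \<in> carrier MR ==> P h ==> P (sg g c \<oplus>\<^bsub>MR\<^esub> h)"
  shows "P f"
proof -
  have "finite (supp f)" using f by (simp add: carrier_MR)
  then show ?thesis using f
  proof (induction "card (supp f)" arbitrary: f rule: less_induct)
    case less
    show ?case
    proof (cases "supp f = {}")
      case True
      have "f = \<zero>\<^bsub>MR\<^esub>"
        by (rule MR_eqI[OF less.prems(2) MR_zero_closed], simp only: pairing_zero)
           (simp add: pairing_def True)
      then show ?thesis using z by simp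
    next
      case False
      then obtain g where g: "g \<in> supp f" by blast
      then have gG: "g \<in> carrier G" by (simp add: supp_def)
      let ?h = "\<lambda>x\<in>carrier G. if x = g then 0 else f x"
      have s: "supp ?h = supp f - {g}" by (auto simp: supp_def)
      then have h: "?h \<in> carrier MR" using less.prems by (auto simp: carrier_MR)
      have "P ?h"
        by (rule less.hyps) (use g s h less.prems(1) in \<open>auto intro: card_Diff1_less simp del: card_Diff_insert\<close>)
      moreover have "f = sg g (f g) \<oplus>\<^bsub>MR\<^esub> ?h"
        using less.prems(2) gG
        by (auto simp: MR_add_apply single_def carrier_MR extensional_def fun_eq_iff restrict_def)
      ultimately show ?thesis using a[OF gG h] by metis
    qed
  qed
qed

end

context monring
begin

abbreviation "ZG \<equiv> monoid_ring (type_ring :: int ring) G"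
abbreviation "zs \<equiv> single (type_ring :: int ring) G"

text \<open>Universal property of the integral monoid ring: multiplicative maps extend additively.\<close>

lemma int_MR_hom:
  assumes B: "ring B" and t: "\<And>g. g \<in> carrier G ==> t g \<in> carrier B"
    and t1: "t \<one> = \<one>\<^bsub>B\<^esub>"
    and tm: "\<And>g h. g \<in> carrier G ==> h \<in> carrier G ==> t (g \<otimes> h) = t g \<otimes>\<^bsub>B\<^esub> t h"
  shows "\<exists>h \<in> ring_hom ZG B. \<forall>g\<in>carrier G. h (zs g 1) = t g"
proof -
  interpret B: ring B by fact
  interpret MR: ring "ZG" by (rule MR_ring)
  define H where "H f = finsum B (\<lambda>x. [f x] \<cdot>\<^bsub>B\<^esub> t x) (supp f)" for f :: "'g => int"
  have tc: "[(k::int)] \<cdot>\<^bsub>B\<^esub> t x \<in> carrier B" if "x \<in> carrier G" for k x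
    using t[OF that] by simp
  have Hsup: "H f = finsum B (\<lambda>x. [f x] \<cdot>\<^bsub>B\<^esub> t x) S"
    if "finite S" "S \<subseteq> carrier G" "supp f \<subseteq> S" for f S
    unfolding H_def using that tc
    by (intro B.add.finprod_mono_neutral_cong_left) (auto simp: supp_def subset_iff add_pow_def Pi_iff)
  have Hc: "H f \<in> carrier B" for f
    unfolding H_def using tc supp_sub[of f] by (intro B.finsum_closed) auto
  have Hadd: "H (f \<oplus>\<^bsub>ZG\<^esub> h) = H f \<oplus>\<^bsub>B\<^esub> H h" if f: "f \<in> carrier ZG" and h: "h \<in> carrier ZG" for f h
  proof -
    let ?S = "supp f \<union> supp h"
    have S: "finite ?S" "?S \<subseteq> carrier G" using f h supp_sub by (auto simp: carrier_MR)
    have "H (f \<oplus>\<^bsub>ZG\<^esub> h) = finsum B (\<lambda>x. [(f \<oplus>\<^bsub>ZG\<^esub> h) x] \<cdot>\<^bsub>B\<^esub> t x) ?S"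
      by (rule Hsup[OF S supp_add])
    also have "\<dots> = finsum B (\<lambda>x. [f x] \<cdot>\<^bsub>B\<^esub> t x \<oplus>\<^bsub>B\<^esub> [h x] \<cdot>\<^bsub>B\<^esub> t x) ?S"
      using S t by (intro B.add.finprod_cong') (auto simp: MR_add_apply B.add.int_pow_mult subset_iff Pi_iff)
    also have "\<dots> = H f \<oplus>\<^bsub>B\<^esub> H h"
      unfolding Hsup[OF S Un_upper1] Hsup[OF S Un_upper2]
      by (rule B.finsum_addf) (use S tc in auto)
    finally show ?thesis .
  qed
  have Hs: "H (zs g c) = [c] \<cdot>\<^bsub>B\<^esub> t g" if g: "g \<in> carrier G" for g c
  proof -
    have "supp (zs g c) \<subseteq> {g}" by (auto simp: supp_def single_def split: if_splits)
    then have "H (zs g c) = finsum B (\<lambda>x. [zs g c x] \<cdot>\<^bsub>B\<^esub> t x) {g}"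
      using g by (intro Hsup) auto
    also have "\<dots> = [c] \<cdot>\<^bsub>B\<^esub> t g" using g t by (simp add: single_def)
    finally show ?thesis .
  qed
  have H0: "H \<zero>\<^bsub>ZG\<^esub> = \<zero>\<^bsub>B\<^esub>"
  proof -
    have "supp (\<zero>\<^bsub>ZG\<^esub> :: 'g => int) = {}" by (auto simp: supp_def MR_zero_apply)
    then show ?thesis by (simp add: H_def)
  qed
  have Hm1: "H (zs g c \<otimes>\<^bsub>ZG\<^esub> h) = H (zs g c) \<otimes>\<^bsub>B\<^esub> H h" if g: "g \<in> carrier G" and h: "h \<in> carrier ZG" for g c h
    using h
  proof (induction rule: MR_induct)
    case zero show ?case using g by (simp add: H0 Hc single_closed)
  next
    case (add k d h)
    have 1: "H (zs g c \<otimes>\<^bsub>ZG\<^esub> zs k d) = H (zs g c) \<otimes>\<^bsub>B\<^esub> H (zs k d)"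
      using g add.hyps(1) t
      by (simp add: single_mult Hs tm B.add_pow_ldistr_int B.add_pow_rdistr_int B.add.int_pow_pow mult.commute)
    show ?case
      using g add 1 by (simp add: MR.r_distr single_closed Hadd Hc B.r_distr MR_closed)
  qed
  have Hm: "H (f \<otimes>\<^bsub>ZG\<^esub> h) = H f \<otimes>\<^bsub>B\<^esub> H h" if f: "f \<in> carrier ZG" and h: "h \<in> carrier ZG" for f h
    using f
  proof (induction rule: MR_induct)
    case zero show ?case using h by (simp add: H0 Hc)
  next
    case (add k d f)
    then show ?case
      using h by (simp add: MR.l_distr single_closed Hadd Hc B.l_distr MR_closed Hm1)
  qed
  have "H \<in> ring_hom ZG B"
    by (rule ring_hom_memI) (simp_all add: Hc Hadd Hm MR_one Hs t1)
  then show ?thesis using Hs t by (intro bexI[of _ H]) auto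
qed

end

section \<open>Tensor products of algebras\<close>

lemma (in ring) quot_hom:
  assumes I: "ideal I R" and B: "ring B" and h: "h \<in> ring_hom R B"
    and k: "\<And>x. x \<in> I ==> h x = \<zero>\<^bsub>B\<^esub>"
  shows "\<exists>j \<in> ring_hom (R Quot I) B. \<forall>x\<in>carrier R. j (I +> x) = h x"
proof -
  interpret I: ideal I R by fact
  interpret Bh: ring_hom_ring R B h by (rule ring_hom_ringI2[OF ring_axioms B h])
  have im: "h ` (I +> x) = {h x}" if x: "x \<in> carrier R" for x
  proof -
    have "h y = h x" if y: "y \<in> I +> x" for y
    proof -
      obtain i where i: "i \<in> I" "y = i \<oplus> x" using y by (auto simp: a_r_coset_def')
      then show ?thesis using x k I.a_subset by auto
    qed
    moreover have "x \<in> I +> x" by (rule I.a_rcos_self[OF x])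
    ultimately show ?thesis by blast
  qed
  define j where "j C = the_elem (h ` C)" for C
  have j: "j (I +> x) = h x" if "x \<in> carrier R" for x
    using im[OF that] by (simp add: j_def)
  have ex: "\<exists>x\<in>carrier R. C = I +> x" if "C \<in> carrier (R Quot I)" for C
    using that by (auto simp: FactRing_def A_RCOSETS_def')
  have hom: "(\<lambda>x. I +> x) \<in> ring_hom R (R Quot I)" by (rule I.rcos_ring_hom)
  have "j \<in> ring_hom (R Quot I) B"
  proof (rule ring_hom_memI)
    fix C assume "C \<in> carrier (R Quot I)"
    then obtain x where x: "x \<in> carrier R" "C = I +> x" using ex by blast
    then show "j C \<in> carrier B" by (simp add: j)
    fix C' assume "C' \<in> carrier (R Quot I)"
    then obtain y where y: "y \<in> carrier R" "C' = I +> y" using ex by blast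
    have "C \<otimes>\<^bsub>R Quot I\<^esub> C' = I +> (x \<otimes> y)" "C \<oplus>\<^bsub>R Quot I\<^esub> C' = I +> (x \<oplus> y)"
      using ring_hom_mult[OF hom x(1) y(1)] ring_hom_add[OF hom x(1) y(1)] x y by simp_all
    then show "j (C \<otimes>\<^bsub>R Quot I\<^esub> C') = j C \<otimes>\<^bsub>B\<^esub> j C'" "j (C \<oplus>\<^bsub>R Quot I\<^esub> C') = j C \<oplus>\<^bsub>B\<^esub> j C'"
      using x y by (simp_all add: j)
  next
    show "j \<one>\<^bsub>R Quot I\<^esub> = \<one>\<^bsub>B\<^esub>" using ring_hom_one[OF hom] j[OF one_closed] by simp
  qed
  then show ?thesis using j by blast
qed

locale tensor_data = U: ring U + A: cring A
  for Z :: "('z, 'p) ring_scheme" and U :: "('u, 'q) ring_scheme" and A :: "('a, 'r) ring_scheme" +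
  fixes s :: "'z => 'u" and \<phi> :: "'z => 'a"
  assumes s: "s \<in> ring_hom Z U" and \<phi>: "\<phi> \<in> ring_hom Z A"
    and central: "\<And>z u. z \<in> carrier Z ==> u \<in> carrier U ==> s z \<otimes>\<^bsub>U\<^esub> u = u \<otimes>\<^bsub>U\<^esub> s z"
begin

interpretation UA: monring "U \<times>\<times> A"
  unfolding monring_def by (rule DirProd_monoid) (rule U.is_monoid A.is_monoid)+

abbreviation "TR \<equiv> tensor_ring Z U s A \<phi>"
abbreviation "tel \<equiv> tensor_elt Z U s A \<phi>"
abbreviation "TI \<equiv> tensor_ideal Z U s A \<phi>"
abbreviation "b u a \<equiv> UA.zs (u, a) 1"

interpretation T: ring "monoid_ring (type_ring :: int ring) (U \<times>\<times> A)"
  by (rule UA.MR_ring)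

lemma carrier_UA [simp]: "carrier (U \<times>\<times> A) = carrier U \<times> carrier A"
  by (simp add: DirProd_def)

lemma mult_UA [simp]: "(u, a) \<otimes>\<^bsub>U \<times>\<times> A\<^esub> (u', a') = (u \<otimes>\<^bsub>U\<^esub> u', a \<otimes>\<^bsub>A\<^esub> a')"
  by (simp add: DirProd_def)

lemma one_UA: "\<one>\<^bsub>U \<times>\<times> A\<^esub> = (\<one>\<^bsub>U\<^esub>, \<one>\<^bsub>A\<^esub>)"
  by (simp add: DirProd_def)

lemma b_closed: "b u a \<in> carrier UA.ZG" by (rule UA.single_closed)

lemma rels_closed: "tensor_rels Z U s A \<phi> \<subseteq> carrier UA.ZG"
  unfolding tensor_rels_def Let_def int_type_ring
  by (auto intro!: T.minus_closed T.a_closed b_closed)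

lemma TI_ideal: "ideal TI UA.ZG"
  unfolding tensor_ideal_def int_type_ring
  by (rule T.genideal_ideal) (use rels_closed in \<open>simp add: int_type_ring\<close>)

interpretation TI: ideal TI "monoid_ring (type_ring :: int ring) (U \<times>\<times> A)" by (rule TI_ideal)

lemma TR_eq: "TR = UA.ZG Quot TI"
  by (simp add: tensor_ring_def int_type_ring)

sublocale TR: ring TR
  unfolding TR_eq by (rule TI.quotient_is_ring)

definition "cl x = TI +>\<^bsub>UA.ZG\<^esub> x"

lemma cl_hom: "cl \<in> ring_hom UA.ZG TR"
  unfolding TR_eq cl_def[abs_def] by (rule TI.rcos_ring_hom)

interpretation cl: ring_hom_ring UA.ZG TR cl
  by (rule ring_hom_ringI2[OF T.ring_axioms TR.ring_axioms cl_hom])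

lemma tel_eq: "tel u a = cl (b u a)"
  by (simp add: tensor_elt_def cl_def int_type_ring)

lemma tel_closed [simp]: "tel u a \<in> carrier TR"
  by (simp add: tel_eq b_closed)

lemma rel_eq:
  assumes "x \<ominus>\<^bsub>UA.ZG\<^esub> y \<in> tensor_rels Z U s A \<phi>" "x \<in> carrier UA.ZG" "y \<in> carrier UA.ZG"
  shows "cl x = cl y"
proof -
  have "x \<ominus>\<^bsub>UA.ZG\<^esub> y \<in> TI"
    using assms(1) T.genideal_self[OF rels_closed] by (auto simp: tensor_ideal_def int_type_ring)
  then have "cl (x \<ominus>\<^bsub>UA.ZG\<^esub> y) = \<zero>\<^bsub>TR\<^esub>"
    unfolding cl_def TR_eq by (simp add: FactRing_def TI.a_rcos_const)
  then show ?thesis using assms(2,3)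
    by (simp add: a_minus_def) (metis TR.minus_equality TR.minus_minus cl.hom_closed TR.a_inv_closed)
qed

lemma tel_add_left:
  "u \<in> carrier U ==> u' \<in> carrier U ==> a \<in> carrier A ==> tel (u \<oplus>\<^bsub>U\<^esub> u') a = tel u a \<oplus>\<^bsub>TR\<^esub> tel u' a"
  unfolding tel_eq cl.hom_add[OF b_closed b_closed, symmetric]
  by (rule rel_eq) (auto simp: tensor_rels_def Let_def int_type_ring intro!: b_closed T.a_closed)

lemma tel_add_right:
  "u \<in> carrier U ==> a \<in> carrier A ==> a' \<in> carrier A ==> tel u (a \<oplus>\<^bsub>A\<^esub> a') = tel u a \<oplus>\<^bsub>TR\<^esub> tel u a'"
  unfolding tel_eq cl.hom_add[OF b_closed b_closed, symmetric]
  by (rule rel_eq) (auto simp: tensor_rels_def Let_def int_type_ring intro!: b_closed T.a_closed)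

lemma tel_scal:
  "z \<in> carrier Z ==> u \<in> carrier U ==> a \<in> carrier A ==> tel (s z \<otimes>\<^bsub>U\<^esub> u) a = tel u (\<phi> z \<otimes>\<^bsub>A\<^esub> a)"
  unfolding tel_eq
  by (rule rel_eq) (auto simp: tensor_rels_def Let_def int_type_ring intro!: b_closed T.a_closed)

lemma tel_mult:
  "u \<in> carrier U ==> u' \<in> carrier U ==> a \<in> carrier A ==> a' \<in> carrier A ==>
    tel u a \<otimes>\<^bsub>TR\<^esub> tel u' a' = tel (u \<otimes>\<^bsub>U\<^esub> u') (a \<otimes>\<^bsub>A\<^esub> a')"
  unfolding tel_eq cl.hom_mult[OF b_closed b_closed, symmetric]
  by (simp add: UA.single_mult)

lemma tel_one: "tel \<one>\<^bsub>U\<^esub> \<one>\<^bsub>A\<^esub> = \<one>\<^bsub>TR\<^esub>"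
  unfolding tel_eq cl.hom_one[symmetric] by (simp add: UA.MR_one one_UA)

lemma tel_zero_right: "u \<in> carrier U ==> tel u \<zero>\<^bsub>A\<^esub> = \<zero>\<^bsub>TR\<^esub>"
  using tel_add_right[of u "\<zero>\<^bsub>A\<^esub>" "\<zero>\<^bsub>A\<^esub>"] by (simp add: TR.add.l_cancel_one')

lemma tel_zero_left: "a \<in> carrier A ==> tel \<zero>\<^bsub>U\<^esub> a = \<zero>\<^bsub>TR\<^esub>"
  using tel_add_left[of "\<zero>\<^bsub>U\<^esub>" "\<zero>\<^bsub>U\<^esub>" a] by (simp add: TR.add.l_cancel_one')

text \<open>Integer multiples of a pure tensor can be moved into its second factor, so pure tensors generate additively.\<close>

lemma TR_induct [consumes 1, case_names tel add]:
  assumes x: "x \<in> carrier TR"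
    and tel: "\<And>u a. u \<in> carrier U ==> a \<in> carrier A ==> P (tel u a)"
    and add: "\<And>x y. x \<in> carrier TR ==> y \<in> carrier TR ==> P x ==> P y ==> P (x \<oplus>\<^bsub>TR\<^esub> y)"
  shows "P x"
proof -
  have z: "P \<zero>\<^bsub>TR\<^esub>" using tel[of "\<zero>\<^bsub>U\<^esub>" "\<zero>\<^bsub>A\<^esub>"] by (simp add: tel_zero_left)
  have pos: "cl (UA.zs (u, a) (int n)) = tel u ([n] \<cdot>\<^bsub>A\<^esub> a)"
    if "u \<in> carrier U" "a \<in> carrier A" for u a n
  proof (induction n)
    case 0
    have "UA.zs (u, a) 0 = \<zero>\<^bsub>UA.ZG\<^esub>" by (auto simp: single_def UA.MR_zero_apply)
    then show ?case using that by (simp add: tel_zero_right)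
  next
    case (Suc n)
    have "UA.zs (u, a) (int (Suc n)) = UA.zs (u, a) (int n) \<oplus>\<^bsub>UA.ZG\<^esub> b u a"
      using that by (simp add: UA.single_add add.commute)
    then show ?case using that Suc
      by (simp add: UA.single_closed tel_add_right A.add.nat_pow_Suc tel_eq[symmetric])
  qed
  have sg: "P (cl (UA.zs (u, a) c))" if ua: "u \<in> carrier U" "a \<in> carrier A" for u a c
  proof (cases "c \<ge> 0")
    case True
    then have "cl (UA.zs (u, a) c) = tel u ([nat c] \<cdot>\<^bsub>A\<^esub> a)" using pos[OF ua, of "nat c"] by simp
    then show ?thesis using tel ua by simp
  next
    case False
    have "UA.zs (u, a) c \<oplus>\<^bsub>UA.ZG\<^esub> UA.zs (u, a) (- c) = \<zero>\<^bsub>UA.ZG\<^esub>"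
      using ua by (simp add: UA.single_add) (auto simp: single_def UA.MR_zero_apply)
    then have 1: "cl (UA.zs (u, a) c) \<oplus>\<^bsub>TR\<^esub> cl (UA.zs (u, a) (- c)) = \<zero>\<^bsub>TR\<^esub>"
      by (metis cl.hom_add cl.hom_zero UA.single_closed)
    have 2: "cl (UA.zs (u, a) (- c)) = tel u ([nat (- c)] \<cdot>\<^bsub>A\<^esub> a)" using False pos[OF ua, of "nat (- c)"] by simp
    let ?y = "[nat (- c)] \<cdot>\<^bsub>A\<^esub> a"
    have y: "?y \<in> carrier A" using ua by simp
    have "tel u (\<ominus>\<^bsub>A\<^esub> ?y) \<oplus>\<^bsub>TR\<^esub> tel u ?y = \<zero>\<^bsub>TR\<^esub>"
      using ua y by (simp add: tel_add_right[symmetric] A.l_neg tel_zero_right)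
    then have "cl (UA.zs (u, a) c) = tel u (\<ominus>\<^bsub>A\<^esub> ?y)"
      using 1 unfolding 2 by (metis TR.minus_equality cl.hom_closed UA.single_closed tel_closed)
    then show ?thesis using tel ua y by simp
  qed
  obtain f where f: "f \<in> carrier UA.ZG" "x = cl f"
    using x unfolding TR_eq cl_def by (auto simp: FactRing_def A_RCOSETS_def')
  have "P (cl f)" using f(1)
  proof (induction rule: UA.MR_induct)
    case zero then show ?case using z by simp
  next
    case (add g c h)
    then show ?case using sg[of "fst g" "snd g" c]
      by (auto simp: UA.single_closed intro!: assms(3))
  qed
  then show ?thesis using f by simp
qed

text \<open>Universal property of the tensor product: pure tensors multiply correctly because the images of \<open>p\<close> and
\<open>q\<close> commute, and the assignment is balanced because both homomorphisms agree on \<open>Z\<close>.\<close>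

lemma TR_hom:
  assumes B: "ring B" and p: "p \<in> ring_hom U B" and q: "q \<in> ring_hom A B"
    and c: "\<And>u a. u \<in> carrier U ==> a \<in> carrier A ==> p u \<otimes>\<^bsub>B\<^esub> q a = q a \<otimes>\<^bsub>B\<^esub> p u"
    and sp: "\<And>z. z \<in> carrier Z ==> p (s z) = q (\<phi> z)"
  shows "\<exists>h \<in> ring_hom TR B. \<forall>u\<in>carrier U. \<forall>a\<in>carrier A. h (tel u a) = p u \<otimes>\<^bsub>B\<^esub> q a"
proof -
  interpret B: ring B by fact
  interpret p: ring_hom_ring U B p by (rule ring_hom_ringI2[OF U.ring_axioms B p])
  interpret q: ring_hom_ring A B q by (rule ring_hom_ringI2[OF A.ring_axioms B q])
  have sU: "z \<in> carrier Z ==> s z \<in> carrier U" for z by (rule ring_hom_closed[OF s])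
  have fA: "z \<in> carrier Z ==> \<phi> z \<in> carrier A" for z by (rule ring_hom_closed[OF \<phi>])
  have m: "(p u \<otimes>\<^bsub>B\<^esub> p u') \<otimes>\<^bsub>B\<^esub> (q a \<otimes>\<^bsub>B\<^esub> q a') = (p u \<otimes>\<^bsub>B\<^esub> q a) \<otimes>\<^bsub>B\<^esub> (p u' \<otimes>\<^bsub>B\<^esub> q a')"
    if "u \<in> carrier U" "u' \<in> carrier U" "a \<in> carrier A" "a' \<in> carrier A" for u u' a a'
  proof -
    have "(p u \<otimes>\<^bsub>B\<^esub> p u') \<otimes>\<^bsub>B\<^esub> (q a \<otimes>\<^bsub>B\<^esub> q a') = p u \<otimes>\<^bsub>B\<^esub> (p u' \<otimes>\<^bsub>B\<^esub> q a) \<otimes>\<^bsub>B\<^esub> q a'"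
      using that by (simp add: B.m_assoc)
    also have "p u' \<otimes>\<^bsub>B\<^esub> q a = q a \<otimes>\<^bsub>B\<^esub> p u'" using that by (simp add: c)
    finally show ?thesis using that by (simp add: B.m_assoc)
  qed
  have "\<exists>h \<in> ring_hom UA.ZG B. \<forall>g\<in>carrier (U \<times>\<times> A). h (UA.zs g 1) = (\<lambda>(u, a). p u \<otimes>\<^bsub>B\<^esub> q a) g"
    by (rule UA.int_MR_hom[OF B]) (auto simp: one_UA m)
  then obtain h where h: "h \<in> ring_hom UA.ZG B"
    and hb: "\<And>u a. u \<in> carrier U ==> a \<in> carrier A ==> h (b u a) = p u \<otimes>\<^bsub>B\<^esub> q a" by auto
  interpret h: ring_hom_ring UA.ZG B h by (rule ring_hom_ringI2[OF T.ring_axioms B h])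
  have hz: "h (x \<ominus>\<^bsub>UA.ZG\<^esub> y) = \<zero>\<^bsub>B\<^esub>"
    if "x \<in> carrier UA.ZG" "y \<in> carrier UA.ZG" "h x = h y" for x y
    using that by (simp add: a_minus_def B.r_neg)
  have ker: "h r = \<zero>\<^bsub>B\<^esub>" if r: "r \<in> tensor_rels Z U s A \<phi>" for r
  proof -
    consider (c1) u u' a where "r = b (u \<oplus>\<^bsub>U\<^esub> u') a \<ominus>\<^bsub>UA.ZG\<^esub> (b u a \<oplus>\<^bsub>UA.ZG\<^esub> b u' a)"
        "u \<in> carrier U" "u' \<in> carrier U" "a \<in> carrier A"
      | (c2) u a a' where "r = b u (a \<oplus>\<^bsub>A\<^esub> a') \<ominus>\<^bsub>UA.ZG\<^esub> (b u a \<oplus>\<^bsub>UA.ZG\<^esub> b u a')"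
        "u \<in> carrier U" "a \<in> carrier A" "a' \<in> carrier A"
      | (c3) z u a where "r = b (s z \<otimes>\<^bsub>U\<^esub> u) a \<ominus>\<^bsub>UA.ZG\<^esub> b u (\<phi> z \<otimes>\<^bsub>A\<^esub> a)"
        "z \<in> carrier Z" "u \<in> carrier U" "a \<in> carrier A"
      using r unfolding tensor_rels_def Let_def int_type_ring by blast
    then show ?thesis
    proof cases
      case c1
      show ?thesis unfolding c1(1)
        by (rule hz) (use c1 in \<open>simp_all add: b_closed hb B.l_distr\<close>)
    next
      case c2
      show ?thesis unfolding c2(1)
        by (rule hz) (use c2 in \<open>simp_all add: b_closed hb B.r_distr\<close>)
    next
      case c3
      have 1: "h (b (s z \<otimes>\<^bsub>U\<^esub> u) a) = (p u \<otimes>\<^bsub>B\<^esub> q (\<phi> z)) \<otimes>\<^bsub>B\<^esub> q a"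
        unfolding central[OF c3(2,3)] using c3 sU fA by (simp add: hb sp)
      have 2: "h (b u (\<phi> z \<otimes>\<^bsub>A\<^esub> a)) = p u \<otimes>\<^bsub>B\<^esub> (q (\<phi> z) \<otimes>\<^bsub>B\<^esub> q a)"
        using c3 fA by (simp add: hb)
      show ?thesis unfolding c3(1)
        by (rule hz[OF b_closed b_closed], unfold 1 2, rule B.m_assoc) (use c3 fA in simp_all)
    qed
  qed
  have "TI \<subseteq> a_kernel UA.ZG B h"
    unfolding tensor_ideal_def int_type_ring
    by (rule T.genideal_minimal[OF h.kernel_is_ideal]) (unfold a_kernel_def', use rels_closed ker in blast)
  then have "\<And>x. x \<in> TI ==> h x = \<zero>\<^bsub>B\<^esub>" unfolding a_kernel_def' by blast
  from T.quot_hom[OF TI_ideal B h this] obtain j where j: "j \<in> ring_hom TR B"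
    "\<And>x. x \<in> carrier UA.ZG ==> j (cl x) = h x" unfolding TR_eq cl_def by blast
  then show ?thesis using hb by (intro bexI[of _ j]) (auto simp: tel_eq b_closed)
qed

end

section \<open>Quantum integers\<close>

definition qnum :: "'k::field => int => 'k" where
  "qnum x n = (x powi n - x powi (- n)) / (x - inverse x)"

definition qchoose :: "'k::field => int => nat => 'k" where
  "qchoose x n r = (\<Prod>i<r. qnum x (n - int i)) / (\<Prod>i=1..r. qnum x (int i))"

definition qfactorial :: "'k::field => nat => 'k" where
  "qfactorial x n = (\<Prod>i=1..n. qnum x (int i))"

text \<open>Not a root of unity; then \<open>[n] \<noteq> 0\<close> for all \<open>n \<noteq> 0\<close>.\<close>

definition generic :: "'k::field => bool" where
  "generic x \<longleftrightarrow> x \<noteq> 0 \<and> (\<forall>n. x powi n = 1 \<longrightarrow> n = 0)"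

definition qd :: "nat => qrat" where
  "qd d = qv powi int d"

lemma qd_powi: "qd d powi n = qv powi (int d * n)"
  by (simp only: qd_def power_int_mult)

lemma qint_qnum: "qint d n = qnum (qd d) n"
proof -
  have "qv powi (- int d) = inverse (qd d)" by (simp only: qd_def power_int_minus)
  then show ?thesis unfolding qint_def qnum_def qd_powi by (simp add: qd_def)
qed

lemma qbinom_qchoose: "qbinom d n r = qchoose (qd d) n r"
  by (simp add: qbinom_def qchoose_def qint_qnum)

lemma qfact_qfactorial: "qfact d n = qfactorial (qd d) n"
  by (simp add: qfact_def qfactorial_def qint_qnum)

lemma qv_power: "qv ^ n = Fract ([:0, 1:] ^ n) 1"
  by (induction n) (simp_all add: qv_def One_fract_def)

lemma qv_nz [simp]: "qv \<noteq> 0"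
  by (simp add: qv_def Zero_fract_def eq_fract)

lemma generic_qv: "generic qv"
proof -
  have pos: "n = 0" if "qv ^ n = 1" for n
  proof (rule ccontr)
    assume "n \<noteq> 0"
    have "Fract ([:0, 1:] ^ n :: rat poly) 1 = Fract 1 1" using that by (simp add: qv_power One_fract_def)
    then have "[:0, 1:] ^ n = (1 :: rat poly)" by (simp add: eq_fract)
    then have "poly ([:0, 1:] ^ n) (0::rat) = 1" by simp
    then show False using \<open>n \<noteq> 0\<close> by (simp add: poly_power power_0_left)
  qed
  have nonneg: "n = 0" if "qv powi n = 1" "n \<ge> 0" for n
    using that(2,1) by (cases rule: nonneg_int_cases) (use pos in simp)
  have "n = 0" if n: "qv powi n = 1" for n
  proof (cases "n \<ge> 0")
    case True then show ?thesis using nonneg[OF n] by simp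
  next
    case False
    have "qv powi (- n) = 1" using n by (simp only: power_int_minus inverse_1)
    then show ?thesis using nonneg[of "- n"] False by simp
  qed
  then show ?thesis by (simp add: generic_def)
qed

lemma generic_powi: "generic x ==> d \<noteq> 0 ==> generic (x powi d)"
  by (auto simp: generic_def power_int_mult[symmetric])

lemma generic_qd: "d > 0 ==> generic (qd d)"
  unfolding qd_def by (intro generic_powi generic_qv) simp

lemma generic_inverse: "generic x ==> generic (inverse x)"
  using generic_powi[of x "-1"] by (simp add: power_int_minus)

lemma generic_diff: assumes "generic x" shows "x - inverse x \<noteq> 0"
proof
  assume "x - inverse x = 0"
  then have "x * x = 1" using assms by (simp add: generic_def field_simps)
  then have "x powi 2 = 1" by (simp add: power2_eq_square)
  then have "(2::int) = 0" using assms unfolding generic_def by blast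
  then show False by simp
qed

lemma qnum_nz: assumes "generic x" "n \<noteq> 0" shows "qnum x n \<noteq> 0"
proof
  assume "qnum x n = 0"
  then have "x powi n = x powi (- n)" using generic_diff[OF assms(1)] by (simp add: qnum_def)
  moreover have "x powi n * x powi (- n) = 1"
    using assms(1) by (simp add: generic_def power_int_minus)
  ultimately have "x powi n * x powi n = 1" by simp
  then have "x powi (n + n) = 1" using assms(1) by (subst power_int_add) (auto simp: generic_def)
  then show False using assms by (auto simp: generic_def)
qed

lemma qnum_0 [simp]: "qnum x 0 = 0"
  by (simp add: qnum_def)

lemma qnum_1: "generic x ==> qnum x 1 = 1"
  using generic_diff by (auto simp: qnum_def power_int_minus)

lemma qnum_inverse: "qnum (inverse x) n = qnum x n"
proof -
  have "inverse x powi n - inverse x powi (- n) = - (x powi n - x powi (- n))"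
    by (simp add: power_int_minus power_int_inverse)
  moreover have "inverse x - inverse (inverse x) = - (x - inverse x)" by simp
  ultimately show ?thesis unfolding qnum_def by (simp only: minus_divide_divide)
qed

lemma qnum_split:
  assumes "generic x"
  shows "qnum x (a + b) = x powi b * qnum x a + x powi (- a) * qnum x b"
proof -
  have "x \<noteq> 0" using assms by (simp add: generic_def)
  then have "x powi (a + b) - x powi (- (a + b))
      = x powi b * (x powi a - x powi (- a)) + x powi (- a) * (x powi b - x powi (- b))"
    by (simp add: algebra_simps power_int_add[symmetric])
  then show ?thesis by (simp add: qnum_def add_divide_distrib)
qed

lemma qfactorial_Suc: "qfactorial x (Suc n) = qfactorial x n * qnum x (int (Suc n))"
  by (simp add: qfactorial_def)

lemma qfactorial_0 [simp]: "qfactorial x 0 = 1"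
  by (simp add: qfactorial_def)

lemma qfactorial_nz: "generic x ==> qfactorial x n \<noteq> 0"
  by (simp add: qfactorial_def qnum_nz)

lemma qfactorial_inverse: "qfactorial (inverse x) n = qfactorial x n"
  by (simp add: qfactorial_def qnum_inverse)

lemma qchoose_0 [simp]: "qchoose x n 0 = 1"
  by (simp add: qchoose_def)

lemma qchoose_Suc:
  "qchoose x n (Suc r) = qchoose x n r * (qnum x (n - int r) / qnum x (int (Suc r)))"
  by (simp add: qchoose_def)

lemma qchoose_shift:
  "qchoose x (n + 1) (Suc r) = qnum x (n + 1) / qnum x (int (Suc r)) * qchoose x n r"
proof -
  have "(\<Prod>i<Suc r. qnum x (n + 1 - int i)) = qnum x (n + 1) * (\<Prod>i<r. qnum x (n - int i))"
    by (subst prod.lessThan_Suc_shift) (simp add: algebra_simps)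
  then show ?thesis by (simp add: qchoose_def)
qed

lemma qchoose_pascal:
  assumes "generic x"
  shows "qchoose x (n + 1) (Suc r)
    = x powi int (Suc r) * qchoose x n (Suc r) + x powi (- (n - int r)) * qchoose x n r"
proof -
  have aux: "(p * q + m * R) / R * c = p * (c * (q / R)) + m * c" if "R \<noteq> 0" for p q m R c :: 'a
    using that by (simp add: field_simps)
  have R: "qnum x (int (Suc r)) \<noteq> 0" by (rule qnum_nz[OF assms]) simp
  have e: "qnum x (n + 1)
      = x powi int (Suc r) * qnum x (n - int r) + x powi (- (n - int r)) * qnum x (int (Suc r))"
    using qnum_split[OF assms, of "n - int r" "int (Suc r)"] by (simp add: algebra_simps)
  show ?thesis
    unfolding qchoose_shift qchoose_Suc[of x n] e by (rule aux[OF R])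
qed

lemma qchoose_zero: "n < r ==> qchoose x (int n) r = 0"
  by (auto simp: qchoose_def intro!: bexI[of _ n])

lemma qchoose_fact:
  assumes "generic x" "r \<le> n"
  shows "qchoose x (int n) r = qfactorial x n / (qfactorial x r * qfactorial x (n - r))"
  using assms(2)
proof (induction r)
  case 0 then show ?case using qfactorial_nz[OF assms(1)] by simp
next
  case (Suc r)
  then have nr: "n - r = Suc (n - Suc r)" by simp
  have i: "int n - int r = int (Suc (n - Suc r))" using Suc.prems by simp
  have "qfactorial x (n - r) = qfactorial x (n - Suc r) * qnum x (int n - int r)"
    unfolding nr qfactorial_Suc i by simp
  then show ?case
    using Suc qfactorial_nz[OF assms(1)] qnum_nz[OF assms(1), of "int (Suc r)"]
      qnum_nz[OF assms(1), of "int n - int r"]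
    by (simp add: qchoose_Suc qfactorial_Suc field_simps)
qed

lemma qchoose_self: "generic x ==> qchoose x (int n) n = 1"
  using qfactorial_nz by (simp add: qchoose_fact)

text \<open>This is the \<open>q\<close>-binomial theorem at a zero of the product. The sum is the value of a polynomial \<open>P N\<close>, and
Pascal's rule splits off a factor of \<open>P (Suc N)\<close>; that factor vanishes at \<open>z = x\<^sup>N\<close>.\<close>

lemma q_alternating_sum:
  assumes "generic x" "N \<ge> 1"
  shows "(\<Sum>s\<le>N. (-1) ^ s * (qfactorial x N / (qfactorial x s * qfactorial x (N - s)))
     * (x powi (int N - 1)) ^ s) = 0"
proof -
  have x: "x \<noteq> 0" using assms by (simp add: generic_def)
  define P where "P N z = (\<Sum>s\<le>N. (-1) ^ s * qchoose x (int N) s * z ^ s)" for N z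
  have ext: "P N z = (\<Sum>s\<le>Suc N. (-1) ^ s * qchoose x (int N) s * z ^ s)" for N z
    by (simp add: P_def qchoose_zero)
  have rec: "P (Suc N) z = (1 - z * x powi (- int N)) * P N (x * z)" for N z
  proof -
    have "P (Suc N) z = 1 + (\<Sum>s\<le>N. (-1) ^ Suc s * qchoose x (int N + 1) (Suc s) * z ^ Suc s)"
      unfolding P_def by (subst sum.atMost_Suc_shift) (simp add: add.commute)
    also have "\<dots> = 1 + ((\<Sum>s\<le>N. (-1) ^ Suc s * qchoose x (int N) (Suc s) * (x * z) ^ Suc s)
       + (\<Sum>s\<le>N. (-1) ^ Suc s * (x powi (- (int N - int s)) * qchoose x (int N) s) * z ^ Suc s))"
      unfolding sum.distrib[symmetric] qchoose_pascal[OF assms(1)]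
      by (intro arg_cong[where f = "\<lambda>t. 1 + t"] sum.cong refl)
        (simp only: power_int_of_nat power_mult_distrib, simp only: algebra_simps)
    also have "1 + ((\<Sum>s\<le>N. (-1) ^ Suc s * qchoose x (int N) (Suc s) * (x * z) ^ Suc s)
       + (\<Sum>s\<le>N. (-1) ^ Suc s * (x powi (- (int N - int s)) * qchoose x (int N) s) * z ^ Suc s))
      = P N (x * z) + (\<Sum>s\<le>N. (-1) ^ Suc s * (x powi (- (int N - int s)) * qchoose x (int N) s) * z ^ Suc s)"
      unfolding ext sum.atMost_Suc_shift[of "\<lambda>s. (-1) ^ s * qchoose x (int N) s * (x * z) ^ s"]
      by (simp del: sum.atMost_Suc)
    also have "(\<Sum>s\<le>N. (-1) ^ Suc s * (x powi (- (int N - int s)) * qchoose x (int N) s) * z ^ Suc s)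
      = - (z * x powi (- int N)) * P N (x * z)"
      unfolding P_def sum_distrib_left
    proof (intro sum.cong refl)
      fix s
      have "x powi (- (int N - int s)) = x powi (- int N) * x ^ s"
        using x by (simp add: power_int_add[symmetric] flip: power_int_of_nat)
      then show "(-1) ^ Suc s * (x powi (- (int N - int s)) * qchoose x (int N) s) * z ^ Suc s
        = - (z * x powi (- int N)) * ((-1) ^ s * qchoose x (int N) s * (x * z) ^ s)"
        by (simp add: power_mult_distrib algebra_simps)
    qed
    finally show ?thesis by (simp add: algebra_simps)
  qed
  obtain M where M: "N = Suc M" using assms(2) by (cases N) auto
  have "P N (x powi (int N - 1)) = 0"
    unfolding M rec using x by (simp add: power_int_minus)
  then show ?thesis
    unfolding P_def by (simp add: qchoose_fact[OF assms(1)])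
qed

lemma q_alternating_sum':
  assumes "generic x" "N \<ge> 1"
  shows "(\<Sum>s\<le>N. (-1) ^ s * (qfactorial x N / (qfactorial x s * qfactorial x (N - s)))
     * (x powi (1 - int N)) ^ s) = 0"
  using q_alternating_sum[OF generic_inverse[OF assms(1)] assms(2)]
  by (simp add: qfactorial_inverse power_int_inverse power_int_minus[symmetric])

subsection \<open>Laurent polynomials\<close>

lemma Qv_simps [simp]:
  "carrier Qv = UNIV" "x \<otimes>\<^bsub>Qv\<^esub> y = x * y" "x \<oplus>\<^bsub>Qv\<^esub> y = x + y" "\<one>\<^bsub>Qv\<^esub> = 1" "\<zero>\<^bsub>Qv\<^esub> = 0"
  "\<ominus>\<^bsub>Qv\<^esub> x = - x"
  by (simp_all add: Qv_def)

lemma Laurent_simps [simp]: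
  "x \<otimes>\<^bsub>Laurent\<^esub> y = x * y" "x \<oplus>\<^bsub>Laurent\<^esub> y = x + y" "\<one>\<^bsub>Laurent\<^esub> = 1" "\<zero>\<^bsub>Laurent\<^esub> = 0"
  by (simp_all add: Laurent_def)

lemma Qv_ring: "cring Qv"
  unfolding Qv_def by (rule cring_from_type_algebra)

lemma Laurent_cring: "cring Laurent"
proof -
  interpret Q: cring Qv by (rule Qv_ring)
  have "subcring (generate_ring Qv {qv, inverse qv}) Qv"
    by (rule Q.subcringI'[OF Q.generate_ring_is_subring]) simp
  then show ?thesis unfolding Laurent_def by (rule Q.subcring_iff[THEN iffD1, rotated]) simp
qed

lemma Laurent_closed:
  "0 \<in> carrier Laurent" "1 \<in> carrier Laurent" "qv powi n \<in> carrier Laurent"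
  "a \<in> carrier Laurent ==> b \<in> carrier Laurent ==> a + b \<in> carrier Laurent"
  "a \<in> carrier Laurent ==> b \<in> carrier Laurent ==> a - b \<in> carrier Laurent"
  "a \<in> carrier Laurent ==> - a \<in> carrier Laurent"
  "a \<in> carrier Laurent ==> b \<in> carrier Laurent ==> a * b \<in> carrier Laurent"
proof -
  interpret L: cring Laurent by (rule Laurent_cring)
  show 0: "0 \<in> carrier Laurent" "1 \<in> carrier Laurent"
    using L.zero_closed L.one_closed by simp_all
  show add: "a + b \<in> carrier Laurent" if "a \<in> carrier Laurent" "b \<in> carrier Laurent" for a b
    using L.a_closed[OF that] by simp
  show mult: "a * b \<in> carrier Laurent" if "a \<in> carrier Laurent" "b \<in> carrier Laurent" for a b
    using L.m_closed[OF that] by simp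
  show neg: "- a \<in> carrier Laurent" if "a \<in> carrier Laurent" for a
    using generate_ring.a_inv[of a Qv] that by (simp add: Laurent_def)
  show "a - b \<in> carrier Laurent" if "a \<in> carrier Laurent" "b \<in> carrier Laurent" for a b
    using add[OF that(1) neg[OF that(2)]] by simp
  have g: "qv \<in> carrier Laurent" "inverse qv \<in> carrier Laurent"
    by (auto simp: Laurent_def intro: generate_ring.incl)
  have p: "y ^ n \<in> carrier Laurent" if "y \<in> carrier Laurent" for y n
    by (induction n) (use that 0 mult in auto)
  show "qv powi n \<in> carrier Laurent" unfolding power_int_def using g p by simp
qed

text \<open>Powers of \<open>v\<close> are units, so Pascal's rule can be read in both directions: it reaches every upper argument from
\<open>0\<close>, positive or negative.\<close>

lemma qbinom_Laurent:
  assumes "d > 0" shows "qbinom d n r \<in> carrier Laurent"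
proof (induction r arbitrary: n)
  case 0 then show ?case by (simp add: qbinom_qchoose Laurent_closed)
next
  case (Suc r)
  let ?x = "qd d"
  have g: "generic ?x" by (rule generic_qd[OF assms])
  have pw: "?x powi k \<in> carrier Laurent" for k
    by (simp add: qd_powi Laurent_closed)
  have up: "qchoose ?x (n + 1) (Suc r) \<in> carrier Laurent" if "qchoose ?x n (Suc r) \<in> carrier Laurent" for n
    unfolding qchoose_pascal[OF g] using that Suc[of n] pw
    by (intro Laurent_closed(4,7)) (auto simp only: qbinom_qchoose)
  have down: "qchoose ?x n (Suc r) \<in> carrier Laurent" if "qchoose ?x (n + 1) (Suc r) \<in> carrier Laurent" for n
  proof -
    have "qchoose ?x n (Suc r) = ?x powi (- int (Suc r)) *
       (qchoose ?x (n + 1) (Suc r) - ?x powi (- (n - int r)) * qchoose ?x n r)"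
      unfolding qchoose_pascal[OF g] using g
      by (simp only: add_diff_cancel_right' mult.assoc[symmetric] power_int_minus generic_def
          left_inverse power_int_eq_0_iff simp_thms mult_1_left)
    then show ?thesis using that Suc[of n] pw by (simp add: qbinom_qchoose Laurent_closed)
  qed
  have "qchoose ?x n (Suc r) \<in> carrier Laurent"
  proof (induction n rule: int_induct[where k = 0])
    case base show ?case using qchoose_zero[of 0 "Suc r" ?x] by (simp add: Laurent_closed)
  next
    case (step1 i) then show ?case using up by simp
  next
    case (step2 i) then show ?case using down[of "i - 1"] by simp
  qed
  then show ?case by (simp add: qbinom_qchoose)
qed

text \<open>Pascal's rule shows that the hypotheses for \<open>(m, n)\<close> imply those for \<open>(m + k, n + k)\<close>. If \<open>m > n\<close>, a shift leads
to \<open>(k, 0)\<close> with \<open>k = m - n\<close>, and there the binomial coefficients with lower argument \<open>k\<close> are \<open>1\<close> and \<open>0\<close>.\<close>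

lemma qbinom_separates:
  assumes A: "domain A" and \<phi>: "\<phi> \<in> ring_hom Laurent A" and d: "d > 0"
    and p: "\<phi> (qv powi (int d * m)) = \<phi> (qv powi (int d * n))"
    and b: "\<And>r. \<phi> (qbinom d m r) = \<phi> (qbinom d n r)"
  shows "m = n"
proof -
  interpret A: domain A by fact
  interpret \<phi>: ring_hom_ring Laurent A \<phi>
    by (rule ring_hom_ringI2[OF cring.axioms(1)[OF Laurent_cring] A.ring_axioms \<phi>])
  let ?x = "qd d"
  have g: "generic ?x" by (rule generic_qd[OF d])
  have pw: "?x powi k \<in> carrier Laurent" for k
    by (simp add: qd_powi Laurent_closed)
  have bc: "qchoose ?x k r \<in> carrier Laurent" for k r
    using qbinom_Laurent[OF d] by (simp add: qbinom_qchoose)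
  have add: "\<phi> (a + b) = \<phi> a \<oplus>\<^bsub>A\<^esub> \<phi> b" and mult: "\<phi> (a * b) = \<phi> a \<otimes>\<^bsub>A\<^esub> \<phi> b"
    if "a \<in> carrier Laurent" "b \<in> carrier Laurent" for a b
    using \<phi>.hom_add[OF that] \<phi>.hom_mult[OF that] by simp_all
  define Q where "Q m n \<longleftrightarrow> \<phi> (?x powi m) = \<phi> (?x powi n) \<and> (\<forall>r. \<phi> (qchoose ?x m r) = \<phi> (qchoose ?x n r))" for m n
  have x0: "?x \<noteq> 0" using g by (simp add: generic_def)
  have Qp: "\<phi> (?x powi (m + k)) = \<phi> (?x powi (n + k))" if "Q m n" for m n k
    using that x0 pw by (simp add: Q_def power_int_add mult)
  have Qm: "\<phi> (?x powi (- m)) = \<phi> (?x powi (- n))" if "Q m n" for m n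
  proof -
    have i: "\<phi> (?x powi (- k)) \<otimes>\<^bsub>A\<^esub> \<phi> (?x powi k) = \<one>\<^bsub>A\<^esub>" for k
      using mult[OF pw pw, of "- k" k] x0 \<phi>.hom_one by (simp add: power_int_minus)
    have "\<phi> (?x powi m) = \<phi> (?x powi n)" using that by (simp add: Q_def)
    then have "\<phi> (?x powi (- m)) \<otimes>\<^bsub>A\<^esub> \<phi> (?x powi n) = \<phi> (?x powi (- n)) \<otimes>\<^bsub>A\<^esub> \<phi> (?x powi n)"
      using i[of m] i[of n] by simp
    moreover have "\<phi> (?x powi n) \<noteq> \<zero>\<^bsub>A\<^esub>"
      using i[of n] pw A.one_not_zero by (metis A.r_null \<phi>.hom_closed)
    ultimately show ?thesis using pw by (simp add: A.m_rcancel)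
  qed
  have Qm': "\<phi> (?x powi (- (m + k))) = \<phi> (?x powi (- (n + k)))" if "Q m n" for m n k
  proof -
    have "\<phi> (?x powi (- m + - k)) = \<phi> (?x powi (- n + - k))"
      using Qm[OF that] x0 pw by (simp only: power_int_add[OF disjI1[OF x0]] mult)
    then show ?thesis by (simp add: algebra_simps)
  qed
  have tmp1: "\<phi> (p * q + r * c) = \<phi> p \<otimes>\<^bsub>A\<^esub> \<phi> q \<oplus>\<^bsub>A\<^esub> \<phi> r \<otimes>\<^bsub>A\<^esub> \<phi> c"
    and tmp2: "\<phi> (p * (q + r * c)) = \<phi> p \<otimes>\<^bsub>A\<^esub> (\<phi> q \<oplus>\<^bsub>A\<^esub> \<phi> r \<otimes>\<^bsub>A\<^esub> \<phi> c)"
    if "p \<in> carrier Laurent" "q \<in> carrier Laurent" "r \<in> carrier Laurent" "c \<in> carrier Laurent" for p q r c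
    using that by (simp_all add: add mult Laurent_closed)
  have up: "Q (m + 1) (n + 1)" if Q: "Q m n" for m n
  proof -
    have "\<phi> (qchoose ?x (m + 1) r) = \<phi> (qchoose ?x (n + 1) r)" for r
    proof (cases r)
      case (Suc r')
      have "\<phi> (?x powi (- (m - int r'))) = \<phi> (?x powi (- (n - int r')))"
        using Qm'[OF Q, of "- int r'"] by simp
      then show ?thesis unfolding Suc qchoose_pascal[OF g]
        using Q by (simp only: tmp1[OF pw bc pw bc] Q_def)
    qed simp
    then show ?thesis using Qp[OF Q, of 1] by (simp add: Q_def)
  qed
  have down: "Q (m - 1) (n - 1)" if Q: "Q m n" for m n
  proof -
    have "\<phi> (qchoose ?x (m - 1) r) = \<phi> (qchoose ?x (n - 1) r)" for r
    proof (induction r)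
      case (Suc r)
      have e: "qchoose ?x (k - 1) (Suc r) = ?x powi (- int (Suc r)) *
         (qchoose ?x k (Suc r) + (- (?x powi (- (k - 1 - int r)))) * qchoose ?x (k - 1) r)" for k
        using qchoose_pascal[OF g, of "k - 1" r] x0
        by (simp only: diff_add_cancel minus_mult_left[symmetric] add_uminus_conv_diff add_diff_cancel_right'
            mult.assoc[symmetric] power_int_minus left_inverse power_int_eq_0_iff simp_thms mult_1_left)
      have "\<phi> (- a) = \<ominus>\<^bsub>A\<^esub> \<phi> a" if "a \<in> carrier Laurent" for a
      proof (rule A.minus_equality[symmetric])
        show "\<phi> (- a) \<oplus>\<^bsub>A\<^esub> \<phi> a = \<zero>\<^bsub>A\<^esub>"
          using add[OF Laurent_closed(6)[OF that] that] \<phi>.hom_zero by simp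
      qed (use that Laurent_closed(6) in auto)
      moreover have "\<phi> (?x powi (- (m - 1 - int r))) = \<phi> (?x powi (- (n - 1 - int r)))"
        using Qm'[OF Q, of "- 1 - int r"] by (simp add: algebra_simps)
      ultimately show ?case unfolding e
        using Q Suc pw by (simp only: tmp2[OF pw bc Laurent_closed(6)[OF pw] bc] Q_def)
    qed simp
    then show ?thesis using Qp[OF Q, of "-1"] by (simp add: Q_def)
  qed
  have shift: "Q (m + k) (n + k)" if Q: "Q m n" for m n k
  proof (induction k rule: int_induct[where k = 0])
    case base then show ?case using Q by simp
  next
    case (step1 i) then show ?case using up[of "m + i" "n + i"] by (simp add: algebra_simps)
  next
    case (step2 i) then show ?case using down[of "m + i" "n + i"] by (simp add: algebra_simps)
  qed
  have no: False if "Q m n" "n < m" for m n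
  proof -
    let ?k = "nat (m - n)"
    have "Q (int ?k) (int 0)" using shift[OF that(1), of "- n"] that(2) by simp
    then have "\<phi> (qchoose ?x (int ?k) ?k) = \<phi> (qchoose ?x (int 0) ?k)" by (simp add: Q_def)
    moreover have "qchoose ?x (int 0) ?k = 0" by (rule qchoose_zero) (use that(2) in simp)
    ultimately have "\<phi> 1 = \<phi> 0" by (simp only: qchoose_self[OF g])
    then show False using \<phi>.hom_one \<phi>.hom_zero A.one_not_zero by simp
  qed
  have "Q m n" using p b by (simp add: Q_def qbinom_qchoose qd_powi)
  moreover have "Q n m" using \<open>Q m n\<close> by (auto simp: Q_def)
  ultimately show ?thesis using no by (metis linorder_neqE)
qed

section \<open>Operators on function spaces\<close>

text \<open>All representations over \<open>\<rat>(v)\<close> live on spaces of functions, as linear operators. The simplifier must treat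
such functions as vectors; hence the pointwise rules are collected in \<open>fun_app\<close> instead of being applied by default.\<close>

definition sca :: "qrat => ('x => qrat) => 'x => qrat" where
  "sca c y = (\<lambda>i. c * y i)"

lemma sca_apply: "sca c y i = c * y i"
  by (simp add: sca_def)

lemma sum_fun_apply: "(\<Sum>i\<in>S. g i) j = (\<Sum>i\<in>S. g i j :: qrat)"
  by (induction S rule: infinite_finite_induct) simp_all

lemma sca_rules:
  "sca c (y + z) = sca c y + sca c z" "sca c (y - z) = sca c y - sca c z"
  "sca (c + d) y = sca c y + sca d y" "sca (- c) y = - sca c y"
  "sca c (sum g S) = (\<Sum>i\<in>S. sca c (g i))"
  by (auto simp: fun_eq_iff algebra_simps sum_fun_apply sum_distrib_left sca_apply)

lemma sca_simps [simp]:
  "sca c (sca d y) = sca (c * d) y" "sca 1 y = y" "sca 0 y = 0" "sca c 0 = 0"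
  by (simp_all add: fun_eq_iff sca_apply)

declare zero_fun_apply [simp del] plus_fun_apply [simp del] minus_apply [simp del] uminus_apply [simp del]

lemmas fun_app = sca_apply zero_fun_apply plus_fun_apply minus_apply uminus_apply sum_fun_apply

definition linop :: "(('x => qrat) => ('y => qrat)) => bool" where
  "linop T \<longleftrightarrow> (\<forall>y z. T (y + z) = T y + T z) \<and> (\<forall>c y. T (sca c y) = sca c (T y))"

lemma linop_add: "linop T ==> T (y + z) = T y + T z"
  and linop_sca: "linop T ==> T (sca c y) = sca c (T y)"
  by (simp_all add: linop_def)

lemma linop_0: assumes "linop T" shows "T 0 = 0"
  using linop_sca[OF assms, of 0 0] by simp

lemma linop_diff: assumes "linop T" shows "T (y - z) = T y - T z"
  using linop_add[OF assms, of "y - z" z] by (simp add: algebra_simps)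

lemma linop_sum: assumes "linop T" shows "T (sum g S) = (\<Sum>i\<in>S. T (g i))"
  using sum_comp_morphism[of T g S, OF linop_0[OF assms] linop_add[OF assms]] by (simp add: comp_def)

lemmas linop_simps = linop_add linop_sca linop_0 linop_diff linop_sum

lemma linop_comp: "linop S ==> linop T ==> linop (\<lambda>y. S (T y))"
  by (simp add: linop_def)

lemma linop_funpow: "linop (T :: ('x => qrat) => ('x => qrat)) ==> linop (T ^^ n)"
  by (induction n) (simp_all add: linop_def)

lemma linop_scaled: "linop T ==> linop (\<lambda>y. sca c (T y))"
  by (simp add: linop_def sca_rules mult.commute)

lemma linop_minus: "linop S ==> linop T ==> linop (\<lambda>y. S y - T y)"
  by (simp add: linop_def sca_rules)

lemma linop_id: "linop (\<lambda>y. y)"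
  by (simp add: linop_def)

lemma linop_zero: "linop (\<lambda>y. 0)"
  by (simp add: linop_def)

definition dpow :: "qrat => (('x => qrat) => ('x => qrat)) => nat => ('x => qrat) => ('x => qrat)" where
  "dpow x T n y = sca (1 / qfactorial x n) ((T ^^ n) y)"

definition dpowi :: "qrat => (('x => qrat) => ('x => qrat)) => int => ('x => qrat) => ('x => qrat)" where
  "dpowi x T j y = (if j < 0 then 0 else dpow x T (nat j) y)"

lemma dpow_0 [simp]: "dpow x T 0 y = y"
  by (simp add: dpow_def)

lemma dpowi_of_nat [simp]: "dpowi x T (int n) y = dpow x T n y"
  by (simp add: dpowi_def)

lemma linop_dpow: "linop T ==> linop (dpow x T n)"
  unfolding dpow_def[abs_def] by (intro linop_scaled linop_funpow)

lemma linop_dpowi: "linop T ==> linop (dpowi x T j)"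
  unfolding dpowi_def[abs_def] by (cases "j < 0") (simp_all add: linop_zero linop_dpow)

lemma dpow_Suc:
  assumes "generic x" "linop T"
  shows "T (dpow x T n y) = sca (qnum x (int (Suc n))) (dpow x T (Suc n) y)"
  using qnum_nz[OF assms(1), of "int (Suc n)"] qfactorial_nz[OF assms(1), of n]
  by (simp add: dpow_def linop_sca[OF assms(2)] qfactorial_Suc del: of_nat_Suc)

lemma dpow_Suc':
  assumes "generic x" "linop T"
  shows "dpow x T (Suc n) y = sca (1 / qnum x (int (Suc n))) (T (dpow x T n y))"
  using qnum_nz[OF assms(1), of "int (Suc n)"] by (simp add: dpow_Suc[OF assms] del: of_nat_Suc)

lemma dpowi_Suc:
  assumes "generic x" "linop T"
  shows "T (dpowi x T j y) = sca (qnum x (j + 1)) (dpowi x T (j + 1) y)"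
proof (cases "j < 0")
  case True
  then show ?thesis using linop_0[OF assms(2)] by (cases "j = -1") (simp_all add: dpowi_def)
next
  case False
  then have "j = int (nat j)" by simp
  then obtain n where n: "j = int n" by blast
  have "dpowi x T (j + 1) y = dpow x T (Suc n) y" using n by (simp add: dpowi_def nat_add_distrib)
  then show ?thesis using dpow_Suc[OF assms, of n y] n by (simp add: add.commute)
qed

text \<open>The relations of quantum \<open>sl\<^sub>2\<close> for operators on a function space. They are required only on a stable subspace
\<open>C\<close>, because for functionals on the free algebra they hold only on those that vanish on the defining ideal.\<close>

locale rank1 =
  fixes x :: qrat and e f k l :: "('x => qrat) => ('x => qrat)" and C :: "('x => qrat) set"
  assumes gen: "generic x"
    and lin: "linop e" "linop f" "linop k" "linop l"
    and C: "\<And>y z. y \<in> C ==> z \<in> C ==> y + z \<in> C" "\<And>c y. y \<in> C ==> sca c y \<in> C"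
      "\<And>y. y \<in> C ==> e y \<in> C" "\<And>y. y \<in> C ==> f y \<in> C" "\<And>y. y \<in> C ==> k y \<in> C" "\<And>y. y \<in> C ==> l y \<in> C"
    and kl: "\<And>y. y \<in> C ==> k (l y) = y" "\<And>y. y \<in> C ==> l (k y) = y"
    and ke: "\<And>y. y \<in> C ==> k (e y) = sca (x powi 2) (e (k y))"
    and kf: "\<And>y. y \<in> C ==> k (f y) = sca (x powi -2) (f (k y))"
    and ef: "\<And>y. y \<in> C ==> e (f y) = f (e y) + sca (1 / (x - inverse x)) (k y - l y)"
begin

lemma xnz [simp]: "x \<noteq> 0" using gen by (simp add: generic_def)

lemma xx: "x powi a * x powi b = x powi (a + b)" by (simp add: power_int_add)

lemma twist_l:
  assumes T: "linop T" "\<And>y. y \<in> C ==> T y \<in> C" "\<And>y. y \<in> C ==> k (T y) = sca (x powi a) (T (k y))" and y: "y \<in> C"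
  shows "l (T y) = sca (x powi - a) (T (l y))"
proof -
  have "l (k (T (l y))) = l (sca (x powi a) (T y))" using T(3)[OF C(6)[OF y]] y by (simp add: kl)
  then have "T (l y) = sca (x powi a) (l (T y))" using y by (simp add: T(2) C kl linop_sca[OF lin(4)])
  then show ?thesis by (simp add: xx)
qed

lemma C0: "y \<in> C ==> 0 \<in> C" using C(2)[of y 0] by simp

lemma Cdiff: "y \<in> C ==> z \<in> C ==> y - z \<in> C"
  using C(1)[of y "sca (-1) z"] C(2)[of z "-1"] by (simp add: sca_rules)

lemma Cpow: assumes "\<And>y. y \<in> C ==> T y \<in> C" "y \<in> C" shows "dpow x T n y \<in> C"
  unfolding dpow_def by (rule C(2), induction n) (use assms in auto)

text \<open>The operator \<open>[k; c] = (x\<^sup>c k - x\<^sup>-\<^sup>c k\<^sup>-\<^sup>1) / (x - x\<^sup>-\<^sup>1)\<close>.\<close>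

definition kap :: "int => ('x => qrat) => ('x => qrat)" where
  "kap c y = sca (1 / (x - inverse x)) (sca (x powi c) (k y) - sca (x powi - c) (l y))"

lemma linop_kap: "linop (kap c)"
  unfolding kap_def[abs_def] by (intro linop_scaled linop_minus lin)

lemma kap_C: "y \<in> C ==> kap c y \<in> C"
  unfolding kap_def by (intro C Cdiff)

lemma ef': "y \<in> C ==> e (f y) = f (e y) + kap 0 y"
  by (simp add: ef kap_def)

lemma kap_twist:
  assumes T: "linop T" "\<And>y. y \<in> C ==> T y \<in> C" "\<And>y. y \<in> C ==> k (T y) = sca (x powi a) (T (k y))" and y: "y \<in> C"
  shows "kap c (T y) = T (kap (c + a) y)"
proof -
  have l: "l (T y) = sca (x powi - a) (T (l y))" by (rule twist_l[OF T y])
  show ?thesis unfolding kap_def T(3)[OF y] l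
    by (simp add: linop_sca[OF T(1)] linop_diff[OF T(1)] xx)
qed

lemma kap_e: "y \<in> C ==> kap c (e y) = e (kap (c + 2) y)"
  by (rule kap_twist[OF lin(1) C(3) ke])

lemma kap_k: "y \<in> C ==> kap c (k y) = k (kap c y)"
  using kap_twist[of k 0 y c] lin C by simp

lemma kap_l: "y \<in> C ==> kap c (l y) = l (kap c y)"
  using kap_twist[of l 0 y c] lin C kl by simp

lemma kap_kap: "y \<in> C ==> kap c (kap d y) = kap d (kap c y)"
  unfolding kap_def[of d]
  by (simp add: linop_simps[OF linop_kap] kap_k kap_l)

lemma kap_combine:
  assumes "a * x powi c + b * x powi d = g * x powi h" "a * x powi - c + b * x powi - d = g * x powi - h"
  shows "sca a (kap c y) + sca b (kap d y) = sca g (kap h y)"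
proof
  fix i
  have "(sca a (kap c y) + sca b (kap d y)) i = 1 / (x - inverse x) *
     ((a * x powi c + b * x powi d) * k y i - (a * x powi - c + b * x powi - d) * l y i)"
    by (simp add: kap_def algebra_simps fun_app)
  also have "\<dots> = sca g (kap h y) i" unfolding assms by (simp add: kap_def algebra_simps fun_app)
  finally show "(sca a (kap c y) + sca b (kap d y)) i = sca g (kap h y) i" .
qed

lemma kap_dpow_twist:
  assumes T: "linop T" "\<And>y. y \<in> C ==> T y \<in> C" "\<And>y. y \<in> C ==> k (T y) = sca (x powi a) (T (k y))" and y: "y \<in> C"
  shows "kap c (dpow x T n y) = dpow x T n (kap (c + int n * a) y)"
  using y
proof (induction n arbitrary: c)
  case (Suc n)
  have "kap c (dpow x T (Suc n) y) = sca (1 / qnum x (int (Suc n))) (kap c (T (dpow x T n y)))"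
    by (simp only: dpow_Suc'[OF gen T(1)] linop_sca[OF linop_kap])
  also have "kap c (T (dpow x T n y)) = T (dpow x T n (kap (c + a + int n * a) y))"
    using Suc by (simp add: kap_twist[OF T] Cpow[OF T(2)])
  finally show ?case by (simp only: dpow_Suc'[OF gen T(1)]) (simp add: algebra_simps)
qed simp

lemma kap_dpow_f: "y \<in> C ==> kap c (dpow x f n y) = dpow x f n (kap (c - 2 * int n) y)"
  using kap_dpow_twist[OF lin(2) C(4) kf, of y c n] by (simp add: algebra_simps)

lemma e_dpow_f:
  "y \<in> C ==> e (dpow x f n y) = dpow x f n (e y) + dpowi x f (int n - 1) (kap (1 - int n) y)"
proof (induction n)
  case 0 then show ?case by (simp add: dpowi_def)
next
  case (Suc n)
  let ?n = "qnum x (int (Suc n))"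
  have C': "dpow x f n y \<in> C" by (rule Cpow[OF C(4) Suc.prems])
  have "e (dpow x f (Suc n) y) = sca (1 / ?n) (e (f (dpow x f n y)))"
    by (simp only: dpow_Suc'[OF gen lin(2)] linop_sca[OF lin(1)])
  also have "e (f (dpow x f n y)) = f (dpow x f n (e y)) + f (dpowi x f (int n - 1) (kap (1 - int n) y))
      + kap 0 (dpow x f n y)"
    by (simp only: ef'[OF C'] Suc.IH[OF Suc.prems] linop_add[OF lin(2)])
  also have "f (dpowi x f (int n - 1) (kap (1 - int n) y)) = sca (qnum x (int n)) (dpow x f n (kap (1 - int n) y))"
    by (subst dpowi_Suc[OF gen lin(2)]) simp
  also have "kap 0 (dpow x f n y) = dpow x f n (kap (- 2 * int n) y)"
    by (subst kap_dpow_f[OF Suc.prems]) simp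
  also have "f (dpow x f n (e y)) + sca (qnum x (int n)) (dpow x f n (kap (1 - int n) y)) + dpow x f n (kap (- 2 * int n) y)
    = f (dpow x f n (e y)) + dpow x f n (sca (qnum x (int n)) (kap (1 - int n) y) + sca 1 (kap (- 2 * int n) y))"
    by (simp add: linop_simps[OF linop_dpow[OF lin(2)]])
  also have "sca (qnum x (int n)) (kap (1 - int n) y) + sca 1 (kap (- 2 * int n) y) = sca ?n (kap (- int n) y)"
  proof (rule kap_combine)
    have 1: "?n = x * qnum x (int n) + x powi - int n"
      using qnum_split[OF gen, of "int n" 1] by (simp add: qnum_1[OF gen] add.commute)
    have 2: "?n = x powi int n + x powi -1 * qnum x (int n)"
      using qnum_split[OF gen, of 1 "int n"] by (simp add: qnum_1[OF gen])
    have xa: "x * x powi a = x powi (a + 1)" for a by (simp add: power_int_add)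
    show "qnum x (int n) * x powi (1 - int n) + 1 * x powi (- 2 * int n) = ?n * x powi (- int n)"
      unfolding 1 by (simp add: distrib_right xx xa mult.left_commute[of x] mult.assoc algebra_simps)
    show "qnum x (int n) * x powi - (1 - int n) + 1 * x powi - (- 2 * int n) = ?n * x powi - (- int n)"
      unfolding 2 distrib_right mult.assoc mult.left_commute[of _ "qnum x (int n)"] mult.commute[of _ "qnum x (int n)"] xx
      by (simp add: algebra_simps del: power_int_of_nat)
  qed
  finally have *: "e (dpow x f (Suc n) y) =
     sca (1 / ?n) (f (dpow x f n (e y)) + dpow x f n (sca ?n (kap (- int n) y)))" .
  have "?n \<noteq> 0" by (rule qnum_nz[OF gen]) simp
  then have "sca (1 / ?n) (dpow x f n (sca ?n (kap (- int n) y))) = dpow x f n (kap (- int n) y)"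
    by (simp add: linop_sca[OF linop_dpow[OF lin(2)]])
  then show ?case unfolding *
    by (simp add: sca_rules dpow_Suc'[OF gen lin(2)] del: of_nat_Suc) (simp add: dpowi_def)
qed

lemma e_dpowi_f:
  "y \<in> C ==> e (dpowi x f j y) = dpowi x f j (e y) + dpowi x f (j - 1) (kap (1 - j) y)"
  using e_dpow_f[of y "nat j"] by (cases "j < 0") (simp_all add: dpowi_def linop_0[OF lin(1)])

text \<open>The torus binomial with upper argument \<open>k\<close> shifted by \<open>c\<close>.\<close>

primrec hop :: "int => nat => ('x => qrat) => ('x => qrat)" where
  "hop c 0 y = y"
| "hop c (Suc r) y = hop c r (sca (1 / qnum x (int (Suc r))) (kap (c - int r) y))"

lemma linop_hop: "linop (hop c r)"
proof (induction r)
  case 0 show ?case unfolding hop.simps(1)[abs_def] by (rule linop_id)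
next
  case (Suc r)
  have "linop (\<lambda>y. sca (1 / qnum x (int (Suc r))) (kap (c - int r) y))" by (intro linop_scaled linop_kap)
  from linop_comp[OF Suc this] show ?case by (simp only: hop.simps(2)[abs_def])
qed

lemma hop_C: "y \<in> C ==> hop c r y \<in> C"
proof (induction r arbitrary: y)
  case (Suc r)
  show ?case unfolding hop.simps(2) by (intro Suc.IH C kap_C Suc.prems)
qed simp

lemma hop_kap: "y \<in> C ==> hop c r (kap d y) = kap d (hop c r y)"
proof (induction r arbitrary: y)
  case (Suc r)
  have "sca b (kap (c - int r) (kap d y)) = kap d (sca b (kap (c - int r) y))" for b
    using Suc.prems by (simp add: kap_kap linop_sca[OF linop_kap])
  then show ?case using Suc by (simp add: C kap_C)
qed simp

lemma hop_e: "y \<in> C ==> hop c r (e y) = e (hop (c + 2) r y)"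
proof (induction r arbitrary: y)
  case (Suc r)
  have "sca b (kap (c - int r) (e y)) = e (sca b (kap (c + 2 - int r) y))" for b
    using Suc.prems by (simp add: kap_e linop_sca[OF lin(1)] algebra_simps)
  then show ?case using Suc by (simp add: C kap_C)
qed simp

lemma hop_shift: "y \<in> C ==> hop (c + 1) (Suc r) y = hop c r (sca (1 / qnum x (int (Suc r))) (kap (c + 1) y))"
proof (induction r arbitrary: y)
  case (Suc r)
  let ?a = "1 / qnum x (int (Suc r))" and ?b = "1 / qnum x (int (Suc (Suc r)))"
  have "hop (c + 1) (Suc (Suc r)) y = hop (c + 1) (Suc r) (sca ?b (kap (c - int r) y))"
    by (subst hop.simps(2)) simp
  also have "\<dots> = hop c r (sca ?a (kap (c + 1) (sca ?b (kap (c - int r) y))))"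
    using Suc by (simp only: C kap_C)
  also have "sca ?a (kap (c + 1) (sca ?b (kap (c - int r) y))) = sca ?a (kap (c - int r) (sca ?b (kap (c + 1) y)))"
    using Suc.prems by (simp only: linop_sca[OF linop_kap] kap_kap[of y "c + 1"])
  finally show ?case by (simp only: hop.simps(2))
qed simp

text \<open>Pascal's rule with coefficients that are units of the Laurent polynomials. It moves the shift \<open>c\<close> without leaving
the integral form.\<close>

lemma hop_pascal:
  assumes "y \<in> C"
  shows "hop (c + 1) (Suc r) y
    = sca (x powi int (Suc r)) (hop c (Suc r) y) + sca (x powi - (c - int r)) (hop c r (l y))"
proof -
  let ?R = "qnum x (int (Suc r))"
  have R: "?R \<noteq> 0" by (rule qnum_nz[OF gen]) simp
  have D: "x - inverse x \<noteq> 0" by (rule generic_diff[OF gen])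
  have RD: "?R * (x - inverse x) = x powi int (Suc r) - x powi - int (Suc r)"
    using D by (simp add: qnum_def del: of_nat_Suc power_int_of_nat)
  have "kap (c + 1) y = sca (x powi int (Suc r)) (kap (c - int r) y) + sca (x powi - (c - int r) * ?R) (l y)"
  proof
    fix i
    have 1: "x powi int (Suc r) * x powi (c - int r) = x powi (c + 1)"
      "x powi int (Suc r) * x powi - (c - int r) = x powi - (c - int r) * x powi int (Suc r)"
      "x powi - (c - int r) * x powi - int (Suc r) = x powi - (c + 1)"
      unfolding xx by (simp_all add: algebra_simps del: power_int_of_nat)
    have e: "K / D - L / D = P * (K' / D - L' / D) + M * R"
      if "D \<noteq> 0" "R * D = P'" "K = P * K'" "M * P' = P * L' - L" for K L K' L' P P' M R D :: qrat
    proof -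
      have "M * R * D = P * L' - L" using that(2,4) by (simp add: mult.assoc)
      then have "M * R = (P * L' - L) / D" using that(1) by (simp add: eq_divide_eq)
      moreover have "K / D - L / D = (P * K' - L) / D" using that(3) by (simp add: diff_divide_distrib)
      ultimately show ?thesis by (simp add: diff_divide_distrib right_diff_distrib)
    qed
    have "x powi (c + 1) * k y i / (x - inverse x) - x powi - (c + 1) * l y i / (x - inverse x) =
      x powi int (Suc r) * (x powi (c - int r) * k y i / (x - inverse x) - x powi - (c - int r) * l y i / (x - inverse x))
       + (x powi - (c - int r) * l y i) * ?R"
      by (rule e[OF D RD])
        (simp_all only: mult.assoc[symmetric] 1(1), simp only: 1 right_diff_distrib left_diff_distrib
          mult.assoc mult.left_commute[of _ "l y i"] mult.commute[of _ "l y i"])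
    then show "kap (c + 1) y i = (sca (x powi int (Suc r)) (kap (c - int r) y) + sca (x powi - (c - int r) * ?R) (l y)) i"
      by (simp add: kap_def algebra_simps diff_divide_distrib fun_app del: of_nat_Suc power_int_of_nat)
  qed
  then have "sca (1 / ?R) (kap (c + 1) y) = sca (x powi int (Suc r)) (sca (1 / ?R) (kap (c - int r) y)) + sca (x powi - (c - int r)) (l y)"
    using R by (simp only: sca_rules sca_simps) (simp add: mult.commute del: of_nat_Suc power_int_of_nat)
  then show ?thesis
    unfolding hop_shift[OF assms] by (simp only: linop_simps[OF linop_hop] hop.simps(2))
qed

text \<open>The two contributions to the coefficient of index \<open>Suc r\<close> when \<open>e\<close> is applied once more in the next lemma.\<close>

lemma hop_key:
  assumes w: "w \<in> C" and b: "b = 2 * int (Suc r) - int m - int n - 2"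
  shows "sca (qnum x (int m - int r)) (hop b (Suc r) w) + kap (int (Suc r) - int n) (hop b r w)
    = sca (qnum x (int (Suc m))) (hop (b + 1) (Suc r) w)"
proof -
  let ?R = "qnum x (int (Suc r))"
  have R: "?R \<noteq> 0" by (rule qnum_nz[OF gen]) simp
  have "sca (qnum x (int m - int r) / ?R) (kap (b - int r) w) + sca 1 (kap (int (Suc r) - int n) w)
    = sca (qnum x (int (Suc m)) / ?R) (kap (b + 1) w)"
  proof (rule kap_combine)
    have s: "int (Suc m) = (int m - int r) + int (Suc r)" by simp
    have 1: "qnum x (int (Suc m)) = x powi (int (Suc r)) * qnum x (int m - int r) + x powi - (int m - int r) * ?R"
      unfolding s by (rule qnum_split[OF gen])
    have 2: "qnum x (int (Suc m)) = x powi (int m - int r) * ?R + x powi - int (Suc r) * qnum x (int m - int r)"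
      unfolding s by (subst add.commute) (rule qnum_split[OF gen])
    have e: "p / R * u + 1 * v = g / R * w'" if "R \<noteq> 0" "g = t * p + z * R" "u = t * w'" "v = z * w'" for p R u v g t z w' :: qrat
      using that by (simp add: field_simps)
    show "qnum x (int m - int r) / ?R * x powi (b - int r) + 1 * x powi (int (Suc r) - int n) = qnum x (int (Suc m)) / ?R * x powi (b + 1)"
      by (rule e[OF R, of _ "x powi - int (Suc r)" _ "x powi (int m - int r)"])
        (simp only: 2 add.commute, simp_all only: xx b, simp_all add: algebra_simps)
    show "qnum x (int m - int r) / ?R * x powi - (b - int r) + 1 * x powi - (int (Suc r) - int n) = qnum x (int (Suc m)) / ?R * x powi - (b + 1)"
      by (rule e[OF R, of _ "x powi int (Suc r)" _ "x powi - (int m - int r)"])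
        (simp only: 1, simp_all only: xx b, simp_all add: algebra_simps)
  qed
  from arg_cong[OF this, of "hop b r"] show ?thesis
    unfolding hop_shift[OF w] hop_kap[OF w, symmetric]
    by (simp add: linop_simps[OF linop_hop] del: of_nat_Suc)
qed

text \<open>Kac's formula. One factor \<open>e\<close> is moved through at a time; the torus factors are kept to the right of the powers of \<open>f\<close>.\<close>

lemma dpow_e_dpow_f:
  assumes y: "y \<in> C"
  shows "dpow x e m (dpow x f n y)
    = (\<Sum>r\<le>m. dpowi x f (int n - int r) (hop (2 * int r - int m - int n) r (dpow x e (m - r) y)))"
proof (induction m)
  case 0 show ?case by simp
next
  case (Suc m)
  let ?h = "\<lambda>r. hop (2 * int r - int m - int n) r (dpow x e (m - r) y)"
  let ?M = "qnum x (int (Suc m))"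
  define A where "A r = dpowi x f (int n - int r)
      (sca (qnum x (int (Suc m) - int r)) (hop (2 * int r - int m - int n - 2) r (dpow x e (Suc m - r) y)))" for r
  define B where "B r = dpowi x f (int n - int r)
      (kap (int r - int n) (hop (2 * int r - int m - int n - 2) (r - 1) (dpow x e (Suc m - r) y)))" for r
  have C': "dpow x e j y \<in> C" for j by (rule Cpow[OF C(3) y])
  have M: "?M \<noteq> 0" by (rule qnum_nz[OF gen]) simp
  have 1: "e (dpowi x f (int n - int r) (?h r)) = A r + B (Suc r)" if "r \<le> m" for r
  proof -
    have "e (?h r) = hop (2 * int r - int m - int n - 2) r (e (dpow x e (m - r) y))"
      using hop_e[OF C', of "2 * int r - int m - int n - 2"] by simp
    also have "e (dpow x e (m - r) y) = sca (qnum x (int (Suc m) - int r)) (dpow x e (Suc m - r) y)"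
      using that dpow_Suc[OF gen lin(1), of "m - r" y] by (simp add: Suc_diff_le of_nat_diff add_diff_eq)
    finally have "dpowi x f (int n - int r) (e (?h r)) = A r"
      by (simp only: A_def linop_sca[OF linop_hop])
    moreover have "dpowi x f (int n - int r - 1) (kap (1 - (int n - int r)) (?h r)) = B (Suc r)"
      by (simp add: B_def algebra_simps)
    ultimately show ?thesis
      using e_dpowi_f[OF hop_C[OF C'], of "int n - int r"] by simp
  qed
  have "?M \<noteq> 0" by (rule M)
  have "sca ?M (dpow x e (Suc m) (dpow x f n y)) = e (dpow x e m (dpow x f n y))"
    by (rule dpow_Suc[OF gen lin(1), symmetric])
  also have "\<dots> = (\<Sum>r\<le>m. A r) + (\<Sum>r\<le>m. B (Suc r))"
    unfolding Suc linop_sum[OF lin(1)] by (simp add: 1 sum.distrib)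
  also have "(\<Sum>r\<le>m. A r) = (\<Sum>r\<le>Suc m. A r)"
    by (simp add: A_def linop_0[OF linop_dpowi[OF lin(2)]])
  also have "\<dots> = A 0 + (\<Sum>r\<le>m. A (Suc r))" by (rule sum.atMost_Suc_shift)
  also have "A 0 + (\<Sum>r\<le>m. A (Suc r)) + (\<Sum>r\<le>m. B (Suc r)) = A 0 + (\<Sum>r\<le>m. A (Suc r) + B (Suc r))"
    by (simp add: sum.distrib)
  also have "\<dots> = sca ?M (dpowi x f (int n - int 0) (hop (2 * int 0 - int (Suc m) - int n) 0 (dpow x e (Suc m - 0) y)))
     + (\<Sum>r\<le>m. sca ?M (dpowi x f (int n - int (Suc r)) (hop (2 * int (Suc r) - int (Suc m) - int n) (Suc r) (dpow x e (Suc m - Suc r) y))))"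
  proof (rule arg_cong2[where f = "(+)"], goal_cases)
    case 1 show ?case by (simp add: A_def linop_sca[OF linop_dpow[OF lin(2)]])
  next
    case 2 show ?case
    proof (rule sum.cong[OF refl])
      fix r
      let ?b = "2 * int (Suc r) - int m - int n - 2"
      let ?w = "dpow x e (Suc m - Suc r) y"
      have "A (Suc r) + B (Suc r) = dpowi x f (int n - int (Suc r))
         (sca (qnum x (int m - int r)) (hop ?b (Suc r) ?w) + kap (int (Suc r) - int n) (hop ?b r ?w))"
        unfolding A_def B_def linop_add[OF linop_dpowi[OF lin(2)]] by (simp del: hop.simps)
      also have "\<dots> = dpowi x f (int n - int (Suc r)) (sca ?M (hop (?b + 1) (Suc r) ?w))"
        by (subst hop_key[OF C' refl]) (rule refl)
      also have "?b + 1 = 2 * int (Suc r) - int (Suc m) - int n" by simp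
      finally show "A (Suc r) + B (Suc r) = sca ?M (dpowi x f (int n - int (Suc r))
          (hop (2 * int (Suc r) - int (Suc m) - int n) (Suc r) ?w))"
        by (simp only: linop_sca[OF linop_dpowi[OF lin(2)]])
    qed
  qed
  also have "\<dots> = sca ?M (\<Sum>r\<le>Suc m. dpowi x f (int n - int r) (hop (2 * int r - int (Suc m) - int n) r (dpow x e (Suc m - r) y)))"
    unfolding sum.atMost_Suc_shift[of _ m] sca_rules(1,5) ..
  finally have "sca (1 / ?M) (sca ?M (dpow x e (Suc m) (dpow x f n y))) = sca (1 / ?M) (sca ?M
      (\<Sum>r\<le>Suc m. dpowi x f (int n - int r) (hop (2 * int r - int (Suc m) - int n) r (dpow x e (Suc m - r) y))))"
    by (rule arg_cong)
  then show ?case using M by (simp only: sca_simps(1,2) nonzero_eq_divide_eq divide_self_if times_divide_eq_left mult_1_left if_False)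
qed

lemma kap_weight:
  assumes "k y = sca (x powi p) y" "l y = sca (x powi - p) y"
  shows "kap c y = sca (qnum x (c + p)) y"
proof
  fix i
  have "x powi c * x powi p = x powi (c + p)" "x powi - c * x powi - p = x powi - (c + p)"
    unfolding xx by simp_all
  then have "kap c y i = 1 / (x - inverse x) * (x powi (c + p) * y i - x powi - (c + p) * y i)"
    unfolding kap_def assms by (simp add: fun_app)
  then show "kap c y i = sca (qnum x (c + p)) y i"
    by (simp add: fun_app qnum_def left_diff_distrib[symmetric])
qed

lemma hop_weight:
  assumes "k y = sca (x powi p) y" "l y = sca (x powi - p) y"
  shows "hop c r y = sca (qchoose x (c + p) r) y"
proof (induction r)
  case (Suc r)
  have "hop c (Suc r) y = hop c r (sca (qnum x (c + p - int r) / qnum x (int (Suc r))) y)"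
    using kap_weight[OF assms, of "c - int r"] by (simp add: algebra_simps del: of_nat_Suc)
  then show ?case
    by (simp only: linop_sca[OF linop_hop] Suc qchoose_Suc sca_simps(1)) (simp only: mult.commute)
qed simp

end

section \<open>Quantum Serre elements\<close>

lemma dpow_commute:
  assumes "linop g" "linop f" "\<And>y. y \<in> C ==> f y \<in> C" "\<And>y. y \<in> C ==> g (f y) = f (g y)" "y \<in> C"
  shows "g (dpow x f n y) = dpow x f n (g y)"
proof -
  have "(f ^^ n) y \<in> C \<and> g ((f ^^ n) y) = (f ^^ n) (g y)"
    by (induction n) (use assms in auto)
  then show ?thesis using assms(1) by (simp add: dpow_def linop_sca)
qed

lemma dpow_dpow:
  assumes "linop f" "generic x" "s \<le> N"
  shows "dpow x f (N - s) (dpow x f s y)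
    = sca (qfactorial x N / (qfactorial x s * qfactorial x (N - s))) (dpow x f N y)"
proof -
  have "(f ^^ (N - s)) ((f ^^ s) y) = (f ^^ N) y"
    using assms(3) by (metis funpow_add comp_apply le_add_diff_inverse2)
  then show ?thesis
    using qfactorial_nz[OF assms(2)] by (simp add: dpow_def linop_sca[OF linop_funpow[OF assms(1)]] mult.commute)
qed

text \<open>The left side of the quantum Serre relation, evaluated at operators.\<close>

definition serre_op ::
  "qrat => nat => (('x => qrat) => ('x => qrat)) => (('x => qrat) => ('x => qrat)) => ('x => qrat) => ('x => qrat)" where
  "serre_op x N f f' y = (\<Sum>s\<le>N. sca ((-1) ^ s) (dpow x f (N - s) (f' (dpow x f s y))))"

lemma linop_sum_fun: "(\<And>i. i \<in> S ==> linop (T i)) ==> linop (\<lambda>y. \<Sum>i\<in>S. T i y)"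
  unfolding linop_def by (auto simp: sum.distrib sca_rules)

lemma linop_serre_op: "linop f ==> linop f' ==> linop (serre_op x N f f')"
  unfolding serre_op_def[abs_def]
  by (intro linop_sum_fun linop_scaled linop_comp[OF linop_dpow linop_comp[OF _ linop_dpow]])

lemma serre_op_commute:
  assumes g: "linop g" and f: "linop f" "\<And>y. y \<in> C ==> f y \<in> C" "\<And>y. y \<in> C ==> g (f y) = f (g y)"
    and f': "\<And>y. y \<in> C ==> f' y \<in> C" "\<And>y. y \<in> C ==> g (f' y) = f' (g y)"
    and Csca: "\<And>c y. y \<in> C ==> sca c y \<in> C" and y: "y \<in> C"
  shows "g (serre_op x N f f' y) = serre_op x N f f' (g y)"
proof -
  have C: "dpow x f n z \<in> C" if "z \<in> C" for n z
    unfolding dpow_def by (rule Csca, induction n) (use that f in auto)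
  show ?thesis
    unfolding serre_op_def linop_sum[OF g] linop_sca[OF g]
    using C f' y by (simp add: dpow_commute[OF g f])
qed

text \<open>Two simple roots; \<open>sym\<close> is the symmetry of \<open>d\<^sub>\<alpha>\<langle>\<beta>, \<alpha>\<^sup>\<or>\<rangle>\<close>.\<close>

locale rank2 = a: rank1 x e f k l C + b: rank1 x' e' f' k' l' C
  for x e f k l x' e' f' k' l' and C :: "('x => qrat) set" +
  fixes p p' :: int
  assumes sym: "x powi p = x' powi p'" and p: "p \<le> 0"
    and ef': "\<And>y. y \<in> C ==> e (f' y) = f' (e y)"
    and e'f: "\<And>y. y \<in> C ==> e' (f y) = f (e' y)"
    and kf': "\<And>y. y \<in> C ==> k (f' y) = sca (x powi - p) (f' (k y))"
    and k'f: "\<And>y. y \<in> C ==> k' (f y) = sca (x' powi - p') (f (k' y))"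
begin

definition "N = nat (1 - p)"

lemma N: "int N = 1 - p" using p by (simp add: N_def)

lemma kap'_dpow:
  assumes y: "y \<in> C" shows "b.kap c (dpow x f n y) = dpow x f n (b.kap (c - int n * p') y)"
proof -
  have Cf: "dpow x f n z \<in> C" if "z \<in> C" for n z by (rule a.Cpow[OF a.C(4) that])
  have "k' (dpow x f n z) = sca (x' powi (- int n * p')) (dpow x f n (k' z))" if "z \<in> C" for z
  proof (induction n)
    case (Suc n)
    have "k' (dpow x f (Suc n) z) = sca (1 / qnum x (int (Suc n))) (sca (x' powi - p') (f (k' (dpow x f n z))))"
      by (simp only: dpow_Suc'[OF a.gen a.lin(2)] linop_sca[OF b.lin(3)] k'f[OF Cf[OF that]])
    also have "\<dots> = sca (x' powi - p' * x' powi (- int n * p')) (dpow x f (Suc n) (k' z))"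
      by (simp only: Suc linop_sca[OF a.lin(2)] dpow_Suc'[OF a.gen a.lin(2)] sca_simps mult.commute mult.left_commute)
    also have "x' powi - p' * x' powi (- int n * p') = x' powi (- int (Suc n) * p')"
      unfolding b.xx by (simp add: algebra_simps)
    finally show ?case .
  qed simp
  from b.kap_twist[OF linop_dpow[OF a.lin(2)] Cf this y, of c] show ?thesis by simp
qed

text \<open>Moving \<open>e\<close> through the two powers of \<open>f\<close> in a term produces two torus terms, \<open>TX\<close> and \<open>TY\<close>; they cancel
between neighbouring terms of the alternating sum.\<close>

lemma serre_e:
  assumes y: "y \<in> C"
  shows "e (serre_op x N f f' y) = serre_op x N f f' (e y)"
proof -
  let ?D = "\<lambda>s. dpow x f (N - s) (f' (dpow x f s (e y)))"
  define TX where "TX s = dpow x f (N - s) (f' (dpowi x f (int s - 1) (a.kap (1 - int s) y)))" for s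
  define TY where "TY s = dpowi x f (int N - int s - 1) (f' (dpow x f s (a.kap (- int s) y)))" for s
  have C: "dpow x f n z \<in> C" if "z \<in> C" for n z by (rule a.Cpow[OF a.C(4) that])
  have l: "linop (\<lambda>z. dpow x f n (f' z))" for n by (rule linop_comp[OF linop_dpow[OF a.lin(2)] b.lin(2)])
  have t: "e (dpow x f (N - s) (f' (dpow x f s y))) = ?D s + TX s + TY s" if s: "s \<le> N" for s
  proof -
    have 1: "dpow x f (N - s) (e (f' (dpow x f s y))) = ?D s + TX s"
      by (simp add: ef'[OF C[OF y]] a.e_dpow_f[OF y] linop_simps[OF b.lin(2)] linop_simps[OF linop_dpow[OF a.lin(2)]] TX_def)
    have "a.kap (1 - int (N - s)) (f' (dpow x f s y)) = f' (a.kap (1 - int (N - s) - p) (dpow x f s y))"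
      using a.kap_twist[OF b.lin(2) b.C(4) kf' C[OF y]] by simp
    also have "\<dots> = f' (dpow x f s (a.kap (- int s) y))"
      using s N by (simp add: a.kap_dpow_f[OF y] of_nat_diff algebra_simps)
    finally have 2: "dpowi x f (int (N - s) - 1) (a.kap (1 - int (N - s)) (f' (dpow x f s y))) = TY s"
      using s by (simp add: TY_def of_nat_diff)
    show ?thesis unfolding a.e_dpow_f[OF b.C(4)[OF C[OF y]]] 1 2 ..
  qed
  have XY: "TX (Suc s) = TY s" if "s < N" for s
  proof -
    have "int N - int s - 1 = int (N - Suc s)" using that by simp
    then show ?thesis unfolding TX_def TY_def by (simp only: dpowi_of_nat) (simp add: algebra_simps)
  qed
  have X0: "TX 0 = 0" by (simp add: TX_def dpowi_def linop_0[OF l])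
  have YN: "TY N = 0" by (simp add: TY_def dpowi_def)
  have "e (serre_op x N f f' y) = (\<Sum>s\<le>N. sca ((-1) ^ s) (?D s + TX s + TY s))"
    unfolding serre_op_def linop_sum[OF a.lin(1)] linop_sca[OF a.lin(1)]
    by (intro sum.cong refl arg_cong[where f = "sca _"] t) simp
  also have "\<dots> = serre_op x N f f' (e y) + ((\<Sum>s\<le>N. sca ((-1) ^ s) (TX s)) + (\<Sum>s\<le>N. sca ((-1) ^ s) (TY s)))"
    by (simp add: serre_op_def sca_rules sum.distrib add.assoc)
  also have "(\<Sum>s\<le>N. sca ((-1) ^ s) (TX s)) = (\<Sum>s<N. sca ((-1) ^ Suc s) (TX (Suc s)))"
    unfolding lessThan_Suc_atMost[symmetric] by (subst sum.lessThan_Suc_shift) (simp add: X0)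
  also have "\<dots> = - (\<Sum>s<N. sca ((-1) ^ s) (TY s))"
    by (simp add: XY sum_negf sca_rules)
  also have "(\<Sum>s\<le>N. sca ((-1) ^ s) (TY s)) = (\<Sum>s<N. sca ((-1) ^ s) (TY s))"
    unfolding lessThan_Suc_atMost[symmetric] by (simp add: YN)
  finally show ?thesis by simp
qed

text \<open>The torus terms add up to a multiple of an alternating sum of \<open>q\<close>-binomial coefficients, which vanishes.\<close>

lemma serre_e':
  assumes y: "y \<in> C"
  shows "e' (serre_op x N f f' y) = serre_op x N f f' (e' y)"
proof -
  let ?D = "\<lambda>s. dpow x f (N - s) (f' (dpow x f s (e' y)))"
  let ?c = "\<lambda>s. qfactorial x N / (qfactorial x s * qfactorial x (N - s))"
  let ?K = "\<lambda>s. b.kap (- int s * p') y"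
  have C: "dpow x f n z \<in> C" if "z \<in> C" for n z by (rule a.Cpow[OF a.C(4) that])
  have comm: "e' (dpow x f n z) = dpow x f n (e' z)" if "z \<in> C" for n z
    by (rule dpow_commute[OF b.lin(1) a.lin(2) a.C(4) e'f that])
  have t: "e' (dpow x f (N - s) (f' (dpow x f s y))) = ?D s + dpow x f N (sca (?c s) (?K s))" if s: "s \<le> N" for s
  proof -
    have "e' (dpow x f (N - s) (f' (dpow x f s y))) = dpow x f (N - s) (e' (f' (dpow x f s y)))"
      by (rule comm[OF b.C(4)[OF C[OF y]]])
    also have "e' (f' (dpow x f s y)) = f' (dpow x f s (e' y)) + dpow x f s (?K s)"
      by (simp add: b.ef'[OF C[OF y]] comm[OF y] kap'_dpow[OF y])
    finally show ?thesis
      by (simp add: linop_simps[OF linop_dpow[OF a.lin(2)]] dpow_dpow[OF a.lin(2) a.gen s])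
  qed
  have xs: "x' powi (- int s * p') = (x powi (int N - 1)) ^ s" "x' powi - (- int s * p') = (x powi (1 - int N)) ^ s" for s
  proof -
    have q: "x' powi (p' * q) = x powi (p * q)" for q by (simp only: power_int_mult sym)
    have "x' powi (- int s * p') = x powi ((int N - 1) * int s)"
      using q[of "- int s"] N by (simp add: mult.commute)
    then show "x' powi (- int s * p') = (x powi (int N - 1)) ^ s"
      by (simp only: power_int_mult power_int_of_nat)
    have "x' powi - (- int s * p') = x powi ((1 - int N) * int s)"
      using q[of "int s"] N by (simp add: mult.commute del: power_int_of_nat)
    then show "x' powi - (- int s * p') = (x powi (1 - int N)) ^ s"
      by (simp only: power_int_mult power_int_of_nat)
  qed
  have aux: "g * (d * (a * m - b * n)) = d * ((g * a) * m - (g * b) * n)" for g d a m b n :: qrat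
    by (simp add: algebra_simps)
  have "(\<Sum>s\<le>N. sca ((-1) ^ s * ?c s) (?K s)) = 0"
  proof
    fix i
    have "(\<Sum>s\<le>N. sca ((-1) ^ s * ?c s) (?K s)) i
      = (\<Sum>s\<le>N. 1 / (x' - inverse x') * (((-1) ^ s * ?c s * (x powi (int N - 1)) ^ s) * k' y i
           - ((-1) ^ s * ?c s * (x powi (1 - int N)) ^ s) * l' y i))"
      unfolding b.kap_def xs fun_app by (simp only: aux)
    also have "\<dots> = 1 / (x' - inverse x') * ((\<Sum>s\<le>N. (-1) ^ s * ?c s * (x powi (int N - 1)) ^ s) * k' y i
           - (\<Sum>s\<le>N. (-1) ^ s * ?c s * (x powi (1 - int N)) ^ s) * l' y i)"
      by (simp only: sum_distrib_right sum_subtractf[symmetric] sum_distrib_left[symmetric])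
    also have "\<dots> = 0"
      using q_alternating_sum[OF a.gen, of N] q_alternating_sum'[OF a.gen, of N] N p by simp
    finally show "(\<Sum>s\<le>N. sca ((-1) ^ s * ?c s) (?K s)) i = 0 i" by (simp add: fun_app)
  qed
  from arg_cong[OF this, of "dpow x f N"]
  have z: "(\<Sum>s\<le>N. sca ((-1) ^ s) (dpow x f N (sca (?c s) (?K s)))) = 0"
    by (simp add: linop_simps[OF linop_dpow[OF a.lin(2)]])
  have "e' (serre_op x N f f' y) = (\<Sum>s\<le>N. sca ((-1) ^ s) (?D s + dpow x f N (sca (?c s) (?K s))))"
    unfolding serre_op_def linop_sum[OF b.lin(1)] linop_sca[OF b.lin(1)]
    by (intro sum.cong refl arg_cong[where f = "sca _"] t) simp
  also have "\<dots> = serre_op x N f f' (e' y)"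
    using z by (simp add: serre_op_def sca_rules sum.distrib)
  finally show ?thesis .
qed

end

section \<open>Root data\<close>

locale root_datum_loc =
  fixes D :: "'v::real_vector root_datum"
  assumes rd: "root_datum D"
begin

lemma rs: "root_system (roots D) (coroot D)" and rb: "root_base (roots D) (simples D)"
  and dnum: "\<alpha> \<in> simples D ==> dnum D \<alpha> \<in> {1, 2, 3}"
  and dsym_real: "\<alpha> \<in> simples D ==> \<beta> \<in> simples D ==>
     real (dnum D \<alpha>) * coroot D \<alpha> \<beta> = real (dnum D \<beta>) * coroot D \<beta> \<alpha>"
  using rd by (auto simp: root_datum_def)

lemma dnum_pos: "\<alpha> \<in> simples D ==> dnum D \<alpha> > 0"
  using dnum by force

lemma fin_roots: "finite (roots D)" using rs by (simp add: root_system_def)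

lemma simples_roots: "\<alpha> \<in> simples D ==> \<alpha> \<in> roots D"
  using rb by (auto simp: root_base_def)

lemma fin_simples: "finite (simples D)"
  using fin_roots simples_roots by (meson finite_subset subsetI)

lemma linear_coroot: "\<alpha> \<in> roots D ==> linear (coroot D \<alpha>)"
  and coroot_self: "\<alpha> \<in> roots D ==> coroot D \<alpha> \<alpha> = 2"
  and reflect: "\<alpha> \<in> roots D ==> \<beta> \<in> roots D ==> \<beta> - coroot D \<alpha> \<beta> *\<^sub>R \<alpha> \<in> roots D"
  and coroot_int: "\<alpha> \<in> roots D ==> \<beta> \<in> roots D ==> coroot D \<alpha> \<beta> \<in> \<int>"
  using rs by (auto simp: root_system_def)

lemma simples_weights: "\<alpha> \<in> simples D ==> \<alpha> \<in> weights D"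
  by (auto simp: weights_def coroot_int simples_roots)

lemma weights_add: "\<mu> \<in> weights D ==> \<nu> \<in> weights D ==> \<mu> + \<nu> \<in> weights D"
  by (auto simp: weights_def linear_add[OF linear_coroot])

lemma weights_uminus: "\<mu> \<in> weights D ==> - \<mu> \<in> weights D"
  by (auto simp: weights_def linear_neg[OF linear_coroot])

lemma weights_scale: "\<mu> \<in> weights D ==> real n *\<^sub>R \<mu> \<in> weights D"
  by (auto simp: weights_def linear_scale[OF linear_coroot])

lemma weights_shift: "\<mu> \<in> weights D ==> \<alpha> \<in> simples D ==> wshift \<mu> n \<alpha> \<in> weights D"
  by (rule weights_add[OF _ weights_scale[OF simples_weights]])

lemma weights_unshift: "\<mu> \<in> weights D ==> \<alpha> \<in> simples D ==> \<mu> - real n *\<^sub>R \<alpha> \<in> weights D"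
  unfolding diff_conv_add_uminus by (rule weights_add[OF _ weights_uminus[OF weights_scale[OF simples_weights]]])

lemma pr_real: "\<nu> \<in> weights D ==> \<alpha> \<in> simples D ==> real_of_int (pr D \<nu> \<alpha>) = coroot D \<alpha> \<nu>"
  using simples_roots by (auto simp: weights_def pr_def elim!: Ints_cases)

lemma pr_self: "\<alpha> \<in> simples D ==> pr D \<alpha> \<alpha> = 2"
  by (simp add: pr_def coroot_self simples_roots)

lemma pr_eqI:
  "\<nu> \<in> weights D ==> \<alpha> \<in> simples D ==> coroot D \<alpha> \<nu> = real_of_int n ==> pr D \<nu> \<alpha> = n"
  using pr_real[of \<nu> \<alpha>] by simp

lemma pr_shift:
  assumes "\<mu> \<in> weights D" "\<alpha> \<in> simples D" "\<beta> \<in> simples D"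
  shows "pr D (wshift \<mu> n \<beta>) \<alpha> = pr D \<mu> \<alpha> + int n * pr D \<beta> \<alpha>"
  using assms pr_real[OF assms(1,2)] pr_real[OF simples_weights assms(2), of \<beta>]
  by (intro pr_eqI weights_shift)
    (auto simp: linear_add[OF linear_coroot] linear_scale[OF linear_coroot] simples_roots)

lemma pr_unshift:
  assumes "\<mu> \<in> weights D" "\<alpha> \<in> simples D" "\<beta> \<in> simples D"
  shows "pr D (\<mu> - real n *\<^sub>R \<beta>) \<alpha> = pr D \<mu> \<alpha> - int n * pr D \<beta> \<alpha>"
  using pr_shift[OF weights_unshift[OF assms(1,3)] assms(2,3), of n n] by simp

lemma dsym:
  assumes "\<alpha> \<in> simples D" "\<beta> \<in> simples D"
  shows "int (dnum D \<alpha>) * pr D \<beta> \<alpha> = int (dnum D \<beta>) * pr D \<alpha> \<beta>"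
proof -
  have "real_of_int (int (dnum D \<alpha>) * pr D \<beta> \<alpha>) = real_of_int (int (dnum D \<beta>) * pr D \<alpha> \<beta>)"
    using dsym_real[OF assms] pr_real[OF simples_weights] assms by simp
  then show ?thesis by linarith
qed

lemma indep_coeffs:
  assumes "(\<Sum>\<gamma>\<in>simples D. u \<gamma> *\<^sub>R \<gamma>) = 0" "\<gamma> \<in> simples D"
  shows "u \<gamma> = 0"
  using assms rb fin_simples dependent_finite[of "simples D"] by (auto simp: root_base_def)

text \<open>Otherwise the reflection of \<open>\<beta>\<close> in \<open>\<alpha>\<close> would be a root with coefficients of both signs.\<close>

lemma pr_nonpos:
  assumes \<alpha>: "\<alpha> \<in> simples D" and \<beta>: "\<beta> \<in> simples D" and ne: "\<alpha> \<noteq> \<beta>"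
  shows "pr D \<beta> \<alpha> \<le> 0"
proof (rule ccontr)
  let ?a = "coroot D \<alpha> \<beta>"
  assume "\<not> ?thesis"
  then have a: "?a > 0" using pr_real[OF simples_weights[OF \<beta>] \<alpha>] by simp
  have "\<beta> - ?a *\<^sub>R \<alpha> \<in> roots D" using reflect simples_roots \<alpha> \<beta> by blast
  then obtain c :: "'v => nat" where
    "\<beta> - ?a *\<^sub>R \<alpha> = (\<Sum>\<gamma>\<in>simples D. real (c \<gamma>) *\<^sub>R \<gamma>) \<or> \<beta> - ?a *\<^sub>R \<alpha> = - (\<Sum>\<gamma>\<in>simples D. real (c \<gamma>) *\<^sub>R \<gamma>)"
    using rb by (auto simp: root_base_def)
  then obtain s :: real where s: "s = 1 \<or> s = -1"
      and e: "\<beta> - ?a *\<^sub>R \<alpha> = s *\<^sub>R (\<Sum>\<gamma>\<in>simples D. real (c \<gamma>) *\<^sub>R \<gamma>)"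
  proof (elim disjE)
    assume "\<beta> - ?a *\<^sub>R \<alpha> = (\<Sum>\<gamma>\<in>simples D. real (c \<gamma>) *\<^sub>R \<gamma>)"
    then show thesis using that[of 1] by simp
  next
    assume "\<beta> - ?a *\<^sub>R \<alpha> = - (\<Sum>\<gamma>\<in>simples D. real (c \<gamma>) *\<^sub>R \<gamma>)"
    then show thesis using that[of "-1"] by simp
  qed
  define u where "u \<gamma> = (if \<gamma> = \<beta> then 1 else 0) - (if \<gamma> = \<alpha> then ?a else 0) - s * real (c \<gamma>)" for \<gamma>
  have "(\<Sum>\<gamma>\<in>simples D. u \<gamma> *\<^sub>R \<gamma>) = (\<Sum>\<gamma>\<in>simples D. (if \<gamma> = \<beta> then \<gamma> else 0) - (if \<gamma> = \<alpha> then ?a *\<^sub>R \<gamma> else 0) - s *\<^sub>R real (c \<gamma>) *\<^sub>R \<gamma>)"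
    by (rule sum.cong) (auto simp: u_def scaleR_diff_left)
  also have "\<dots> = \<beta> - ?a *\<^sub>R \<alpha> - s *\<^sub>R (\<Sum>\<gamma>\<in>simples D. real (c \<gamma>) *\<^sub>R \<gamma>)"
    using \<alpha> \<beta> fin_simples by (simp add: sum_subtractf scaleR_sum_right)
  finally have z: "(\<Sum>\<gamma>\<in>simples D. u \<gamma> *\<^sub>R \<gamma>) = 0" using e by simp
  have "u \<beta> = 0" "u \<alpha> = 0" using indep_coeffs[OF z] \<alpha> \<beta> by auto
  then show False using ne a s by (auto simp: u_def)
qed

lemma span_simples: "span (simples D) = UNIV"
proof -
  have "\<beta> \<in> span (simples D)" if "\<beta> \<in> roots D" for \<beta>
  proof -
    obtain c :: "'v => nat" where
      "\<beta> = (\<Sum>\<gamma>\<in>simples D. real (c \<gamma>) *\<^sub>R \<gamma>) \<or> \<beta> = - (\<Sum>\<gamma>\<in>simples D. real (c \<gamma>) *\<^sub>R \<gamma>)"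
      using rb \<open>\<beta> \<in> roots D\<close> by (auto simp: root_base_def)
    moreover have "(\<Sum>\<gamma>\<in>simples D. real (c \<gamma>) *\<^sub>R \<gamma>) \<in> span (simples D)"
      by (intro span_sum span_scale span_base)
    ultimately show ?thesis by (metis span_neg)
  qed
  then have "roots D \<subseteq> span (simples D)" by blast
  then have "span (roots D) \<subseteq> span (simples D)" using span_minimal subspace_span by blast
  then show ?thesis using rs by (auto simp: root_system_def)
qed

lemma reflection_sum:
  assumes \<alpha>: "\<alpha> \<in> roots D"
  shows "(\<Sum>\<beta>\<in>roots D. h (\<beta> - coroot D \<alpha> \<beta> *\<^sub>R \<alpha>)) = (\<Sum>\<beta>\<in>roots D. h \<beta> :: real)"
proof -
  let ?s = "\<lambda>\<beta>. \<beta> - coroot D \<alpha> \<beta> *\<^sub>R \<alpha>"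
  have ss: "?s (?s \<beta>) = \<beta>" for \<beta>
    using linear_coroot[OF \<alpha>] coroot_self[OF \<alpha>]
    by (simp add: linear_diff linear_scale scaleR_diff_left)
  have "bij_betw ?s (roots D) (roots D)"
    by (rule bij_betw_byWitness[where f' = ?s]) (use ss reflect[OF \<alpha>] in auto)
  then show ?thesis by (rule sum.reindex_bij_betw)
qed

text \<open>For a linear form \<open>g\<close>, the sum on the left is the value of the invariant form at \<open>g\<close> and \<open>\<alpha>\<^sup>\<or>\<close>. The
reflection in \<open>\<alpha>\<close> permutes the roots, so \<open>\<alpha>\<^sup>\<or>\<close> is dual to a positive multiple of \<open>\<alpha>\<close>.\<close>

lemma coroot_form:
  assumes \<alpha>: "\<alpha> \<in> roots D" and g: "linear g"
  shows "2 * (\<Sum>\<beta>\<in>roots D. g \<beta> * coroot D \<alpha> \<beta>) = g \<alpha> * (\<Sum>\<beta>\<in>roots D. coroot D \<alpha> \<beta> * coroot D \<alpha> \<beta>)"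
proof -
  have "(\<Sum>\<beta>\<in>roots D. g \<beta> * coroot D \<alpha> \<beta>)
    = (\<Sum>\<beta>\<in>roots D. g (\<beta> - coroot D \<alpha> \<beta> *\<^sub>R \<alpha>) * coroot D \<alpha> (\<beta> - coroot D \<alpha> \<beta> *\<^sub>R \<alpha>))"
    by (rule reflection_sum[OF \<alpha>, symmetric, of "\<lambda>\<beta>. g \<beta> * coroot D \<alpha> \<beta>"])
  also have "\<dots> = (\<Sum>\<beta>\<in>roots D. g \<alpha> * (coroot D \<alpha> \<beta> * coroot D \<alpha> \<beta>) - g \<beta> * coroot D \<alpha> \<beta>)"
    using g linear_coroot[OF \<alpha>] coroot_self[OF \<alpha>]
    by (intro sum.cong) (simp_all add: linear_diff linear_scale algebra_simps)
  finally show ?thesis by (simp add: sum_subtractf sum_distrib_left)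
qed

text \<open>The roots span, so the invariant form identifies every vector with a linear form \<open>g\<close>. Vanishing simple coroots at
the vector mean that \<open>g\<close> vanishes at the simple roots, which span.\<close>

lemma coroots_separate:
  assumes x: "\<And>\<alpha>. \<alpha> \<in> simples D ==> coroot D \<alpha> x = 0"
  shows "x = 0"
proof -
  define T where "T g = (\<Sum>\<beta>\<in>roots D. g \<beta> *\<^sub>R \<beta>)" for g :: "'v => real"
  let ?W = "T ` {g. linear g}"
  have sub: "subspace ?W"
  proof (rule subspaceI)
    show "0 \<in> ?W" by (rule image_eqI[of _ _ "\<lambda>x. 0"]) (auto simp: T_def linear_zero)
    fix y z assume "y \<in> ?W" "z \<in> ?W"
    then obtain g h where gh: "linear g" "linear h" "y = T g" "z = T h" by auto
    show "y + z \<in> ?W"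
      by (rule image_eqI[of _ _ "\<lambda>x. g x + h x"])
        (use gh in \<open>auto simp: T_def scaleR_left_distrib sum.distrib linear_compose_add\<close>)
  next
    fix c :: real and y assume "y \<in> ?W"
    then obtain g where g: "linear g" "y = T g" by auto
    show "c *\<^sub>R y \<in> ?W"
      by (rule image_eqI[of _ _ "\<lambda>x. c * g x"])
        (use g linear_compose_scale_right[of g c] in \<open>auto simp: T_def scaleR_sum_right\<close>)
  qed
  have fT: "f (T g) = (\<Sum>\<beta>\<in>roots D. g \<beta> * f \<beta>)" if "linear f" for f g
    by (simp add: T_def linear_sum[OF that] linear_scale[OF that])
  have "x \<in> ?W"
  proof (rule ccontr)
    assume nx: "x \<notin> ?W"
    obtain B where B: "B \<subseteq> ?W" "independent B" "span B = ?W"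
      using sub by (metis basis_exists span_subspace)
    then have "independent (insert x B)" using nx by (simp add: independent_insert)
    then obtain f :: "'v => real" where f: "linear f" "\<forall>b\<in>insert x B. f b = (if b = x then 1 else 0)"
      using linear_independent_extend[of "insert x B" "\<lambda>b. if b = x then 1 else 0 :: real"] by blast
    have "f b = 0" if "b \<in> B" for b using f(2) that nx B(1) by auto
    then have "f y = 0" if "y \<in> ?W" for y
      using linear_eq_0_on_span[OF f(1)] B(3) that by blast
    then have "f (T f) = 0" using f(1) by blast
    then have "\<forall>\<beta>\<in>roots D. f \<beta> * f \<beta> = 0"
      unfolding fT[OF f(1)] by (subst (asm) sum_nonneg_eq_0_iff) (auto intro: fin_roots)
    then have "f \<beta> = 0" if "\<beta> \<in> roots D" for \<beta> using that by simp
    then have "f x = 0" using linear_eq_0_on_span[OF f(1)] rs by (metis UNIV_I root_system_def)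
    then show False using f(2) by simp
  qed
  then obtain g where g: "linear g" "x = T g" by auto
  have "g \<alpha> = 0" if "\<alpha> \<in> simples D" for \<alpha>
  proof -
    have r: "\<alpha> \<in> roots D" using that by (rule simples_roots)
    have "(\<Sum>\<beta>\<in>roots D. g \<beta> * coroot D \<alpha> \<beta>) = 0"
      using x[OF that] fT[OF linear_coroot[OF r], of g] g by simp
    then have "g \<alpha> * (\<Sum>\<beta>\<in>roots D. coroot D \<alpha> \<beta> * coroot D \<alpha> \<beta>) = 0"
      using coroot_form[OF r g(1)] by simp
    moreover have "(\<Sum>\<beta>\<in>roots D. coroot D \<alpha> \<beta> * coroot D \<alpha> \<beta>) > 0"
      by (rule sum_pos2[OF fin_roots r]) (auto simp: coroot_self[OF r])
    ultimately show ?thesis by simp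
  qed
  then have "g y = 0" for y using linear_eq_0_on_span[OF g(1)] span_simples by (metis UNIV_I)
  then show ?thesis using g by (simp add: T_def)
qed

lemma pr_separates:
  assumes "\<mu> \<in> weights D" "\<nu> \<in> weights D" "\<And>\<alpha>. \<alpha> \<in> simples D ==> pr D \<mu> \<alpha> = pr D \<nu> \<alpha>"
  shows "\<mu> = \<nu>"
proof -
  have "coroot D \<alpha> (\<mu> - \<nu>) = 0" if "\<alpha> \<in> simples D" for \<alpha>
    using assms pr_real[OF _ that] that by (simp add: linear_diff[OF linear_coroot] simples_roots flip: pr_real)
  then show ?thesis using coroots_separate by (metis right_minus_eq)
qed

subsection \<open>Induction on weights\<close>

lemma wle_refl: "wle D \<mu> \<mu>"
  by (auto simp: wle_def intro!: exI[of _ "\<lambda>_. 0"])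

lemma wle_shift: assumes "wle D (wshift \<mu> n \<alpha>) \<nu>" "\<alpha> \<in> simples D" shows "wle D \<mu> \<nu>"
proof -
  obtain c :: "'v => nat" where c: "\<nu> - wshift \<mu> n \<alpha> = (\<Sum>\<gamma>\<in>simples D. real (c \<gamma>) *\<^sub>R \<gamma>)"
    using assms by (auto simp: wle_def)
  have "(\<Sum>\<gamma>\<in>simples D. real (c \<gamma> + (if \<gamma> = \<alpha> then n else 0)) *\<^sub>R \<gamma>)
    = (\<Sum>\<gamma>\<in>simples D. real (c \<gamma>) *\<^sub>R \<gamma> + (if \<gamma> = \<alpha> then real n *\<^sub>R \<gamma> else 0))"
    by (rule sum.cong) (auto simp: scaleR_left_distrib)
  also have "\<dots> = \<nu> - \<mu>" using assms(2) fin_simples c by (simp add: sum.distrib algebra_simps)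
  finally show ?thesis unfolding wle_def by metis
qed

lemma not_wle_shift: assumes "n > 0" "\<alpha> \<in> simples D" shows "\<not> wle D (wshift \<mu> n \<alpha>) \<mu>"
proof
  assume "wle D (wshift \<mu> n \<alpha>) \<mu>"
  then obtain c :: "'v => nat" where c: "\<mu> - wshift \<mu> n \<alpha> = (\<Sum>\<gamma>\<in>simples D. real (c \<gamma>) *\<^sub>R \<gamma>)"
    by (auto simp: wle_def)
  have "(\<Sum>\<gamma>\<in>simples D. real (c \<gamma> + (if \<gamma> = \<alpha> then n else 0)) *\<^sub>R \<gamma>)
    = (\<Sum>\<gamma>\<in>simples D. real (c \<gamma>) *\<^sub>R \<gamma> + (if \<gamma> = \<alpha> then real n *\<^sub>R \<gamma> else 0))"
    by (rule sum.cong) (auto simp: scaleR_left_distrib)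
  also have "\<dots> = 0" using assms(2) fin_simples c[symmetric] by (simp add: sum.distrib)
  finally have "real (c \<alpha> + (if \<alpha> = \<alpha> then n else 0)) = 0"
    using indep_coeffs[of "\<lambda>\<gamma>. real (c \<gamma> + (if \<gamma> = \<alpha> then n else 0))" \<alpha>] assms(2) by simp
  then show False using assms(1) by simp
qed

text \<open>Downward induction on weights: the set of elements of \<open>S\<close> above \<open>\<mu>\<close> is finite, and it shrinks when \<open>\<mu>\<close> is
raised within \<open>S\<close>.\<close>

lemma weight_induct:
  assumes qb: "quasi_bounded D S" and \<mu>: "\<mu> \<in> weights D"
    and out: "\<And>\<mu>. \<mu> \<in> weights D ==> \<mu> \<notin> S ==> P \<mu>"
    and step: "\<And>\<mu>. \<mu> \<in> weights D ==> (\<And>\<alpha> n. \<alpha> \<in> simples D ==> n > 0 ==> P (wshift \<mu> n \<alpha>)) ==> P \<mu>"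
  shows "P \<mu>"
  using \<mu>
proof (induction "card {\<nu> \<in> S. wle D \<mu> \<nu>}" arbitrary: \<mu> rule: less_induct)
  case less
  show ?case
  proof (cases "\<mu> \<in> S")
    case False then show ?thesis using out less.prems by blast
  next
    case True
    have fin: "finite {\<nu> \<in> S. wle D \<mu> \<nu>}" using qb less.prems by (auto simp: quasi_bounded_def)
    show ?thesis
    proof (rule step[OF less.prems])
      fix \<alpha> n assume \<alpha>: "\<alpha> \<in> simples D" and n: "(n::nat) > 0"
      have "{\<nu> \<in> S. wle D (wshift \<mu> n \<alpha>) \<nu>} \<subset> {\<nu> \<in> S. wle D \<mu> \<nu>}"
        using True wle_shift[OF _ \<alpha>] not_wle_shift[OF n \<alpha>] wle_refl by blast
      then have "card {\<nu> \<in> S. wle D (wshift \<mu> n \<alpha>) \<nu>} < card {\<nu> \<in> S. wle D \<mu> \<nu>}"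
        by (rule psubset_card_mono[OF fin])
      then show "P (wshift \<mu> n \<alpha>)" using less.hyps weights_shift[OF less.prems \<alpha>] by blast
    qed
  qed
qed

end

section \<open>Operator representations of the free algebra\<close>

lemma Qv_type_ring: "Qv = type_ring"
  by (simp add: Qv_def)

lemma free_monoid_monoid: "Group.monoid (free_monoid S)"
  by (rule monoidI) (auto simp: free_monoid_def)

locale free_alg = root_datum_loc D for D :: "'v::real_vector root_datum"
begin

abbreviation "G \<equiv> free_monoid (qgens D)"
abbreviation "Fr \<equiv> Free D"

sublocale MG: monring "free_monoid (qgens D)"
  unfolding monring_def by (rule free_monoid_monoid)

lemma Free_eq: "Fr = monoid_ring type_ring G"
  by (simp add: Free_def Qv_type_ring)

sublocale F: ring Fr
  unfolding Free_eq by (rule MG.MR_ring)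

lemma carrier_G [simp]: "carrier G = lists (qgens D)"
  by (simp add: free_monoid_def)

lemma mult_G [simp]: "u \<otimes>\<^bsub>G\<^esub> v = u @ v"
  by (simp add: free_monoid_def)

lemma one_G [simp]: "\<one>\<^bsub>G\<^esub> = []"
  by (simp add: free_monoid_def)

lemma fscal_closed [simp]: "fscal D c \<in> carrier Fr"
  unfolding fscal_def Free_eq Qv_type_ring by (rule MG.single_closed)

lemma fgen_closed [simp]: "fgen D x \<in> carrier Fr"
  unfolding fgen_def Free_eq Qv_type_ring by (rule MG.single_closed)

lemma fdiv_closed [simp]: "fdiv D g \<alpha> n \<in> carrier Fr"
  by (simp add: fdiv_def)

lemma fkbin_closed [simp]: "fkbin D \<alpha> n \<in> carrier Fr"
  by (induction n) (simp_all add: Let_def)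

lemma serre_closed [simp]: "serre D g \<alpha> \<beta> \<in> carrier Fr"
  unfolding serre_def Let_def by (rule F.finsum_closed) auto

lemma qrels_closed: "qrels D \<subseteq> carrier Fr"
  unfolding qrels_def Let_def by auto

lemma fscal_add: "fscal D a \<oplus>\<^bsub>Fr\<^esub> fscal D b = fscal D (a + b)"
  unfolding fscal_def Free_eq Qv_type_ring by (rule MG.single_add) simp

lemma fscal_mult: "fscal D a \<otimes>\<^bsub>Fr\<^esub> fscal D b = fscal D (a * b)"
  unfolding fscal_def Free_eq Qv_type_ring by (subst MG.single_mult) simp_all

lemma fscal_one: "fscal D 1 = \<one>\<^bsub>Fr\<^esub>"
  unfolding fscal_def Free_eq Qv_type_ring MG.MR_one by simp

lemma fscal_central:
  assumes "f \<in> carrier Fr" shows "fscal D c \<otimes>\<^bsub>Fr\<^esub> f = f \<otimes>\<^bsub>Fr\<^esub> fscal D c"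
  unfolding fscal_def Free_eq Qv_type_ring
  by (rule MG.MR_eqI)
    (use assms in \<open>simp_all add: Free_eq MG.MR_closed MG.MR_pairing MG.pairing_lin cong: MG.pairing_cong\<close>)

lemma qideal_ideal: "ideal (qideal D) Fr"
  unfolding qideal_def by (rule F.genideal_ideal[OF qrels_closed])

sublocale I: ideal "qideal D" Fr by (rule qideal_ideal)

definition act :: "('v qgen => ('x => qrat) => ('x => qrat)) => 'v qfree => ('x => qrat) => ('x => qrat)" where
  "act op f y = (\<lambda>i. MG.pairing (\<lambda>w. foldr op w y i) f)"

end

locale free_rep = free_alg D for D :: "'v::real_vector root_datum" +
  fixes op :: "'v qgen => ('x => qrat) => ('x => qrat)"
  assumes linop_op: "linop (op x)"
begin

abbreviation "ac \<equiv> act op"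

lemma linop_word: "linop (foldr op w)"
proof (induction w)
  case Nil show ?case by (simp add: linop_def)
next
  case (Cons a w) from linop_comp[OF linop_op[of a] Cons] show ?case by (simp add: comp_def)
qed

lemma act_sum: "ac f y = (\<Sum>w\<in>MG.supp f. sca (f w) (foldr op w y))"
  by (rule ext) (simp add: act_def MG.pairing_def fun_app)

lemma linop_act: "linop (ac f)"
proof -
  have "linop (\<lambda>y. \<Sum>w\<in>MG.supp f. sca (f w) (foldr op w y))"
    by (intro linop_sum_fun linop_scaled linop_word)
  then show ?thesis by (simp add: act_sum[abs_def])
qed

lemma act_add: "f \<in> carrier Fr ==> h \<in> carrier Fr ==> ac (f \<oplus>\<^bsub>Fr\<^esub> h) y = ac f y + ac h y"
  by (rule ext) (simp add: act_def Free_eq MG.pairing_add fun_app)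

lemma act_zero: "ac \<zero>\<^bsub>Fr\<^esub> y = 0"
  by (rule ext) (simp add: act_def Free_eq fun_app)

lemma act_mult:
  assumes "f \<in> carrier Fr" "h \<in> carrier Fr"
  shows "ac (f \<otimes>\<^bsub>Fr\<^esub> h) y = ac f (ac h y)"
proof
  fix i
  have "foldr op u (ac h y) i = MG.pairing (\<lambda>v. foldr op (u @ v) y i) h" for u
    unfolding act_sum linop_sum[OF linop_word] linop_sca[OF linop_word]
    by (simp add: fun_app MG.pairing_def)
  then show "ac (f \<otimes>\<^bsub>Fr\<^esub> h) y i = ac f (ac h y) i"
    using assms by (simp add: act_def Free_eq MG.pairing_mult)
qed

lemma act_uminus: assumes "f \<in> carrier Fr" shows "ac (\<ominus>\<^bsub>Fr\<^esub> f) y = - ac f y"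
proof -
  have "ac (\<ominus>\<^bsub>Fr\<^esub> f) y + ac f y = 0"
    using act_add[of "\<ominus>\<^bsub>Fr\<^esub> f" f y] assms by (simp add: F.l_neg act_zero)
  then show ?thesis by (simp add: eq_neg_iff_add_eq_0)
qed

lemma act_minus: "f \<in> carrier Fr ==> h \<in> carrier Fr ==> ac (f \<ominus>\<^bsub>Fr\<^esub> h) y = ac f y - ac h y"
  by (simp add: a_minus_def act_add act_uminus)

lemma act_fscal: "ac (fscal D c) y = sca c y"
  by (rule ext) (simp add: act_def fscal_def Qv_type_ring MG.pairing_single fun_app)

lemma act_fgen: "x \<in> qgens D ==> ac (fgen D x) y = op x y"
  by (rule ext) (simp add: act_def fgen_def Qv_type_ring MG.pairing_single)

lemma act_one: "ac \<one>\<^bsub>Fr\<^esub> y = y"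
  using act_fscal[of 1] by (simp add: fscal_one)

lemma act_pow: "f \<in> carrier Fr ==> ac (f [^]\<^bsub>Fr\<^esub> (n::nat)) y = ((ac f) ^^ n) y"
  by (induction n arbitrary: y) (simp_all add: act_one act_mult funpow_swap1)

lemma act_finsum:
  "finite S ==> (\<And>s. s \<in> S ==> h s \<in> carrier Fr) ==> ac (finsum Fr h S) y = (\<Sum>s\<in>S. ac (h s) y)"
  by (induction rule: finite_induct) (simp_all add: act_zero act_add Pi_iff)

lemma gens: "\<alpha> \<in> simples D ==> GE \<alpha> \<in> qgens D" "\<alpha> \<in> simples D ==> GF \<alpha> \<in> qgens D"
  "\<alpha> \<in> simples D ==> GK \<alpha> \<in> qgens D" "\<alpha> \<in> simples D ==> GL \<alpha> \<in> qgens D"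
  by (auto simp: qgens_def)

lemma act_fdiv:
  assumes "g \<in> {GE, GF}" "\<alpha> \<in> simples D"
  shows "ac (fdiv D g \<alpha> n) y = dpow (qd (dnum D \<alpha>)) (op (g \<alpha>)) n y"
proof -
  have x: "g \<alpha> \<in> qgens D" using assms gens by auto
  have "ac (fgen D (g \<alpha>)) = op (g \<alpha>)" by (rule ext) (rule act_fgen[OF x])
  then show ?thesis
    by (simp add: fdiv_def act_mult act_fscal act_pow dpow_def qfact_qfactorial)
qed

lemma act_serre:
  assumes g: "g \<in> {GE, GF}" and \<alpha>: "\<alpha> \<in> simples D" and \<beta>: "\<beta> \<in> simples D"
  shows "ac (serre D g \<alpha> \<beta>) y = serre_op (qd (dnum D \<alpha>)) (nat (1 - pr D \<beta> \<alpha>)) (op (g \<alpha>)) (op (g \<beta>)) y"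
proof -
  have x: "g \<beta> \<in> qgens D" using g \<beta> gens by auto
  show ?thesis
    unfolding serre_def Let_def serre_op_def atLeast0AtMost
    by (subst act_finsum) (simp_all add: act_mult act_fscal act_fdiv[OF g \<alpha>] act_fgen[OF x])
qed

end

text \<open>The elements of the free algebra that annihilate a stable subspace \<open>C\<close> form an ideal, so it suffices to check
the defining relations on \<open>C\<close>.\<close>

locale qrep = free_rep D op for D :: "'v::real_vector root_datum"
    and op :: "'v qgen => ('x => qrat) => ('x => qrat)" +
  fixes C :: "('x => qrat) set"
  assumes C0: "0 \<in> C" and Cadd: "\<And>y z. y \<in> C ==> z \<in> C ==> y + z \<in> C"
    and Csca: "\<And>c y. y \<in> C ==> sca c y \<in> C"
    and Cop: "\<And>x y. x \<in> qgens D ==> y \<in> C ==> op x y \<in> C"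
begin

lemma C_act: assumes "f \<in> carrier Fr" "y \<in> C" shows "ac f y \<in> C"
proof -
  have w: "foldr op w y \<in> C" if "w \<in> lists (qgens D)" for w
    using that by (induction w) (auto intro: assms Cop)
  have "(\<Sum>w\<in>S. sca (f w) (foldr op w y)) \<in> C" if "finite S" "S \<subseteq> lists (qgens D)" for S
    using that by (induction rule: finite_induct) (auto intro: C0 Cadd Csca w)
  then show ?thesis unfolding act_sum
    using assms(1) MG.supp_sub[of f] by (simp add: Free_eq MG.carrier_MR)
qed

lemma annihilator_ideal: "ideal {f \<in> carrier Fr. \<forall>y\<in>C. ac f y = 0} Fr"
proof (rule idealI[OF F.ring_axioms])
  show "subgroup {f \<in> carrier Fr. \<forall>y\<in>C. ac f y = 0} (add_monoid Fr)"
  proof (rule F.add.subgroupI)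
    show "{f \<in> carrier Fr. \<forall>y\<in>C. ac f y = 0} \<noteq> {}" using act_zero by blast
  qed (auto simp: act_add act_uminus)
qed (auto simp: act_mult C_act linop_0[OF linop_act])

lemma qideal_zero:
  assumes "\<And>r y. r \<in> qrels D ==> y \<in> C ==> ac r y = 0" and "f \<in> qideal D" "y \<in> C"
  shows "ac f y = 0"
proof -
  have "qideal D \<subseteq> {f \<in> carrier Fr. \<forall>y\<in>C. ac f y = 0}"
    unfolding qideal_def
    by (rule F.genideal_minimal[OF annihilator_ideal]) (use assms(1) qrels_closed in auto)
  then show ?thesis using assms by blast
qed

end

section \<open>Highest weight modules\<close>

text \<open>On functions on words, \<open>e\<^sub>\<beta>\<close> shall append \<open>\<beta>\<close> to the argument. The commutators of \<open>f\<^sub>\<alpha>\<close> with all \<open>e\<^sub>\<beta>\<close>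
then determine \<open>f\<^sub>\<alpha>\<close>: it deletes one letter \<open>\<alpha>\<close> from the argument in all possible ways, with the quantum integer of
the weight at that position as coefficient. The recursion keeps track of this weight in \<open>m\<close>.\<close>

primrec frec :: "'v root_datum => 'v => int => ('v list => qrat) => 'v list => qrat" where
  "frec D \<alpha> m \<psi> [] = 0"
| "frec D \<alpha> m \<psi> (\<beta> # w) = (if \<beta> = \<alpha> then qnum (qd (dnum D \<alpha>)) m * \<psi> w else 0)
     + frec D \<alpha> (m - pr D \<beta> \<alpha>) (\<lambda>u. \<psi> (\<beta> # u)) w"

definition wsum :: "'v root_datum => 'v => 'v list => int" where
  "wsum D \<alpha> w = (\<Sum>\<beta>\<leftarrow>w. pr D \<beta> \<alpha>)"

lemma wsum_simps [simp]: "wsum D \<alpha> [] = 0" "wsum D \<alpha> (\<beta> # w) = pr D \<beta> \<alpha> + wsum D \<alpha> w"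
  "wsum D \<alpha> (u @ w) = wsum D \<alpha> u + wsum D \<alpha> w"
  by (simp_all add: wsum_def)

lemma frec_snoc:
  "frec D \<alpha> m \<psi> (w @ [\<beta>]) = frec D \<alpha> m (\<lambda>u. \<psi> (u @ [\<beta>])) w
     + (if \<beta> = \<alpha> then qnum (qd (dnum D \<alpha>)) (m - wsum D \<alpha> w) * \<psi> w else 0)"
  by (induction w arbitrary: m \<psi>) (auto simp: algebra_simps)

lemma frec_add: "frec D \<alpha> m (\<lambda>u. \<psi> u + \<chi> u) w = frec D \<alpha> m \<psi> w + frec D \<alpha> m \<chi> w"
  by (induction w arbitrary: m \<psi> \<chi>) (auto simp: algebra_simps)

lemma frec_scale: "frec D \<alpha> m (\<lambda>u. c * \<psi> u) w = c * frec D \<alpha> m \<psi> w"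
  by (induction w arbitrary: m \<psi>) (auto simp: algebra_simps)

lemma frec_twist:
  "frec D \<alpha> m (\<lambda>u. x powi (t - wsum D \<beta> u) * \<psi> u) w
    = x powi (t + pr D \<alpha> \<beta> - wsum D \<beta> w) * frec D \<alpha> m \<psi> w"
proof (induction w arbitrary: m \<psi> t)
  case (Cons \<gamma> w)
  have "frec D \<alpha> (m - pr D \<gamma> \<alpha>) (\<lambda>u. x powi (t - pr D \<gamma> \<beta> - wsum D \<beta> u) * \<psi> (\<gamma> # u)) w
    = x powi (t - pr D \<gamma> \<beta> + pr D \<alpha> \<beta> - wsum D \<beta> w) * frec D \<alpha> (m - pr D \<gamma> \<alpha>) (\<lambda>u. \<psi> (\<gamma> # u)) w"
    by (rule Cons)
  then show ?case by (auto simp: algebra_simps)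
qed simp

primrec vop :: "'v root_datum => 'v => 'v qgen => ('v list => qrat) => 'v list => qrat" where
  "vop D \<nu> (GE \<alpha>) \<psi> = (\<lambda>w. \<psi> (w @ [\<alpha>]))"
| "vop D \<nu> (GF \<alpha>) \<psi> = frec D \<alpha> (pr D \<nu> \<alpha>) \<psi>"
| "vop D \<nu> (GK \<alpha>) \<psi> = (\<lambda>w. qd (dnum D \<alpha>) powi (pr D \<nu> \<alpha> - wsum D \<alpha> w) * \<psi> w)"
| "vop D \<nu> (GL \<alpha>) \<psi> = (\<lambda>w. qd (dnum D \<alpha>) powi - (pr D \<nu> \<alpha> - wsum D \<alpha> w) * \<psi> w)"

lemma linop_vop: "linop (vop D \<nu> g)"
proof (cases g)
  case (GF \<alpha>)
  have "frec D \<alpha> m (y + z) = frec D \<alpha> m y + frec D \<alpha> m z" for m y z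
    by (rule ext) (simp add: plus_fun_def frec_add)
  moreover have "frec D \<alpha> m (sca c y) = sca c (frec D \<alpha> m y)" for m c y
    by (rule ext) (simp add: sca_def frec_scale)
  ultimately show ?thesis using GF by (simp add: linop_def)
qed (simp_all add: linop_def fun_eq_iff fun_app algebra_simps)

definition hwv :: "'v list => qrat" where
  "hwv w = (if w = [] then 1 else 0)"

text \<open>The simple module of highest weight \<open>\<nu>\<close>, since a function killed by all \<open>e\<^sub>\<alpha>\<close> is supported on the empty word.\<close>

inductive_set hwmod :: "'v root_datum => 'v => ('v list => qrat) set" for D \<nu> where
  hwv: "hwv \<in> hwmod D \<nu>"
| add: "y \<in> hwmod D \<nu> ==> z \<in> hwmod D \<nu> ==> y + z \<in> hwmod D \<nu>"
| sca: "y \<in> hwmod D \<nu> ==> sca c y \<in> hwmod D \<nu>"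
| low: "\<alpha> \<in> simples D ==> y \<in> hwmod D \<nu> ==> vop D \<nu> (GF \<alpha>) y \<in> hwmod D \<nu>"

locale hw = free_alg D for D :: "'v::real_vector root_datum" +
  fixes \<nu> :: 'v
begin

abbreviation "E \<alpha> \<equiv> vop D \<nu> (GE \<alpha>)"
abbreviation "Fo \<alpha> \<equiv> vop D \<nu> (GF \<alpha>)"
abbreviation "K \<alpha> \<equiv> vop D \<nu> (GK \<alpha>)"
abbreviation "L \<alpha> \<equiv> vop D \<nu> (GL \<alpha>)"
abbreviation "x \<alpha> \<equiv> qd (dnum D \<alpha>)"

lemma gen_x: "\<alpha> \<in> simples D ==> generic (x \<alpha>)"
  by (rule generic_qd[OF dnum_pos])

lemma x_nz [simp]: "x \<alpha> \<noteq> 0"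
  by (simp add: qd_def)

lemma K_L: "K \<alpha> (L \<alpha> y) = y" "L \<alpha> (K \<alpha> y) = y"
proof -
  have "x \<alpha> powi a * (x \<alpha> powi - a * c) = c" "x \<alpha> powi - a * (x \<alpha> powi a * c) = c" for a c
    by (simp_all add: power_int_minus)
  then show "K \<alpha> (L \<alpha> y) = y" "L \<alpha> (K \<alpha> y) = y"
    by (simp_all only: vop.simps)
qed

lemma K_E: "K \<alpha> (E \<beta> y) = sca (x \<alpha> powi pr D \<beta> \<alpha>) (E \<beta> (K \<alpha> y))"
  and L_E: "L \<alpha> (E \<beta> y) = sca (x \<alpha> powi - pr D \<beta> \<alpha>) (E \<beta> (L \<alpha> y))"
  by (simp_all add: fun_eq_iff fun_app mult.assoc[symmetric] power_int_add[symmetric])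

lemma K_F: "K \<alpha> (Fo \<beta> y) = sca (x \<alpha> powi - pr D \<beta> \<alpha>) (Fo \<beta> (K \<alpha> y))"
  by (simp add: fun_eq_iff fun_app frec_twist mult.assoc[symmetric] power_int_add[symmetric])

lemma E_F: "\<alpha> \<noteq> \<beta> ==> E \<alpha> (Fo \<beta> y) = Fo \<beta> (E \<alpha> y)"
  by (simp add: fun_eq_iff frec_snoc)

lemma E_F_self:
  "E \<alpha> (Fo \<alpha> y) = Fo \<alpha> (E \<alpha> y) + sca (1 / (x \<alpha> - inverse (x \<alpha>))) (K \<alpha> y - L \<alpha> y)"
  by (simp add: fun_eq_iff frec_snoc fun_app qnum_def left_diff_distrib)

lemma K_K: "K \<alpha> (K \<beta> y) = K \<beta> (K \<alpha> y)" "K \<alpha> (L \<beta> y) = L \<beta> (K \<alpha> y)" "L \<alpha> (L \<beta> y) = L \<beta> (L \<alpha> y)"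
  by (simp_all add: fun_eq_iff)

lemma rank1: assumes "\<alpha> \<in> simples D" shows "rank1 (x \<alpha>) (E \<alpha>) (Fo \<alpha>) (K \<alpha>) (L \<alpha>) UNIV"
  by (rule rank1.intro)
    (simp_all only: UNIV_I gen_x[OF assms] linop_vop K_L K_E K_F E_F_self pr_self[OF assms])

lemma L_F: "\<alpha> \<in> simples D ==> L \<alpha> (Fo \<beta> y) = sca (x \<alpha> powi pr D \<beta> \<alpha>) (Fo \<beta> (L \<alpha> y))"
  using rank1.twist_l[OF rank1 linop_vop UNIV_I K_F UNIV_I, of \<alpha> \<beta> y] by simp

lemma rank1': assumes "\<alpha> \<in> simples D" shows "rank1 (x \<alpha>) (Fo \<alpha>) (E \<alpha>) (L \<alpha>) (K \<alpha>) UNIV"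
proof (rule rank1.intro)
  fix y
  show "L \<alpha> (Fo \<alpha> y) = sca (x \<alpha> powi 2) (Fo \<alpha> (L \<alpha> y))" using L_F[OF assms, of \<alpha>] pr_self[OF assms] by simp
  show "L \<alpha> (E \<alpha> y) = sca (x \<alpha> powi - 2) (E \<alpha> (L \<alpha> y))" using L_E[of \<alpha> \<alpha>] pr_self[OF assms] by simp
  have "sca (1 / (x \<alpha> - inverse (x \<alpha>))) (K \<alpha> y - L \<alpha> y) + sca (1 / (x \<alpha> - inverse (x \<alpha>))) (L \<alpha> y - K \<alpha> y) = 0"
    by (simp add: sca_rules)
  then show "Fo \<alpha> (E \<alpha> y) = E \<alpha> (Fo \<alpha> y) + sca (1 / (x \<alpha> - inverse (x \<alpha>))) (L \<alpha> y - K \<alpha> y)"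
    unfolding E_F_self by (simp add: add.assoc)
qed (simp_all only: UNIV_I gen_x[OF assms] linop_vop K_L)

lemma sym_x: "\<alpha> \<in> simples D ==> \<beta> \<in> simples D ==> x \<alpha> powi pr D \<beta> \<alpha> = x \<beta> powi pr D \<alpha> \<beta>"
  by (simp only: qd_powi dsym)

lemma rank2:
  assumes "\<alpha> \<in> simples D" "\<beta> \<in> simples D" "\<alpha> \<noteq> \<beta>"
  shows "rank2 (x \<alpha>) (E \<alpha>) (Fo \<alpha>) (K \<alpha>) (L \<alpha>) (x \<beta>) (E \<beta>) (Fo \<beta>) (K \<beta>) (L \<beta>) UNIV (pr D \<beta> \<alpha>) (pr D \<alpha> \<beta>)"
    "rank2 (x \<alpha>) (Fo \<alpha>) (E \<alpha>) (L \<alpha>) (K \<alpha>) (x \<beta>) (Fo \<beta>) (E \<beta>) (L \<beta>) (K \<beta>) UNIV (pr D \<beta> \<alpha>) (pr D \<alpha> \<beta>)"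
  using rank1[OF assms(1)] rank1[OF assms(2)] rank1'[OF assms(1)] rank1'[OF assms(2)] assms
  by (simp_all only: rank2_def rank2_axioms_def sym_x pr_nonpos K_F L_E E_F E_F[OF not_sym]
      simp_thms UNIV_I not_False_eq_True)

lemma serre_F_E:
  assumes "\<alpha> \<in> simples D" "\<beta> \<in> simples D" "\<alpha> \<noteq> \<beta>"
  shows "E \<gamma> (serre_op (x \<alpha>) (nat (1 - pr D \<beta> \<alpha>)) (Fo \<alpha>) (Fo \<beta>) y)
    = serre_op (x \<alpha>) (nat (1 - pr D \<beta> \<alpha>)) (Fo \<alpha>) (Fo \<beta>) (E \<gamma> y)"
proof -
  interpret r: rank2 "x \<alpha>" "E \<alpha>" "Fo \<alpha>" "K \<alpha>" "L \<alpha>" "x \<beta>" "E \<beta>" "Fo \<beta>" "K \<beta>" "L \<beta>" UNIV "pr D \<beta> \<alpha>" "pr D \<alpha> \<beta>"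
    by (rule rank2(1)[OF assms])
  consider "\<gamma> = \<alpha>" | "\<gamma> = \<beta>" | "\<gamma> \<noteq> \<alpha>" "\<gamma> \<noteq> \<beta>" by blast
  then show ?thesis
  proof cases
    case 1 then show ?thesis using r.serre_e[of y] by (simp only: r.N_def UNIV_I simp_thms)
  next
    case 2 then show ?thesis using r.serre_e'[of y] by (simp only: r.N_def UNIV_I simp_thms)
  next
    case 3 show ?thesis
      by (rule serre_op_commute[where C = UNIV]) (simp_all only: linop_vop UNIV_I E_F[OF 3(1)] E_F[OF 3(2)])
  qed
qed

lemma serre_E_F:
  assumes "\<alpha> \<in> simples D" "\<beta> \<in> simples D" "\<alpha> \<noteq> \<beta>"
  shows "Fo \<gamma> (serre_op (x \<alpha>) (nat (1 - pr D \<beta> \<alpha>)) (E \<alpha>) (E \<beta>) y)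
    = serre_op (x \<alpha>) (nat (1 - pr D \<beta> \<alpha>)) (E \<alpha>) (E \<beta>) (Fo \<gamma> y)"
proof -
  interpret r: rank2 "x \<alpha>" "Fo \<alpha>" "E \<alpha>" "L \<alpha>" "K \<alpha>" "x \<beta>" "Fo \<beta>" "E \<beta>" "L \<beta>" "K \<beta>" UNIV "pr D \<beta> \<alpha>" "pr D \<alpha> \<beta>"
    by (rule rank2(2)[OF assms])
  consider "\<gamma> = \<alpha>" | "\<gamma> = \<beta>" | "\<gamma> \<noteq> \<alpha>" "\<gamma> \<noteq> \<beta>" by blast
  then show ?thesis
  proof cases
    case 1 then show ?thesis using r.serre_e[of y] by (simp only: r.N_def UNIV_I simp_thms)
  next
    case 2 then show ?thesis using r.serre_e'[of y] by (simp only: r.N_def UNIV_I simp_thms)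
  next
    case 3 show ?thesis
      by (rule serre_op_commute[where C = UNIV])
        (simp_all only: linop_vop UNIV_I E_F[OF 3(1)[symmetric]] E_F[OF 3(2)[symmetric]])
  qed
qed

lemma F_Nil: "Fo \<alpha> y [] = 0" by simp

lemma dpow_F_Nil: "n > 0 ==> dpow c (Fo \<alpha>) n y [] = 0"
  by (cases n) (simp_all add: dpow_def fun_app)

text \<open>At a word that ends with \<open>\<gamma>\<close> the value is computed by first applying \<open>e\<^sub>\<gamma>\<close>, which commutes with the Serre
element; at the empty word all \<open>f\<close>'s give zero.\<close>

lemma serre_F_zero:
  assumes "\<alpha> \<in> simples D" "\<beta> \<in> simples D" "\<alpha> \<noteq> \<beta>"
  shows "serre_op (x \<alpha>) (nat (1 - pr D \<beta> \<alpha>)) (Fo \<alpha>) (Fo \<beta>) y = 0" (is "?S y = 0")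
proof
  fix w show "?S y w = 0 w"
  proof (induction w arbitrary: y rule: rev_induct)
    case Nil
    have "dpow (x \<alpha>) (Fo \<alpha>) n (Fo \<beta> z) [] = 0" for n z
      using dpow_F_Nil[of n] F_Nil[of \<beta> z] by (cases "n = 0") simp_all
    then show ?case by (simp add: serre_op_def fun_app del: vop.simps)
  next
    case (snoc \<gamma> w)
    have "?S y (w @ [\<gamma>]) = E \<gamma> (?S y) w" by simp
    also have "\<dots> = ?S (E \<gamma> y) w" by (simp only: serre_F_E[OF assms])
    finally show ?case using snoc by (simp add: fun_app)
  qed
qed

lemma E_hwv: "E \<alpha> hwv = 0"
  by (simp add: fun_eq_iff hwv_def fun_app)

lemma K_hwv: "K \<alpha> hwv = sca (x \<alpha> powi pr D \<nu> \<alpha>) hwv" "L \<alpha> hwv = sca (x \<alpha> powi - pr D \<nu> \<alpha>) hwv"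
  by (simp_all add: fun_eq_iff hwv_def fun_app)

lemma serre_E_hwv:
  assumes "\<alpha> \<in> simples D" "\<beta> \<in> simples D"
  shows "serre_op c N (E \<alpha>) (E \<beta>) hwv = 0"
proof -
  have 1: "dpow c (E \<alpha>) s hwv = 0" if "s > 0" for s
    using that by (cases s) (simp_all only: dpow_def funpow_Suc_right comp_apply E_hwv
      linop_0[OF linop_funpow[OF linop_vop]] sca_simps)
  have "dpow c (E \<alpha>) n (E \<beta> (dpow c (E \<alpha>) s hwv)) = 0" for n s
    using 1[of s] by (cases "s = 0")
      (simp_all only: dpow_0 E_hwv linop_0[OF linop_vop] linop_0[OF linop_dpow[OF linop_vop]])
  then show ?thesis by (simp add: serre_op_def)
qed

text \<open>The Serre element in the \<open>e\<close>'s kills the generator and commutes with the \<open>f\<close>'s.\<close>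

lemma serre_E_zero:
  assumes "\<alpha> \<in> simples D" "\<beta> \<in> simples D" "\<alpha> \<noteq> \<beta>" and y: "y \<in> hwmod D \<nu>"
  shows "serre_op (x \<alpha>) (nat (1 - pr D \<beta> \<alpha>)) (E \<alpha>) (E \<beta>) y = 0"
  using y
proof (induction rule: hwmod.induct)
  case hwv show ?case by (rule serre_E_hwv[OF assms(1,2)])
next
  case (add y z) then show ?case by (simp only: linop_add[OF linop_serre_op[OF linop_vop linop_vop]] add_0)
next
  case (sca y c) then show ?case by (simp only: linop_sca[OF linop_serre_op[OF linop_vop linop_vop]] sca_simps)
next
  case (low \<gamma> y) then show ?case by (simp only: serre_E_F[OF assms(1-3), symmetric] linop_0[OF linop_vop])
qed

lemma hwmod_0: "0 \<in> hwmod D \<nu>"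
  using hwmod.sca[OF hwmod.hwv, where c = 0] by simp

lemma hwmod_diff: "y \<in> hwmod D \<nu> ==> z \<in> hwmod D \<nu> ==> y - z \<in> hwmod D \<nu>"
  using hwmod.add[of y D \<nu> "sca (-1) z"] hwmod.sca[of z D \<nu>, where c = "-1"] by (simp add: sca_rules)

lemma hwmod_K: "\<alpha> \<in> simples D ==> y \<in> hwmod D \<nu> ==> K \<alpha> y \<in> hwmod D \<nu> \<and> L \<alpha> y \<in> hwmod D \<nu>"
  apply (rotate_tac 1)
  apply (induction rule: hwmod.induct)
  by (simp_all only: K_hwv linop_add[OF linop_vop] linop_sca[OF linop_vop] K_F L_F
      hwmod.intros simp_thms)

lemma hwmod_E: assumes \<alpha>: "\<alpha> \<in> simples D" and y: "y \<in> hwmod D \<nu>" shows "E \<alpha> y \<in> hwmod D \<nu>"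
  using y
proof (induction rule: hwmod.induct)
  case (low \<beta> y)
  show ?case
  proof (cases "\<alpha> = \<beta>")
    case True
    show ?thesis using low hwmod_K[OF \<alpha> low.hyps(2)] unfolding True
      by (simp only: E_F_self hwmod.intros hwmod_diff)
  next
    case False
    then show ?thesis using low by (simp only: E_F[OF False] hwmod.intros)
  qed
qed (simp_all only: E_hwv hwmod_0 linop_add[OF linop_vop] linop_sca[OF linop_vop] hwmod.intros)

sublocale V: qrep D "vop D \<nu>" "hwmod D \<nu>"
proof
  fix x y assume "x \<in> qgens D" "y \<in> hwmod D \<nu>"
  then show "vop D \<nu> x y \<in> hwmod D \<nu>"
    using hwmod_E hwmod_K hwmod.low by (auto simp: qgens_def simp del: vop.simps)
qed (rule linop_vop hwmod_0 hwmod.add hwmod.sca; assumption?)+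

lemma qrels_zero:
  assumes "r \<in> qrels D" "y \<in> hwmod D \<nu>" shows "V.ac r y = 0"
proof -
  have kl: "V.ac (fgen D a) (V.ac (fgen D b) y) = V.ac (fgen D b) (V.ac (fgen D a) y)"
    if "a \<in> GK ` simples D \<union> GL ` simples D" "b \<in> GK ` simples D \<union> GL ` simples D" for a b y
    using that by (auto simp: V.act_fgen V.gens K_K simp del: vop.simps)
  have q: "qv powi (int (dnum D \<alpha>) * n) = x \<alpha> powi n" for \<alpha> n by (simp only: qd_powi)
  have q': "inverse (qv powi (int (dnum D \<alpha>) * n)) = x \<alpha> powi - n" for \<alpha> n by (simp only: qd_powi power_int_minus)
  have q1: "qv powi int (dnum D \<alpha>) - qv powi - int (dnum D \<alpha>) = x \<alpha> - inverse (x \<alpha>)" for \<alpha>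
    by (simp only: qd_def power_int_minus)
  show ?thesis
    using assms(1) unfolding qrels_def Let_def
    apply (elim UnE; elim CollectE exE conjE)
    subgoal premises p for a b unfolding p(2) using kl[OF p(3,4), of y] by (simp add: V.act_minus V.act_mult)
    subgoal by (simp add: V.act_minus V.act_mult V.act_fgen V.gens V.act_one K_L del: vop.simps)
    subgoal for \<alpha> \<beta> by (simp add: V.act_minus V.act_mult V.act_fgen V.gens V.act_fscal K_E K_L q del: vop.simps)
    subgoal for \<alpha> \<beta> by (simp add: V.act_minus V.act_mult V.act_fgen V.gens V.act_fscal K_F K_L q' del: vop.simps)
    subgoal for \<alpha> \<beta> by (simp add: V.act_minus V.act_mult V.act_fgen V.gens E_F del: vop.simps)
    subgoal premises p for \<alpha> unfolding p(2) q1
      using p(3) by (simp add: V.act_minus V.act_mult V.act_fgen V.gens V.act_fscal E_F_self del: vop.simps)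
    subgoal for g \<alpha> \<beta> using assms(2) by (auto simp: V.act_serre serre_E_zero serre_F_zero simp del: vop.simps)
    done
qed

lemma qideal_act: "f \<in> qideal D ==> y \<in> hwmod D \<nu> ==> V.ac f y = 0"
  by (rule V.qideal_zero[OF qrels_zero])

end

section \<open>The integral form\<close>

lemma (in free_rep) act_fkbin:
  assumes "rank1 (qd (dnum D \<alpha>)) (op (GE \<alpha>)) (op (GF \<alpha>)) (op (GK \<alpha>)) (op (GL \<alpha>)) C"
    and \<alpha>: "\<alpha> \<in> simples D" and "\<psi> \<in> C"
  shows "ac (fkbin D \<alpha> m) \<psi> = rank1.hop (qd (dnum D \<alpha>)) (op (GK \<alpha>)) (op (GL \<alpha>)) 0 m \<psi>"
proof -
  let ?x = "qd (dnum D \<alpha>)"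
  interpret r: rank1 ?x "op (GE \<alpha>)" "op (GF \<alpha>)" "op (GK \<alpha>)" "op (GL \<alpha>)" C by fact
  show ?thesis using assms(3)
  proof (induction m arbitrary: \<psi>)
    case 0 then show ?case by (simp add: act_one)
  next
    case (Suc m)
    let ?s = "int (Suc m)" and ?d = "int (dnum D \<alpha>)"
    let ?c = "1 / (?x powi ?s - ?x powi - ?s)"
    have e: "qv powi (?d * ?s) = ?x powi ?s" "qv powi (- (?d * ?s)) = ?x powi - ?s"
      "qv powi (?d * (1 - ?s)) = ?x powi (0 - int m)" "qv powi (?d * (?s - 1)) = ?x powi - (0 - int m)"
      unfolding qd_powi by (simp_all add: algebra_simps)
    have D: "?x - inverse ?x \<noteq> 0" by (rule generic_diff[OF r.gen])
    have R: "qnum ?x ?s \<noteq> 0" by (rule qnum_nz[OF r.gen]) simp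
    have "1 / qnum ?x ?s * (1 / (?x - inverse ?x)) = ?c"
      using D R by (simp add: qnum_def)
    then have k: "sca (1 / qnum ?x ?s) (r.kap (0 - int m) \<psi>)
       = sca (?c * ?x powi (0 - int m)) (op (GK \<alpha>) \<psi>) - sca (?c * ?x powi - (0 - int m)) (op (GL \<alpha>) \<psi>)"
      unfolding r.kap_def sca_simps(1) sca_rules(2) by (simp only: mult.assoc[symmetric])
    have C': "sca (1 / qnum ?x ?s) (r.kap (0 - int m) \<psi>) \<in> C"
      by (rule r.C(2)[OF r.kap_C[OF Suc.prems]])
    have "ac (fkbin D \<alpha> (Suc m)) \<psi> = ac (fkbin D \<alpha> m) (sca (1 / qnum ?x ?s) (r.kap (0 - int m) \<psi>))"
      unfolding fkbin.simps Let_def e k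
      by (simp add: act_mult act_minus act_fscal act_fgen gens[OF \<alpha>] del: of_nat_Suc)
    then show ?case unfolding Suc.IH[OF C'] by (simp only: r.hop.simps)
  qed
qed

context free_alg
begin

lemma UQ_eq: "UQ D = Fr Quot qideal D"
  by (simp add: UQ_def)

sublocale UQ: ring "UQ D"
  unfolding UQ_eq by (rule I.quotient_is_ring)

lemma qcls_hom: "qcls D \<in> ring_hom Fr (UQ D)"
  unfolding UQ_eq qcls_def[abs_def] by (rule I.rcos_ring_hom)

sublocale q: ring_hom_ring Fr "UQ D" "qcls D"
  by (rule ring_hom_ringI2[OF F.ring_axioms UQ.ring_axioms qcls_hom])

lemma qcls_eq_iff:
  assumes "f \<in> carrier Fr" "h \<in> carrier Fr"
  shows "qcls D f = qcls D h \<longleftrightarrow> f \<ominus>\<^bsub>Fr\<^esub> h \<in> qideal D"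
  unfolding qcls_def using assms
  by (metis F.quotient_eq_iff_same_a_r_cos I.is_ideal)

lemma UQ_ex: "u \<in> carrier (UQ D) ==> \<exists>f\<in>carrier Fr. u = qcls D f"
  by (auto simp: UQ_eq FactRing_def A_RCOSETS_def' qcls_def)

text \<open>A common frame for Lusztig's form and for its torus part.\<close>

definition form :: "'v qfree set => 'v qfree set ring" where
  "form S = (UQ D)\<lparr>carrier := generate_ring (UQ D) (qscal D ` carrier Laurent \<union> qcls D ` S)\<rparr>"

lemma UZ_form: "UZ D = form (U_gens D)" and UZ0_form: "UZ0 D = form (U0_gens D)"
  by (simp_all add: UZ_def UZ0_def form_def)

lemma qscal_closed [simp]: "qscal D c \<in> carrier (UQ D)"
  by (simp add: qscal_def)

lemma form_simps [simp]:
  "u \<otimes>\<^bsub>form S\<^esub> w = u \<otimes>\<^bsub>UQ D\<^esub> w" "u \<oplus>\<^bsub>form S\<^esub> w = u \<oplus>\<^bsub>UQ D\<^esub> w"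
  "\<one>\<^bsub>form S\<^esub> = \<one>\<^bsub>UQ D\<^esub>" "\<zero>\<^bsub>form S\<^esub> = \<zero>\<^bsub>UQ D\<^esub>"
  by (simp_all add: form_def)

lemma form_gens: "S \<subseteq> carrier Fr ==> qscal D ` carrier Laurent \<union> qcls D ` S \<subseteq> carrier (UQ D)"
  by auto

lemma form_closed: "S \<subseteq> carrier Fr ==> u \<in> carrier (form S) ==> u \<in> carrier (UQ D)"
  using UQ.generate_ring_in_carrier[OF form_gens] by (auto simp: form_def)

lemma form_ring: "S \<subseteq> carrier Fr ==> ring (form S)"
  unfolding form_def by (rule UQ.generate_ring_is_ring[OF form_gens])

lemma form_incl: "s \<in> S ==> qcls D s \<in> carrier (form S)"
  and form_scal: "c \<in> carrier Laurent ==> qscal D c \<in> carrier (form S)"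
  by (auto simp: form_def intro!: generate_ring.incl)

lemma qscal_hom: "qscal D \<in> ring_hom Laurent (UQ D)"
  by (rule ring_hom_memI)
    (simp_all add: qscal_def fscal_add[symmetric] fscal_mult[symmetric] fscal_one)

lemma qscal_form_hom: "qscal D \<in> ring_hom Laurent (form S)"
  using qscal_hom form_scal by (auto simp: ring_hom_def)

lemma qscal_central:
  assumes "u \<in> carrier (UQ D)" shows "qscal D c \<otimes>\<^bsub>UQ D\<^esub> u = u \<otimes>\<^bsub>UQ D\<^esub> qscal D c"
proof -
  obtain f where f: "f \<in> carrier Fr" "u = qcls D f" using UQ_ex[OF assms] by blast
  have "qcls D (fscal D c \<otimes>\<^bsub>Fr\<^esub> f) = qcls D (f \<otimes>\<^bsub>Fr\<^esub> fscal D c)" by (simp only: fscal_central[OF f(1)])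
  then show ?thesis using f by (simp add: qscal_def)
qed

lemma form_induct [consumes 2, case_names scal incl add mult]:
  assumes u: "u \<in> carrier (form S)" and S: "S \<subseteq> carrier Fr"
    and scal: "\<And>c. c \<in> carrier Laurent ==> P (qscal D c)" and incl: "\<And>s. s \<in> S ==> P (qcls D s)"
    and add: "\<And>u w. u \<in> carrier (form S) ==> w \<in> carrier (form S) ==> P u ==> P w ==> P (u \<oplus>\<^bsub>UQ D\<^esub> w)"
    and mult: "\<And>u w. u \<in> carrier (form S) ==> w \<in> carrier (form S) ==> P u ==> P w ==> P (u \<otimes>\<^bsub>UQ D\<^esub> w)"
  shows "P u"
proof -
  let ?H = "qscal D ` carrier Laurent \<union> qcls D ` S"
  have "u \<in> generate_ring (UQ D) ?H" using u by (simp add: form_def)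
  then show ?thesis
  proof (induction rule: generate_ring.induct)
    case one
    have "\<one>\<^bsub>UQ D\<^esub> = qscal D 1" by (simp add: qscal_def fscal_one)
    then show ?case using scal[OF Laurent_closed(2)] by simp
  next
    case (a_inv h)
    have h: "h \<in> carrier (UQ D)" using a_inv.hyps form_closed[OF S] by (simp add: form_def)
    have "qscal D (-1) \<oplus>\<^bsub>UQ D\<^esub> qscal D 1 = qscal D 0"
      unfolding qscal_def q.hom_add[OF fscal_closed fscal_closed, symmetric] fscal_add by simp
    moreover have "qscal D 0 = \<zero>\<^bsub>UQ D\<^esub>" using qscal_hom ring_hom_zero[OF qscal_hom cring.axioms(1)[OF Laurent_cring] UQ.ring_axioms] by simp
    moreover have "qscal D 1 = \<one>\<^bsub>UQ D\<^esub>" by (simp add: qscal_def fscal_one)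
    ultimately have "qscal D (-1) = \<ominus>\<^bsub>UQ D\<^esub> \<one>\<^bsub>UQ D\<^esub>" using UQ.minus_equality by simp
    then have "\<ominus>\<^bsub>UQ D\<^esub> h = qscal D (-1) \<otimes>\<^bsub>UQ D\<^esub> h" using h by (simp add: UQ.l_minus)
    then show ?case
      using mult[of "qscal D (-1)" h] scal[of "-1"] a_inv form_scal[of "-1" S] Laurent_closed(2,6)
      by (simp add: form_def)
  qed (use scal incl add mult in \<open>auto simp: form_def\<close>)
qed

lemma U_gens_closed: "U_gens D \<subseteq> carrier Fr" and U0_gens_closed: "U0_gens D \<subseteq> carrier Fr"
  by (auto simp: U_gens_def U0_gens_def)

lemma fdiv_U_gens: "g \<in> {GE, GF} ==> \<alpha> \<in> simples D ==> fdiv D g \<alpha> n \<in> U_gens D"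
  unfolding U_gens_def by blast

definition BZ :: "'v qfree set" where
  "BZ = {f \<in> carrier Fr. qcls D f \<in> carrier (UZ D)}"

lemma BZ_closed:
  "f \<in> BZ ==> h \<in> BZ ==> f \<oplus>\<^bsub>Fr\<^esub> h \<in> BZ"
  "f \<in> BZ ==> h \<in> BZ ==> f \<otimes>\<^bsub>Fr\<^esub> h \<in> BZ"
  "c \<in> carrier Laurent ==> fscal D c \<in> BZ"
  "s \<in> U_gens D ==> s \<in> BZ"
proof -
  interpret UZ: ring "form (U_gens D)" by (rule form_ring[OF U_gens_closed])
  show "f \<in> BZ ==> h \<in> BZ ==> f \<oplus>\<^bsub>Fr\<^esub> h \<in> BZ" "f \<in> BZ ==> h \<in> BZ ==> f \<otimes>\<^bsub>Fr\<^esub> h \<in> BZ"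
    using UZ.a_closed UZ.m_closed by (auto simp: BZ_def UZ_form)
  show "c \<in> carrier Laurent ==> fscal D c \<in> BZ"
    using form_scal[of c "U_gens D"] by (simp add: BZ_def UZ_form qscal_def)
  show "s \<in> U_gens D ==> s \<in> BZ"
    using form_incl[of s "U_gens D"] U_gens_closed by (auto simp: BZ_def UZ_form)
qed

lemma BZ_carrier: "f \<in> BZ ==> f \<in> carrier Fr"
  by (simp add: BZ_def)

subsection \<open>Linear functionals vanishing on the defining ideal\<close>

text \<open>Equality in the quantum group is tested on the functionals on the free algebra that vanish on the defining ideal
(\<open>Dual\<close>). There a generator acts by appending a letter, which makes the operator calculus applicable.\<close>

definition dop :: "'v qgen => ('v qgen list => qrat) => ('v qgen list => qrat)" where
  "dop g \<psi> = (\<lambda>w. \<psi> (w @ [g]))"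

definition Dual :: "('v qgen list => qrat) set" where
  "Dual = {\<psi>. (\<forall>w. w \<notin> lists (qgens D) \<longrightarrow> \<psi> w = 0) \<and> (\<forall>f\<in>qideal D. MG.pairing \<psi> f = 0)}"

lemma foldr_dop: "foldr dop u \<psi> w = \<psi> (w @ u)"
  by (induction u arbitrary: w) (simp_all add: dop_def)

lemma dop_rep: "free_rep D dop"
  by unfold_locales (simp add: linop_def dop_def fun_eq_iff fun_app)

interpretation dr: free_rep D dop by (rule dop_rep)

lemma act_dop: "dr.ac f \<psi> w = MG.pairing (\<lambda>u. \<psi> (w @ u)) f"
  by (simp add: act_def foldr_dop)

lemma word_closed: "MG.sg w (c::qrat) \<in> carrier Fr"
  unfolding Free_eq by (rule MG.single_closed)

lemma Dual_rep: "qrep D dop Dual"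
proof
  show "0 \<in> Dual" by (simp add: Dual_def MG.pairing_lin fun_app zero_fun_def)
  show "y + z \<in> Dual" if "y \<in> Dual" "z \<in> Dual" for y z
    using that by (simp add: Dual_def MG.pairing_lin fun_app plus_fun_def)
  show "sca c y \<in> Dual" if "y \<in> Dual" for c y
    using that by (simp add: Dual_def MG.pairing_lin sca_def)
  show "dop g \<psi> \<in> Dual" if g: "g \<in> qgens D" and \<psi>: "\<psi> \<in> Dual" for g \<psi>
  proof -
    have "MG.pairing (dop g \<psi>) f = 0" if f: "f \<in> qideal D" for f
    proof -
      have fc: "f \<in> carrier Fr" using f I.a_subset by blast
      have "f \<otimes>\<^bsub>Fr\<^esub> fgen D g \<in> qideal D" using f by (rule I.I_r_closed) simp
      then have "MG.pairing \<psi> (f \<otimes>\<^bsub>Fr\<^esub> fgen D g) = 0" using \<psi> by (simp add: Dual_def)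
      moreover have "MG.pairing \<psi> (f \<otimes>\<^bsub>Fr\<^esub> fgen D g) = MG.pairing (dop g \<psi>) f"
        using fc g by (simp add: fgen_def Free_eq Qv_type_ring MG.pairing_mult MG.pairing_single MG.single_closed dop_def)
      ultimately show ?thesis by simp
    qed
    then show ?thesis using \<psi> by (auto simp: Dual_def dop_def)
  qed
qed

interpretation dq: qrep D dop Dual by (rule Dual_rep)

lemma Dual_qideal:
  assumes f: "f \<in> qideal D" and \<psi>: "\<psi> \<in> Dual" shows "dr.ac f \<psi> = 0"
proof
  fix w
  have fc: "f \<in> carrier Fr" using f I.a_subset by blast
  show "dr.ac f \<psi> w = 0 w"
  proof (cases "w \<in> lists (qgens D)")
    case True
    have "MG.sg w 1 \<otimes>\<^bsub>Fr\<^esub> f \<in> qideal D" using f by (rule I.I_l_closed) (rule word_closed)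
    then have "MG.pairing \<psi> (MG.sg w 1 \<otimes>\<^bsub>Fr\<^esub> f) = 0" using \<psi> by (simp add: Dual_def)
    moreover have "MG.pairing \<psi> (MG.sg w 1 \<otimes>\<^bsub>Fr\<^esub> f) = MG.pairing (\<lambda>u. \<psi> (w @ u)) f"
      using fc True by (simp add: Free_eq MG.pairing_mult MG.pairing_single MG.single_closed)
    ultimately show ?thesis by (simp add: act_dop fun_app)
  next
    case False
    then have "\<psi> (w @ u) = 0" for u using \<psi> by (auto simp: Dual_def)
    then show ?thesis by (simp add: act_dop MG.pairing_lin fun_app)
  qed
qed

text \<open>An element outside of the ideal is detected by a functional, extended from a basis of the ideal.\<close>

lemma Dual_separates:
  assumes h: "h \<in> carrier Fr" and z: "\<And>\<psi>. \<psi> \<in> Dual ==> dr.ac h \<psi> = 0"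
  shows "h \<in> qideal D"
proof (rule ccontr)
  assume nh: "h \<notin> qideal D"
  interpret vp: vector_space_pair "sca :: qrat => ('v qgen list => qrat) => _" "(*) :: qrat => qrat => qrat"
    by unfold_locales (simp_all add: sca_rules algebra_simps)
  define e where "e f = (\<lambda>w. if w \<in> lists (qgens D) then f w else 0 :: qrat)" for f
  have e_add: "e (f \<oplus>\<^bsub>Fr\<^esub> h) = e f + e h" for f h
    by (rule ext) (simp add: e_def Free_eq MG.MR_add_apply plus_fun_apply)
  have e_sca: "e (fscal D c \<otimes>\<^bsub>Fr\<^esub> f) = sca c (e f)" if f: "f \<in> carrier Fr" for c f
  proof
    fix w
    show "e (fscal D c \<otimes>\<^bsub>Fr\<^esub> f) w = sca c (e f) w"
    proof (cases "w \<in> lists (qgens D)")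
      case True
      have p: "g w = MG.pairing (\<lambda>u. if u = w then 1 else 0) g" if g: "g \<in> carrier Fr" for g
      proof -
        have fin: "finite (MG.supp g)" using g by (simp add: Free_eq MG.carrier_MR)
        have "MG.pairing (\<lambda>u. if u = w then 1 else 0) g = (\<Sum>u\<in>MG.supp g. if u = w then g u else 0)"
          unfolding MG.pairing_def by (rule sum.cong) auto
        also have "\<dots> = g w" using fin True by (simp add: sum.delta MG.supp_def)
        finally show ?thesis by simp
      qed
      have "(fscal D c \<otimes>\<^bsub>Fr\<^esub> f) w = c * f w"
        unfolding p[OF F.m_closed[OF fscal_closed f]] p[OF f]
        using f by (simp add: fscal_def Free_eq Qv_type_ring MG.pairing_mult MG.pairing_single MG.single_closed)
      then show ?thesis using True by (simp add: e_def sca_apply)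
    qed (simp add: e_def sca_apply)
  qed
  have e_inj: "f = g" if "f \<in> carrier Fr" "g \<in> carrier Fr" "e f = e g" for f g
  proof (rule extensionalityI[where A = "carrier G"])
    show "f \<in> extensional (carrier G)" "g \<in> extensional (carrier G)"
      using that by (simp_all add: Free_eq MG.carrier_MR)
    show "f w = g w" if "w \<in> carrier G" for w
      using fun_cong[OF \<open>e f = e g\<close>, of w] that by (simp add: e_def)
  qed
  let ?J = "e ` qideal D"
  have sub: "vp.vs1.subspace ?J"
  proof (rule vp.vs1.subspaceI)
    have "e \<zero>\<^bsub>Fr\<^esub> = 0" by (simp add: e_def Free_eq MG.MR_zero_apply fun_eq_iff fun_app)
    then show "0 \<in> ?J" using I.zero_closed by (metis image_eqI)
    show "x + y \<in> ?J" if "x \<in> ?J" "y \<in> ?J" for x y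
      using that e_add I.a_closed by (metis (no_types, lifting) image_iff)
    show "sca c x \<in> ?J" if x: "x \<in> ?J" for c x
    proof -
      obtain f where f: "f \<in> qideal D" "x = e f" using x by blast
      then have "fscal D c \<otimes>\<^bsub>Fr\<^esub> f \<in> qideal D" by (intro I.I_l_closed) simp_all
      moreover have "f \<in> carrier Fr" using f I.a_subset by blast
      ultimately show ?thesis using f e_sca by (metis image_eqI)
    qed
  qed
  have nhJ: "e h \<notin> ?J"
  proof
    assume "e h \<in> ?J"
    then obtain f where "f \<in> qideal D" "e h = e f" by blast
    then show False using e_inj[OF h, of f] I.a_subset nh by blast
  qed
  obtain B where B: "B \<subseteq> ?J" "\<not> vp.vs1.dependent B" "vp.vs1.span B = ?J"
    using sub by (metis vp.vs1.basis_exists vp.vs1.span_subspace)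
  then have "\<not> vp.vs1.dependent (insert (e h) B)" using nhJ by (simp add: vp.vs1.independent_insert)
  from vp.linear_independent_extend[OF this, of "\<lambda>b. if b = e h then 1 else 0"]
  obtain g where g: "Vector_Spaces.linear sca (*) g" "\<And>b. b \<in> insert (e h) B ==> g b = (if b = e h then 1 else 0)"
    by blast
  interpret g: Vector_Spaces.linear sca "(*)" g by (rule g(1))
  have gB: "g b = 0" if "b \<in> B" for b using g(2)[of b] that nhJ B(1) by auto
  have gJ: "g b = 0" if "b \<in> ?J" for b
    by (rule vp.linear_eq_0_on_span[OF g(1) gB]) (use that B(3) in auto)
  define \<psi> where "\<psi> w = (if w \<in> lists (qgens D) then g (\<lambda>u. if u = w then 1 else 0) else 0)" for w
  have pair: "MG.pairing \<psi> f = g (e f)" if f: "f \<in> carrier Fr" for f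
  proof -
    have fin: "finite (MG.supp f)" using f by (simp add: Free_eq MG.carrier_MR)
    have "e f = (\<Sum>w\<in>MG.supp f. sca (f w) (\<lambda>u. if u = w then 1 else 0))"
    proof
      fix u
      have "(\<Sum>w\<in>MG.supp f. sca (f w) (\<lambda>u. if u = w then 1 else 0)) u = (\<Sum>w\<in>MG.supp f. if u = w then f w else 0)"
        unfolding sum_fun_apply by (rule sum.cong) (simp_all add: sca_apply)
      also have "\<dots> = e f u" using fin by (simp add: sum.delta' e_def MG.supp_def)
      finally show "e f u = (\<Sum>w\<in>MG.supp f. sca (f w) (\<lambda>u. if u = w then 1 else 0)) u" by simp
    qed
    then have "g (e f) = (\<Sum>w\<in>MG.supp f. f w * g (\<lambda>u. if u = w then 1 else 0))"
      by (simp only: g.sum g.scale)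
    also have "\<dots> = MG.pairing \<psi> f"
      unfolding MG.pairing_def by (rule sum.cong) (auto simp: \<psi>_def MG.supp_def)
    finally show ?thesis by simp
  qed
  have "\<psi> \<in> Dual"
    using gJ pair I.a_subset by (auto simp: Dual_def \<psi>_def)
  from z[OF this] have "MG.pairing \<psi> h = 0"
    using act_dop[of h \<psi> "[]"] by (simp add: fun_app)
  then show False using pair[OF h] g(2)[of "e h"] by simp
qed

subsection \<open>Torus binomials are integral\<close>

lemma qrels_Dual: "r \<in> qrels D ==> \<psi> \<in> Dual ==> dr.ac r \<psi> = 0"
  using Dual_qideal F.genideal_self[OF qrels_closed] by (auto simp: qideal_def)

lemma Dual_rank1:
  assumes \<alpha>: "\<alpha> \<in> simples D"
  shows "rank1 (qd (dnum D \<alpha>)) (dop (GE \<alpha>)) (dop (GF \<alpha>)) (dop (GK \<alpha>)) (dop (GL \<alpha>)) Dual"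
proof
  let ?x = "qd (dnum D \<alpha>)"
  note s = dr.act_minus dr.act_mult dr.act_fgen dr.gens[OF \<alpha>] dr.act_fscal dr.act_one
  have xk: "qv powi (int (dnum D \<alpha>) * pr D \<alpha> \<alpha>) = ?x powi 2"
    using pr_self[OF \<alpha>] by (simp only: qd_powi)
  show "generic ?x" by (rule generic_qd[OF dnum_pos[OF \<alpha>]])
  fix y z :: "'v qgen list => qrat" assume y: "y \<in> Dual"
  show kl: "dop (GK \<alpha>) (dop (GL \<alpha>) y) = y" if y: "y \<in> Dual" for y
  proof -
    have "fK D \<alpha> \<otimes>\<^bsub>Fr\<^esub> fL D \<alpha> \<ominus>\<^bsub>Fr\<^esub> \<one>\<^bsub>Fr\<^esub> \<in> qrels D"
      unfolding qrels_def Let_def using \<alpha> by blast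
    from qrels_Dual[OF this y] show ?thesis by (simp add: s)
  qed
  show lk: "dop (GL \<alpha>) (dop (GK \<alpha>) y) = y" if y: "y \<in> Dual" for y
  proof -
    have "fgen D (GK \<alpha>) \<otimes>\<^bsub>Fr\<^esub> fgen D (GL \<alpha>) \<ominus>\<^bsub>Fr\<^esub> fgen D (GL \<alpha>) \<otimes>\<^bsub>Fr\<^esub> fgen D (GK \<alpha>) \<in> qrels D"
      unfolding qrels_def Let_def using \<alpha> by blast
    from qrels_Dual[OF this y] show ?thesis by (simp add: s kl[OF y])
  qed
  have K: "dop (GK \<alpha>) y \<in> Dual" by (rule dq.Cop[OF dr.gens(3)[OF \<alpha>] y])
  show "dop (GK \<alpha>) (dop (GE \<alpha>) y) = sca (?x powi 2) (dop (GE \<alpha>) (dop (GK \<alpha>) y))"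
  proof -
    have "fK D \<alpha> \<otimes>\<^bsub>Fr\<^esub> fgen D (GE \<alpha>) \<otimes>\<^bsub>Fr\<^esub> fL D \<alpha>
         \<ominus>\<^bsub>Fr\<^esub> fscal D (qv powi (int (dnum D \<alpha>) * pr D \<alpha> \<alpha>)) \<otimes>\<^bsub>Fr\<^esub> fgen D (GE \<alpha>) \<in> qrels D"
      unfolding qrels_def Let_def using \<alpha> by blast
    from qrels_Dual[OF this K] show ?thesis by (simp add: s xk lk[OF y])
  qed
  show "dop (GK \<alpha>) (dop (GF \<alpha>) y) = sca (?x powi - 2) (dop (GF \<alpha>) (dop (GK \<alpha>) y))"
  proof -
    have "fK D \<alpha> \<otimes>\<^bsub>Fr\<^esub> fgen D (GF \<alpha>) \<otimes>\<^bsub>Fr\<^esub> fL D \<alpha>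
         \<ominus>\<^bsub>Fr\<^esub> fscal D (inverse (qv powi (int (dnum D \<alpha>) * pr D \<alpha> \<alpha>))) \<otimes>\<^bsub>Fr\<^esub> fgen D (GF \<alpha>) \<in> qrels D"
      unfolding qrels_def Let_def using \<alpha> by blast
    from qrels_Dual[OF this K] show ?thesis by (simp add: s xk lk[OF y] power_int_minus)
  qed
  show "dop (GE \<alpha>) (dop (GF \<alpha>) y) = dop (GF \<alpha>) (dop (GE \<alpha>) y)
     + sca (1 / (?x - inverse ?x)) (dop (GK \<alpha>) y - dop (GL \<alpha>) y)"
  proof -
    have q1: "qv powi int (dnum D \<alpha>) - qv powi - int (dnum D \<alpha>) = ?x - inverse ?x"
      by (simp only: qd_def power_int_minus)
    have "(fgen D (GE \<alpha>) \<otimes>\<^bsub>Fr\<^esub> fgen D (GF \<alpha>) \<ominus>\<^bsub>Fr\<^esub> fgen D (GF \<alpha>) \<otimes>\<^bsub>Fr\<^esub> fgen D (GE \<alpha>))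
         \<ominus>\<^bsub>Fr\<^esub> fscal D (1 / (qv powi int (dnum D \<alpha>) - qv powi (- int (dnum D \<alpha>))))
               \<otimes>\<^bsub>Fr\<^esub> (fK D \<alpha> \<ominus>\<^bsub>Fr\<^esub> fL D \<alpha>) \<in> qrels D"
      unfolding qrels_def Let_def using \<alpha> by blast
    from qrels_Dual[OF this y] show ?thesis unfolding q1 by (simp add: s algebra_simps)
  qed
  show "y + z \<in> Dual" if "z \<in> Dual" by (rule dq.Cadd[OF y that])
  show "sca c y \<in> Dual" for c by (rule dq.Csca[OF y])
  show "dop (GE \<alpha>) y \<in> Dual" "dop (GF \<alpha>) y \<in> Dual" "dop (GK \<alpha>) y \<in> Dual" "dop (GL \<alpha>) y \<in> Dual"
    using dq.Cop[OF dr.gens(1)[OF \<alpha>] y] dq.Cop[OF dr.gens(2)[OF \<alpha>] y] K dq.Cop[OF dr.gens(4)[OF \<alpha>] y] by simp_all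
qed (rule dr.linop_op)+

text \<open>Induction on the lower argument. In Kac's formula for \<open>e\<^sup>[\<^sup>j\<^sup>] f\<^sup>[\<^sup>j\<^sup>]\<close> every term except for one, the torus binomial
with shift \<open>0\<close>, involves binomials with smaller lower argument; Pascal's rule then provides the other shifts.
The predicate \<open>P\<close> singles out the operators on functionals that come from Lusztig's form.\<close>

lemma fkbin_BZ:
  assumes \<alpha>: "\<alpha> \<in> simples D" shows "fkbin D \<alpha> n \<in> BZ"
proof -
  let ?x = "qd (dnum D \<alpha>)"
  interpret r: rank1 ?x "dop (GE \<alpha>)" "dop (GF \<alpha>)" "dop (GK \<alpha>)" "dop (GL \<alpha>)" Dual by (rule Dual_rank1[OF \<alpha>])
  define P where "P T \<longleftrightarrow> (\<exists>Y\<in>BZ. \<forall>\<psi>\<in>Dual. dr.ac Y \<psi> = T \<psi>)" for T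
  have PI: "P T" if "Y \<in> BZ" "\<And>\<psi>. \<psi> \<in> Dual ==> dr.ac Y \<psi> = T \<psi>" for T Y
    using that by (auto simp: P_def)
  have P_id: "P (\<lambda>\<psi>. \<psi>)" by (rule PI[OF BZ_closed(3)[OF Laurent_closed(2)]]) (simp add: dr.act_fscal)
  have P_sca: "P (\<lambda>\<psi>. sca c (T \<psi>))" if H: "P T" "c \<in> carrier Laurent" for T c
  proof -
    obtain Y where Y: "Y \<in> BZ" "\<forall>\<psi>\<in>Dual. dr.ac Y \<psi> = T \<psi>" using H unfolding P_def by blast
    show ?thesis
      by (rule PI[OF BZ_closed(2)[OF BZ_closed(3)[OF H(2)] Y(1)]])
        (use Y in \<open>simp add: dr.act_mult dr.act_fscal BZ_carrier\<close>)
  qed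
  have P_add: "P (\<lambda>\<psi>. S \<psi> + T \<psi>)" if H: "P S" "P T" for S T
  proof -
    obtain Y Z where Y: "Y \<in> BZ" "\<forall>\<psi>\<in>Dual. dr.ac Y \<psi> = S \<psi>" and Z: "Z \<in> BZ" "\<forall>\<psi>\<in>Dual. dr.ac Z \<psi> = T \<psi>"
      using H unfolding P_def by blast
    show ?thesis
      by (rule PI[OF BZ_closed(1)[OF Y(1) Z(1)]]) (use Y Z in \<open>simp add: dr.act_add BZ_carrier\<close>)
  qed
  have P_comp: "P (\<lambda>\<psi>. S (T \<psi>))" if H: "P S" "P T" for S T
  proof -
    obtain Y Z where Y: "Y \<in> BZ" "\<forall>\<psi>\<in>Dual. dr.ac Y \<psi> = S \<psi>" and Z: "Z \<in> BZ" "\<forall>\<psi>\<in>Dual. dr.ac Z \<psi> = T \<psi>"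
      using H unfolding P_def by blast
    show ?thesis
      by (rule PI[OF BZ_closed(2)[OF Y(1) Z(1)]])
        (use Y Z in \<open>simp add: dr.act_mult BZ_carrier dq.C_act flip: Z(2)\<close>)
  qed
  have P_cong: "P T" if "P S" "\<And>\<psi>. \<psi> \<in> Dual ==> S \<psi> = T \<psi>" for S T
    using that unfolding P_def by simp
  have P_diff: "P (\<lambda>\<psi>. S \<psi> - T \<psi>)" if "P S" "P T" for S T
    by (rule P_cong[OF P_add[OF that(1) P_sca[OF that(2), of "-1"]]]) (simp_all add: sca_rules Laurent_closed)
  have P_sum: "P (\<lambda>\<psi>. \<Sum>i<k. S i \<psi>)" if "\<And>i. i < k ==> P (S i)" for S and k :: nat
    using that
  proof (induction k)
    case 0
    show ?case by (rule P_cong[OF P_sca[OF P_id Laurent_closed(1)]]) simp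
  next
    case (Suc k)
    show ?case by (rule P_cong[OF P_add[OF Suc.IH Suc.prems[of k]]]) (use Suc.prems in simp_all)
  qed
  have P_L: "P (dop (GL \<alpha>))"
    by (rule PI[OF BZ_closed(4), of "fL D \<alpha>"]) (use \<alpha> in \<open>auto simp: U_gens_def dr.act_fgen dr.gens\<close>)
  have P_div: "P (dpow ?x (dop (g \<alpha>)) m)" if "g \<in> {GE, GF}" for g m
    by (rule PI[OF BZ_closed(4)[OF fdiv_U_gens[OF that \<alpha>]] dr.act_fdiv[OF that \<alpha>]])
  have P_F: "P (dpowi ?x (dop (GF \<alpha>)) (int a - int b))" if "b \<le> a" for a b
  proof -
    have i: "int a - int b = int (a - b)" using that by simp
    have "dpowi ?x (dop (GF \<alpha>)) (int a - int b) = dpow ?x (dop (GF \<alpha>)) (a - b)"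
      unfolding i by (rule ext) (rule dpowi_of_nat)
    moreover have "P (dpow ?x (dop (GF \<alpha>)) (a - b))" by (rule P_div) simp
    ultimately show ?thesis by (simp only:)
  qed
  have pw: "?x powi k \<in> carrier Laurent" for k by (simp only: qd_powi Laurent_closed)
  have hop: "P (r.hop c j)" for c j
  proof (induction j arbitrary: c rule: less_induct)
    case (less j)
    show ?case
    proof (cases j)
      case 0 show ?thesis unfolding 0 by (rule P_cong[OF P_id]) simp
    next
      case (Suc j')
      have L: "P (\<lambda>\<psi>. r.hop c j' (dop (GL \<alpha>) \<psi>))" for c
        by (rule P_comp[OF less.IH P_L]) (simp add: Suc)
      have up: "P (r.hop (c + 1) j)" if "P (r.hop c j)" for c
        by (rule P_cong[OF P_add[OF P_sca[OF that pw] P_sca[OF L pw]]])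
          (simp only: Suc r.hop_pascal)
      have down: "P (r.hop c j)" if "P (r.hop (c + 1) j)" for c
      proof (rule P_cong[OF P_sca[OF P_diff[OF that P_sca[OF L pw]] pw]])
        fix \<psi> assume \<psi>: "\<psi> \<in> Dual"
        show "sca (?x powi - int (Suc j')) (r.hop (c + 1) j \<psi> - sca (?x powi - (c - int j')) (r.hop c j' (dop (GL \<alpha>) \<psi>))) = r.hop c j \<psi>"
          unfolding Suc r.hop_pascal[OF \<psi>]
          by (simp only: add_diff_cancel_right' sca_simps(1) r.xx) (simp only: add.left_inverse power_int_0_right sca_simps)
      qed
      have zero: "P (r.hop 0 j)"
      proof -
        let ?T = "\<lambda>i \<psi>. dpowi ?x (dop (GF \<alpha>)) (int j - int i) (r.hop (2 * int i - int j - int j) i (dpow ?x (dop (GE \<alpha>)) (j - i) \<psi>))"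
        have T: "P (?T i)" if "i < j" for i
          by (rule P_comp[OF P_F P_comp[OF less.IH P_div]]) (use that in auto)
        show ?thesis
        proof (rule P_cong[OF P_diff[OF P_comp[OF P_div[of GE j] P_div[of GF j]] P_sum[of j ?T, OF T]]])
          fix \<psi> assume \<psi>: "\<psi> \<in> Dual"
          show "dpow ?x (dop (GE \<alpha>)) j (dpow ?x (dop (GF \<alpha>)) j \<psi>) - (\<Sum>i<j. ?T i \<psi>) = r.hop 0 j \<psi>"
            unfolding r.dpow_e_dpow_f[OF \<psi>] lessThan_Suc_atMost[symmetric] sum.lessThan_Suc
            by (simp add: dpowi_def)
        qed simp_all
      qed
      show ?thesis
      proof (induction c rule: int_induct[where k = 0])
        case base show ?case by (rule zero)
      next
        case (step1 i) then show ?case using up by blast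
      next
        case (step2 i) then show ?case using down[of "i - 1"] by simp
      qed
    qed
  qed
  have kb: "dr.ac (fkbin D \<alpha> m) \<psi> = r.hop 0 m \<psi>" if "\<psi> \<in> Dual" for m \<psi>
    by (rule dr.act_fkbin[OF Dual_rank1[OF \<alpha>] \<alpha> that])
  obtain Y where Y: "Y \<in> BZ" "\<And>\<psi>. \<psi> \<in> Dual ==> dr.ac Y \<psi> = r.hop 0 n \<psi>"
    using hop[of 0 n] by (auto simp: P_def)
  have "fkbin D \<alpha> n \<ominus>\<^bsub>Fr\<^esub> Y \<in> qideal D"
    by (rule Dual_separates) (use Y in \<open>simp_all add: BZ_carrier dr.act_minus kb\<close>)
  then have "qcls D (fkbin D \<alpha> n) = qcls D Y" using Y by (simp add: qcls_eq_iff BZ_carrier)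
  then show ?thesis using Y by (simp add: BZ_def)
qed

lemma UZ0_subset: "carrier (UZ0 D) \<subseteq> carrier (UZ D)"
proof -
  have "qscal D ` carrier Laurent \<union> qcls D ` U0_gens D \<subseteq> carrier (UZ D)"
    using fkbin_BZ form_incl[of _ "U_gens D"] form_scal[of _ "U_gens D"]
    by (auto simp: U0_gens_def BZ_def UZ_form U_gens_def)
  moreover have "subring (carrier (UZ D)) (UQ D)"
    unfolding UZ_def using UQ.generate_ring_is_subring[OF form_gens[OF U_gens_closed]] by simp
  ultimately have "generate_ring (UQ D) (qscal D ` carrier Laurent \<union> qcls D ` U0_gens D) \<subseteq> carrier (UZ D)"
    using UQ.generate_ring_min_subring1[OF _ _] form_gens[OF U0_gens_closed] by blast
  then show ?thesis by (simp add: UZ0_def)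
qed

end

section \<open>Base change and weight characters\<close>

locale base_change = free_alg D + A: domain A
  for D :: "'v::real_vector root_datum" and A :: "'a ring" +
  fixes \<phi> :: "qrat => 'a"
  assumes phi: "\<phi> \<in> ring_hom Laurent A"
begin

abbreviation "UU \<equiv> UA D A \<phi>"
abbreviation "UU0 \<equiv> UA0 D A \<phi>"
abbreviation "tel \<equiv> ua_elt D A \<phi>"
abbreviation "tel0 \<equiv> ua0_elt D A \<phi>"
abbreviation "usc \<equiv> ua_scal D A \<phi>"
abbreviation "udiv \<equiv> ua_div D A \<phi>"
abbreviation "incl0 \<equiv> ua0_incl D A \<phi>"
abbreviation "ch \<equiv> chi D A \<phi>"

lemma phi_closed [simp]: "c \<in> carrier Laurent ==> \<phi> c \<in> carrier A"
  by (rule ring_hom_closed[OF phi])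

lemma phi_simps:
  "a \<in> carrier Laurent ==> b \<in> carrier Laurent ==> \<phi> (a + b) = \<phi> a \<oplus>\<^bsub>A\<^esub> \<phi> b"
  "a \<in> carrier Laurent ==> b \<in> carrier Laurent ==> \<phi> (a * b) = \<phi> a \<otimes>\<^bsub>A\<^esub> \<phi> b"
  "\<phi> 1 = \<one>\<^bsub>A\<^esub>" "\<phi> 0 = \<zero>\<^bsub>A\<^esub>"
  using ring_hom_add[OF phi, of a b] ring_hom_mult[OF phi, of a b] ring_hom_one[OF phi]
    ring_hom_zero[OF phi cring.axioms(1)[OF Laurent_cring] A.ring_axioms] by simp_all

lemma tensor_form: "S \<subseteq> carrier Fr ==> tensor_data Laurent (form S) A (qscal D) \<phi>"
  unfolding tensor_data_def tensor_data_axioms_def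
  using form_ring A.is_cring qscal_form_hom phi form_closed qscal_central by simp

lemma UA_data: "tensor_data Laurent (UZ D) A (qscal D) \<phi>"
  unfolding UZ_form by (rule tensor_form[OF U_gens_closed])

lemma UA0_data: "tensor_data Laurent (UZ0 D) A (qscal D) \<phi>"
  unfolding UZ0_form by (rule tensor_form[OF U0_gens_closed])

lemmas UA_tel_closed = tensor_data.tel_closed[OF UA_data, folded UA_def]
  and UA_tel_add_left = tensor_data.tel_add_left[OF UA_data, folded UA_def]
  and UA_tel_add_right = tensor_data.tel_add_right[OF UA_data, folded UA_def]
  and UA_tel_mult = tensor_data.tel_mult[OF UA_data, folded UA_def]
  and UA_tel_one = tensor_data.tel_one[OF UA_data, folded UA_def]
  and UA_tel_scal = tensor_data.tel_scal[OF UA_data, folded UA_def]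
  and UA_TR_hom = tensor_data.TR_hom[OF UA_data, folded UA_def]

lemmas UA0_tel_closed = tensor_data.tel_closed[OF UA0_data, folded UA0_def]
  and UA0_TR_hom = tensor_data.TR_hom[OF UA0_data, folded UA0_def]

lemma UA_tel_induct [consumes 1, case_names tel add]:
  assumes "x \<in> carrier UU"
    and "\<And>u a. u \<in> carrier (UZ D) ==> a \<in> carrier A ==> P (tel u a)"
    and "\<And>x y. x \<in> carrier UU ==> y \<in> carrier UU ==> P x ==> P y ==> P (x \<oplus>\<^bsub>UU\<^esub> y)"
  shows "P x"
  using tensor_data.TR_induct[OF UA_data, folded UA_def, of x P] assms by blast

lemma UA0_tel_induct [consumes 1, case_names tel add]:
  assumes "x \<in> carrier UU0"
    and "\<And>u a. u \<in> carrier (UZ0 D) ==> a \<in> carrier A ==> P (tel0 u a)"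
    and "\<And>x y. x \<in> carrier UU0 ==> y \<in> carrier UU0 ==> P x ==> P y ==> P (x \<oplus>\<^bsub>UU0\<^esub> y)"
  shows "P x"
  using tensor_data.TR_induct[OF UA0_data, folded UA0_def, of x P] assms by blast

lemma tensor_data_ring:
  assumes "tensor_data Z U B s f" shows "ring (tensor_ring Z U s B f)"
  unfolding tensor_ring_def int_type_ring
  by (rule ideal.quotient_is_ring[OF tensor_data.TI_ideal[OF assms]])

lemma UA_ring: "ring UU" and UA0_ring: "ring UU0"
  using tensor_data_ring[OF UA_data] tensor_data_ring[OF UA0_data] by (simp_all add: UA_def UA0_def)

lemma form_one_closed: "S \<subseteq> carrier Fr ==> \<one>\<^bsub>UQ D\<^esub> \<in> carrier (form S)"
  by (simp add: form_def generate_ring.one)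

lemma UZ_one_closed [simp]: "\<one>\<^bsub>UZ D\<^esub> \<in> carrier (UZ D)" and UZ0_one_closed [simp]: "\<one>\<^bsub>UZ0 D\<^esub> \<in> carrier (UZ0 D)"
  using form_one_closed[OF U_gens_closed] form_one_closed[OF U0_gens_closed] by (simp_all add: UZ_form UZ0_form)

lemma UZ_units [simp]:
  "u \<in> carrier (UZ D) ==> \<one>\<^bsub>UZ D\<^esub> \<otimes>\<^bsub>UZ D\<^esub> u = u" "u \<in> carrier (UZ D) ==> u \<otimes>\<^bsub>UZ D\<^esub> \<one>\<^bsub>UZ D\<^esub> = u"
  using form_closed[OF U_gens_closed, of u] by (simp_all add: UZ_form)

lemma UZ0_ring: "ring (UZ0 D)"
  unfolding UZ0_form by (rule form_ring[OF U0_gens_closed])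

lemma form_tensor_induct:
  assumes S: "S \<subseteq> carrier Fr" and x: "x \<in> carrier (tensor_ring Laurent (form S) (qscal D) A \<phi>)"
    and scal: "\<And>a. a \<in> carrier A ==> P (tensor_elt Laurent (form S) (qscal D) A \<phi> \<one>\<^bsub>form S\<^esub> a)"
    and incl: "\<And>s. s \<in> S ==> P (tensor_elt Laurent (form S) (qscal D) A \<phi> (qcls D s) \<one>\<^bsub>A\<^esub>)"
    and add: "\<And>x y. x \<in> carrier (tensor_ring Laurent (form S) (qscal D) A \<phi>) ==>
      y \<in> carrier (tensor_ring Laurent (form S) (qscal D) A \<phi>) ==> P x ==> P y ==>
      P (x \<oplus>\<^bsub>tensor_ring Laurent (form S) (qscal D) A \<phi>\<^esub> y)"
    and mult: "\<And>x y. x \<in> carrier (tensor_ring Laurent (form S) (qscal D) A \<phi>) ==>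
      y \<in> carrier (tensor_ring Laurent (form S) (qscal D) A \<phi>) ==> P x ==> P y ==>
      P (x \<otimes>\<^bsub>tensor_ring Laurent (form S) (qscal D) A \<phi>\<^esub> y)"
  shows "P x"
proof -
  note T = tensor_form[OF S]
  let ?tel = "tensor_elt Laurent (form S) (qscal D) A \<phi>" and ?T = "tensor_ring Laurent (form S) (qscal D) A \<phi>"
  note o = form_one_closed[OF S]
  have one: "P (?tel u \<one>\<^bsub>A\<^esub>)" if "u \<in> carrier (form S)" for u
    using that S
  proof (induction rule: form_induct)
    case (scal c)
    have "?tel (qscal D c \<otimes>\<^bsub>form S\<^esub> \<one>\<^bsub>form S\<^esub>) \<one>\<^bsub>A\<^esub> = ?tel \<one>\<^bsub>form S\<^esub> (\<phi> c \<otimes>\<^bsub>A\<^esub> \<one>\<^bsub>A\<^esub>)"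
      by (rule tensor_data.tel_scal[OF T]) (use scal o in simp_all)
    then have "?tel (qscal D c) \<one>\<^bsub>A\<^esub> = ?tel \<one>\<^bsub>form S\<^esub> (\<phi> c)"
      using scal by (simp add: phi_closed)
    then show ?case using assms(3)[of "\<phi> c"] scal by (simp add: phi_closed)
  next
    case (incl s) then show ?case using assms(4) by blast
  next
    case (add u w)
    then show ?case using tensor_data.tel_add_left[OF T, of u w "\<one>\<^bsub>A\<^esub>"]
        assms(5)[OF tensor_data.tel_closed[OF T] tensor_data.tel_closed[OF T], of u "\<one>\<^bsub>A\<^esub>" w "\<one>\<^bsub>A\<^esub>"] by simp
  next
    case (mult u w)
    then show ?case using tensor_data.tel_mult[OF T, of u w "\<one>\<^bsub>A\<^esub>" "\<one>\<^bsub>A\<^esub>"]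
        assms(6)[OF tensor_data.tel_closed[OF T] tensor_data.tel_closed[OF T], of u "\<one>\<^bsub>A\<^esub>" w "\<one>\<^bsub>A\<^esub>"] by simp
  qed
  have tel: "P (?tel u a)" if ua: "u \<in> carrier (form S)" "a \<in> carrier A" for u a
  proof -
    have "?tel u \<one>\<^bsub>A\<^esub> \<otimes>\<^bsub>?T\<^esub> ?tel \<one>\<^bsub>form S\<^esub> a = ?tel (u \<otimes>\<^bsub>form S\<^esub> \<one>\<^bsub>form S\<^esub>) (\<one>\<^bsub>A\<^esub> \<otimes>\<^bsub>A\<^esub> a)"
      by (rule tensor_data.tel_mult[OF T]) (use ua o in simp_all)
    also have "\<dots> = ?tel u a" using ua form_closed[OF S] by simp
    finally show ?thesis
      using mult[OF tensor_data.tel_closed[OF T] tensor_data.tel_closed[OF T] one[OF ua(1)] scal[OF ua(2)]] by simp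
  qed
  show ?thesis by (rule tensor_data.TR_induct[OF T x tel assms(5)])
qed

lemmas UA_induct = form_tensor_induct[OF U_gens_closed, folded UZ_form, folded UA_def]
lemmas UA0_induct = form_tensor_induct[OF U0_gens_closed, folded UZ0_form, folded UA0_def]

lemma ua_scal_hom: "usc \<in> ring_hom A UU"
proof (rule ring_hom_memI)
  fix a b assume "a \<in> carrier A" "b \<in> carrier A"
  then show "usc (a \<otimes>\<^bsub>A\<^esub> b) = usc a \<otimes>\<^bsub>UU\<^esub> usc b"
    "usc (a \<oplus>\<^bsub>A\<^esub> b) = usc a \<oplus>\<^bsub>UU\<^esub> usc b"
    using UA_tel_mult[of "\<one>\<^bsub>UZ D\<^esub>" "\<one>\<^bsub>UZ D\<^esub>" a b] UA_tel_add_right[of "\<one>\<^bsub>UZ D\<^esub>" a b]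
    by (simp_all add: ua_scal_def)
qed (use UA_tel_closed UA_tel_one in \<open>simp_all add: ua_scal_def\<close>)

lemma ua_scal_central:
  assumes "x \<in> carrier UU" "a \<in> carrier A"
  shows "usc a \<otimes>\<^bsub>UU\<^esub> x = x \<otimes>\<^bsub>UU\<^esub> usc a"
proof -
  interpret R: ring "UU" by (rule UA_ring)
  show ?thesis using assms(1)
  proof (induction rule: UA_tel_induct)
    case (tel u b)
    then show ?case using assms(2)
      by (simp add: ua_scal_def UA_tel_mult A.m_comm)
  next
    case (add x y)
    then show ?case using assms(2) by (simp add: R.r_distr R.l_distr UA_tel_closed ua_scal_def)
  qed
qed

subsection \<open>The inclusion of the torus part\<close>

lemma ua0_incl_ex: "\<exists>!j. j \<in> ring_hom UU0 UU \<and> j \<in> extensional (carrier UU0) \<and>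
      (\<forall>u\<in>carrier (UZ0 D). \<forall>a\<in>carrier A. j (tel0 u a) = tel u a)"
  (is "\<exists>!j. ?P j")
proof -
  have one: "\<one>\<^bsub>UZ0 D\<^esub> = \<one>\<^bsub>UZ D\<^esub>" by (simp add: UZ_form UZ0_form)
  have sub: "u \<in> carrier (UZ0 D) ==> u \<in> carrier (UZ D)" for u using UZ0_subset by blast
  have ops: "u \<otimes>\<^bsub>UZ0 D\<^esub> w = u \<otimes>\<^bsub>UZ D\<^esub> w" "u \<oplus>\<^bsub>UZ0 D\<^esub> w = u \<oplus>\<^bsub>UZ D\<^esub> w" for u w
    by (simp_all add: UZ_form UZ0_form)
  have "\<exists>h \<in> ring_hom UU0 UU. \<forall>u\<in>carrier (UZ0 D). \<forall>a\<in>carrier A.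
     h (tel0 u a) = tel u \<one>\<^bsub>A\<^esub> \<otimes>\<^bsub>UU\<^esub> tel \<one>\<^bsub>UZ D\<^esub> a"
  proof (rule UA0_TR_hom[OF UA_ring])
    show "(\<lambda>u. tel u \<one>\<^bsub>A\<^esub>) \<in> ring_hom (UZ0 D) UU"
      by (rule ring_hom_memI) (simp_all add: one ops UA_tel_mult UA_tel_add_left UA_tel_one UA_tel_closed sub)
    show "(\<lambda>a. tel \<one>\<^bsub>UZ D\<^esub> a) \<in> ring_hom A UU"
      by (rule ring_hom_memI) (simp_all add: UA_tel_mult UA_tel_add_right UA_tel_one UA_tel_closed)
    show "tel u \<one>\<^bsub>A\<^esub> \<otimes>\<^bsub>UU\<^esub> tel \<one>\<^bsub>UZ D\<^esub> a = tel \<one>\<^bsub>UZ D\<^esub> a \<otimes>\<^bsub>UU\<^esub> tel u \<one>\<^bsub>A\<^esub>"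
      if "u \<in> carrier (UZ0 D)" "a \<in> carrier A" for u a
      using that sub by (simp add: UA_tel_mult)
    show "tel (qscal D z) \<one>\<^bsub>A\<^esub> = tel \<one>\<^bsub>UZ D\<^esub> (\<phi> z)" if "z \<in> carrier Laurent" for z
      using UA_tel_scal[OF that UZ_one_closed A.one_closed] that form_scal[OF that, of "U_gens D"]
      by (simp add: UZ_form[symmetric])
  qed
  then obtain h where h: "h \<in> ring_hom UU0 UU"
    "\<And>u a. u \<in> carrier (UZ0 D) ==> a \<in> carrier A ==> h (tel0 u a) = tel u a"
    using sub by (auto simp: UA_tel_mult)
  show ?thesis
  proof (rule ex1I)
    show "?P (restrict h (carrier UU0))"
      using h UA0_tel_closed UA0_ring
      by (simp add: ring.ring_hom_restrict[OF UA0_ring])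
  next
    fix j assume j: "?P j"
    have "j x = h x" if "x \<in> carrier UU0" for x
      using that
    proof (induction rule: UA0_tel_induct)
      case (tel u a) then show ?case using j h by simp
    next
      case (add x y)
      have "j \<in> ring_hom UU0 UU" using j by blast
      with add show ?case using h(1) by (simp only: ring_hom_add)
    qed
    then show "j = restrict h (carrier UU0)"
      using j by (intro extensionalityI[where A = "carrier UU0"]) auto
  qed
qed

lemma ua0_incl:
  "incl0 \<in> ring_hom UU0 UU"
  "u \<in> carrier (UZ0 D) ==> a \<in> carrier A ==> incl0 (tel0 u a) = tel u a"
  using theI'[OF ua0_incl_ex] unfolding ua0_incl_def by blast+

subsection \<open>Existence of the characters\<close>

text \<open>The scalar by which the torus part acts on the highest weight vector of weight \<open>\<nu>\<close>.\<close>

definition torus_char :: "'v => 'v qfree set => qrat" where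
  "torus_char \<nu> u = (THE c. \<forall>f\<in>carrier Fr. qcls D f = u \<longrightarrow> act (vop D \<nu>) f hwv = sca c hwv)"

lemma torus_char:
  assumes u: "u \<in> carrier (UZ0 D)"
  shows "torus_char \<nu> u \<in> carrier Laurent"
    "f \<in> carrier Fr ==> qcls D f = u ==> act (vop D \<nu>) f hwv = sca (torus_char \<nu> u) hwv"
proof -
  interpret h: hw D \<nu> by unfold_locales
  define Q where "Q u c \<longleftrightarrow> (\<forall>f\<in>carrier Fr. qcls D f = u \<longrightarrow> h.V.ac f hwv = sca c hwv)" for u c
  have QI: "Q (qcls D f) c" if f: "f \<in> carrier Fr" "h.V.ac f hwv = sca c hwv" for f c
    unfolding Q_def
  proof (intro ballI impI)
    fix g assume g: "g \<in> carrier Fr" "qcls D g = qcls D f"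
    then have "h.V.ac (g \<ominus>\<^bsub>Fr\<^esub> f) hwv = 0"
      using f(1) by (intro h.qideal_act hwmod.hwv) (simp add: qcls_eq_iff)
    then show "h.V.ac g hwv = sca c hwv" using f g by (simp add: h.V.act_minus)
  qed
  have ex: "\<exists>c\<in>carrier Laurent. Q u c"
    using u unfolding UZ0_form
  proof (induction rule: form_induct[OF _ U0_gens_closed, consumes 1, case_names scal incl add mult])
    case (scal c)
    then show ?case unfolding qscal_def by (intro bexI[of _ c] QI) (simp_all add: h.V.act_fscal)
  next
    case (incl s)
    then consider (K) \<alpha> where "\<alpha> \<in> simples D" "s = fK D \<alpha>" | (L) \<alpha> where "\<alpha> \<in> simples D" "s = fL D \<alpha>"
      | (B) \<alpha> n where "\<alpha> \<in> simples D" "s = fkbin D \<alpha> n"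
      by (auto simp: U0_gens_def)
    then show ?case
    proof cases
      case K
      show ?thesis unfolding K(2)
        by (intro bexI[of _ "qv powi (int (dnum D \<alpha>) * pr D \<nu> \<alpha>)"] QI) (simp_all add: h.V.act_fgen h.V.gens[OF K(1)] h.K_hwv qd_powi Laurent_closed del: vop.simps)
    next
      case L
      show ?thesis unfolding L(2)
        by (intro bexI[of _ "qv powi - (int (dnum D \<alpha>) * pr D \<nu> \<alpha>)"] QI) (simp_all add: h.V.act_fgen h.V.gens[OF L(1)] h.K_hwv qd_powi Laurent_closed del: vop.simps)
    next
      case B
      show ?thesis unfolding B(2)
      proof (intro bexI[of _ "qbinom (dnum D \<alpha>) (pr D \<nu> \<alpha>) n"] QI)
        show "h.V.ac (fkbin D \<alpha> n) hwv = sca (qbinom (dnum D \<alpha>) (pr D \<nu> \<alpha>) n) hwv"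
          unfolding h.V.act_fkbin[OF h.rank1[OF B(1)] B(1) UNIV_I]
          using rank1.hop_weight[OF h.rank1[OF B(1)] h.K_hwv, where c = 0 and r = n] by (simp add: qbinom_qchoose del: vop.simps)
      qed (use qbinom_Laurent dnum_pos B in auto)
    qed
  next
    case (add u w)
    obtain c d where cd: "c \<in> carrier Laurent" "Q u c" "d \<in> carrier Laurent" "Q w d" using add.IH by blast
    obtain f where f: "f \<in> carrier Fr" "u = qcls D f"
      using UQ_ex form_closed[OF U0_gens_closed] add.hyps by metis
    obtain g where g: "g \<in> carrier Fr" "w = qcls D g"
      using UQ_ex form_closed[OF U0_gens_closed] add.hyps by metis
    have "h.V.ac f hwv = sca c hwv" "h.V.ac g hwv = sca d hwv" using cd f g by (simp_all add: Q_def)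
    then have "Q (qcls D (f \<oplus>\<^bsub>Fr\<^esub> g)) (c + d)"
      by (intro QI) (use f g in \<open>simp_all add: h.V.act_add sca_rules\<close>)
    then show ?case using f g cd by (intro bexI[of _ "c + d"]) (simp_all add: Laurent_closed)
  next
    case (mult u w)
    obtain c d where cd: "c \<in> carrier Laurent" "Q u c" "d \<in> carrier Laurent" "Q w d" using mult.IH by blast
    obtain f where f: "f \<in> carrier Fr" "u = qcls D f"
      using UQ_ex form_closed[OF U0_gens_closed] mult.hyps by metis
    obtain g where g: "g \<in> carrier Fr" "w = qcls D g"
      using UQ_ex form_closed[OF U0_gens_closed] mult.hyps by metis
    have "h.V.ac f hwv = sca c hwv" "h.V.ac g hwv = sca d hwv" using cd f g by (simp_all add: Q_def)
    then have "Q (qcls D (f \<otimes>\<^bsub>Fr\<^esub> g)) (c * d)"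
      by (intro QI) (use f g in \<open>simp_all add: h.V.act_mult linop_sca[OF h.V.linop_act] mult.commute\<close>)
    then show ?case using f g cd by (intro bexI[of _ "c * d"]) (simp_all add: Laurent_closed)
  qed
  obtain f where f: "f \<in> carrier Fr" "u = qcls D f"
    using u UQ_ex form_closed[OF U0_gens_closed] unfolding UZ0_form by metis
  have uniq: "c = d" if "Q u c" "Q u d" for c d
  proof -
    have "sca c (hwv :: 'v list => qrat) = sca d hwv" using that f unfolding Q_def by metis
    from fun_cong[OF this, of "[]"] show ?thesis by (simp add: sca_apply hwv_def)
  qed
  obtain c where c: "c \<in> carrier Laurent" "Q u c" using ex by blast
  have "torus_char \<nu> u = c"
    unfolding torus_char_def Q_def[symmetric] by (rule the_equality) (use c uniq in auto)
  then show "torus_char \<nu> u \<in> carrier Laurent"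
    "f \<in> carrier Fr ==> qcls D f = u ==> act (vop D \<nu>) f hwv = sca (torus_char \<nu> u) hwv" for f
    using c by (auto simp: Q_def)
qed

lemma torus_charI:
  assumes u: "qcls D f \<in> carrier (UZ0 D)" and f: "f \<in> carrier Fr" "act (vop D \<nu>) f hwv = sca c hwv"
  shows "torus_char \<nu> (qcls D f) = c"
proof -
  have "sca (torus_char \<nu> (qcls D f)) (hwv :: 'v list => qrat) = sca c hwv"
    by (rule trans[OF torus_char(2)[OF u f(1) refl, symmetric] f(2)])
  from fun_cong[OF this, of "[]"] show ?thesis by (simp add: sca_apply hwv_def)
qed

lemma UZ0_gens:
  assumes "\<alpha> \<in> simples D"
  shows "qcls D (fK D \<alpha>) \<in> carrier (UZ0 D)" "qcls D (fL D \<alpha>) \<in> carrier (UZ0 D)" "qcls D (fkbin D \<alpha> n) \<in> carrier (UZ0 D)"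
  unfolding UZ0_form by (rule form_incl, use assms in \<open>auto simp: U0_gens_def\<close>)+

lemma torus_char_gens:
  assumes \<alpha>: "\<alpha> \<in> simples D"
  shows "torus_char \<nu> (qcls D (fK D \<alpha>)) = qv powi (int (dnum D \<alpha>) * pr D \<nu> \<alpha>)"
    "torus_char \<nu> (qcls D (fL D \<alpha>)) = qv powi - (int (dnum D \<alpha>) * pr D \<nu> \<alpha>)"
    "torus_char \<nu> (qcls D (fkbin D \<alpha> n)) = qbinom (dnum D \<alpha>) (pr D \<nu> \<alpha>) n"
proof -
  interpret h: hw D \<nu> by unfold_locales
  show "torus_char \<nu> (qcls D (fK D \<alpha>)) = qv powi (int (dnum D \<alpha>) * pr D \<nu> \<alpha>)"
    by (rule torus_charI[OF UZ0_gens(1)[OF \<alpha>]]) (simp_all add: h.V.act_fgen h.V.gens[OF \<alpha>] h.K_hwv qd_powi del: vop.simps)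
  show "torus_char \<nu> (qcls D (fL D \<alpha>)) = qv powi - (int (dnum D \<alpha>) * pr D \<nu> \<alpha>)"
    by (rule torus_charI[OF UZ0_gens(2)[OF \<alpha>]]) (simp_all add: h.V.act_fgen h.V.gens[OF \<alpha>] h.K_hwv qd_powi del: vop.simps)
  show "torus_char \<nu> (qcls D (fkbin D \<alpha> n)) = qbinom (dnum D \<alpha>) (pr D \<nu> \<alpha>) n"
  proof (rule torus_charI[OF UZ0_gens(3)[OF \<alpha>]])
    show "h.V.ac (fkbin D \<alpha> n) hwv = sca (qbinom (dnum D \<alpha>) (pr D \<nu> \<alpha>) n) hwv"
      unfolding h.V.act_fkbin[OF h.rank1[OF \<alpha>] \<alpha> UNIV_I]
      using rank1.hop_weight[OF h.rank1[OF \<alpha>] h.K_hwv, where c = 0 and r = n] by (simp add: qbinom_qchoose del: vop.simps)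
  qed simp
qed

lemma torus_char_hom: "torus_char \<nu> \<in> ring_hom (UZ0 D) Laurent"
proof (rule ring_hom_memI)
  interpret h: hw D \<nu> by unfold_locales
  interpret U0: ring "UZ0 D" by (rule UZ0_ring)
  have ops: "u \<otimes>\<^bsub>UZ0 D\<^esub> w = u \<otimes>\<^bsub>UQ D\<^esub> w" "u \<oplus>\<^bsub>UZ0 D\<^esub> w = u \<oplus>\<^bsub>UQ D\<^esub> w" "\<one>\<^bsub>UZ0 D\<^esub> = \<one>\<^bsub>UQ D\<^esub>" for u w
    by (simp_all add: UZ0_form)
  show "torus_char \<nu> u \<in> carrier Laurent" if "u \<in> carrier (UZ0 D)" for u by (rule torus_char(1)[OF that])
  have one: "qcls D \<one>\<^bsub>Fr\<^esub> \<in> carrier (UZ0 D)" using U0.one_closed ops by simp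
  show "torus_char \<nu> \<one>\<^bsub>UZ0 D\<^esub> = \<one>\<^bsub>Laurent\<^esub>"
    using torus_charI[OF one, of \<nu> 1] by (simp add: ops h.V.act_one)
  fix u w assume uw: "u \<in> carrier (UZ0 D)" "w \<in> carrier (UZ0 D)"
  obtain f where f: "f \<in> carrier Fr" "u = qcls D f"
    using uw UQ_ex form_closed[OF U0_gens_closed] unfolding UZ0_form by metis
  obtain g where g: "g \<in> carrier Fr" "w = qcls D g"
    using uw UQ_ex form_closed[OF U0_gens_closed] unfolding UZ0_form by metis
  note c = torus_char(2)[OF uw(1) f(1) f(2)[symmetric], of \<nu>] torus_char(2)[OF uw(2) g(1) g(2)[symmetric], of \<nu>]
  have "qcls D (f \<otimes>\<^bsub>Fr\<^esub> g) = u \<otimes>\<^bsub>UZ0 D\<^esub> w" "qcls D (f \<oplus>\<^bsub>Fr\<^esub> g) = u \<oplus>\<^bsub>UZ0 D\<^esub> w"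
    using f g by (simp_all add: ops)
  then show "torus_char \<nu> (u \<otimes>\<^bsub>UZ0 D\<^esub> w) = torus_char \<nu> u \<otimes>\<^bsub>Laurent\<^esub> torus_char \<nu> w"
    "torus_char \<nu> (u \<oplus>\<^bsub>UZ0 D\<^esub> w) = torus_char \<nu> u \<oplus>\<^bsub>Laurent\<^esub> torus_char \<nu> w"
    using torus_charI[of "f \<otimes>\<^bsub>Fr\<^esub> g" \<nu> "torus_char \<nu> u * torus_char \<nu> w"]
      torus_charI[of "f \<oplus>\<^bsub>Fr\<^esub> g" \<nu> "torus_char \<nu> u + torus_char \<nu> w"] f g uw c
      U0.m_closed[OF uw] U0.a_closed[OF uw]
    by (simp_all add: h.V.act_mult h.V.act_add linop_sca[OF h.V.linop_act] sca_rules mult.commute)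
qed

lemma torus_char_qscal: "c \<in> carrier Laurent ==> torus_char \<nu> (qscal D c) = c"
proof -
  assume c: "c \<in> carrier Laurent"
  interpret h: hw D \<nu> by unfold_locales
  show ?thesis unfolding qscal_def
    by (rule torus_charI) (use form_scal[OF c, of "U0_gens D"] in \<open>simp_all add: h.V.act_fscal UZ0_form qscal_def\<close>)
qed

text \<open>The characters over \<open>A\<close> are obtained from those on highest weight vectors by base change.\<close>

lemma chi_ex:
  "\<exists>!c. c \<in> ring_hom UU0 A \<and> c \<in> extensional (carrier UU0) \<and>
      (\<forall>a\<in>carrier A. c (tel0 \<one>\<^bsub>UZ0 D\<^esub> a) = a) \<and>
      (\<forall>\<alpha>\<in>simples D.
        c (tel0 (qcls D (fK D \<alpha>)) \<one>\<^bsub>A\<^esub>) = \<phi> (qv powi (int (dnum D \<alpha>) * pr D \<mu> \<alpha>)) \<and>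
        c (tel0 (qcls D (fL D \<alpha>)) \<one>\<^bsub>A\<^esub>) = \<phi> (qv powi (- (int (dnum D \<alpha>) * pr D \<mu> \<alpha>))) \<and>
        (\<forall>r. c (tel0 (qcls D (fkbin D \<alpha> r)) \<one>\<^bsub>A\<^esub>) = \<phi> (qbinom (dnum D \<alpha>) (pr D \<mu> \<alpha>) r)))"
  (is "\<exists>!c. ?P c")
proof -
  have "\<exists>h \<in> ring_hom UU0 A. \<forall>u\<in>carrier (UZ0 D). \<forall>a\<in>carrier A.
     h (tel0 u a) = (\<phi> \<circ> torus_char \<mu>) u \<otimes>\<^bsub>A\<^esub> (\<lambda>a. a) a"
  proof (rule UA0_TR_hom[OF A.ring_axioms ring_hom_trans[OF torus_char_hom phi]])
    show "(\<lambda>a. a) \<in> ring_hom A A" by (simp add: ring_hom_def)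
  qed (simp_all add: torus_char_qscal A.m_comm torus_char(1) phi_closed)
  then obtain h where h: "h \<in> ring_hom UU0 A"
    "\<And>u a. u \<in> carrier (UZ0 D) ==> a \<in> carrier A ==> h (tel0 u a) = \<phi> (torus_char \<mu> u) \<otimes>\<^bsub>A\<^esub> a"
    by auto
  have h1: "torus_char \<mu> \<one>\<^bsub>UZ0 D\<^esub> = 1" using ring_hom_one[OF torus_char_hom] by simp
  have bL: "\<alpha> \<in> simples D ==> qbinom (dnum D \<alpha>) n r \<in> carrier Laurent" for \<alpha> n r
    using qbinom_Laurent dnum_pos by blast
  have hP: "?P (restrict h (carrier UU0))"
    using h(1) UA0_tel_closed
    by (simp add: ring.ring_hom_restrict[OF UA0_ring] h(2) h1 phi_simps UZ0_gens torus_char_gens Laurent_closed bL)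
  show ?thesis
  proof (rule ex1I)
    show "?P (restrict h (carrier UU0))" by (rule hP)
  next
    fix j assume j: "?P j"
    let ?h = "restrict h (carrier UU0)"
    have "j x = ?h x" if "x \<in> carrier UU0" for x
    proof (rule UA0_induct[OF that])
      fix s assume "s \<in> U0_gens D"
      then show "j (tel0 (qcls D s) \<one>\<^bsub>A\<^esub>) = ?h (tel0 (qcls D s) \<one>\<^bsub>A\<^esub>)"
        using j hP unfolding U0_gens_def by (elim UnE imageE CollectE exE conjE) simp_all
    next
      fix x y assume "x \<in> carrier UU0" "y \<in> carrier UU0" "j x = ?h x" "j y = ?h y"
      moreover have "j \<in> ring_hom UU0 A" "?h \<in> ring_hom UU0 A" using j hP by blast+
      ultimately show "j (x \<oplus>\<^bsub>UU0\<^esub> y) = ?h (x \<oplus>\<^bsub>UU0\<^esub> y)" "j (x \<otimes>\<^bsub>UU0\<^esub> y) = ?h (x \<otimes>\<^bsub>UU0\<^esub> y)"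
        by (simp_all only: ring_hom_add ring_hom_mult)
    next
      fix a assume a: "a \<in> carrier A"
      have "\<forall>a\<in>carrier A. j (tel0 \<one>\<^bsub>UZ0 D\<^esub> a) = a"
        and "\<forall>a\<in>carrier A. ?h (tel0 \<one>\<^bsub>UZ0 D\<^esub> a) = a"
        using j hP by blast+
      from trans[OF bspec[OF this(1) a] bspec[OF this(2) a, symmetric]]
      show "j (tel0 \<one>\<^bsub>UZ0 D\<^esub> a) = ?h (tel0 \<one>\<^bsub>UZ0 D\<^esub> a)" .
    qed
    then show "j = ?h"
      using j hP by (intro extensionalityI[where A = "carrier UU0"]) blast+
  qed
qed

lemma chi:
  "ch \<mu> \<in> ring_hom UU0 A"
  "a \<in> carrier A ==> ch \<mu> (tel0 \<one>\<^bsub>UZ0 D\<^esub> a) = a"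
  "\<alpha> \<in> simples D ==> ch \<mu> (tel0 (qcls D (fK D \<alpha>)) \<one>\<^bsub>A\<^esub>) = \<phi> (qv powi (int (dnum D \<alpha>) * pr D \<mu> \<alpha>))"
  "\<alpha> \<in> simples D ==> ch \<mu> (tel0 (qcls D (fL D \<alpha>)) \<one>\<^bsub>A\<^esub>) = \<phi> (qv powi (- (int (dnum D \<alpha>) * pr D \<mu> \<alpha>)))"
  "\<alpha> \<in> simples D ==> ch \<mu> (tel0 (qcls D (fkbin D \<alpha> r)) \<one>\<^bsub>A\<^esub>) = \<phi> (qbinom (dnum D \<alpha>) (pr D \<mu> \<alpha>) r)"
  using theI'[OF chi_ex[of \<mu>]] unfolding chi_def[symmetric] by blast+

end

section \<open>Endomorphism rings and quotient modules\<close>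

definition endo_ring :: "('a, 'm, 'q) module_scheme => ('m => 'm) ring" where
  "endo_ring M =
    \<lparr>carrier = {T \<in> carrier M \<rightarrow>\<^sub>E carrier M. \<forall>x\<in>carrier M. \<forall>y\<in>carrier M. T (x \<oplus>\<^bsub>M\<^esub> y) = T x \<oplus>\<^bsub>M\<^esub> T y},
     monoid.mult = (\<lambda>S T. compose (carrier M) S T), one = (\<lambda>x\<in>carrier M. x),
     ring.zero = (\<lambda>x\<in>carrier M. \<zero>\<^bsub>M\<^esub>), add = (\<lambda>S T. \<lambda>x\<in>carrier M. S x \<oplus>\<^bsub>M\<^esub> T x)\<rparr>"

lemma endo_carrier: "T \<in> carrier (endo_ring M) \<longleftrightarrow> T \<in> carrier M \<rightarrow>\<^sub>E carrier M \<and>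
    (\<forall>x\<in>carrier M. \<forall>y\<in>carrier M. T (x \<oplus>\<^bsub>M\<^esub> y) = T x \<oplus>\<^bsub>M\<^esub> T y)"
  by (simp add: endo_ring_def)

lemma endo_simps:
  "x \<in> carrier M ==> (S \<otimes>\<^bsub>endo_ring M\<^esub> T) x = S (T x)"
  "x \<in> carrier M ==> (S \<oplus>\<^bsub>endo_ring M\<^esub> T) x = S x \<oplus>\<^bsub>M\<^esub> T x"
  "x \<in> carrier M ==> \<one>\<^bsub>endo_ring M\<^esub> x = x"
  "x \<in> carrier M ==> \<zero>\<^bsub>endo_ring M\<^esub> x = \<zero>\<^bsub>M\<^esub>"
  by (simp_all add: endo_ring_def compose_eq)

lemma endo_closed: "T \<in> carrier (endo_ring M) ==> x \<in> carrier M ==> T x \<in> carrier M"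
  by (auto simp: endo_carrier)

lemma endo_add: "T \<in> carrier (endo_ring M) ==> x \<in> carrier M ==> y \<in> carrier M ==> T (x \<oplus>\<^bsub>M\<^esub> y) = T x \<oplus>\<^bsub>M\<^esub> T y"
  by (auto simp: endo_carrier)

lemma endo_eqI:
  assumes "S \<in> carrier (endo_ring M)" "T \<in> carrier (endo_ring M)" "\<And>x. x \<in> carrier M ==> S x = T x"
  shows "S = T"
  by (rule extensionalityI[where A = "carrier M"]) (use assms in \<open>auto simp: endo_carrier PiE_def\<close>)

lemma endo_ops_closed:
  assumes M: "abelian_group M"
  shows "S \<in> carrier (endo_ring M) ==> T \<in> carrier (endo_ring M) ==> S \<otimes>\<^bsub>endo_ring M\<^esub> T \<in> carrier (endo_ring M)"
    "S \<in> carrier (endo_ring M) ==> T \<in> carrier (endo_ring M) ==> S \<oplus>\<^bsub>endo_ring M\<^esub> T \<in> carrier (endo_ring M)"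
    "\<one>\<^bsub>endo_ring M\<^esub> \<in> carrier (endo_ring M)" "\<zero>\<^bsub>endo_ring M\<^esub> \<in> carrier (endo_ring M)"
proof -
  interpret abelian_group M by fact
  have ext: "S \<otimes>\<^bsub>endo_ring M\<^esub> T \<in> extensional (carrier M)" "S \<oplus>\<^bsub>endo_ring M\<^esub> T \<in> extensional (carrier M)"
    "\<one>\<^bsub>endo_ring M\<^esub> \<in> extensional (carrier M)" "\<zero>\<^bsub>endo_ring M\<^esub> \<in> extensional (carrier M)"
    by (simp_all add: endo_ring_def compose_def)
  show "S \<otimes>\<^bsub>endo_ring M\<^esub> T \<in> carrier (endo_ring M)" if "S \<in> carrier (endo_ring M)" "T \<in> carrier (endo_ring M)"
    using that ext by (simp add: endo_carrier[of "_ \<otimes>\<^bsub>_\<^esub> _"] PiE_def Pi_iff endo_simps endo_closed endo_add)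
  show "S \<oplus>\<^bsub>endo_ring M\<^esub> T \<in> carrier (endo_ring M)" if "S \<in> carrier (endo_ring M)" "T \<in> carrier (endo_ring M)"
    using that ext by (simp add: endo_carrier[of "_ \<oplus>\<^bsub>_\<^esub> _"] PiE_def Pi_iff endo_simps endo_closed endo_add a_ac)
  show "\<one>\<^bsub>endo_ring M\<^esub> \<in> carrier (endo_ring M)" "\<zero>\<^bsub>endo_ring M\<^esub> \<in> carrier (endo_ring M)"
    using ext by (simp_all add: endo_carrier PiE_def Pi_iff endo_simps)
qed

lemma endo_ring_ring:
  assumes M: "abelian_group M" shows "ring (endo_ring M)"
proof -
  interpret abelian_group M by fact
  note eqI = endo_eqI[where M = M]
  note s = endo_simps endo_closed endo_add endo_ops_closed[OF M]
  show ?thesis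
  proof (rule ringI)
    show "abelian_group (endo_ring M)"
    proof (rule abelian_groupI)
      fix S T U assume S: "S \<in> carrier (endo_ring M)"
      show "\<zero>\<^bsub>endo_ring M\<^esub> \<oplus>\<^bsub>endo_ring M\<^esub> S = S"
        by (rule eqI) (simp_all add: s S)
      let ?N = "\<lambda>x\<in>carrier M. \<ominus>\<^bsub>M\<^esub> S x"
      have N: "?N \<in> carrier (endo_ring M)" 
        unfolding endo_carrier by (auto simp: endo_closed[OF S] endo_add[OF S] minus_add)
      have "?N \<oplus>\<^bsub>endo_ring M\<^esub> S = \<zero>\<^bsub>endo_ring M\<^esub>"
        by (rule eqI) (simp_all add: s S N l_neg)
      then show "\<exists>N\<in>carrier (endo_ring M). N \<oplus>\<^bsub>endo_ring M\<^esub> S = \<zero>\<^bsub>endo_ring M\<^esub>" using N by blast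
      assume T: "T \<in> carrier (endo_ring M)"
      show "S \<oplus>\<^bsub>endo_ring M\<^esub> T \<in> carrier (endo_ring M)" by (simp add: s S T)
      show "S \<oplus>\<^bsub>endo_ring M\<^esub> T = T \<oplus>\<^bsub>endo_ring M\<^esub> S"
        by (rule eqI) (simp_all add: s S T a_comm)
      assume U: "U \<in> carrier (endo_ring M)"
      show "S \<oplus>\<^bsub>endo_ring M\<^esub> T \<oplus>\<^bsub>endo_ring M\<^esub> U = S \<oplus>\<^bsub>endo_ring M\<^esub> (T \<oplus>\<^bsub>endo_ring M\<^esub> U)"
        by (rule eqI) (simp_all add: s S T U a_assoc)
    qed (simp add: s)
    show "Group.monoid (endo_ring M)"
    proof (rule monoidI)
      fix S T U assume S: "S \<in> carrier (endo_ring M)"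
      show "\<one>\<^bsub>endo_ring M\<^esub> \<otimes>\<^bsub>endo_ring M\<^esub> S = S" "S \<otimes>\<^bsub>endo_ring M\<^esub> \<one>\<^bsub>endo_ring M\<^esub> = S"
        by (rule eqI, simp_all add: s S)+
      assume T: "T \<in> carrier (endo_ring M)" and U: "U \<in> carrier (endo_ring M)"
      show "S \<otimes>\<^bsub>endo_ring M\<^esub> T \<otimes>\<^bsub>endo_ring M\<^esub> U = S \<otimes>\<^bsub>endo_ring M\<^esub> (T \<otimes>\<^bsub>endo_ring M\<^esub> U)"
        by (rule eqI) (simp_all add: s S T U)
    qed (simp_all add: s)
    fix S T U assume S: "S \<in> carrier (endo_ring M)" and T: "T \<in> carrier (endo_ring M)" and U: "U \<in> carrier (endo_ring M)"
    show "(S \<oplus>\<^bsub>endo_ring M\<^esub> T) \<otimes>\<^bsub>endo_ring M\<^esub> U = S \<otimes>\<^bsub>endo_ring M\<^esub> U \<oplus>\<^bsub>endo_ring M\<^esub> T \<otimes>\<^bsub>endo_ring M\<^esub> U"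
      by (rule eqI) (simp_all add: s S T U)
    show "U \<otimes>\<^bsub>endo_ring M\<^esub> (S \<oplus>\<^bsub>endo_ring M\<^esub> T) = U \<otimes>\<^bsub>endo_ring M\<^esub> S \<oplus>\<^bsub>endo_ring M\<^esub> U \<otimes>\<^bsub>endo_ring M\<^esub> T"
      by (rule eqI) (simp_all add: s S T U)
  qed
qed

lemma quot_module_module:
  assumes N: "module A N" and H: "submodule H A N"
  shows "module A (quot_module N H)"
    and "x \<in> carrier N ==> a \<in> carrier A ==> a \<odot>\<^bsub>quot_module N H\<^esub> (H +>\<^bsub>N\<^esub> x) = H +>\<^bsub>N\<^esub> (a \<odot>\<^bsub>N\<^esub> x)"
proof -
  interpret N: module A N by fact
  interpret H: abelian_subgroup H N
    by (rule abelian_subgroupI3[OF additive_subgroup.intro[OF submodule.axioms(1)[OF H]] N.abelian_group_axioms])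
  let ?Q = "quot_module N H"
  have ex: "\<exists>x\<in>carrier N. C = H +>\<^bsub>N\<^esub> x" if "C \<in> carrier ?Q" for C
    using that by (auto simp: quot_module_def A_RCOSETS_def')
  have cl: "H +>\<^bsub>N\<^esub> x \<in> carrier ?Q" if "x \<in> carrier N" for x
    using that by (auto simp: quot_module_def A_RCOSETS_def')
  have add: "(H +>\<^bsub>N\<^esub> x) \<oplus>\<^bsub>?Q\<^esub> (H +>\<^bsub>N\<^esub> y) = H +>\<^bsub>N\<^esub> (x \<oplus>\<^bsub>N\<^esub> y)" if "x \<in> carrier N" "y \<in> carrier N" for x y
    using H.a_rcos_sum[OF that] by (simp add: quot_module_def)
  have sm: "a \<odot>\<^bsub>?Q\<^esub> (H +>\<^bsub>N\<^esub> x) = H +>\<^bsub>N\<^esub> (a \<odot>\<^bsub>N\<^esub> x)" if x: "x \<in> carrier N" and a: "a \<in> carrier A" for a x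
  proof -
    have "H +>\<^bsub>N\<^esub> (a \<odot>\<^bsub>N\<^esub> y) = H +>\<^bsub>N\<^esub> (a \<odot>\<^bsub>N\<^esub> x)" if y: "y \<in> H +>\<^bsub>N\<^esub> x" for y
    proof -
      obtain h where h: "h \<in> H" "y = h \<oplus>\<^bsub>N\<^esub> x" using y by (auto simp: a_r_coset_def')
      have hN: "h \<in> carrier N" using h(1) H.a_subset by blast
      have ah: "a \<odot>\<^bsub>N\<^esub> h \<in> H" using submodule.smult_closed[OF H a h(1)] .
      have "a \<odot>\<^bsub>N\<^esub> y \<in> H +>\<^bsub>N\<^esub> (a \<odot>\<^bsub>N\<^esub> x)"
        using ah h(2) hN x a by (auto simp: a_r_coset_def' N.smult_r_distr)
      then show ?thesis using H.a_repr_independence'[of "a \<odot>\<^bsub>N\<^esub> y" "a \<odot>\<^bsub>N\<^esub> x"] x a by simp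
    qed
    moreover have "x \<in> H +>\<^bsub>N\<^esub> x" by (rule H.a_rcos_self[OF x])
    ultimately have "(\<Union>y\<in>H +>\<^bsub>N\<^esub> x. H +>\<^bsub>N\<^esub> (a \<odot>\<^bsub>N\<^esub> y)) = H +>\<^bsub>N\<^esub> (a \<odot>\<^bsub>N\<^esub> x)" by blast
    then show ?thesis by (simp add: quot_module_def)
  qed
  then show "x \<in> carrier N ==> a \<in> carrier A ==> a \<odot>\<^bsub>quot_module N H\<^esub> (H +>\<^bsub>N\<^esub> x) = H +>\<^bsub>N\<^esub> (a \<odot>\<^bsub>N\<^esub> x)" .
  have zero: "\<zero>\<^bsub>?Q\<^esub> = H +>\<^bsub>N\<^esub> \<zero>\<^bsub>N\<^esub>"
    using H.a_rcos_const[OF H.zero_closed] by (simp add: quot_module_def)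
  have "abelian_group ?Q"
  proof (rule abelian_groupI)
    show "\<zero>\<^bsub>?Q\<^esub> \<in> carrier ?Q" unfolding zero by (rule cl) simp
    fix C C' C'' assume "C \<in> carrier ?Q"
    then obtain x where x: "x \<in> carrier N" "C = H +>\<^bsub>N\<^esub> x" using ex by blast
    show "\<zero>\<^bsub>?Q\<^esub> \<oplus>\<^bsub>?Q\<^esub> C = C" using x by (simp add: zero add)
    have "(H +>\<^bsub>N\<^esub> (\<ominus>\<^bsub>N\<^esub> x)) \<oplus>\<^bsub>?Q\<^esub> C = \<zero>\<^bsub>?Q\<^esub>" using x by (simp add: zero add N.l_neg)
    then show "\<exists>C'\<in>carrier ?Q. C' \<oplus>\<^bsub>?Q\<^esub> C = \<zero>\<^bsub>?Q\<^esub>" using cl[of "\<ominus>\<^bsub>N\<^esub> x"] x by blast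
    assume "C' \<in> carrier ?Q"
    then obtain y where y: "y \<in> carrier N" "C' = H +>\<^bsub>N\<^esub> y" using ex by blast
    show "C \<oplus>\<^bsub>?Q\<^esub> C' \<in> carrier ?Q" "C \<oplus>\<^bsub>?Q\<^esub> C' = C' \<oplus>\<^bsub>?Q\<^esub> C" using x y by (simp_all add: add cl N.a_comm)
    assume "C'' \<in> carrier ?Q"
    then obtain z where z: "z \<in> carrier N" "C'' = H +>\<^bsub>N\<^esub> z" using ex by blast
    show "C \<oplus>\<^bsub>?Q\<^esub> C' \<oplus>\<^bsub>?Q\<^esub> C'' = C \<oplus>\<^bsub>?Q\<^esub> (C' \<oplus>\<^bsub>?Q\<^esub> C'')" using x y z by (simp add: add N.a_assoc)
  qed
  then show "module A ?Q"
  proof (intro moduleI N.R.is_cring)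
    fix a b C C' assume a: "a \<in> carrier A" and "C \<in> carrier ?Q"
    then obtain x where x: "x \<in> carrier N" "C = H +>\<^bsub>N\<^esub> x" using ex by blast
    show "a \<odot>\<^bsub>?Q\<^esub> C \<in> carrier ?Q" using a x by (simp add: sm cl)
    { assume "C' \<in> carrier ?Q"
      then obtain y where y: "y \<in> carrier N" "C' = H +>\<^bsub>N\<^esub> y" using ex by blast
      show "a \<odot>\<^bsub>?Q\<^esub> (C \<oplus>\<^bsub>?Q\<^esub> C') = a \<odot>\<^bsub>?Q\<^esub> C \<oplus>\<^bsub>?Q\<^esub> a \<odot>\<^bsub>?Q\<^esub> C'"
        using a x y by (simp add: sm add N.smult_r_distr) }
    assume b: "b \<in> carrier A"
    show "(a \<oplus>\<^bsub>A\<^esub> b) \<odot>\<^bsub>?Q\<^esub> C = a \<odot>\<^bsub>?Q\<^esub> C \<oplus>\<^bsub>?Q\<^esub> b \<odot>\<^bsub>?Q\<^esub> C"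
      using a b x by (simp add: sm add N.smult_l_distr)
    show "(a \<otimes>\<^bsub>A\<^esub> b) \<odot>\<^bsub>?Q\<^esub> C = a \<odot>\<^bsub>?Q\<^esub> (b \<odot>\<^bsub>?Q\<^esub> C)"
      using a b x by (simp add: sm N.smult_assoc1)
  next
    fix C assume "C \<in> carrier ?Q"
    then obtain x where x: "x \<in> carrier N" "C = H +>\<^bsub>N\<^esub> x" using ex by blast
    show "\<one>\<^bsub>A\<^esub> \<odot>\<^bsub>?Q\<^esub> C = C" using x by (simp add: sm)
  qed
qed

lemma free_module_torsion_free:
  assumes A: "domain A" and Q: "module A Q" and free: "free_module A Q"
    and a: "a \<in> carrier A" "a \<noteq> \<zero>\<^bsub>A\<^esub>" and x: "x \<in> carrier Q" "a \<odot>\<^bsub>Q\<^esub> x = \<zero>\<^bsub>Q\<^esub>"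
  shows "x = \<zero>\<^bsub>Q\<^esub>"
proof -
  interpret A: domain A by fact
  interpret Q: module A Q by fact
  define P where "P B x c \<longleftrightarrow> c \<in> B \<rightarrow>\<^sub>E carrier A \<and> finite {b\<in>B. c b \<noteq> \<zero>\<^bsub>A\<^esub>} \<and>
      x = finsum Q (\<lambda>b. c b \<odot>\<^bsub>Q\<^esub> b) {b\<in>B. c b \<noteq> \<zero>\<^bsub>A\<^esub>}" for B x c
  obtain B where B: "B \<subseteq> carrier Q" and u: "\<forall>x\<in>carrier Q. \<exists>!c. P B x c"
    using free unfolding free_module_def P_def[symmetric] by blast
  obtain c where "P B x c" using u x(1) by blast
  then have c: "c \<in> B \<rightarrow>\<^sub>E carrier A" "finite {b\<in>B. c b \<noteq> \<zero>\<^bsub>A\<^esub>}"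
      "x = finsum Q (\<lambda>b. c b \<odot>\<^bsub>Q\<^esub> b) {b\<in>B. c b \<noteq> \<zero>\<^bsub>A\<^esub>}"
    unfolding P_def by blast+
  let ?S = "{b\<in>B. c b \<noteq> \<zero>\<^bsub>A\<^esub>}"
  let ?c = "\<lambda>b\<in>B. a \<otimes>\<^bsub>A\<^esub> c b" and ?z = "\<lambda>b\<in>B. \<zero>\<^bsub>A\<^esub>"
  have cA: "c b \<in> carrier A" if "b \<in> B" for b using c(1) that by auto
  have S: "{b\<in>B. ?c b \<noteq> \<zero>\<^bsub>A\<^esub>} = ?S" using a cA A.integral_iff by auto
  have "finsum Q (\<lambda>b. ?c b \<odot>\<^bsub>Q\<^esub> b) ?S = finsum Q (\<lambda>b. a \<odot>\<^bsub>Q\<^esub> (c b \<odot>\<^bsub>Q\<^esub> b)) ?S"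
    using B cA a by (intro Q.add.finprod_cong') (auto simp: Q.smult_assoc1)
  also have "\<dots> = a \<odot>\<^bsub>Q\<^esub> x"
    unfolding c(3) using B cA a c(2) by (intro Q.finsum_smult_ldistr[symmetric]) auto
  finally have "finsum Q (\<lambda>b. ?c b \<odot>\<^bsub>Q\<^esub> b) ?S = \<zero>\<^bsub>Q\<^esub>" using x(2) by simp
  then have 1: "P B \<zero>\<^bsub>Q\<^esub> ?c" unfolding P_def S using c(2) a cA by simp
  have "{b\<in>B. ?z b \<noteq> \<zero>\<^bsub>A\<^esub>} = {}" by auto
  then have 2: "P B \<zero>\<^bsub>Q\<^esub> ?z" unfolding P_def by simp
  have cz: "?c = ?z" using bspec[OF u Q.zero_closed] 1 2 by blast
  have "c b = \<zero>\<^bsub>A\<^esub>" if "b \<in> B" for b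
    using fun_cong[OF cz, of b] that a cA[OF that] A.integral_iff by simp
  then have S0: "?S = {}" by blast
  show ?thesis using c(3) unfolding S0 by simp
qed

section \<open>Graded modules with commuting structure maps\<close>

locale xmod = base_change D A \<phi> for D :: "'v::real_vector root_datum" and A :: "'a ring" and \<phi> +
  fixes M :: "('a, 'm, 'v) xobj" (structure)
  assumes gd: "graded_data D A M" and x1: "X1 D A M" and x2: "X2 D \<phi> M"
begin

abbreviation "EM \<equiv> endo_ring M"

lemma module_M: "module A M" using gd by (simp add: graded_data_def)

sublocale Mo: module A M by (rule module_M)

lemma ids: "internal_direct_sum A M (weights D) (wt M)" using gd by (simp add: graded_data_def)

lemma wt_submodule: "\<mu> \<in> weights D ==> submodule (wt M \<mu>) A M"
  using ids by (simp add: internal_direct_sum_def)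

lemma wt_closed:
  assumes "\<mu> \<in> weights D"
  shows "x \<in> wt M \<mu> ==> x \<in> carrier M"
    "x \<in> wt M \<mu> ==> y \<in> wt M \<mu> ==> x \<oplus> y \<in> wt M \<mu>"
    "x \<in> wt M \<mu> ==> \<ominus> x \<in> wt M \<mu>"
    "a \<in> carrier A ==> x \<in> wt M \<mu> ==> a \<odot> x \<in> wt M \<mu>"
    "\<zero> \<in> wt M \<mu>"
proof -
  note s = wt_submodule[OF assms]
  show "x \<in> wt M \<mu> ==> x \<in> carrier M" using Mo.submoduleE(1)[OF s] by blast
  show "x \<in> wt M \<mu> ==> y \<in> wt M \<mu> ==> x \<oplus> y \<in> wt M \<mu>" by (rule Mo.submoduleE(5)[OF s])
  show "x \<in> wt M \<mu> ==> \<ominus> x \<in> wt M \<mu>" by (rule Mo.submoduleE(3)[OF s])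
  show "a \<in> carrier A ==> x \<in> wt M \<mu> ==> a \<odot> x \<in> wt M \<mu>" by (rule Mo.submoduleE(4)[OF s])
  show "\<zero> \<in> wt M \<mu>" using subgroup.one_closed[OF submodule.axioms(1)[OF s]] by simp
qed

definition is_dec :: "'m => ('v => 'm) => bool" where
  "is_dec x g \<longleftrightarrow> g \<in> (\<Pi>\<^sub>E \<mu>\<in>weights D. wt M \<mu>) \<and> finite {\<mu>\<in>weights D. g \<mu> \<noteq> \<zero>} \<and>
      x = finsum M g {\<mu>\<in>weights D. g \<mu> \<noteq> \<zero>}"

lemma dec_ex1: "x \<in> carrier M ==> \<exists>!g. is_dec x g"
  using ids unfolding internal_direct_sum_def is_dec_def by blast

definition dec :: "'m => 'v => 'm" where "dec x = (THE g. is_dec x g)"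

lemma dec: "x \<in> carrier M ==> is_dec x (dec x)"
  unfolding dec_def by (rule theI'[OF dec_ex1])

lemma dec_unique: "x \<in> carrier M ==> is_dec x g ==> dec x = g"
  using dec_ex1[of x] dec[of x] by blast

lemma dec_wt: "x \<in> carrier M ==> \<mu> \<in> weights D ==> dec x \<mu> \<in> wt M \<mu>"
  using dec[of x] by (auto simp: is_dec_def)

lemma finsum_superset:
  assumes "finite S" "S \<subseteq> I" "\<And>i. i \<in> I ==> g i \<in> carrier M" "\<And>i. i \<in> I ==> i \<notin> S ==> g i = \<zero>" "{i \<in> I. c i} \<subseteq> S"
    "\<And>i. i \<in> I ==> \<not> c i ==> g i = \<zero>"
  shows "finsum M g {i \<in> I. c i} = finsum M g S"
  by (rule Mo.add.finprod_mono_neutral_cong_left) (use assms in auto)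

lemma is_decI:
  assumes "finite S" "S \<subseteq> weights D" "\<And>\<mu>. \<mu> \<in> weights D ==> g \<mu> \<in> wt M \<mu>"
    "\<And>\<mu>. \<mu> \<in> weights D ==> \<mu> \<notin> S ==> g \<mu> = \<zero>" "x = finsum M g S"
  shows "is_dec x (restrict g (weights D))"
proof -
  let ?g = "restrict g (weights D)"
  have sub: "{\<mu>\<in>weights D. ?g \<mu> \<noteq> \<zero>} \<subseteq> S" using assms(4) by auto
  have "finsum M ?g {\<mu>\<in>weights D. ?g \<mu> \<noteq> \<zero>} = finsum M ?g S"
    by (rule finsum_superset[OF assms(1,2) _ _ sub]) (use assms wt_closed in auto)
  also have "\<dots> = finsum M g S"
    by (rule Mo.add.finprod_cong') (use assms wt_closed in \<open>auto simp: Pi_iff subset_iff\<close>)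
  finally show ?thesis unfolding is_dec_def
    using assms finite_subset[OF sub assms(1)] by auto
qed

lemma dec_sum:
  assumes "x \<in> carrier M" "finite S" "S \<subseteq> weights D" "\<And>\<mu>. \<mu> \<in> weights D ==> dec x \<mu> \<noteq> \<zero> ==> \<mu> \<in> S"
  shows "x = finsum M (dec x) S"
proof -
  have "x = finsum M (dec x) {\<mu>\<in>weights D. dec x \<mu> \<noteq> \<zero>}" using dec[OF assms(1)] by (simp add: is_dec_def)
  also have "\<dots> = finsum M (dec x) S"
    by (rule finsum_superset[OF assms(2,3)]) (use assms dec_wt wt_closed in auto)
  finally show ?thesis .
qed

definition dsupp :: "'m => 'v set" where "dsupp x = {\<mu>\<in>weights D. dec x \<mu> \<noteq> \<zero>}"

lemma dsupp: "x \<in> carrier M ==> finite (dsupp x)" "dsupp x \<subseteq> weights D"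
  using dec[of x] by (auto simp: is_dec_def dsupp_def)

lemma dec_carrier: "x \<in> carrier M ==> \<mu> \<in> weights D ==> dec x \<mu> \<in> carrier M"
  using dec_wt wt_closed(1) by blast

lemma dec_add:
  assumes x: "x \<in> carrier M" and y: "y \<in> carrier M" and \<mu>: "\<mu> \<in> weights D"
  shows "dec (x \<oplus> y) \<mu> = dec x \<mu> \<oplus> dec y \<mu>"
proof -
  let ?S = "dsupp x \<union> dsupp y"
  have S: "finite ?S" "?S \<subseteq> weights D" using dsupp x y by auto
  have "is_dec (x \<oplus> y) (restrict (\<lambda>\<mu>. dec x \<mu> \<oplus> dec y \<mu>) (weights D))"
  proof (rule is_decI[OF S])
    have "finsum M (\<lambda>\<mu>. dec x \<mu> \<oplus> dec y \<mu>) ?S = finsum M (dec x) ?S \<oplus> finsum M (dec y) ?S"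
      by (rule Mo.finsum_addf) (use S dec_carrier x y in auto)
    also have "\<dots> = x \<oplus> y"
      using dec_sum[OF x S] dec_sum[OF y S] by (simp add: dsupp_def)
    finally show "x \<oplus> y = finsum M (\<lambda>\<mu>. dec x \<mu> \<oplus> dec y \<mu>) ?S" by simp
  qed (use dec_wt x y wt_closed(2) in \<open>auto simp: dsupp_def\<close>)
  then have "dec (x \<oplus> y) = restrict (\<lambda>\<mu>. dec x \<mu> \<oplus> dec y \<mu>) (weights D)"
    using x y by (intro dec_unique) simp_all
  then show ?thesis using \<mu> by simp
qed

lemma dec_smult:
  assumes x: "x \<in> carrier M" and a: "a \<in> carrier A" and \<mu>: "\<mu> \<in> weights D"
  shows "dec (a \<odot> x) \<mu> = a \<odot> dec x \<mu>"
proof -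
  note S = dsupp(1)[OF x] dsupp(2)[of x]
  have "is_dec (a \<odot> x) (restrict (\<lambda>\<mu>. a \<odot> dec x \<mu>) (weights D))"
  proof (rule is_decI[OF S])
    have "finsum M (\<lambda>\<mu>. a \<odot> dec x \<mu>) (dsupp x) = a \<odot> finsum M (dec x) (dsupp x)"
      by (rule Mo.finsum_smult_ldistr[symmetric]) (use S dec_carrier x a in auto)
    then show "a \<odot> x = finsum M (\<lambda>\<mu>. a \<odot> dec x \<mu>) (dsupp x)"
      using dec_sum[OF x S] by (simp add: dsupp_def)
  qed (use dec_wt x a wt_closed(4) in \<open>auto simp: dsupp_def\<close>)
  then have "dec (a \<odot> x) = restrict (\<lambda>\<mu>. a \<odot> dec x \<mu>) (weights D)"
    using x a by (intro dec_unique) simp_all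
  then show ?thesis using \<mu> by simp
qed

lemma dec_wt_eq:
  assumes \<mu>: "\<mu> \<in> weights D" and x: "x \<in> wt M \<mu>" and \<nu>: "\<nu> \<in> weights D"
  shows "dec x \<nu> = (if \<nu> = \<mu> then x else \<zero>)"
proof -
  have "is_dec x (restrict (\<lambda>\<nu>. if \<nu> = \<mu> then x else \<zero>) (weights D))"
    by (rule is_decI[of "{\<mu>}"]) (use \<mu> x wt_closed in auto)
  then show ?thesis using dec_unique[OF wt_closed(1)[OF \<mu> x]] \<nu> by simp
qed

lemma dec_zero_imp: assumes "x \<in> carrier M" "\<And>\<mu>. \<mu> \<in> weights D ==> dec x \<mu> = \<zero>" shows "x = \<zero>"
  using dec_sum[OF assms(1), of "{}"] assms(2) by simp

lemma wt_induct:
  assumes x: "x \<in> carrier M" and add: "\<And>x y. x \<in> carrier M ==> y \<in> carrier M ==> P x ==> P y ==> P (x \<oplus> y)"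
    and z: "P \<zero>" and wt: "\<And>\<mu> x. \<mu> \<in> weights D ==> x \<in> wt M \<mu> ==> P x"
  shows "P x"
proof -
  have "P (finsum M (dec x) S)" if "finite S" "S \<subseteq> weights D" for S
    using that
  proof (induction rule: finite_induct)
    case empty then show ?case using z by simp
  next
    case (insert \<mu> S)
    then show ?case
      using add[OF _ _ wt[OF _ dec_wt[OF x]], of \<mu> "finsum M (dec x) S"] dec_carrier[OF x]
      by (simp add: Pi_iff subset_iff)
  qed
  from this[OF dsupp(1)[OF x] dsupp(2)] show ?thesis
    using dec_sum[OF x dsupp(1)[OF x] dsupp(2)] by (simp add: dsupp_def)
qed

definition lend :: "('m => 'm) set" where
  "lend = {T \<in> carrier EM. \<forall>a\<in>carrier A. \<forall>x\<in>carrier M. T (a \<odot> x) = a \<odot> T x}"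

lemma lend_endo: "T \<in> lend ==> T \<in> carrier EM"
  and lend_closed: "T \<in> lend ==> x \<in> carrier M ==> T x \<in> carrier M"
  and lend_add: "T \<in> lend ==> x \<in> carrier M ==> y \<in> carrier M ==> T (x \<oplus> y) = T x \<oplus> T y"
  and lend_smult: "T \<in> lend ==> a \<in> carrier A ==> x \<in> carrier M ==> T (a \<odot> x) = a \<odot> T x"
  by (auto simp: lend_def endo_closed endo_add)

lemma lend_zero: "T \<in> lend ==> T \<zero> = \<zero>"
  using lend_smult[of T "\<zero>\<^bsub>A\<^esub>" "\<zero>"] lend_closed[of T "\<zero>"] by simp

lemma lend_eqI:
  assumes "S \<in> lend" "T \<in> lend" "\<And>\<mu> x. \<mu> \<in> weights D ==> x \<in> wt M \<mu> ==> S x = T x"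
  shows "S = T"
proof (rule endo_eqI[OF lend_endo[OF assms(1)] lend_endo[OF assms(2)]])
  fix x assume "x \<in> carrier M"
  then show "S x = T x"
    by (rule wt_induct) (simp_all add: assms lend_add lend_zero)
qed

text \<open>The operator on \<open>M\<close> assembled from maps on the homogeneous components.\<close>

definition glue :: "('v => 'm => 'm) => 'm => 'm" where
  "glue t = (\<lambda>x\<in>carrier M. finsum M (\<lambda>\<mu>. t \<mu> (dec x \<mu>)) (dsupp x))"

definition graded_map :: "('v => 'm => 'm) => bool" where
  "graded_map t \<longleftrightarrow> (\<forall>\<mu>\<in>weights D. \<forall>x\<in>wt M \<mu>. t \<mu> x \<in> carrier M \<and>
      (\<forall>y\<in>wt M \<mu>. t \<mu> (x \<oplus> y) = t \<mu> x \<oplus> t \<mu> y) \<and> (\<forall>a\<in>carrier A. t \<mu> (a \<odot> x) = a \<odot> t \<mu> x))"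

lemma glue:
  assumes t: "graded_map t"
  shows "glue t \<in> lend" "\<mu> \<in> weights D ==> x \<in> wt M \<mu> ==> glue t x = t \<mu> x"
proof -
  have tc: "t \<mu> x \<in> carrier M" if "\<mu> \<in> weights D" "x \<in> wt M \<mu>" for \<mu> x
    using t that by (auto simp: graded_map_def)
  have ta: "t \<mu> (x \<oplus> y) = t \<mu> x \<oplus> t \<mu> y" if "\<mu> \<in> weights D" "x \<in> wt M \<mu>" "y \<in> wt M \<mu>" for \<mu> x y
    using t that by (auto simp: graded_map_def)
  have ts: "t \<mu> (a \<odot> x) = a \<odot> t \<mu> x" if "\<mu> \<in> weights D" "x \<in> wt M \<mu>" "a \<in> carrier A" for \<mu> x a
    using t that by (auto simp: graded_map_def)
  have t0: "t \<mu> \<zero> = \<zero>" if "\<mu> \<in> weights D" for \<mu>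
    using ts[OF that wt_closed(5)[OF that] A.zero_closed] tc[OF that wt_closed(5)[OF that]] by simp
  have td: "t \<mu> (dec x \<mu>) \<in> carrier M" if "\<mu> \<in> weights D" "x \<in> carrier M" for \<mu> x
    using that by (intro tc dec_wt)
  have sup: "glue t x = finsum M (\<lambda>\<mu>. t \<mu> (dec x \<mu>)) S"
    if x: "x \<in> carrier M" and S: "finite S" "S \<subseteq> weights D" "dsupp x \<subseteq> S" for x S
  proof -
    have "finsum M (\<lambda>\<mu>. t \<mu> (dec x \<mu>)) {\<mu>\<in>weights D. dec x \<mu> \<noteq> \<zero>} = finsum M (\<lambda>\<mu>. t \<mu> (dec x \<mu>)) S"
      by (rule finsum_superset[OF S(1,2)]) (use td x t0 S(3) in \<open>auto simp: dsupp_def\<close>)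
    then show ?thesis using x by (simp add: glue_def dsupp_def)
  qed
  have gc: "glue t x \<in> carrier M" if "x \<in> carrier M" for x
    using that td dsupp(2)[of x] by (auto simp: glue_def intro!: Mo.finsum_closed)
  have "glue t (x \<oplus> y) = glue t x \<oplus> glue t y" if x: "x \<in> carrier M" and y: "y \<in> carrier M" for x y
  proof -
    let ?S = "dsupp x \<union> dsupp y"
    have S: "finite ?S" "?S \<subseteq> weights D" using dsupp x y by auto
    have sub: "dsupp (x \<oplus> y) \<subseteq> ?S" using x y by (auto simp: dsupp_def dec_add)
    have "glue t (x \<oplus> y) = finsum M (\<lambda>\<mu>. t \<mu> (dec (x \<oplus> y) \<mu>)) ?S"
      using x y sub S by (intro sup) simp_all
    also have "\<dots> = finsum M (\<lambda>\<mu>. t \<mu> (dec x \<mu>) \<oplus> t \<mu> (dec y \<mu>)) ?S"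
      using S x y td by (intro Mo.add.finprod_cong') (auto simp: dec_add ta dec_wt subset_iff Pi_iff)
    also have "\<dots> = finsum M (\<lambda>\<mu>. t \<mu> (dec x \<mu>)) ?S \<oplus> finsum M (\<lambda>\<mu>. t \<mu> (dec y \<mu>)) ?S"
      by (rule Mo.finsum_addf) (use S td x y in auto)
    also have "\<dots> = glue t x \<oplus> glue t y" using sup[OF x S] sup[OF y S] by simp
    finally show ?thesis .
  qed
  moreover have "glue t (a \<odot> x) = a \<odot> glue t x" if x: "x \<in> carrier M" and a: "a \<in> carrier A" for x a
  proof -
    note S = dsupp(1)[OF x] dsupp(2)[of x]
    have sub: "dsupp (a \<odot> x) \<subseteq> dsupp x" using x a by (auto simp: dsupp_def dec_smult)
    have "glue t (a \<odot> x) = finsum M (\<lambda>\<mu>. t \<mu> (dec (a \<odot> x) \<mu>)) (dsupp x)"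
      using x a sub S by (intro sup) simp_all
    also have "\<dots> = finsum M (\<lambda>\<mu>. a \<odot> t \<mu> (dec x \<mu>)) (dsupp x)"
      using S x a td by (intro Mo.add.finprod_cong') (auto simp: dec_smult ts dec_wt subset_iff Pi_iff)
    also have "\<dots> = a \<odot> finsum M (\<lambda>\<mu>. t \<mu> (dec x \<mu>)) (dsupp x)"
      by (rule Mo.finsum_smult_ldistr[symmetric]) (use S td x a in auto)
    also have "\<dots> = a \<odot> glue t x" using x by (simp add: glue_def)
    finally show ?thesis .
  qed
  ultimately show "glue t \<in> lend" using gc by (auto simp: lend_def endo_carrier glue_def)
  show "glue t x = t \<mu> x" if \<mu>: "\<mu> \<in> weights D" and x: "x \<in> wt M \<mu>" for \<mu> x
  proof -
    have "glue t x = finsum M (\<lambda>\<mu>. t \<mu> (dec x \<mu>)) {\<mu>}"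
      by (rule sup) (use \<mu> x wt_closed in \<open>auto simp: dsupp_def dec_wt_eq split: if_splits\<close>)
    then show ?thesis using \<mu> x tc by (simp add: dec_wt_eq)
  qed
qed

lemma lend_ops:
  "S \<in> lend ==> T \<in> lend ==> S \<otimes>\<^bsub>EM\<^esub> T \<in> lend"
  "S \<in> lend ==> T \<in> lend ==> S \<oplus>\<^bsub>EM\<^esub> T \<in> lend"
  using endo_ops_closed[OF Mo.abelian_group_axioms]
  by (simp_all add: lend_def endo_simps endo_closed Mo.smult_r_distr)

definition scal :: "'a => 'm => 'm" where "scal a = (\<lambda>x\<in>carrier M. a \<odot> x)"

lemma scal_lend: "a \<in> carrier A ==> scal a \<in> lend"
  by (auto simp: scal_def lend_def endo_carrier Mo.smult_r_distr Mo.smult_assoc1[symmetric] A.m_comm)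

end

section \<open>Divided powers on highest weight modules\<close>

context hw
begin

lemma dpow_E_F_weight:
  assumes \<alpha>: "\<alpha> \<in> simples D" and y: "K \<alpha> y = sca (x \<alpha> powi p) y" "L \<alpha> y = sca (x \<alpha> powi - p) y"
  shows "dpow (x \<alpha>) (E \<alpha>) m (dpow (x \<alpha>) (Fo \<alpha>) n y)
    = (\<Sum>r\<in>{0..min m n}. sca (qchoose (x \<alpha>) (p + int m - int n) r)
        (dpow (x \<alpha>) (Fo \<alpha>) (n - r) (dpow (x \<alpha>) (E \<alpha>) (m - r) y)))"
proof -
  interpret r: rank1 "x \<alpha>" "E \<alpha>" "Fo \<alpha>" "K \<alpha>" "L \<alpha>" UNIV by (rule rank1[OF \<alpha>])
  have KE: "K \<alpha> (dpow (x \<alpha>) (E \<alpha>) j y) = sca (x \<alpha> powi (p + 2 * int j)) (dpow (x \<alpha>) (E \<alpha>) j y)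
     \<and> L \<alpha> (dpow (x \<alpha>) (E \<alpha>) j y) = sca (x \<alpha> powi - (p + 2 * int j)) (dpow (x \<alpha>) (E \<alpha>) j y)" for j
  proof (induction j)
    case 0 show ?case using y by (simp del: vop.simps)
  next
    case (Suc j)
    let ?z = "dpow (x \<alpha>) (E \<alpha>) j y"
    have s: "2 + (p + 2 * int j) = p + 2 * int (Suc j)" "- 2 + - (p + 2 * int j) = - (p + 2 * int (Suc j))" by simp_all
    have "K \<alpha> (E \<alpha> ?z) = sca (x \<alpha> powi (p + 2 * int (Suc j))) (E \<alpha> ?z)"
      by (simp only: K_E pr_self[OF \<alpha>] conjunct1[OF Suc] linop_sca[OF linop_vop] sca_simps(1) r.xx s)
    moreover have "L \<alpha> (E \<alpha> ?z) = sca (x \<alpha> powi - (p + 2 * int (Suc j))) (E \<alpha> ?z)"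
      by (simp only: L_E pr_self[OF \<alpha>] conjunct2[OF Suc] linop_sca[OF linop_vop] sca_simps(1) r.xx s)
    ultimately show ?case
      by (simp only: dpow_Suc'[OF r.gen r.lin(1)] linop_sca[OF linop_vop] sca_simps(1) mult.commute simp_thms)
  qed
  \<comment> \<open>On a weight vector the torus factor in the commutation formula is a scalar.\<close>
  have t: "r.hop (2 * int i - int m - int n) i (dpow (x \<alpha>) (E \<alpha>) (m - i) y)
    = sca (qchoose (x \<alpha>) (p + int m - int n) i) (dpow (x \<alpha>) (E \<alpha>) (m - i) y)" if "i \<le> m" for i
    using r.hop_weight[OF conjunct1[OF KE] conjunct2[OF KE], of "2 * int i - int m - int n" i "m - i"] that
    by (simp add: of_nat_diff algebra_simps del: vop.simps)
  have "dpow (x \<alpha>) (E \<alpha>) m (dpow (x \<alpha>) (Fo \<alpha>) n y)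
    = (\<Sum>i\<le>m. dpowi (x \<alpha>) (Fo \<alpha>) (int n - int i) (sca (qchoose (x \<alpha>) (p + int m - int n) i) (dpow (x \<alpha>) (E \<alpha>) (m - i) y)))"
    unfolding r.dpow_e_dpow_f[OF UNIV_I] by (rule sum.cong) (simp_all only: atMost_iff t)
  also have "\<dots> = (\<Sum>i\<in>{0..min m n}. dpowi (x \<alpha>) (Fo \<alpha>) (int n - int i) (sca (qchoose (x \<alpha>) (p + int m - int n) i) (dpow (x \<alpha>) (E \<alpha>) (m - i) y)))"
    by (rule sum.mono_neutral_right) (auto simp: dpowi_def)
  also have "\<dots> = (\<Sum>r\<in>{0..min m n}. sca (qchoose (x \<alpha>) (p + int m - int n) r)
        (dpow (x \<alpha>) (Fo \<alpha>) (n - r) (dpow (x \<alpha>) (E \<alpha>) (m - r) y)))"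
  proof (rule sum.cong[OF refl])
    fix i assume "i \<in> {0..min m n}"
    then have "int n - int i = int (n - i)" by simp
    then show "dpowi (x \<alpha>) (Fo \<alpha>) (int n - int i) (sca (qchoose (x \<alpha>) (p + int m - int n) i) (dpow (x \<alpha>) (E \<alpha>) (m - i) y))
      = sca (qchoose (x \<alpha>) (p + int m - int n) i) (dpow (x \<alpha>) (Fo \<alpha>) (n - i) (dpow (x \<alpha>) (E \<alpha>) (m - i) y))"
      by (simp only: dpowi_of_nat linop_sca[OF linop_dpow[OF linop_vop]])
  qed
  finally show ?thesis .
qed

lemma dpow_E_F_comm:
  assumes "\<alpha> \<noteq> \<beta>"
  shows "dpow c (E \<alpha>) m (dpow d (Fo \<beta>) n y) = dpow d (Fo \<beta>) n (dpow c (E \<alpha>) m y)"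
proof -
  have 1: "Fo \<beta> (dpow c (E \<alpha>) m z) = dpow c (E \<alpha>) m (Fo \<beta> z)" for z
    by (rule dpow_commute[where C = UNIV]) (simp_all only: linop_vop UNIV_I E_F[OF assms])
  show ?thesis
    by (rule dpow_commute[where C = UNIV]) (simp_all only: linop_vop linop_dpow UNIV_I 1)
qed

lemma K_dpow_F:
  assumes \<alpha>: "\<alpha> \<in> simples D"
  shows "K \<alpha> (dpow c (Fo \<beta>) n y) = sca (x \<alpha> powi (- int n * pr D \<beta> \<alpha>)) (dpow c (Fo \<beta>) n (K \<alpha> y))"
    "L \<alpha> (dpow c (Fo \<beta>) n y) = sca (x \<alpha> powi (int n * pr D \<beta> \<alpha>)) (dpow c (Fo \<beta>) n (L \<alpha> y))"
proof -
  have "K \<alpha> ((Fo \<beta> ^^ n) y) = sca (x \<alpha> powi (- int n * pr D \<beta> \<alpha>)) ((Fo \<beta> ^^ n) (K \<alpha> y))"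
    by (induction n) (simp_all add: K_F linop_sca[OF linop_vop] power_int_add[symmetric] algebra_simps del: vop.simps)
  then show "K \<alpha> (dpow c (Fo \<beta>) n y) = sca (x \<alpha> powi (- int n * pr D \<beta> \<alpha>)) (dpow c (Fo \<beta>) n (K \<alpha> y))"
    by (simp add: dpow_def linop_sca[OF linop_vop] mult.commute del: vop.simps)
  have "L \<alpha> ((Fo \<beta> ^^ n) y) = sca (x \<alpha> powi (int n * pr D \<beta> \<alpha>)) ((Fo \<beta> ^^ n) (L \<alpha> y))"
    by (induction n) (simp_all add: L_F[OF \<alpha>] linop_sca[OF linop_vop] power_int_add[symmetric] algebra_simps del: vop.simps)
  then show "L \<alpha> (dpow c (Fo \<beta>) n y) = sca (x \<alpha> powi (int n * pr D \<beta> \<alpha>)) (dpow c (Fo \<beta>) n (L \<alpha> y))"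
    by (simp add: dpow_def linop_sca[OF linop_vop] mult.commute del: vop.simps)
qed

text \<open>Words of length \<open>h\<close> with letters of sum \<open>\<nu> - \<mu>\<close>. The length separates the highest weight vector from all lower ones.\<close>

definition homog :: "int => 'v => ('v list => qrat) => bool" where
  "homog h \<mu> y \<longleftrightarrow> (\<forall>w. y w \<noteq> 0 \<longrightarrow> int (length w) = h \<and> \<nu> - sum_list w = \<mu>)"

lemma frec_support:
  assumes "frec D \<alpha> m y w \<noteq> 0"
  shows "\<exists>u. y u \<noteq> 0 \<and> length w = Suc (length u) \<and> sum_list w = sum_list u + \<alpha>"
  using assms
proof (induction w arbitrary: m y)
  case Nil then show ?case by simp
next
  case (Cons \<beta> w)
  show ?case
  proof (cases "frec D \<alpha> (m - pr D \<beta> \<alpha>) (\<lambda>u. y (\<beta> # u)) w = 0")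
    case True
    have "(if \<beta> = \<alpha> then qnum (x \<alpha>) m * y w else 0) \<noteq> 0"
      using Cons.prems unfolding frec.simps True by simp
    then have "\<beta> = \<alpha>" "y w \<noteq> 0" by (simp_all split: if_splits)
    then show ?thesis by (intro exI[of _ w]) (simp add: add.commute)
  next
    case False
    obtain u where u: "y (\<beta> # u) \<noteq> 0" "length w = Suc (length u)" "sum_list w = sum_list u + \<alpha>"
      using Cons.IH[OF False] by (elim exE conjE)
    show ?thesis by (rule exI[of _ "\<beta> # u"]) (use u in \<open>simp add: add.assoc\<close>)
  qed
qed

lemma homog_F: assumes y: "homog h \<mu> y" shows "homog (h + 1) (\<mu> - \<alpha>) (Fo \<alpha> y)"
  unfolding homog_def
proof (intro allI impI)
  fix w assume "Fo \<alpha> y w \<noteq> 0"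
  then obtain u where u: "y u \<noteq> 0" "length w = Suc (length u)" "sum_list w = sum_list u + \<alpha>"
    using frec_support[of \<alpha> "pr D \<nu> \<alpha>" y w] by auto
  then have "int (length u) = h" "\<nu> - sum_list u = \<mu>" using y unfolding homog_def by blast+
  then show "int (length w) = h + 1 \<and> \<nu> - sum_list w = \<mu> - \<alpha>" using u by (simp add: algebra_simps)
qed

lemma homog_dpow: assumes "homog h \<mu> y" shows "homog (h + int n) (\<mu> - real n *\<^sub>R \<alpha>) (dpow c (Fo \<alpha>) n y)"
proof -
  have "homog (h + int n) (\<mu> - real n *\<^sub>R \<alpha>) ((Fo \<alpha> ^^ n) y)"
  proof (induction n)
    case (Suc n)
    have "homog (h + int n + 1) (\<mu> - real n *\<^sub>R \<alpha> - \<alpha>) (Fo \<alpha> ((Fo \<alpha> ^^ n) y))" by (rule homog_F[OF Suc])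
    moreover have "\<mu> - real n *\<^sub>R \<alpha> - \<alpha> = \<mu> - real (Suc n) *\<^sub>R \<alpha>" by (simp add: scaleR_left_distrib)
    ultimately show ?case by (simp add: algebra_simps del: vop.simps)
  qed (simp add: assms)
  then show ?thesis unfolding dpow_def homog_def by (simp add: sca_apply del: vop.simps)
qed

end

section \<open>Structure maps as global operators\<close>

context xmod
begin

lemma Emap0_props:
  assumes \<mu>: "\<mu> \<in> weights D" and \<alpha>: "\<alpha> \<in> simples D" and x: "x \<in> wt M \<mu>"
  shows "Emap0 M \<mu> \<alpha> n x \<in> wt M (wshift \<mu> n \<alpha>)"
    "y \<in> wt M \<mu> ==> Emap0 M \<mu> \<alpha> n (x \<oplus> y) = Emap0 M \<mu> \<alpha> n x \<oplus> Emap0 M \<mu> \<alpha> n y"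
    "a \<in> carrier A ==> Emap0 M \<mu> \<alpha> n (a \<odot> x) = a \<odot> Emap0 M \<mu> \<alpha> n x"
proof -
  have E: "Emap M \<mu> \<alpha> n \<in> lin_maps A (wspace M \<mu>) (wspace M (wshift \<mu> n \<alpha>))" if "n > 0"
    using gd \<mu> \<alpha> that by (simp add: graded_data_def)
  show "Emap0 M \<mu> \<alpha> n x \<in> wt M (wshift \<mu> n \<alpha>)"
    using E x by (cases "n = 0") (auto simp: Emap0_def lin_maps_def)
  show "y \<in> wt M \<mu> ==> Emap0 M \<mu> \<alpha> n (x \<oplus> y) = Emap0 M \<mu> \<alpha> n x \<oplus> Emap0 M \<mu> \<alpha> n y"
    using E x by (cases "n = 0") (auto simp: Emap0_def lin_maps_def)
  show "a \<in> carrier A ==> Emap0 M \<mu> \<alpha> n (a \<odot> x) = a \<odot> Emap0 M \<mu> \<alpha> n x"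
    using E x by (cases "n = 0") (auto simp: Emap0_def lin_maps_def)
qed

lemma Fmap0_props:
  assumes \<mu>: "\<mu> \<in> weights D" and \<alpha>: "\<alpha> \<in> simples D" and x: "x \<in> wt M (wshift \<mu> n \<alpha>)"
  shows "Fmap0 M \<mu> \<alpha> n x \<in> wt M \<mu>"
    "y \<in> wt M (wshift \<mu> n \<alpha>) ==> Fmap0 M \<mu> \<alpha> n (x \<oplus> y) = Fmap0 M \<mu> \<alpha> n x \<oplus> Fmap0 M \<mu> \<alpha> n y"
    "a \<in> carrier A ==> Fmap0 M \<mu> \<alpha> n (a \<odot> x) = a \<odot> Fmap0 M \<mu> \<alpha> n x"
proof -
  have E: "Fmap M \<mu> \<alpha> n \<in> lin_maps A (wspace M (wshift \<mu> n \<alpha>)) (wspace M \<mu>)" if "n > 0"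
    using gd \<mu> \<alpha> that by (simp add: graded_data_def)
  show "Fmap0 M \<mu> \<alpha> n x \<in> wt M \<mu>"
    using E x by (cases "n = 0") (auto simp: Fmap0_def lin_maps_def)
  show "y \<in> wt M (wshift \<mu> n \<alpha>) ==> Fmap0 M \<mu> \<alpha> n (x \<oplus> y) = Fmap0 M \<mu> \<alpha> n x \<oplus> Fmap0 M \<mu> \<alpha> n y"
    using E x by (cases "n = 0") (auto simp: Fmap0_def lin_maps_def)
  show "a \<in> carrier A ==> Fmap0 M \<mu> \<alpha> n (a \<odot> x) = a \<odot> Fmap0 M \<mu> \<alpha> n x"
    using E x by (cases "n = 0") (auto simp: Fmap0_def lin_maps_def)
qed

text \<open>The index \<open>\<mu>\<close> of a structure map is determined by the weight of its argument, so each family of structure maps is one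
operator on \<open>M\<close>; \<open>F\<close> from weight \<open>\<mu>\<close> has index \<open>\<mu> - n \<alpha>\<close>. On weight vectors the operators with \<open>n = 0\<close> are the identity. In \<open>Kop\<close> the sign \<open>s\<close> is \<open>1\<close> for
\<open>k\<^sub>\<alpha>\<close> and \<open>-1\<close> for its inverse.\<close>

definition "Eop \<alpha> n = glue (\<lambda>\<mu>. Emap0 M \<mu> \<alpha> n)"
definition "Fop \<alpha> n = glue (\<lambda>\<mu>. Fmap0 M (\<mu> - real n *\<^sub>R \<alpha>) \<alpha> n)"
definition "Kop \<alpha> s = glue (\<lambda>\<mu> x. \<phi> (qv powi (s * (int (dnum D \<alpha>) * pr D \<mu> \<alpha>))) \<odot> x)"

lemma Eop:
  assumes \<alpha>: "\<alpha> \<in> simples D"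
  shows "Eop \<alpha> n \<in> lend" "\<mu> \<in> weights D ==> x \<in> wt M \<mu> ==> Eop \<alpha> n x = Emap0 M \<mu> \<alpha> n x"
    "\<mu> \<in> weights D ==> x \<in> wt M \<mu> ==> Eop \<alpha> n x \<in> wt M (wshift \<mu> n \<alpha>)"
proof -
  have g: "graded_map (\<lambda>\<mu>. Emap0 M \<mu> \<alpha> n)"
    unfolding graded_map_def
    using Emap0_props[OF _ \<alpha>] wt_closed(1)[OF weights_shift[OF _ \<alpha>]] by blast
  show "Eop \<alpha> n \<in> lend" unfolding Eop_def by (rule glue(1)[OF g])
  show e: "\<mu> \<in> weights D ==> x \<in> wt M \<mu> ==> Eop \<alpha> n x = Emap0 M \<mu> \<alpha> n x"
    unfolding Eop_def by (rule glue(2)[OF g])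
  show "\<mu> \<in> weights D ==> x \<in> wt M \<mu> ==> Eop \<alpha> n x \<in> wt M (wshift \<mu> n \<alpha>)"
    using e Emap0_props(1)[OF _ \<alpha>] by simp
qed

lemma Fop:
  assumes \<alpha>: "\<alpha> \<in> simples D"
  shows "Fop \<alpha> n \<in> lend" "\<mu> \<in> weights D ==> x \<in> wt M \<mu> ==> Fop \<alpha> n x = Fmap0 M (\<mu> - real n *\<^sub>R \<alpha>) \<alpha> n x"
    "\<mu> \<in> weights D ==> x \<in> wt M \<mu> ==> Fop \<alpha> n x \<in> wt M (\<mu> - real n *\<^sub>R \<alpha>)"
proof -
  have F: "Fmap0 M (\<mu> - real n *\<^sub>R \<alpha>) \<alpha> n x \<in> wt M (\<mu> - real n *\<^sub>R \<alpha>)"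
    "y \<in> wt M \<mu> ==> Fmap0 M (\<mu> - real n *\<^sub>R \<alpha>) \<alpha> n (x \<oplus> y)
        = Fmap0 M (\<mu> - real n *\<^sub>R \<alpha>) \<alpha> n x \<oplus> Fmap0 M (\<mu> - real n *\<^sub>R \<alpha>) \<alpha> n y"
    "a \<in> carrier A ==> Fmap0 M (\<mu> - real n *\<^sub>R \<alpha>) \<alpha> n (a \<odot> x) = a \<odot> Fmap0 M (\<mu> - real n *\<^sub>R \<alpha>) \<alpha> n x"
    if "\<mu> \<in> weights D" "x \<in> wt M \<mu>" for \<mu> x y a
    using Fmap0_props[OF weights_unshift[OF that(1) \<alpha>, of n] \<alpha>, where x = x and n = n] that(2) by simp_all
  have g: "graded_map (\<lambda>\<mu>. Fmap0 M (\<mu> - real n *\<^sub>R \<alpha>) \<alpha> n)"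
    unfolding graded_map_def
    using F wt_closed(1)[OF weights_unshift[OF _ \<alpha>]] by blast
  show "Fop \<alpha> n \<in> lend" unfolding Fop_def by (rule glue(1)[OF g])
  show e: "\<mu> \<in> weights D ==> x \<in> wt M \<mu> ==> Fop \<alpha> n x = Fmap0 M (\<mu> - real n *\<^sub>R \<alpha>) \<alpha> n x"
    unfolding Fop_def by (rule glue(2)[OF g])
  show "\<mu> \<in> weights D ==> x \<in> wt M \<mu> ==> Fop \<alpha> n x \<in> wt M (\<mu> - real n *\<^sub>R \<alpha>)"
    using e F(1) by simp
qed

lemma Kop:
  shows "Kop \<alpha> s \<in> lend"
    "\<mu> \<in> weights D ==> x \<in> wt M \<mu> ==> Kop \<alpha> s x = \<phi> (qv powi (s * (int (dnum D \<alpha>) * pr D \<mu> \<alpha>))) \<odot> x"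
proof -
  have g: "graded_map (\<lambda>\<mu> x. \<phi> (qv powi (s * (int (dnum D \<alpha>) * pr D \<mu> \<alpha>))) \<odot> x)"
    unfolding graded_map_def
    using wt_closed(1) by (simp add: Laurent_closed Mo.smult_r_distr Mo.smult_assoc1[symmetric] A.m_comm)
  show "Kop \<alpha> s \<in> lend" unfolding Kop_def by (rule glue(1)[OF g])
  show "\<mu> \<in> weights D ==> x \<in> wt M \<mu> ==> Kop \<alpha> s x = \<phi> (qv powi (s * (int (dnum D \<alpha>) * pr D \<mu> \<alpha>))) \<odot> x"
    unfolding Kop_def by (rule glue(2)[OF g])
qed

lemma Eop_0: "\<alpha> \<in> simples D ==> \<mu> \<in> weights D ==> x \<in> wt M \<mu> ==> Eop \<alpha> 0 x = x"
  and Fop_0: "\<alpha> \<in> simples D ==> \<mu> \<in> weights D ==> x \<in> wt M \<mu> ==> Fop \<alpha> 0 x = x"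
  by (simp_all add: Eop(2) Fop(2) Emap0_def Fmap0_def)

lemma E_F_ne:
  assumes \<alpha>: "\<alpha> \<in> simples D" and \<beta>: "\<beta> \<in> simples D" and ne: "\<alpha> \<noteq> \<beta>" and \<nu>: "\<nu> \<in> weights D" and x: "x \<in> wt M \<nu>"
  shows "Eop \<alpha> m (Fop \<beta> n x) = Fop \<beta> n (Eop \<alpha> m x)"
proof -
  let ?\<mu> = "\<nu> - real n *\<^sub>R \<beta>"
  have \<mu>: "?\<mu> \<in> weights D" by (rule weights_unshift[OF \<nu> \<beta>])
  have F: "Fop \<beta> n x \<in> wt M ?\<mu>" by (rule Fop(3)[OF \<beta> \<nu> x])
  have E: "Eop \<alpha> m x \<in> wt M (wshift \<nu> m \<alpha>)" by (rule Eop(3)[OF \<alpha> \<nu> x])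
  have s: "wshift \<nu> m \<alpha> - real n *\<^sub>R \<beta> = wshift ?\<mu> m \<alpha>" by simp
  consider "m = 0" | "n = 0" | "m > 0" "n > 0" by blast
  then show ?thesis
  proof cases
    case 1 then show ?thesis using Eop_0[OF \<alpha> \<mu> F] Eop_0[OF \<alpha> \<nu> x] by simp
  next
    case 2 then show ?thesis using Fop_0[OF \<beta> weights_shift[OF \<nu> \<alpha>] E] Fop_0[OF \<beta> \<nu> x] by simp
  next
    case 3
    have "Emap M ?\<mu> \<alpha> m (Fmap M ?\<mu> \<beta> n x) = Fmap M (wshift ?\<mu> m \<alpha>) \<beta> n (Emap M (wshift ?\<mu> n \<beta>) \<alpha> m x)"
      using x2 \<mu> \<alpha> \<beta> 3 x ne unfolding X2_def by simp
    moreover have "Eop \<alpha> m (Fop \<beta> n x) = Emap M ?\<mu> \<alpha> m (Fmap M ?\<mu> \<beta> n x)"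
      unfolding Eop(2)[OF \<alpha> \<mu> F, of m] unfolding Fop(2)[OF \<beta> \<nu> x] using 3 by (simp add: Emap0_def Fmap0_def)
    moreover have "Fop \<beta> n (Eop \<alpha> m x) = Fmap M (wshift ?\<mu> m \<alpha>) \<beta> n (Emap M \<nu> \<alpha> m x)"
      unfolding Fop(2)[OF \<beta> weights_shift[OF \<nu> \<alpha>] E] s unfolding Eop(2)[OF \<alpha> \<nu> x] using 3 by (simp add: Emap0_def Fmap0_def)
    ultimately show ?thesis by simp
  qed
qed

lemma E_F_eq:
  assumes \<alpha>: "\<alpha> \<in> simples D" and \<nu>: "\<nu> \<in> weights D" and x: "x \<in> wt M \<nu>"
  shows "Eop \<alpha> m (Fop \<alpha> n x) = finsum M (\<lambda>r. \<phi> (qbinom (dnum D \<alpha>) (pr D \<nu> \<alpha> + int m - int n) r) \<odot>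
      Fop \<alpha> (n - r) (Eop \<alpha> (m - r) x)) {0..min m n}"
proof -
  let ?\<mu> = "\<nu> - real n *\<^sub>R \<alpha>"
  have \<mu>: "?\<mu> \<in> weights D" by (rule weights_unshift[OF \<nu> \<alpha>])
  have F: "Fop \<alpha> n x \<in> wt M ?\<mu>" by (rule Fop(3)[OF \<alpha> \<nu> x])
  have E: "Eop \<alpha> j x \<in> wt M (wshift \<nu> j \<alpha>)" for j by (rule Eop(3)[OF \<alpha> \<nu> x])
  have q0: "qbinom d p 0 = 1" for d p by (simp add: qbinom_def)
  have o: "\<phi> 1 \<odot> y = y" if "y \<in> carrier M" for y using that by (simp add: phi_simps)
  consider "m = 0" | "n = 0" | "m > 0" "n > 0" by blast
  then show ?thesis
  proof cases
    case 1
    have "Fop \<alpha> n x \<in> carrier M" using F \<mu> wt_closed(1) by blast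
    then show ?thesis using 1 Eop_0[OF \<alpha> \<mu> F] Eop_0[OF \<alpha> \<nu> x] by (simp add: q0 o)
  next
    case 2
    have "Eop \<alpha> m x \<in> carrier M" using E weights_shift[OF \<nu> \<alpha>] wt_closed(1) by blast
    then show ?thesis using 2 Fop_0[OF \<alpha> weights_shift[OF \<nu> \<alpha>] E] Fop_0[OF \<alpha> \<nu> x] by (simp add: q0 o)
  next
    case 3
    have sx: "wshift ?\<mu> n \<alpha> = \<nu>" by simp
    have p: "pr D ?\<mu> \<alpha> + int m + int n = pr D \<nu> \<alpha> + int m - int n"
      using pr_unshift[OF \<nu> \<alpha> \<alpha>, of n] pr_self[OF \<alpha>] by simp
    have "Emap M ?\<mu> \<alpha> m (Fmap M ?\<mu> \<alpha> n x) = finsum M (\<lambda>r. \<phi> (qbinom (dnum D \<alpha>) (pr D ?\<mu> \<alpha> + int m + int n) r) \<odot>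
        Fmap0 M (wshift ?\<mu> m \<alpha>) \<alpha> (n - r) (Emap0 M (wshift ?\<mu> n \<alpha>) \<alpha> (m - r) x)) {0..min m n}"
      using x2 \<mu> \<alpha> 3 x unfolding X2_def by simp
    also have "\<dots> = finsum M (\<lambda>r. \<phi> (qbinom (dnum D \<alpha>) (pr D \<nu> \<alpha> + int m - int n) r) \<odot>
      Fop \<alpha> (n - r) (Eop \<alpha> (m - r) x)) {0..min m n}"
    proof (rule Mo.add.finprod_cong'[OF refl])
      have t: "Fop \<alpha> (n - r) (Eop \<alpha> (m - r) x) = Fmap0 M (wshift ?\<mu> m \<alpha>) \<alpha> (n - r) (Emap0 M (wshift ?\<mu> n \<alpha>) \<alpha> (m - r) x)"
        if "r \<in> {0..min m n}" for r
      proof -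
        have "wshift \<nu> (m - r) \<alpha> - real (n - r) *\<^sub>R \<alpha> = wshift ?\<mu> m \<alpha>"
          using that by (simp add: of_nat_diff scaleR_left_diff_distrib)
        then show ?thesis
          by (simp only: sx Eop(2)[OF \<alpha> \<nu> x, symmetric] Fop(2)[OF \<alpha> weights_shift[OF \<nu> \<alpha>] E])
      qed
      show "\<phi> (qbinom (dnum D \<alpha>) (pr D ?\<mu> \<alpha> + int m + int n) r) \<odot>
        Fmap0 M (wshift ?\<mu> m \<alpha>) \<alpha> (n - r) (Emap0 M (wshift ?\<mu> n \<alpha>) \<alpha> (m - r) x)
        = \<phi> (qbinom (dnum D \<alpha>) (pr D \<nu> \<alpha> + int m - int n) r) \<odot> Fop \<alpha> (n - r) (Eop \<alpha> (m - r) x)"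
        if "r \<in> {0..min m n}" for r by (simp only: p t[OF that])
      show "(\<lambda>r. \<phi> (qbinom (dnum D \<alpha>) (pr D \<nu> \<alpha> + int m - int n) r) \<odot> Fop \<alpha> (n - r) (Eop \<alpha> (m - r) x)) \<in> {0..min m n} \<rightarrow> carrier M"
        using lend_closed[OF Fop(1)[OF \<alpha>] lend_closed[OF Eop(1)[OF \<alpha>] wt_closed(1)[OF \<nu> x]]] qbinom_Laurent[OF dnum_pos[OF \<alpha>]] by simp
    qed
    moreover have "Eop \<alpha> m (Fop \<alpha> n x) = Emap M ?\<mu> \<alpha> m (Fmap M ?\<mu> \<alpha> n x)"
      unfolding Eop(2)[OF \<alpha> \<mu> F, of m] unfolding Fop(2)[OF \<alpha> \<nu> x] using 3 by (simp add: Emap0_def Fmap0_def)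
    ultimately show ?thesis by simp
  qed
qed

subsection \<open>The image of \<open>F\<close>\<close>

lemma imF_data:
  "x \<in> imF D M \<mu> \<longleftrightarrow> (\<exists>g. (\<forall>\<alpha>\<in>simples D. \<forall>n>0. g (\<alpha>, n) \<in> wt M (wshift \<mu> n \<alpha>)) \<and> g \<in> extensional (didx D) \<and>
     finite {i\<in>didx D. g i \<noteq> \<zero>} \<and> x = finsum M (\<lambda>i. Fmap M \<mu> (fst i) (snd i) (g i)) {i\<in>didx D. g i \<noteq> \<zero>})"
  unfolding imF_def Mdelta_def dsum_module_def Frow_def
  by (auto simp: PiE_def Pi_iff didx_def case_prod_beta' image_iff)

text \<open>Arguments for the row vector \<open>F\<^sub>\<mu>\<close>, not required to be extensional: this makes sums of families families again.\<close>

definition Fam :: "'v => ('v \<times> nat => 'm) => bool" where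
  "Fam \<mu> g \<longleftrightarrow> (\<forall>\<alpha>\<in>simples D. \<forall>n>0. g (\<alpha>, n) \<in> wt M (wshift \<mu> n \<alpha>))"

lemma Fmap_props:
  assumes "\<mu> \<in> weights D" "Fam \<mu> g" "i \<in> didx D"
  shows "Fmap M \<mu> (fst i) (snd i) (g i) \<in> wt M \<mu>" "g i \<in> wt M (wshift \<mu> (snd i) (fst i))"
    "Fop (fst i) (snd i) (g i) = Fmap M \<mu> (fst i) (snd i) (g i)"
proof -
  obtain \<alpha> n where i: "i = (\<alpha>, n)" "\<alpha> \<in> simples D" "n > 0" using assms(3) by (auto simp: didx_def)
  show g: "g i \<in> wt M (wshift \<mu> (snd i) (fst i))" using assms(2) i by (simp add: Fam_def)
  show "Fop (fst i) (snd i) (g i) = Fmap M \<mu> (fst i) (snd i) (g i)"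
    using Fop(2)[OF i(2) weights_shift[OF assms(1) i(2)], of "g i" n n] g i by (simp add: Fmap0_def)
  show "Fmap M \<mu> (fst i) (snd i) (g i) \<in> wt M \<mu>"
    using Fmap0_props(1)[OF assms(1) i(2), of "g i" n] g i by (simp add: Fmap0_def)
qed

lemma imF_I:
  assumes \<mu>: "\<mu> \<in> weights D" and g: "Fam \<mu> g" and S: "finite S" "S \<subseteq> didx D" "\<And>i. i \<in> didx D ==> i \<notin> S ==> g i = \<zero>"
  shows "finsum M (\<lambda>i. Fop (fst i) (snd i) (g i)) S \<in> imF D M \<mu>"
proof -
  let ?g = "restrict g (didx D)"
  have Fg: "Fam \<mu> ?g" using g by (simp add: Fam_def didx_def)
  have sub: "{i\<in>didx D. ?g i \<noteq> \<zero>} \<subseteq> S" using S by auto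
  have "finsum M (\<lambda>i. Fmap M \<mu> (fst i) (snd i) (?g i)) {i\<in>didx D. ?g i \<noteq> \<zero>} = finsum M (\<lambda>i. Fmap M \<mu> (fst i) (snd i) (?g i)) S"
  proof (rule finsum_superset[OF S(1,2) _ _ sub])
    have z: "Fmap M \<mu> (fst i) (snd i) \<zero> = \<zero>" if i: "i \<in> didx D" for i
    proof -
      have F0: "Fam \<mu> (\<lambda>i. \<zero>)" using wt_closed(5) weights_shift \<mu> by (simp add: Fam_def)
      have "fst i \<in> simples D" using i by (auto simp: didx_def)
      then show ?thesis using Fmap_props(3)[OF \<mu> F0 i] lend_zero[OF Fop(1)] by simp
    qed
    show "i \<in> didx D ==> Fmap M \<mu> (fst i) (snd i) (?g i) \<in> carrier M" for i
      using Fmap_props(1)[OF \<mu> Fg] wt_closed(1)[OF \<mu>] by blast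
    show "i \<in> didx D ==> i \<notin> S ==> Fmap M \<mu> (fst i) (snd i) (?g i) = \<zero>" for i using S(3) z by simp
    show "i \<in> didx D ==> \<not> ?g i \<noteq> \<zero> ==> Fmap M \<mu> (fst i) (snd i) (?g i) = \<zero>" for i using z by simp
  qed
  also have "\<dots> = finsum M (\<lambda>i. Fop (fst i) (snd i) (g i)) S"
    by (rule Mo.add.finprod_cong'[OF refl])
      (use S(2) Fmap_props(1,3)[OF \<mu> g] wt_closed(1)[OF \<mu>] in \<open>simp_all add: Pi_iff subset_eq\<close>)
  finally have "finsum M (\<lambda>i. Fop (fst i) (snd i) (g i)) S = finsum M (\<lambda>i. Fmap M \<mu> (fst i) (snd i) (?g i)) {i\<in>didx D. ?g i \<noteq> \<zero>}" by simp
  moreover have "finite {i\<in>didx D. ?g i \<noteq> \<zero>}" by (rule finite_subset[OF sub S(1)])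
  ultimately show ?thesis unfolding imF_data using Fg by (intro exI[of _ ?g]) (simp add: Fam_def)
qed

lemma imF_E:
  assumes \<mu>: "\<mu> \<in> weights D" and x: "x \<in> imF D M \<mu>"
  shows "\<exists>g S. Fam \<mu> g \<and> finite S \<and> S \<subseteq> didx D \<and> (\<forall>i\<in>didx D - S. g i = \<zero>) \<and>
    x = finsum M (\<lambda>i. Fop (fst i) (snd i) (g i)) S"
proof -
  obtain g where g: "Fam \<mu> g" "finite {i\<in>didx D. g i \<noteq> \<zero>}"
    "x = finsum M (\<lambda>i. Fmap M \<mu> (fst i) (snd i) (g i)) {i\<in>didx D. g i \<noteq> \<zero>}"
    using x unfolding imF_data Fam_def by blast
  have "x = finsum M (\<lambda>i. Fop (fst i) (snd i) (g i)) {i\<in>didx D. g i \<noteq> \<zero>}"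
    unfolding g(3)
    by (rule Mo.add.finprod_cong'[OF refl])
      (use Fmap_props(1,3)[OF \<mu> g(1)] wt_closed(1)[OF \<mu>] in \<open>simp_all add: Pi_iff\<close>)
  then show ?thesis using g(1,2) by (intro exI[of _ g] exI[of _ "{i\<in>didx D. g i \<noteq> \<zero>}"]) simp
qed

lemma imF_superset:
  assumes \<mu>: "\<mu> \<in> weights D" and g: "Fam \<mu> g" and S: "finite S" "S \<subseteq> S'" "S' \<subseteq> didx D" "finite S'" "\<And>i. i \<in> didx D ==> i \<notin> S ==> g i = \<zero>"
  shows "finsum M (\<lambda>i. Fop (fst i) (snd i) (g i)) S = finsum M (\<lambda>i. Fop (fst i) (snd i) (g i)) S'"
proof (rule Mo.add.finprod_mono_neutral_cong_left[OF S(4,2)])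
  show "Fop (fst i) (snd i) (g i) = \<zero>" if i: "i \<in> S' - S" for i
  proof -
    have "i \<in> didx D" using i S(3) by blast
    then have "fst i \<in> simples D" by (auto simp: didx_def)
    then show ?thesis using lend_zero[OF Fop(1)] S(5)[OF \<open>i \<in> didx D\<close>] i by simp
  qed
  show "(\<lambda>i. Fop (fst i) (snd i) (g i)) \<in> S' \<rightarrow> carrier M"
    using Fmap_props(1,3)[OF \<mu> g] wt_closed(1)[OF \<mu>] S(3) by (simp add: Pi_iff subset_eq)
qed simp

lemma imF_wt: assumes \<mu>: "\<mu> \<in> weights D" and x: "x \<in> imF D M \<mu>" shows "x \<in> wt M \<mu>"
proof -
  obtain g S where g: "Fam \<mu> g" "finite S" "S \<subseteq> didx D"
    "\<forall>i\<in>didx D - S. g i = \<zero>"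
    "x = finsum M (\<lambda>i. Fop (fst i) (snd i) (g i)) S" using imF_E[OF \<mu> x] by metis
  have "finsum M (\<lambda>i. Fop (fst i) (snd i) (g i)) S \<in> wt M \<mu>" using g(2,3)
  proof (induction rule: finite_induct)
    case empty show ?case using wt_closed(5)[OF \<mu>] by simp
  next
    case (insert i S)
    have "Fop (fst j) (snd j) (g j) \<in> wt M \<mu>" if "j \<in> insert i S" for j
    proof -
      have j: "j \<in> didx D" using that insert.prems by blast
      show ?thesis using Fmap_props(1,3)[OF \<mu> g(1) j] by simp
    qed
    then show ?case using insert wt_closed(1,2)[OF \<mu>] by (simp add: Pi_iff)
  qed
  then show ?thesis using g(5) by simp
qed

lemma imF_zero: "\<mu> \<in> weights D ==> \<zero> \<in> imF D M \<mu>"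
  using imF_I[of \<mu> "\<lambda>i. \<zero>" "{}"] wt_closed(5) weights_shift by (simp add: Fam_def)

lemma imF_F:
  assumes \<mu>: "\<mu> \<in> weights D" and \<alpha>: "\<alpha> \<in> simples D" and n: "n > 0" and x: "x \<in> wt M (wshift \<mu> n \<alpha>)"
  shows "Fop \<alpha> n x \<in> imF D M \<mu>"
proof -
  let ?g = "\<lambda>i. if i = (\<alpha>, n) then x else \<zero>"
  have g: "Fam \<mu> ?g" using x wt_closed(5) weights_shift \<mu> by (simp add: Fam_def)
  have c: "Fop \<alpha> n x \<in> carrier M" by (rule lend_closed[OF Fop(1)[OF \<alpha>] wt_closed(1)[OF weights_shift[OF \<mu> \<alpha>] x]])
  have "finsum M (\<lambda>i. Fop (fst i) (snd i) (?g i)) {(\<alpha>, n)} \<in> imF D M \<mu>"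
    by (rule imF_I[OF \<mu> g]) (use \<alpha> n in \<open>auto simp: didx_def\<close>)
  then show ?thesis using c by simp
qed

lemma imF_add:
  assumes \<mu>: "\<mu> \<in> weights D" and x: "x \<in> imF D M \<mu>" and y: "y \<in> imF D M \<mu>"
  shows "x \<oplus> y \<in> imF D M \<mu>"
proof -
  obtain g S where g: "Fam \<mu> g" "finite S" "S \<subseteq> didx D" "\<forall>i\<in>didx D - S. g i = \<zero>"
    "x = finsum M (\<lambda>i. Fop (fst i) (snd i) (g i)) S" using imF_E[OF \<mu> x] by metis
  obtain h T where h: "Fam \<mu> h" "finite T" "T \<subseteq> didx D" "\<forall>i\<in>didx D - T. h i = \<zero>"
    "y = finsum M (\<lambda>i. Fop (fst i) (snd i) (h i)) T" using imF_E[OF \<mu> y] by metis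
  let ?U = "S \<union> T" and ?k = "\<lambda>i. g i \<oplus> h i"
  have U: "finite ?U" "?U \<subseteq> didx D" using g h by auto
  have xx: "x = finsum M (\<lambda>i. Fop (fst i) (snd i) (g i)) ?U"
    unfolding g(5) by (rule imF_superset[OF \<mu> g(1,2) _ U(2,1)]) (use g(4) in simp_all)
  have yy: "y = finsum M (\<lambda>i. Fop (fst i) (snd i) (h i)) ?U"
    unfolding h(5) by (rule imF_superset[OF \<mu> h(1,2) _ U(2,1)]) (use h(4) in simp_all)
  have c: "Fop (fst i) (snd i) (g i) \<in> carrier M" "Fop (fst i) (snd i) (h i) \<in> carrier M"
    "Fop (fst i) (snd i) (?k i) = Fop (fst i) (snd i) (g i) \<oplus> Fop (fst i) (snd i) (h i)" if "i \<in> didx D" for i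
  proof -
    have s: "fst i \<in> simples D" using that by (auto simp: didx_def)
    have "g i \<in> carrier M" "h i \<in> carrier M"
      using Fmap_props(2)[OF \<mu> g(1) that] Fmap_props(2)[OF \<mu> h(1) that] wt_closed(1)[OF weights_shift[OF \<mu> s]] by auto
    then show "Fop (fst i) (snd i) (g i) \<in> carrier M" "Fop (fst i) (snd i) (h i) \<in> carrier M"
      "Fop (fst i) (snd i) (?k i) = Fop (fst i) (snd i) (g i) \<oplus> Fop (fst i) (snd i) (h i)"
      using lend_closed[OF Fop(1)[OF s]] lend_add[OF Fop(1)[OF s]] by simp_all
  qed
  have k: "Fam \<mu> ?k" using g(1) h(1) wt_closed(2)[OF weights_shift[OF \<mu>]] by (simp add: Fam_def)
  have "finsum M (\<lambda>i. Fop (fst i) (snd i) (?k i)) ?U \<in> imF D M \<mu>"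
    by (rule imF_I[OF \<mu> k U]) (use g(4) h(4) in auto)
  also have "finsum M (\<lambda>i. Fop (fst i) (snd i) (?k i)) ?U = finsum M (\<lambda>i. Fop (fst i) (snd i) (g i) \<oplus> Fop (fst i) (snd i) (h i)) ?U"
    by (rule Mo.add.finprod_cong'[OF refl]) (use c U in \<open>auto simp: Pi_iff subset_iff\<close>)
  also have "\<dots> = x \<oplus> y" unfolding xx yy by (rule Mo.finsum_addf) (use c U in auto)
  finally show ?thesis .
qed

lemma imF_smult:
  assumes \<mu>: "\<mu> \<in> weights D" and x: "x \<in> imF D M \<mu>" and a: "a \<in> carrier A"
  shows "a \<odot> x \<in> imF D M \<mu>"
proof -
  obtain g S where g: "Fam \<mu> g" "finite S" "S \<subseteq> didx D"
    "\<forall>i\<in>didx D - S. g i = \<zero>"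
    "x = finsum M (\<lambda>i. Fop (fst i) (snd i) (g i)) S" using imF_E[OF \<mu> x] by metis
  have c: "Fop (fst i) (snd i) (g i) \<in> wt M \<mu>" "a \<odot> Fop (fst i) (snd i) (g i) \<in> imF D M \<mu>" if i: "i \<in> didx D" for i
  proof -
    have s: "fst i \<in> simples D" "snd i > 0" using i by (auto simp: didx_def)
    show "Fop (fst i) (snd i) (g i) \<in> wt M \<mu>" using Fmap_props[OF \<mu> g(1) i] by simp
    have gi: "g i \<in> wt M (wshift \<mu> (snd i) (fst i))" by (rule Fmap_props(2)[OF \<mu> g(1) i])
    have "a \<odot> Fop (fst i) (snd i) (g i) = Fop (fst i) (snd i) (a \<odot> g i)"
      by (rule lend_smult[OF Fop(1)[OF s(1)] a wt_closed(1)[OF weights_shift[OF \<mu> s(1)] gi], symmetric])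
    then show "a \<odot> Fop (fst i) (snd i) (g i) \<in> imF D M \<mu>"
      using imF_F[OF \<mu> s wt_closed(4)[OF weights_shift[OF \<mu> s(1)] a gi]] by simp
  qed
  have "a \<odot> finsum M (\<lambda>i. Fop (fst i) (snd i) (g i)) S \<in> imF D M \<mu>"
    using g(2,3)
  proof (induction rule: finite_induct)
    case empty then show ?case using imF_zero[OF \<mu>] a by simp
  next
    case (insert i S)
    then show ?case using c wt_closed(1)[OF \<mu>] a
      by (simp add: Pi_iff subset_eq Mo.smult_r_distr imF_add[OF \<mu>])
  qed
  then show ?thesis using g(5) by simp
qed

lemma imF_induct:
  assumes \<mu>: "\<mu> \<in> weights D" and x: "x \<in> imF D M \<mu>" and z: "P \<zero>"
    and add: "\<And>x y. x \<in> carrier M ==> y \<in> carrier M ==> P x ==> P y ==> P (x \<oplus> y)"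
    and F: "\<And>\<alpha> n x. \<alpha> \<in> simples D ==> n > 0 ==> x \<in> wt M (wshift \<mu> n \<alpha>) ==> P (Fop \<alpha> n x)"
  shows "P x"
proof -
  obtain g S where g: "Fam \<mu> g" "finite S" "S \<subseteq> didx D"
    "\<forall>i\<in>didx D - S. g i = \<zero>"
    "x = finsum M (\<lambda>i. Fop (fst i) (snd i) (g i)) S" using imF_E[OF \<mu> x] by metis
  have c: "Fop (fst i) (snd i) (g i) \<in> carrier M" "P (Fop (fst i) (snd i) (g i))" if i: "i \<in> didx D" for i
  proof -
    have s: "fst i \<in> simples D" "snd i > 0" using i by (auto simp: didx_def)
    show "Fop (fst i) (snd i) (g i) \<in> carrier M" using Fmap_props[OF \<mu> g(1) i] wt_closed(1)[OF \<mu>] by simp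
    show "P (Fop (fst i) (snd i) (g i))" by (rule F[OF s Fmap_props(2)[OF \<mu> g(1) i]])
  qed
  have "P (finsum M (\<lambda>i. Fop (fst i) (snd i) (g i)) S)"
    using g(2,3)
  proof (induction rule: finite_induct)
    case empty then show ?case using z by simp
  next
    case (insert i S)
    then have i: "i \<in> didx D" and S: "S \<subseteq> didx D" by auto
    have "finsum M (\<lambda>i. Fop (fst i) (snd i) (g i)) (insert i S)
        = Fop (fst i) (snd i) (g i) \<oplus> finsum M (\<lambda>i. Fop (fst i) (snd i) (g i)) S"
      by (rule Mo.finsum_insert[OF insert.hyps]) (use c(1) i S in blast)+
    moreover have "finsum M (\<lambda>i. Fop (fst i) (snd i) (g i)) S \<in> carrier M"
      by (rule Mo.finsum_closed) (use c(1) S in blast)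
    ultimately show ?case using add[OF c(1)[OF i] _ c(2)[OF i] insert.IH[OF S]] by simp
  qed
  then show ?thesis using g(5) by simp
qed

lemma imF_submodule: assumes \<mu>: "\<mu> \<in> weights D" shows "submodule (imF D M \<mu>) A (wspace M \<mu>)"
proof -
  interpret w: module A "wspace M \<mu>" by (rule submodule.submodule_is_module[OF wt_submodule[OF \<mu>] module_M])
  show ?thesis
  proof (rule w.submoduleI)
    fix x assume x: "x \<in> imF D M \<mu>"
    have xw: "x \<in> wt M \<mu>" by (rule imF_wt[OF \<mu> x])
    have "\<ominus>\<^bsub>wspace M \<mu>\<^esub> x = (\<ominus>\<^bsub>A\<^esub> \<one>\<^bsub>A\<^esub>) \<odot> x"
      using w.smult_l_minus[of "\<one>\<^bsub>A\<^esub>" x] w.smult_one[of x] xw by simp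
    then show "\<ominus>\<^bsub>wspace M \<mu>\<^esub> x \<in> imF D M \<mu>" using imF_smult[OF \<mu> x] by simp
  next
    show "imF D M \<mu> \<subseteq> carrier (wspace M \<mu>)" using imF_wt[OF \<mu>] by (intro subsetI) simp
  next
    show "\<zero>\<^bsub>wspace M \<mu>\<^esub> \<in> imF D M \<mu>" using imF_zero[OF \<mu>] by simp
  next
    fix a x y assume "x \<in> imF D M \<mu>" "y \<in> imF D M \<mu>"
    then show "x \<oplus>\<^bsub>wspace M \<mu>\<^esub> y \<in> imF D M \<mu>" using imF_add[OF \<mu>] by simp
  next
    fix a x assume "a \<in> carrier A" "x \<in> imF D M \<mu>"
    then show "a \<odot>\<^bsub>wspace M \<mu>\<^esub> x \<in> imF D M \<mu>" using imF_smult[OF \<mu>] by simp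
  qed
qed

end

section \<open>Torsion-freeness and primitive vectors\<close>

locale xobject = xmod D A \<phi> M for D :: "'v::real_vector root_datum" and A :: "'a ring" and \<phi> and M :: "('a, 'm, 'v) xobj" (structure) +
  assumes x3: "X3 D A M"
begin

lemma Ecol_apply:
  assumes "\<mu> \<in> weights D" "x \<in> wt M \<mu>" "\<alpha> \<in> simples D" "n > 0"
  shows "Ecol D M \<mu> x (\<alpha>, n) = Eop \<alpha> n x"
  using assms by (simp add: Ecol_def didx_def Eop(2) Emap0_def)

text \<open>The injectivity condition in \<open>X3\<close>.\<close>

lemma imF_primitive_zero:
  assumes \<mu>: "\<mu> \<in> weights D" and x: "x \<in> imF D M \<mu>"
    and E: "\<And>\<alpha> n. \<alpha> \<in> simples D ==> n > 0 ==> Eop \<alpha> n x = \<zero>"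
  shows "x = \<zero>"
proof -
  have "Ecol D M \<mu> x = Ecol D M \<mu> \<zero>"
  proof (rule extensionalityI[where A = "didx D"])
    fix i assume "i \<in> didx D"
    then obtain \<alpha> n where i: "i = (\<alpha>, n)" "\<alpha> \<in> simples D" "n > 0" by (auto simp: didx_def)
    show "Ecol D M \<mu> x i = Ecol D M \<mu> \<zero> i"
      unfolding i(1) Ecol_apply[OF \<mu> imF_wt[OF \<mu> x] i(2,3)] Ecol_apply[OF \<mu> wt_closed(5)[OF \<mu>] i(2,3)]
      by (simp only: E[OF i(2,3)] lend_zero[OF Eop(1)[OF i(2)]])
  qed (simp_all add: Ecol_def)
  moreover have "inj_on (Ecol D M \<mu>) (imF D M \<mu>)" using x3 \<mu> by (simp add: X3_def)
  ultimately show ?thesis using x imF_zero[OF \<mu>] by (simp add: inj_on_def)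
qed

text \<open>The quotient \<open>M\<^sub>\<mu> / im F\<close> is free, hence a torsion element lies in \<open>im F\<close>. There it is determined by its images under
the \<open>E\<close>'s, which are torsion elements of higher weights.\<close>

lemma torsion_free_wt:
  assumes \<mu>: "\<mu> \<in> weights D" and a: "a \<in> carrier A" "a \<noteq> \<zero>\<^bsub>A\<^esub>"
  shows "\<forall>x\<in>wt M \<mu>. a \<odot> x = \<zero> \<longrightarrow> x = \<zero>"
proof -
  have qb: "quasi_bounded D {\<mu>\<in>weights D. wt M \<mu> \<noteq> {\<zero>}}" using x1 by (simp add: X1_def)
  show ?thesis
  proof (rule weight_induct[OF qb \<mu>])
    fix \<mu> assume "\<mu> \<in> weights D" "\<mu> \<notin> {\<mu>\<in>weights D. wt M \<mu> \<noteq> {\<zero>}}"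
    then have "wt M \<mu> = {\<zero>}" by blast
    then show "\<forall>x\<in>wt M \<mu>. a \<odot> x = \<zero> \<longrightarrow> x = \<zero>" by simp
  next
    fix \<mu> assume \<mu>: "\<mu> \<in> weights D"
      and IH: "\<And>\<alpha> n. \<alpha> \<in> simples D ==> n > 0 ==> \<forall>x\<in>wt M (wshift \<mu> n \<alpha>). a \<odot> x = \<zero> \<longrightarrow> x = \<zero>"
    interpret w: module A "wspace M \<mu>" by (rule submodule.submodule_is_module[OF wt_submodule[OF \<mu>] module_M])
    interpret I: abelian_subgroup "imF D M \<mu>" "wspace M \<mu>"
      by (rule abelian_subgroupI3[OF additive_subgroup.intro[OF submodule.axioms(1)[OF imF_submodule[OF \<mu>]]] w.abelian_group_axioms])
    show "\<forall>x\<in>wt M \<mu>. a \<odot> x = \<zero> \<longrightarrow> x = \<zero>"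
    proof (intro ballI impI)
      fix x assume x: "x \<in> wt M \<mu>" and ax: "a \<odot> x = \<zero>"
      let ?Q = "quot_module (wspace M \<mu>) (imF D M \<mu>)"
      note Q = quot_module_module[OF w.module_axioms imF_submodule[OF \<mu>]]
      let ?C = "imF D M \<mu> +>\<^bsub>wspace M \<mu>\<^esub> x"
      have C: "?C \<in> carrier ?Q" using x by (auto simp: quot_module_def A_RCOSETS_def')
      have "a \<odot>\<^bsub>?Q\<^esub> ?C = imF D M \<mu> +>\<^bsub>wspace M \<mu>\<^esub> \<zero>" using Q(2)[of x a] x a ax by simp
      also have "\<dots> = \<zero>\<^bsub>?Q\<^esub>" using I.a_rcos_const[OF I.zero_closed] by (simp add: quot_module_def)
      finally have "?C = \<zero>\<^bsub>?Q\<^esub>"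
        using x3 \<mu> by (intro free_module_torsion_free[OF A.domain_axioms Q(1) _ a C]) (simp_all add: X3_def)
      then have "?C = imF D M \<mu>" by (simp add: quot_module_def)
      then have xI: "x \<in> imF D M \<mu>" using I.a_rcos_self[of x] x by simp
      show "x = \<zero>"
      proof (rule imF_primitive_zero[OF \<mu> xI])
        fix \<alpha> and n :: nat assume \<alpha>: "\<alpha> \<in> simples D" and n: "n > 0"
        have "a \<odot> Eop \<alpha> n x = \<zero>"
          using lend_smult[OF Eop(1)[OF \<alpha>, of n] a(1) wt_closed(1)[OF \<mu> x]] lend_zero[OF Eop(1)[OF \<alpha>, of n]] ax by simp
        then show "Eop \<alpha> n x = \<zero>" using IH[OF \<alpha> n] Eop(3)[OF \<alpha> \<mu> x] by blast
      qed
    qed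
  qed
qed

lemma torsion_free:
  assumes "a \<in> carrier A" "a \<noteq> \<zero>\<^bsub>A\<^esub>" "x \<in> carrier M" "a \<odot> x = \<zero>"
  shows "x = \<zero>"
proof (rule dec_zero_imp[OF assms(3)])
  fix \<mu> assume \<mu>: "\<mu> \<in> weights D"
  have "dec \<zero> \<mu> = \<zero>" using dec_wt_eq[OF \<mu> wt_closed(5)[OF \<mu>] \<mu>] by simp
  then have "a \<odot> dec x \<mu> = \<zero>" using dec_smult[OF assms(3,1) \<mu>] assms(4) by simp
  then show "dec x \<mu> = \<zero>" using torsion_free_wt[OF \<mu> assms(1,2)] dec_wt[OF assms(3) \<mu>] by blast
qed

definition prim :: "'v => 'm => bool" where
  "prim \<kappa> z \<longleftrightarrow> \<kappa> \<in> weights D \<and> z \<in> wt M \<kappa> \<and> (\<forall>\<alpha>\<in>simples D. \<forall>n>0. Eop \<alpha> n z = \<zero>)"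

lemma primD: "prim \<kappa> z ==> \<kappa> \<in> weights D" "prim \<kappa> z ==> z \<in> wt M \<kappa>" "prim \<kappa> z ==> z \<in> carrier M"
    "prim \<kappa> z ==> \<alpha> \<in> simples D ==> n > 0 ==> Eop \<alpha> n z = \<zero>"
  using wt_closed(1)[of \<kappa> z] by (simp_all add: prim_def)

text \<open>A nonzero multiple of the column vector of the \<open>E\<close>'s at \<open>x\<close> comes from some \<open>y \<in> im F\<close>, by the torsion condition in
\<open>X3\<close>; the difference of this multiple of \<open>x\<close> and \<open>y\<close> is primitive.\<close>

lemma primitive_decomposition:
  assumes \<mu>: "\<mu> \<in> weights D" and x: "x \<in> wt M \<mu>"
  shows "\<exists>a\<in>carrier A. \<exists>y\<in>imF D M \<mu>. \<exists>z. a \<noteq> \<zero>\<^bsub>A\<^esub> \<and> prim \<mu> z \<and> a \<odot> x = y \<oplus> z"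
proof -
  let ?M = "(Mdelta D M \<mu>)\<lparr>carrier := Ecol D M \<mu> ` wt M \<mu>\<rparr>" and ?N = "Ecol D M \<mu> ` imF D M \<mu>"
  let ?C = "?N +>\<^bsub>?M\<^esub> Ecol D M \<mu> x"
  have "?C \<in> carrier (quot_module ?M ?N)" using x by (auto simp: quot_module_def A_RCOSETS_def')
  moreover have "torsion_module A (quot_module ?M ?N)" using x3 \<mu> by (simp add: X3_def)
  ultimately obtain a where a: "a \<in> carrier A" "a \<noteq> \<zero>\<^bsub>A\<^esub>" "a \<odot>\<^bsub>quot_module ?M ?N\<^esub> ?C = ?N"
    by (auto simp: torsion_module_def quot_module_def)
  have 0: "Ecol D M \<mu> \<zero> \<in> ?N" using imF_zero[OF \<mu>] by blast
  \<comment> \<open>A representative of the coset; this way no module structure on the columns has to be established.\<close>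
  let ?g = "Ecol D M \<mu> \<zero> \<oplus>\<^bsub>?M\<^esub> Ecol D M \<mu> x"
  have "?g \<in> ?C" unfolding a_r_coset_def' using 0 by blast
  moreover have "Ecol D M \<mu> \<zero> \<oplus>\<^bsub>?M\<^esub> (a \<odot>\<^bsub>?M\<^esub> ?g) \<in> ?N +>\<^bsub>?M\<^esub> (a \<odot>\<^bsub>?M\<^esub> ?g)"
    unfolding a_r_coset_def' using 0 by blast
  ultimately have "Ecol D M \<mu> \<zero> \<oplus>\<^bsub>?M\<^esub> (a \<odot>\<^bsub>?M\<^esub> ?g) \<in> a \<odot>\<^bsub>quot_module ?M ?N\<^esub> ?C"
    unfolding quot_module_def module.select_convs by blast
  then obtain y where y: "y \<in> imF D M \<mu>" "Ecol D M \<mu> \<zero> \<oplus>\<^bsub>?M\<^esub> (a \<odot>\<^bsub>?M\<^esub> ?g) = Ecol D M \<mu> y"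
    unfolding a(3) by blast
  have yw: "y \<in> wt M \<mu>" by (rule imF_wt[OF \<mu> y(1)])
  have xc: "x \<in> carrier M" and yc: "y \<in> carrier M" using wt_closed(1)[OF \<mu>] x yw by auto
  have E: "Eop \<alpha> n y = a \<odot> Eop \<alpha> n x" if \<alpha>: "\<alpha> \<in> simples D" and n: "n > 0" for \<alpha> n
  proof -
    have i: "(\<alpha>, n) \<in> didx D" using \<alpha> n by (simp add: didx_def)
    have c: "Eop \<alpha> n x \<in> carrier M" by (rule lend_closed[OF Eop(1)[OF \<alpha>] xc])
    have "Eop \<alpha> n y = (Ecol D M \<mu> \<zero> \<oplus>\<^bsub>?M\<^esub> (a \<odot>\<^bsub>?M\<^esub> ?g)) (\<alpha>, n)"
      unfolding y(2) by (rule Ecol_apply[OF \<mu> yw \<alpha> n, symmetric])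
    also have "\<dots> = Ecol D M \<mu> \<zero> (\<alpha>, n) \<oplus> (a \<odot> (Ecol D M \<mu> \<zero> (\<alpha>, n) \<oplus> Ecol D M \<mu> x (\<alpha>, n)))"
      using i by (simp add: Mdelta_def dsum_module_def)
    also have "\<dots> = a \<odot> Eop \<alpha> n x"
      unfolding Ecol_apply[OF \<mu> x \<alpha> n] Ecol_apply[OF \<mu> wt_closed(5)[OF \<mu>] \<alpha> n] lend_zero[OF Eop(1)[OF \<alpha>]]
      using c a(1) by simp
    finally show ?thesis .
  qed
  let ?z = "a \<odot> x \<oplus> (\<ominus> y)"
  have "prim \<mu> ?z" unfolding prim_def
  proof (intro conjI ballI allI impI)
    show "?z \<in> wt M \<mu>" using wt_closed[OF \<mu>] x yw a(1) by simp
    fix \<alpha> and n :: nat assume \<alpha>: "\<alpha> \<in> simples D" and n: "n > 0"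
    note T = Eop(1)[OF \<alpha>, of n]
    have m: "\<ominus> y = (\<ominus>\<^bsub>A\<^esub> \<one>\<^bsub>A\<^esub>) \<odot> y" using yc by (simp add: Mo.smult_l_minus)
    have c: "Eop \<alpha> n x \<in> carrier M" "Eop \<alpha> n y \<in> carrier M" by (rule lend_closed[OF T xc], rule lend_closed[OF T yc])
    have "Eop \<alpha> n (\<ominus> y) = \<ominus> Eop \<alpha> n y"
      unfolding m using lend_smult[OF T _ yc, of "\<ominus>\<^bsub>A\<^esub> \<one>\<^bsub>A\<^esub>"] c(2) by (simp add: Mo.smult_l_minus)
    then have "Eop \<alpha> n ?z = a \<odot> Eop \<alpha> n x \<oplus> (\<ominus> Eop \<alpha> n y)"
      using lend_add[OF T, of "a \<odot> x" "\<ominus> y"] lend_smult[OF T a(1) xc] xc yc a(1) by simp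
    then show "Eop \<alpha> n ?z = \<zero>" using E[OF \<alpha> n] c a(1) by (simp add: Mo.r_neg)
  qed (rule \<mu>)
  moreover have "a \<odot> x = y \<oplus> ?z" using Mo.a_lcomm[of y "a \<odot> x" "\<ominus> y"] xc yc a(1) by (simp add: Mo.r_neg)
  ultimately show ?thesis using a(1,2) y(1) by blast
qed

section \<open>Comparison with highest weight modules\<close>

text \<open>Pairs of a vector in the module of highest weight \<open>\<kappa>\<close> and a vector in \<open>M\<close>, obtained by the same operations from
\<open>hwv\<close> and from a primitive vector \<open>z\<close> of weight \<open>\<kappa>\<close>. The height \<open>h\<close> and the weight \<open>\<nu>\<close> are recorded. Heights are
integers and \<open>zero\<close> is available at every height, because \<open>W_E\<close> may lower the height below \<open>0\<close>.\<close>

inductive W :: "'v => 'm => int => 'v => ('v list => qrat) => 'm => bool" for \<kappa> z where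
  top: "c \<in> carrier Laurent ==> W \<kappa> z 0 \<kappa> (sca c hwv) (\<phi> c \<odot> z)"
| low: "W \<kappa> z h \<nu> y x ==> \<alpha> \<in> simples D ==>
    W \<kappa> z (h + int n) (\<nu> - real n *\<^sub>R \<alpha>) (dpow (qd (dnum D \<alpha>)) (vop D \<kappa> (GF \<alpha>)) n y) (Fop \<alpha> n x)"
| add: "W \<kappa> z h \<nu> y x ==> W \<kappa> z h \<nu> y' x' ==> W \<kappa> z h \<nu> (y + y') (x \<oplus> x')"
| zero: "\<nu> \<in> weights D ==> W \<kappa> z h \<nu> 0 \<zero>"

lemma W_wt:
  assumes z: "prim \<kappa> z" and w: "W \<kappa> z h \<nu> y x"
  shows "\<nu> \<in> weights D" "x \<in> wt M \<nu>" "x \<in> carrier M"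
proof -
  have "\<nu> \<in> weights D \<and> x \<in> wt M \<nu>" using w
  proof induction
    case (top c) then show ?case using z wt_closed(4) by (simp add: prim_def)
  next
    case (low h \<nu> y x \<alpha> n) then show ?case using weights_unshift Fop(3) by simp
  next
    case add then show ?case using wt_closed(2) by simp
  next
    case zero then show ?case using wt_closed(5) by simp
  qed
  then show "\<nu> \<in> weights D" "x \<in> wt M \<nu>" "x \<in> carrier M" using wt_closed(1) by auto
qed

lemma hwmod_dpow_F:
  assumes "\<alpha> \<in> simples D" "y \<in> hwmod D \<kappa>" shows "dpow c (vop D \<kappa> (GF \<alpha>)) n y \<in> hwmod D \<kappa>"
proof -
  have "(vop D \<kappa> (GF \<alpha>) ^^ n) y \<in> hwmod D \<kappa>"
    by (induction n) (use assms in \<open>simp_all add: hwmod.low del: vop.simps\<close>)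
  then show ?thesis unfolding dpow_def by (rule hwmod.sca)
qed

lemma W_hw:
  assumes z: "prim \<kappa> z" and w: "W \<kappa> z h \<nu> y x"
  shows "y \<in> hwmod D \<kappa>" "hw.homog \<kappa> h \<nu> y"
    "\<alpha> \<in> simples D ==> vop D \<kappa> (GK \<alpha>) y = sca (qd (dnum D \<alpha>) powi pr D \<nu> \<alpha>) y"
    "\<alpha> \<in> simples D ==> vop D \<kappa> (GL \<alpha>) y = sca (qd (dnum D \<alpha>) powi - pr D \<nu> \<alpha>) y"
proof -
  interpret h: hw D \<kappa> by unfold_locales
  show "y \<in> hwmod D \<kappa>" using w
    by induction (simp_all only: hwmod.hwv hwmod.sca hwmod.add hwmod_dpow_F h.hwmod_0)
  show "h.homog h \<nu> y" using w
  proof induction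
    case (top c) then show ?case by (simp add: h.homog_def hwv_def sca_apply)
  next
    case low then show ?case using h.homog_dpow by blast
  next
    case (add h \<nu> y x y' x')
    have "y w \<noteq> 0 \<or> y' w \<noteq> 0" if "(y + y') w \<noteq> 0" for w using that by (auto simp: plus_fun_apply)
    then show ?case using add.IH unfolding h.homog_def by metis
  next
    case zero then show ?case by (simp add: h.homog_def zero_fun_apply)
  qed
  show "h.K \<alpha> y = sca (h.x \<alpha> powi pr D \<nu> \<alpha>) y" if \<alpha>: "\<alpha> \<in> simples D" for \<alpha>
    using w
  proof induction
    case (top c) show ?case by (simp only: linop_sca[OF linop_vop] h.K_hwv sca_simps(1) mult.commute)
  next
    case (low g \<nu> y x \<beta> n)
    have "h.x \<alpha> powi (- int n * pr D \<beta> \<alpha>) * h.x \<alpha> powi pr D \<nu> \<alpha> = h.x \<alpha> powi pr D (\<nu> - real n *\<^sub>R \<beta>) \<alpha>"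
      using pr_unshift[OF W_wt(1)[OF z low.hyps(1)] \<alpha> low.hyps(2), of n] by (simp add: power_int_add[symmetric])
    then show ?case
      by (simp only: h.K_dpow_F[OF \<alpha>] low.IH linop_sca[OF linop_dpow[OF linop_vop]] sca_simps(1))
  next
    case add then show ?case by (simp only: linop_add[OF linop_vop] sca_rules(1))
  next
    case zero show ?case by (simp only: linop_0[OF linop_vop] sca_simps(4))
  qed
  show "h.L \<alpha> y = sca (h.x \<alpha> powi - pr D \<nu> \<alpha>) y" if \<alpha>: "\<alpha> \<in> simples D" for \<alpha>
    using w
  proof induction
    case (top c) show ?case by (simp only: linop_sca[OF linop_vop] h.K_hwv sca_simps(1) mult.commute)
  next
    case (low g \<nu> y x \<beta> n)
    have "h.x \<alpha> powi (int n * pr D \<beta> \<alpha>) * h.x \<alpha> powi - pr D \<nu> \<alpha> = h.x \<alpha> powi - pr D (\<nu> - real n *\<^sub>R \<beta>) \<alpha>"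
      using pr_unshift[OF W_wt(1)[OF z low.hyps(1)] \<alpha> low.hyps(2), of n] by (simp add: power_int_add[symmetric])
    then show ?case
      by (simp only: h.K_dpow_F[OF \<alpha>] low.IH linop_sca[OF linop_dpow[OF linop_vop]] sca_simps(1))
  next
    case add then show ?case by (simp only: linop_add[OF linop_vop] sca_rules(1))
  next
    case zero show ?case by (simp only: linop_0[OF linop_vop] sca_simps(4))
  qed
qed

lemma W_sca:
  assumes z: "prim \<kappa> z" and c: "c \<in> carrier Laurent" and w: "W \<kappa> z h \<nu> y x"
  shows "W \<kappa> z h \<nu> (sca c y) (\<phi> c \<odot> x)"
  using w
proof induction
  case (top b)
  have "\<phi> c \<odot> (\<phi> b \<odot> z) = \<phi> (c * b) \<odot> z"
    using primD(3)[OF z] c top by (simp add: phi_simps Mo.smult_assoc1)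
  then show ?case using W.top[of "c * b"] c top by (simp add: Laurent_closed)
next
  case (low h \<nu> y x \<alpha> n)
  have "Fop \<alpha> n (\<phi> c \<odot> x) = \<phi> c \<odot> Fop \<alpha> n x"
    by (rule lend_smult[OF Fop(1)[OF low.hyps(2)] phi_closed[OF c] W_wt(3)[OF z low.hyps(1)]])
  then show ?case
    using W.low[OF low.IH low.hyps(2), of n] by (simp only: linop_sca[OF linop_dpow[OF linop_vop]])
next
  case (add h \<nu> y x y' x')
  show ?case using W.add[OF add.IH] W_wt(3)[OF z add.hyps(1)] W_wt(3)[OF z add.hyps(2)] c
    by (simp add: sca_rules Mo.smult_r_distr)
next
  case (zero \<nu> h) then show ?case using W.zero[OF zero.hyps] c by simp
qed

lemma W_smult:
  assumes z: "prim \<kappa> z" and a: "a \<in> carrier A" and w: "W \<kappa> z h \<nu> y x"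
  shows "W \<kappa> (a \<odot> z) h \<nu> y (a \<odot> x)"
  using w
proof induction
  case (top c)
  have "a \<odot> (\<phi> c \<odot> z) = \<phi> c \<odot> (a \<odot> z)"
    using primD(3)[OF z] top a by (simp add: Mo.smult_assoc1[symmetric] A.m_comm)
  then show ?case using W.top[OF top] by simp
next
  case (low h \<nu> y x \<alpha> n)
  have "Fop \<alpha> n (a \<odot> x) = a \<odot> Fop \<alpha> n x"
    by (rule lend_smult[OF Fop(1)[OF low.hyps(2)] a W_wt(3)[OF z low.hyps(1)]])
  then show ?case using W.low[OF low.IH low.hyps(2), of n] by simp
next
  case (add h \<nu> y x y' x')
  show ?case using W.add[OF add.IH] W_wt(3)[OF z add.hyps(1)] W_wt(3)[OF z add.hyps(2)] a
    by (simp add: Mo.smult_r_distr)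
next
  case (zero \<nu> h) then show ?case using W.zero[OF zero.hyps] a by simp
qed

lemma prim_smult: "prim \<kappa> z ==> a \<in> carrier A ==> prim \<kappa> (a \<odot> z)"
  using wt_closed(4)[OF primD(1) _ primD(2)] primD(1,3,4) by (simp add: prim_def[of _ "_ \<odot>\<^bsub>_\<^esub> _"] lend_smult[OF Eop(1)])

lemma W_sum:
  assumes z: "prim \<kappa> z" and S: "finite S" and \<nu>: "\<nu> \<in> weights D"
    and w: "\<And>i. i \<in> S ==> W \<kappa> z h \<nu> (y i) (x i)"
  shows "W \<kappa> z h \<nu> (\<Sum>i\<in>S. y i) (finsum M x S)"
  using S w
proof (induction rule: finite_induct)
  case empty show ?case by (simp add: W.zero \<nu>)
next
  case (insert i S)
  have c: "x j \<in> carrier M" if "j \<in> insert i S" for j using W_wt(3)[OF z insert.prems[OF that]] .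
  have "finsum M x (insert i S) = x i \<oplus> finsum M x S"
    by (rule Mo.finsum_insert[OF insert.hyps]) (use c in auto)
  then show ?case using W.add[OF insert.prems[of i] insert.IH] insert.prems insert.hyps by simp
qed

lemma dpow_E_hwv: assumes "m > 0" shows "dpow c (vop D \<kappa> (GE \<alpha>)) m hwv = 0"
proof -
  interpret h: hw D \<kappa> by unfold_locales
  obtain k where m: "m = Suc k" using assms by (cases m) auto
  show ?thesis unfolding m
    by (simp only: dpow_def funpow_Suc_right comp_apply h.E_hwv linop_0[OF linop_funpow[OF linop_vop]] sca_simps)
qed

text \<open>Both sides obey the commutation formula with the same coefficients, the second side by \<open>X2\<close>, and both generators
are primitive.\<close>

lemma W_E:
  assumes z: "prim \<kappa> z" and \<alpha>: "\<alpha> \<in> simples D" and w: "W \<kappa> z h \<nu> y x"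
  shows "W \<kappa> z (h - int m) (wshift \<nu> m \<alpha>) (dpow (qd (dnum D \<alpha>)) (vop D \<kappa> (GE \<alpha>)) m y) (Eop \<alpha> m x)"
  using w
proof (induction arbitrary: m)
  case (top c)
  have \<kappa>: "\<kappa> \<in> weights D" "z \<in> wt M \<kappa>" using z by (simp_all add: prim_def)
  have cz: "\<phi> c \<odot> z \<in> wt M \<kappa>" using wt_closed(4)[OF \<kappa>(1) phi_closed[OF top] \<kappa>(2)] .
  show ?case
  proof (cases "m = 0")
    case True
    then show ?thesis using Eop_0[OF \<alpha> \<kappa>(1) cz] W.top[OF top] by simp
  next
    case False
    have "Eop \<alpha> m (\<phi> c \<odot> z) = \<phi> c \<odot> Eop \<alpha> m z"
      by (rule lend_smult[OF Eop(1)[OF \<alpha>] phi_closed[OF top] wt_closed(1)[OF \<kappa>]])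
    also have "\<dots> = \<zero>" using z \<alpha> False top by (simp add: prim_def)
    finally have 1: "Eop \<alpha> m (\<phi> c \<odot> z) = \<zero>" .
    have 2: "dpow (qd (dnum D \<alpha>)) (vop D \<kappa> (GE \<alpha>)) m (sca c hwv) = 0"
      using False by (simp only: linop_sca[OF linop_dpow[OF linop_vop]] dpow_E_hwv sca_simps neq0_conv)
    show ?thesis unfolding 1 2 by (rule W.zero[OF weights_shift[OF \<kappa>(1) \<alpha>]])
  qed
next
  case (low h \<nu> y x \<beta> n)
  interpret h: hw D \<kappa> by unfold_locales
  note \<nu> = W_wt(1)[OF z low.hyps(1)] and x = W_wt(2)[OF z low.hyps(1)] and \<beta> = low.hyps(2)
  show ?case
  proof (cases "\<alpha> = \<beta>")
    case False
    have e: "dpow (h.x \<alpha>) (h.E \<alpha>) m (dpow (h.x \<beta>) (h.Fo \<beta>) n y) = dpow (h.x \<beta>) (h.Fo \<beta>) n (dpow (h.x \<alpha>) (h.E \<alpha>) m y)"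
      by (rule h.dpow_E_F_comm[OF False])
    have s: "h + int n - int m = h - int m + int n" "wshift (\<nu> - real n *\<^sub>R \<beta>) m \<alpha> = wshift \<nu> m \<alpha> - real n *\<^sub>R \<beta>" by simp_all
    show ?thesis unfolding e E_F_ne[OF \<alpha> \<beta> False \<nu> x] s by (rule W.low[OF low.IH \<beta>])
  next
    case True
    note w = W_hw(3,4)[OF z low.hyps(1) \<alpha>]
    have e: "dpow (h.x \<alpha>) (h.E \<alpha>) m (dpow (h.x \<alpha>) (h.Fo \<alpha>) n y)
      = (\<Sum>r\<in>{0..min m n}. sca (qbinom (dnum D \<alpha>) (pr D \<nu> \<alpha> + int m - int n) r)
        (dpow (h.x \<alpha>) (h.Fo \<alpha>) (n - r) (dpow (h.x \<alpha>) (h.E \<alpha>) (m - r) y)))"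
      unfolding qbinom_qchoose by (rule h.dpow_E_F_weight[OF \<alpha> w])
    show ?thesis unfolding True[symmetric] e E_F_eq[OF \<alpha> \<nu> x]
    proof (rule W_sum[OF z])
      show "wshift (\<nu> - real n *\<^sub>R \<alpha>) m \<alpha> \<in> weights D" by (rule weights_shift[OF weights_unshift[OF \<nu> \<alpha>] \<alpha>])
      fix r assume r: "r \<in> {0..min m n}"
      have s: "h + int n - int m = h - int (m - r) + int (n - r)"
        "wshift (\<nu> - real n *\<^sub>R \<alpha>) m \<alpha> = wshift \<nu> (m - r) \<alpha> - real (n - r) *\<^sub>R \<alpha>"
        using r by (simp_all add: of_nat_diff scaleR_left_diff_distrib)
      show "W \<kappa> z (h + int n - int m) (wshift (\<nu> - real n *\<^sub>R \<alpha>) m \<alpha>)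
        (sca (qbinom (dnum D \<alpha>) (pr D \<nu> \<alpha> + int m - int n) r)
          (dpow (h.x \<alpha>) (h.Fo \<alpha>) (n - r) (dpow (h.x \<alpha>) (h.E \<alpha>) (m - r) y)))
        (\<phi> (qbinom (dnum D \<alpha>) (pr D \<nu> \<alpha> + int m - int n) r) \<odot> Fop \<alpha> (n - r) (Eop \<alpha> (m - r) x))"
        unfolding s by (rule W_sca[OF z qbinom_Laurent[OF dnum_pos[OF \<alpha>]] W.low[OF low.IH \<alpha>]])
    qed simp
  qed
next
  case (add h \<nu> y x y' x')
  note c = W_wt(3)[OF z add.hyps(1)] W_wt(3)[OF z add.hyps(2)]
  show ?case
    unfolding lend_add[OF Eop(1)[OF \<alpha>] c] linop_add[OF linop_dpow[OF linop_vop]]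
    by (rule W.add[OF add.IH])
next
  case (zero \<nu> h)
  show ?case
    unfolding lend_zero[OF Eop(1)[OF \<alpha>]] linop_0[OF linop_dpow[OF linop_vop]]
    by (rule W.zero[OF weights_shift[OF zero.hyps \<alpha>]])
qed

text \<open>Every proper lowering step ends in \<open>im F\<close>, so only height \<open>0\<close> contributes multiples of \<open>z\<close> itself.\<close>

lemma W_level:
  assumes z: "prim \<kappa> z" and w: "W \<kappa> z h \<nu> y x"
  shows "(h < 0 \<longrightarrow> y = 0 \<and> x = \<zero>) \<and>
    (h = 0 \<longrightarrow> (\<exists>c\<in>carrier Laurent. y = sca c hwv \<and> x = \<phi> c \<odot> z)) \<and>
    (h > 0 \<longrightarrow> x \<in> imF D M \<nu>)"
proof -
  have zc: "z \<in> carrier M" using z wt_closed(1) by (auto simp: prim_def)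
  have z0: "\<exists>c\<in>carrier Laurent. (0 :: 'v list => qrat) = sca c hwv \<and> \<zero> = \<phi> c \<odot> z"
    using zc by (intro bexI[of _ 0]) (simp_all add: phi_simps Laurent_closed)
  show ?thesis using w
  proof induction
    case (top c) then show ?case by auto
  next
    case (low h \<nu> y x \<alpha> n)
    note \<nu> = W_wt(1)[OF z low.hyps(1)] and x = W_wt(2)[OF z low.hyps(1)]
    show ?case
    proof (cases "n = 0")
      case True
      have 1: "Fop \<alpha> n x = x" unfolding True by (rule Fop_0[OF low.hyps(2) \<nu> x])
      have 2: "dpow (qd (dnum D \<alpha>)) (vop D \<kappa> (GF \<alpha>)) n y = y" "h + int n = h" "\<nu> - real n *\<^sub>R \<alpha> = \<nu>"
        unfolding True by (simp_all del: vop.simps)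
      show ?thesis unfolding 1 2 by (rule low.IH)
    next
      case False
      have F: "Fop \<alpha> n x \<in> imF D M (\<nu> - real n *\<^sub>R \<alpha>)"
        by (rule imF_F[OF weights_unshift[OF \<nu> low.hyps(2)] low.hyps(2)]) (use False x in simp_all)
      have n: "dpow (qd (dnum D \<alpha>)) (vop D \<kappa> (GF \<alpha>)) n y = 0 \<and> Fop \<alpha> n x = \<zero>" if "h < 0"
        using low.IH that by (simp only: linop_0[OF linop_dpow[OF linop_vop]] lend_zero[OF Fop(1)[OF low.hyps(2)]] simp_thms)
      have neg: "h < 0" if "h + int n \<le> 0" using that False by linarith
      show ?thesis
      proof (intro conjI[of "_ \<longrightarrow> _"] impI)
        assume "h + int n < 0"
        then show "dpow (qd (dnum D \<alpha>)) (vop D \<kappa> (GF \<alpha>)) n y = 0 \<and> Fop \<alpha> n x = \<zero>" using n neg by simp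
      next
        assume "h + int n = 0"
        then have n0: "dpow (qd (dnum D \<alpha>)) (vop D \<kappa> (GF \<alpha>)) n y = 0" "Fop \<alpha> n x = \<zero>" using n neg by simp_all
        show "\<exists>c\<in>carrier Laurent. dpow (qd (dnum D \<alpha>)) (vop D \<kappa> (GF \<alpha>)) n y = sca c hwv \<and> Fop \<alpha> n x = \<phi> c \<odot> z"
          unfolding n0 by (rule z0)
      next
        show "Fop \<alpha> n x \<in> imF D M (\<nu> - real n *\<^sub>R \<alpha>)" by (rule F)
      qed
    qed
  next
    case (add h \<nu> y x y' x')
    note c = W_wt(3)[OF z add.hyps(1)] W_wt(3)[OF z add.hyps(2)]
    consider "h < 0" | "h = 0" | "h > 0" by linarith
    then show ?case
    proof cases
      case 1 then show ?thesis using add.IH by simp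
    next
      case 2
      obtain c d where cd: "c \<in> carrier Laurent" "y = sca c hwv" "x = \<phi> c \<odot> z"
        "d \<in> carrier Laurent" "y' = sca d hwv" "x' = \<phi> d \<odot> z"
        using add.IH 2 by blast
      have "y + y' = sca (c + d) hwv" "x \<oplus> x' = \<phi> (c + d) \<odot> z"
        using cd zc by (simp_all add: sca_rules phi_simps Mo.smult_l_distr)
      then show ?thesis using 2 Laurent_closed(4)[OF cd(1,4)] by auto
    next
      case 3 then show ?thesis using add.IH imF_add[OF W_wt(1)[OF z add.hyps(1)]] by simp
    qed
  next
    case (zero \<nu> h)
    then show ?case using imF_zero z0 by simp
  qed
qed

text \<open>By induction on the height. At positive height \<open>x\<close> lies in \<open>im F\<close>, and its images under the \<open>E\<close>'s are paired with
\<open>0\<close> at smaller height, so they vanish.\<close>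

lemma W_inj:
  assumes z: "prim \<kappa> z" and w: "W \<kappa> z h \<nu> 0 x" shows "x = \<zero>"
  using w
proof (induction "nat h" arbitrary: h \<nu> x rule: less_induct)
  case less
  note L = W_level[OF z less.prems]
  consider "h < 0" | "h = 0" | "h > 0" by linarith
  then show ?case
  proof cases
    case 1 then show ?thesis using L by blast
  next
    case 2
    then obtain c where c: "c \<in> carrier Laurent" "(0 :: 'v list => qrat) = sca c hwv" "x = \<phi> c \<odot> z" using L by blast
    from fun_cong[OF c(2), of "[]"] have "c = 0" by (simp add: hwv_def fun_app)
    then show ?thesis using c(3) primD(3)[OF z] by (simp add: phi_simps)
  next
    case 3
    then have xI: "x \<in> imF D M \<nu>" using L by blast
    show ?thesis
    proof (rule imF_primitive_zero[OF W_wt(1)[OF z less.prems] xI])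
      fix \<alpha> and n :: nat assume \<alpha>: "\<alpha> \<in> simples D" and n: "n > 0"
      have "W \<kappa> z (h - int n) (wshift \<nu> n \<alpha>) 0 (Eop \<alpha> n x)"
        using W_E[OF z \<alpha> less.prems, of n] by (simp only: linop_0[OF linop_dpow[OF linop_vop]])
      then show "Eop \<alpha> n x = \<zero>" by (rule less.hyps[rotated]) (use 3 n in linarith)
    qed
  qed
qed

text \<open>Elements of the free algebra are not homogeneous, so sums of pairs of various heights and weights are needed.\<close>

inductive Wtot :: "'v => 'm => ('v list => qrat) => 'm => bool" for \<kappa> z where
  base: "W \<kappa> z h \<nu> y x ==> Wtot \<kappa> z y x"
| add: "Wtot \<kappa> z y x ==> Wtot \<kappa> z y' x' ==> Wtot \<kappa> z (y + y') (x \<oplus> x')"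

lemma Wtot_closed:
  assumes z: "prim \<kappa> z" and w: "Wtot \<kappa> z y x"
  shows "y \<in> hwmod D \<kappa>" "x \<in> carrier M"
  using w by (induction) (use W_hw(1)[OF z] W_wt(3)[OF z] hwmod.add in auto)

text \<open>First components of different height or weight have disjoint supports. Restricting to the words of one height and
weight therefore recovers the homogeneous summands.\<close>

definition cut :: "'v => int \<times> 'v => ('v list => qrat) => 'v list => qrat" where
  "cut \<kappa> i y = (\<lambda>w. if int (length w) = fst i \<and> \<kappa> - sum_list w = snd i then y w else 0)"

lemma Wtot_components:
  assumes z: "prim \<kappa> z" and w: "Wtot \<kappa> z y x"
  shows "\<exists>g S. finite S \<and> S \<subseteq> UNIV \<times> weights D \<and> (\<forall>i. i \<notin> S \<longrightarrow> g i = \<zero>) \<and> x = finsum M g S \<and>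
    (\<forall>i\<in>UNIV \<times> weights D. W \<kappa> z (fst i) (snd i) (cut \<kappa> i y) (g i))"
  using w
proof induction
  case (base h \<nu> y x)
  let ?g = "\<lambda>i. if i = (h, \<nu>) then x else \<zero>"
  have c: "x \<in> carrier M" "\<nu> \<in> weights D" using W_wt[OF z base] by auto
  have hom: "hw.homog \<kappa> h \<nu> y" by (rule W_hw(2)[OF z base])
  interpret h: hw D \<kappa> by unfold_locales
  have cut: "cut \<kappa> i y = (if i = (h, \<nu>) then y else 0)" for i
    using hom by (auto simp: cut_def h.homog_def fun_eq_iff zero_fun_apply)
  show ?case
  proof (intro exI[of _ ?g] exI[of _ "{(h, \<nu>)}"] conjI ballI)
    fix i :: "int \<times> 'v" assume "i \<in> UNIV \<times> weights D"
    then show "W \<kappa> z (fst i) (snd i) (cut \<kappa> i y) (?g i)"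
      unfolding cut using base W.zero[of "snd i"] by auto
  qed (use c in auto)
next
  case (add y x y' x')
  obtain g S where g: "finite S" "S \<subseteq> UNIV \<times> weights D" "\<forall>i. i \<notin> S \<longrightarrow> g i = \<zero>" "x = finsum M g S"
    "\<forall>i\<in>UNIV \<times> weights D. W \<kappa> z (fst i) (snd i) (cut \<kappa> i y) (g i)" using add.IH(1) by metis
  obtain g' S' where g': "finite S'" "S' \<subseteq> UNIV \<times> weights D" "\<forall>i. i \<notin> S' \<longrightarrow> g' i = \<zero>" "x' = finsum M g' S'"
    "\<forall>i\<in>UNIV \<times> weights D. W \<kappa> z (fst i) (snd i) (cut \<kappa> i y') (g' i)" using add.IH(2) by metis
  let ?U = "S \<union> S'"
  have c: "g i \<in> carrier M" "g' i \<in> carrier M" if "i \<in> UNIV \<times> weights D" for i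
    using W_wt(3)[OF z bspec[OF g(5) that]] W_wt(3)[OF z bspec[OF g'(5) that]] by simp_all
  have U: "finite ?U" "?U \<subseteq> UNIV \<times> weights D" using g g' by auto
  have P: "g \<in> ?U \<rightarrow> carrier M" "g' \<in> ?U \<rightarrow> carrier M" using c U(2) by (simp_all add: Pi_iff subset_eq)
  have "finsum M g S = finsum M g ?U"
    by (rule Mo.add.finprod_mono_neutral_cong_left) (use U g(3) P in auto)
  moreover have "finsum M g' S' = finsum M g' ?U"
    by (rule Mo.add.finprod_mono_neutral_cong_left) (use U g'(3) P in auto)
  ultimately have x: "x \<oplus> x' = finsum M (\<lambda>i. g i \<oplus> g' i) ?U"
    unfolding g(4) g'(4) using Mo.finsum_addf[OF P] by simp
  have cut: "cut \<kappa> i (y + y') = cut \<kappa> i y + cut \<kappa> i y'" for i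
    by (simp add: cut_def fun_eq_iff plus_fun_apply)
  show ?case
    by (intro exI[of _ "\<lambda>i. g i \<oplus> g' i"] exI[of _ ?U] conjI ballI U x)
      (use g(3) g'(3) W.add[OF bspec[OF g(5)] bspec[OF g'(5)]] in \<open>simp_all add: cut\<close>)
qed

lemma Wtot_zero:
  assumes z: "prim \<kappa> z" and w: "Wtot \<kappa> z 0 x" shows "x = \<zero>"
proof -
  obtain g S where g: "finite S" "S \<subseteq> UNIV \<times> weights D" "x = finsum M g S"
    "\<forall>i\<in>UNIV \<times> weights D. W \<kappa> z (fst i) (snd i) (cut \<kappa> i 0) (g i)"
    using Wtot_components[OF z w] by metis
  have "cut \<kappa> i 0 = 0" for i by (simp add: cut_def fun_eq_iff zero_fun_apply)
  then have "g i = \<zero>" if "i \<in> S" for i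
    using bspec[OF g(4), of i] that g(2) W_inj[OF z] by (metis subsetD)
  then show ?thesis unfolding g(3) using Mo.add.finprod_one_eqI[of S g] by simp
qed

lemma Wtot_unique:
  assumes z: "prim \<kappa> z" and w: "Wtot \<kappa> z y x" "Wtot \<kappa> z y x'" shows "x = x'"
proof -
  \<comment> \<open>Negatives are available since \<open>-1\<close> is a Laurent polynomial.\<close>
  have s: "Wtot \<kappa> z (sca (-1) y) (\<phi> (-1) \<odot> x)" if "Wtot \<kappa> z y x" for y x
    using that
  proof induction
    case (base h \<nu> y x)
    then show ?case by (intro Wtot.base[OF W_sca[OF z _ base]]) (simp add: Laurent_closed)
  next
    case (add y x y' x')
    have l: "\<phi> (-1) \<in> carrier A" by (simp add: Laurent_closed)
    show ?case using Wtot.add[OF add.IH] Wtot_closed(2)[OF z add.hyps(1)] Wtot_closed(2)[OF z add.hyps(2)] l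
      by (simp add: sca_rules Mo.smult_r_distr)
  qed
  let ?t = "\<phi> (-1) \<odot> x"
  have y: "y + sca (-1) y = 0" by (simp add: sca_rules)
  have "x \<oplus> ?t = \<zero>" "x' \<oplus> ?t = \<zero>"
    using Wtot_zero[OF z] Wtot.add[OF w(1) s[OF w(1)]] Wtot.add[OF w(2) s[OF w(1)]] unfolding y by blast+
  moreover have "?t \<in> carrier M" "x \<in> carrier M" "x' \<in> carrier M"
    using Wtot_closed(2)[OF z] w by (simp_all add: Laurent_closed)
  ultimately show ?thesis using Mo.add.r_cancel by metis
qed

end

section \<open>The action of the integral form\<close>

context xobject
begin

text \<open>The operators on \<open>M\<close> that an element of the free algebra should induce. Different expressions for the same element
could a priori induce different operators, hence a relation.\<close>

inductive Rel :: "'v qfree => ('m => 'm) => bool" where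
  scal: "c \<in> carrier Laurent ==> Rel (fscal D c) (scal (\<phi> c))"
| E: "\<alpha> \<in> simples D ==> Rel (fdiv D GE \<alpha> n) (Eop \<alpha> n)"
| F: "\<alpha> \<in> simples D ==> Rel (fdiv D GF \<alpha> n) (Fop \<alpha> n)"
| K: "\<alpha> \<in> simples D ==> Rel (fK D \<alpha>) (Kop \<alpha> 1)"
| L: "\<alpha> \<in> simples D ==> Rel (fL D \<alpha>) (Kop \<alpha> (-1))"
| add: "Rel f S ==> Rel g T ==> Rel (f \<oplus>\<^bsub>Fr\<^esub> g) (S \<oplus>\<^bsub>EM\<^esub> T)"
| mult: "Rel f S ==> Rel g T ==> Rel (f \<otimes>\<^bsub>Fr\<^esub> g) (S \<otimes>\<^bsub>EM\<^esub> T)"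

lemma Rel_closed:
  assumes "Rel f T" shows "f \<in> carrier Fr" "T \<in> lend"
  using assms by (induction) (simp_all add: scal_lend Eop(1) Fop(1) Kop(1) lend_ops)

lemma Wtot_lift:
  assumes z: "prim \<kappa> z" and P: "linop P" and T: "T \<in> lend"
    and b: "\<And>h \<nu> y x. W \<kappa> z h \<nu> y x ==> Wtot \<kappa> z (P y) (T x)" and w: "Wtot \<kappa> z y x"
  shows "Wtot \<kappa> z (P y) (T x)"
  using w
proof induction
  case (base h \<nu> y x) then show ?case by (rule b)
next
  case (add y x y' x')
  note c = Wtot_closed(2)[OF z add.hyps(1)] Wtot_closed(2)[OF z add.hyps(2)]
  show ?case unfolding linop_add[OF P] lend_add[OF T c] by (rule Wtot.add[OF add.IH])
qed

text \<open>Whatever the free algebra does on the highest weight module is mirrored on \<open>M\<close>.\<close>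

lemma Wtot_Rel:
  assumes z: "prim \<kappa> z" and R: "Rel f T" and w: "Wtot \<kappa> z y x"
  shows "Wtot \<kappa> z (act (vop D \<kappa>) f y) (T x)"
proof -
  interpret h: hw D \<kappa> by unfold_locales
  show ?thesis using R w
  proof (induction arbitrary: y x)
    case (scal c)
    show ?case
    proof (rule Wtot_lift[OF z h.V.linop_act scal_lend[OF phi_closed[OF scal.hyps]] _ scal.prems])
      fix h \<nu> y x assume w: "W \<kappa> z h \<nu> y x"
      show "Wtot \<kappa> z (h.V.ac (fscal D c) y) (scal (\<phi> c) x)"
        using Wtot.base[OF W_sca[OF z scal.hyps w]] W_wt(3)[OF z w] by (simp add: h.V.act_fscal scal_def)
    qed
  next
    case (E \<alpha> n)
    show ?case
    proof (rule Wtot_lift[OF z h.V.linop_act Eop(1)[OF E.hyps] _ E.prems])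
      fix h \<nu> y x assume w: "W \<kappa> z h \<nu> y x"
      show "Wtot \<kappa> z (h.V.ac (fdiv D GE \<alpha> n) y) (Eop \<alpha> n x)"
        using Wtot.base[OF W_E[OF z E.hyps w]] h.V.act_fdiv[OF _ E.hyps, of GE] by simp
    qed
  next
    case (F \<alpha> n)
    show ?case
    proof (rule Wtot_lift[OF z h.V.linop_act Fop(1)[OF F.hyps] _ F.prems])
      fix h \<nu> y x assume w: "W \<kappa> z h \<nu> y x"
      have e: "h.V.ac (fdiv D GF \<alpha> n) y = dpow (h.x \<alpha>) (h.Fo \<alpha>) n y" by (rule h.V.act_fdiv[OF _ F.hyps]) simp
      show "Wtot \<kappa> z (h.V.ac (fdiv D GF \<alpha> n) y) (Fop \<alpha> n x)"
        unfolding e by (rule Wtot.base[OF W.low[OF w F.hyps]])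
    qed
  next
    case (K \<alpha>)
    show ?case
    proof (rule Wtot_lift[OF z h.V.linop_act Kop(1) _ K.prems])
      fix h \<nu> y x assume w: "W \<kappa> z h \<nu> y x"
      have e: "h.V.ac (fK D \<alpha>) y = sca (qv powi (int (dnum D \<alpha>) * pr D \<nu> \<alpha>)) y"
        by (simp only: h.V.act_fgen[OF h.V.gens(3)[OF K.hyps]] W_hw(3)[OF z w K.hyps] qd_powi)
      show "Wtot \<kappa> z (h.V.ac (fK D \<alpha>) y) (Kop \<alpha> 1 x)"
        unfolding e Kop(2)[OF W_wt(1,2)[OF z w]] mult_1_left
        by (rule Wtot.base[OF W_sca[OF z Laurent_closed(3) w]])
    qed
  next
    case (L \<alpha>)
    show ?case
    proof (rule Wtot_lift[OF z h.V.linop_act Kop(1) _ L.prems])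
      fix h \<nu> y x assume w: "W \<kappa> z h \<nu> y x"
      have e: "h.V.ac (fL D \<alpha>) y = sca (qv powi (-1 * (int (dnum D \<alpha>) * pr D \<nu> \<alpha>))) y"
        by (simp only: h.V.act_fgen[OF h.V.gens(4)[OF L.hyps]] W_hw(4)[OF z w L.hyps] qd_powi) simp
      show "Wtot \<kappa> z (h.V.ac (fL D \<alpha>) y) (Kop \<alpha> (-1) x)"
        unfolding e Kop(2)[OF W_wt(1,2)[OF z w]]
        by (rule Wtot.base[OF W_sca[OF z Laurent_closed(3) w]])
    qed
  next
    case (add f S g T)
    show ?case
      unfolding h.V.act_add[OF Rel_closed(1)[OF add.hyps(1)] Rel_closed(1)[OF add.hyps(2)]]
        endo_simps(2)[OF Wtot_closed(2)[OF z add.prems]]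
      by (rule Wtot.add[OF add.IH(1)[OF add.prems] add.IH(2)[OF add.prems]])
  next
    case (mult f S g T)
    show ?case
      unfolding h.V.act_mult[OF Rel_closed(1)[OF mult.hyps(1)] Rel_closed(1)[OF mult.hyps(2)]]
        endo_simps(1)[OF Wtot_closed(2)[OF z mult.prems]]
      by (rule mult.IH(1)[OF mult.IH(2)[OF mult.prems]])
  qed
qed

text \<open>Sums of vectors of weight \<open>\<mu>\<close> that occur in a pair; primitive vectors of all weights \<open>\<kappa>\<close> are admitted.\<close>

inductive Wsp :: "'v => 'm => bool" for \<mu> where
  base: "prim \<kappa> z ==> W \<kappa> z h \<mu> y x ==> Wsp \<mu> x"
| add: "Wsp \<mu> x ==> Wsp \<mu> x' ==> Wsp \<mu> (x \<oplus> x')"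

lemma Wsp_closed: "Wsp \<mu> x ==> x \<in> carrier M"
  by (induction rule: Wsp.induct) (use W_wt(3) in auto)

lemma Wsp_smult: assumes "Wsp \<mu> x" "a \<in> carrier A" shows "Wsp \<mu> (a \<odot> x)"
  using assms(1)
proof induction
  case (base \<kappa> z h y x) then show ?case using Wsp.base[OF prim_smult W_smult] assms(2) by blast
next
  case (add x x') then show ?case using Wsp.add[OF add.IH] assms(2) Wsp_closed[OF add.hyps(1)] Wsp_closed[OF add.hyps(2)]
    by (simp add: Mo.smult_r_distr)
qed

lemma Wsp_F: assumes \<alpha>: "\<alpha> \<in> simples D" and x: "Wsp (wshift \<mu> n \<alpha>) x" shows "Wsp \<mu> (Fop \<alpha> n x)"
  using x
proof induction
  case (base \<kappa> z h y x)
  have "W \<kappa> z (h + int n) (wshift \<mu> n \<alpha> - real n *\<^sub>R \<alpha>) (dpow (qd (dnum D \<alpha>)) (vop D \<kappa> (GF \<alpha>)) n y) (Fop \<alpha> n x)"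
    by (rule W.low[OF base(2) \<alpha>])
  then show ?case using Wsp.base[OF base(1)] by (simp del: vop.simps)
next
  case (add x x')
  show ?case
    unfolding lend_add[OF Fop(1)[OF \<alpha>] Wsp_closed[OF add.hyps(1)] Wsp_closed[OF add.hyps(2)]]
    by (rule Wsp.add[OF add.IH])
qed

definition Gen :: "'v => 'm => bool" where
  "Gen \<mu> x \<longleftrightarrow> x \<in> carrier M \<and> (\<exists>a\<in>carrier A. a \<noteq> \<zero>\<^bsub>A\<^esub> \<and> Wsp \<mu> (a \<odot> x))"

lemma GenI: "x \<in> carrier M ==> a \<in> carrier A ==> a \<noteq> \<zero>\<^bsub>A\<^esub> ==> Wsp \<mu> (a \<odot> x) ==> Gen \<mu> x"
  by (auto simp: Gen_def)

lemma Gen_add: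
  assumes "Gen \<mu> x" "Gen \<mu> y" shows "Gen \<mu> (x \<oplus> y)"
proof -
  obtain a where x: "x \<in> carrier M" and a: "a \<in> carrier A" "a \<noteq> \<zero>\<^bsub>A\<^esub>" "Wsp \<mu> (a \<odot> x)"
    using assms(1) unfolding Gen_def by blast
  obtain b where y: "y \<in> carrier M" and b: "b \<in> carrier A" "b \<noteq> \<zero>\<^bsub>A\<^esub>" "Wsp \<mu> (b \<odot> y)"
    using assms(2) unfolding Gen_def by blast
  have ba: "(a \<otimes>\<^bsub>A\<^esub> b) \<odot> x = b \<odot> (a \<odot> x)"
    unfolding A.m_comm[OF a(1) b(1)] by (rule Mo.smult_assoc1[OF b(1) a(1) x])
  have ab: "(a \<otimes>\<^bsub>A\<^esub> b) \<odot> y = a \<odot> (b \<odot> y)" by (rule Mo.smult_assoc1[OF a(1) b(1) y])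
  have "Wsp \<mu> ((a \<otimes>\<^bsub>A\<^esub> b) \<odot> (x \<oplus> y))"
    unfolding Mo.smult_r_distr[OF A.m_closed[OF a(1) b(1)] x y] ba ab
    by (intro Wsp.add Wsp_smult a b)
  then show ?thesis
    by (rule GenI[rotated 3]) (use a b x y A.integral_iff in simp_all)
qed

lemma Gen_F:
  assumes \<alpha>: "\<alpha> \<in> simples D" and x: "Gen (wshift \<mu> n \<alpha>) x" shows "Gen \<mu> (Fop \<alpha> n x)"
proof -
  obtain a where c: "x \<in> carrier M" and a: "a \<in> carrier A" "a \<noteq> \<zero>\<^bsub>A\<^esub>" "Wsp (wshift \<mu> n \<alpha>) (a \<odot> x)"
    using x unfolding Gen_def by blast
  have "Wsp \<mu> (a \<odot> Fop \<alpha> n x)"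
    using Wsp_F[OF \<alpha> a(3)] unfolding lend_smult[OF Fop(1)[OF \<alpha>] a(1) c] .
  then show ?thesis by (rule GenI[OF lend_closed[OF Fop(1)[OF \<alpha>] c] a(1,2)])
qed

lemma Gen_zero: "\<mu> \<in> weights D ==> Gen \<mu> \<zero>"
proof (rule GenI[of _ "\<one>\<^bsub>A\<^esub>"])
  assume \<mu>: "\<mu> \<in> weights D"
  have "prim \<mu> \<zero>" unfolding prim_def using \<mu> wt_closed(5)[OF \<mu>] lend_zero[OF Eop(1)] by blast
  from Wsp.base[OF this W.zero[OF \<mu>]] show "Wsp \<mu> (\<one>\<^bsub>A\<^esub> \<odot> \<zero>)" by simp
qed simp_all

text \<open>Downward induction on \<open>\<mu>\<close> through the primitive decomposition: the part in \<open>im F\<close> is covered by higher weights and the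
primitive part is paired with \<open>hwv\<close>.\<close>

lemma Gen_all:
  assumes \<mu>: "\<mu> \<in> weights D" shows "\<forall>x\<in>wt M \<mu>. Gen \<mu> x"
proof -
  have qb: "quasi_bounded D {\<mu>\<in>weights D. wt M \<mu> \<noteq> {\<zero>}}" using x1 by (simp add: X1_def)
  show ?thesis
  proof (rule weight_induct[OF qb \<mu>])
    fix \<mu> assume \<mu>: "\<mu> \<in> weights D" and "\<mu> \<notin> {\<mu>\<in>weights D. wt M \<mu> \<noteq> {\<zero>}}"
    then have "wt M \<mu> = {\<zero>}" by blast
    then show "\<forall>x\<in>wt M \<mu>. Gen \<mu> x" using Gen_zero[OF \<mu>] by simp
  next
    fix \<mu> assume \<mu>: "\<mu> \<in> weights D"
      and IH: "\<And>\<alpha> n. \<alpha> \<in> simples D ==> n > 0 ==> \<forall>x\<in>wt M (wshift \<mu> n \<alpha>). Gen (wshift \<mu> n \<alpha>) x"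
    show "\<forall>x\<in>wt M \<mu>. Gen \<mu> x"
    proof
      fix x assume x: "x \<in> wt M \<mu>"
      have xc: "x \<in> carrier M" by (rule wt_closed(1)[OF \<mu> x])
      obtain a y z where a: "a \<in> carrier A" "a \<noteq> \<zero>\<^bsub>A\<^esub>" and y: "y \<in> imF D M \<mu>" and z: "prim \<mu> z"
        and e: "a \<odot> x = y \<oplus> z" using primitive_decomposition[OF \<mu> x] by metis
      have "Gen \<mu> y"
      proof (rule imF_induct[OF \<mu> y])
        show "Gen \<mu> \<zero>" by (rule Gen_zero[OF \<mu>])
        show "Gen \<mu> (u \<oplus> w)" if "Gen \<mu> u" "Gen \<mu> w" for u w by (rule Gen_add[OF that])
        show "Gen \<mu> (Fop \<alpha> n u)" if "\<alpha> \<in> simples D" "n > 0" "u \<in> wt M (wshift \<mu> n \<alpha>)" for \<alpha> n u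
          using IH[OF that(1,2)] that by (intro Gen_F) auto
      qed
      moreover have "Gen \<mu> z"
      proof (rule GenI[OF primD(3)[OF z] A.one_closed A.one_not_zero])
        have "W \<mu> z 0 \<mu> (sca 1 hwv) (\<phi> 1 \<odot> z)" by (rule W.top[OF Laurent_closed(2)])
        then show "Wsp \<mu> (\<one>\<^bsub>A\<^esub> \<odot> z)" using Wsp.base[OF z] by (simp only: phi_simps)
      qed
      ultimately have "Gen \<mu> (a \<odot> x)" unfolding e by (rule Gen_add)
      then obtain b where b: "b \<in> carrier A" "b \<noteq> \<zero>\<^bsub>A\<^esub>" "Wsp \<mu> (b \<odot> (a \<odot> x))" unfolding Gen_def by blast
      then show "Gen \<mu> x"
        using a xc A.integral_iff by (intro GenI[of x "b \<otimes>\<^bsub>A\<^esub> a"]) (simp_all add: Mo.smult_assoc1)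
    qed
  qed
qed

text \<open>As \<open>M\<close> is torsion free, agreement on the vectors that occur in pairs is enough.\<close>

lemma lend_eq_from_W:
  assumes S: "S \<in> lend" and T: "T \<in> lend" and \<mu>: "\<mu> \<in> weights D" and x: "x \<in> wt M \<mu>"
    and W: "\<And>\<kappa> z h y x. prim \<kappa> z ==> W \<kappa> z h \<mu> y x ==> S x = T x"
  shows "S x = T x"
proof -
  obtain a where a: "a \<in> carrier A" "a \<noteq> \<zero>\<^bsub>A\<^esub>" "Wsp \<mu> (a \<odot> x)" and xc: "x \<in> carrier M"
    using Gen_all[OF \<mu>] x unfolding Gen_def by blast
  have c: "S x \<in> carrier M" "T x \<in> carrier M" by (rule lend_closed[OF S xc], rule lend_closed[OF T xc])
  have "S (a \<odot> x) = T (a \<odot> x)" using a(3)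
  proof induction
    case (base \<kappa> z h y x) then show ?case by (rule W)
  next
    case (add x x')
    note c = Wsp_closed[OF add.hyps(1)] Wsp_closed[OF add.hyps(2)]
    show ?case unfolding lend_add[OF S c] lend_add[OF T c] by (simp only: add.IH)
  qed
  then have e: "a \<odot> S x = a \<odot> T x" unfolding lend_smult[OF S a(1) xc] lend_smult[OF T a(1) xc] .
  have "a \<odot> (S x \<ominus> T x) = \<zero>"
    using c a(1) e by (simp add: a_minus_def Mo.smult_r_distr Mo.smult_r_minus Mo.r_neg)
  then have "S x \<ominus> T x = \<zero>" using torsion_free[OF a(1,2)] c by simp
  moreover have "S x = (S x \<ominus> T x) \<oplus> T x" using c by (simp add: a_minus_def Mo.a_assoc Mo.l_neg)
  ultimately show ?thesis using c by simp
qed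

text \<open>The difference of \<open>f\<close> and \<open>g\<close> kills the highest weight modules. So \<open>S x\<close> and \<open>T x\<close> are paired with the same vector
whenever \<open>x\<close> occurs in a pair.\<close>

lemma Rel_unique:
  assumes R: "Rel f S" "Rel g T" and e: "qcls D f = qcls D g" shows "S = T"
proof (rule lend_eqI[OF Rel_closed(2)[OF R(1)] Rel_closed(2)[OF R(2)]])
  note c = Rel_closed(1)[OF R(1)] Rel_closed(1)[OF R(2)]
  fix \<mu> x assume \<mu>: "\<mu> \<in> weights D" and x: "x \<in> wt M \<mu>"
  show "S x = T x"
  proof (rule lend_eq_from_W[OF Rel_closed(2)[OF R(1)] Rel_closed(2)[OF R(2)] \<mu> x])
    fix \<kappa> z h y x assume z: "prim \<kappa> z" and w: "W \<kappa> z h \<mu> y x"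
    interpret h: hw D \<kappa> by unfold_locales
    have "h.V.ac (f \<ominus>\<^bsub>Fr\<^esub> g) y = 0"
      by (rule h.qideal_act[OF _ W_hw(1)[OF z w]]) (use e c in \<open>simp add: qcls_eq_iff\<close>)
    then have a: "h.V.ac f y = h.V.ac g y" using c by (simp add: h.V.act_minus)
    show "S x = T x"
      by (rule Wtot_unique[OF z Wtot_Rel[OF z R(1) Wtot.base[OF w]]])
        (unfold a, rule Wtot_Rel[OF z R(2) Wtot.base[OF w]])
  qed
qed

lemma Rel_ex: "u \<in> carrier (UZ D) ==> \<exists>f T. Rel f T \<and> qcls D f = u"
  unfolding UZ_form
proof (induction rule: form_induct[OF _ U_gens_closed, consumes 1, case_names scal incl add mult])
  case (scal c) then show ?case using Rel.scal[OF scal] by (auto simp: qscal_def)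
next
  case (incl s)
  then consider (K) \<alpha> where "\<alpha> \<in> simples D" "s = fK D \<alpha>" | (L) \<alpha> where "\<alpha> \<in> simples D" "s = fL D \<alpha>"
    | (E) \<alpha> n where "\<alpha> \<in> simples D" "s = fdiv D GE \<alpha> n" | (F) \<alpha> n where "\<alpha> \<in> simples D" "s = fdiv D GF \<alpha> n"
    by (auto simp: U_gens_def)
  then show ?case using Rel.K Rel.L Rel.E Rel.F by cases blast+
next
  case (add u w)
  obtain f S g T where "Rel f S" "qcls D f = u" "Rel g T" "qcls D g = w" using add.IH by blast
  then show ?case using Rel.add[of f S g T] Rel_closed(1) q.hom_add by metis
next
  case (mult u w)
  obtain f S g T where "Rel f S" "qcls D f = u" "Rel g T" "qcls D g = w" using mult.IH by blast
  then show ?case using Rel.mult[of f S g T] Rel_closed(1) q.hom_mult by metis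
qed

definition rho :: "'v qfree set => 'm => 'm" where
  "rho u = (THE T. \<exists>f. Rel f T \<and> qcls D f = u)"

lemma rho_eq: assumes "Rel f T" shows "rho (qcls D f) = T"
  unfolding rho_def by (rule the_equality) (use assms Rel_unique in blast)+

lemma rho_lend: "u \<in> carrier (UZ D) ==> rho u \<in> lend"
  using Rel_ex rho_eq Rel_closed(2) by metis

lemma rho_gens:
  "c \<in> carrier Laurent ==> rho (qscal D c) = scal (\<phi> c)"
  "\<alpha> \<in> simples D ==> rho (qcls D (fdiv D GE \<alpha> n)) = Eop \<alpha> n"
  "\<alpha> \<in> simples D ==> rho (qcls D (fdiv D GF \<alpha> n)) = Fop \<alpha> n"
  "\<alpha> \<in> simples D ==> rho (qcls D (fK D \<alpha>)) = Kop \<alpha> 1"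
  "\<alpha> \<in> simples D ==> rho (qcls D (fL D \<alpha>)) = Kop \<alpha> (-1)"
  unfolding qscal_def by (rule rho_eq, erule Rel.intros)+

lemma scal_one: "scal \<one>\<^bsub>A\<^esub> = \<one>\<^bsub>EM\<^esub>"
  by (rule endo_eqI[where M = M, OF lend_endo[OF scal_lend] endo_ops_closed(3)[OF Mo.abelian_group_axioms]])
    (simp_all add: scal_def endo_simps)

lemma rho_hom: "rho \<in> ring_hom (UZ D) EM"
proof (rule ring_hom_memI)
  show "rho u \<in> carrier EM" if "u \<in> carrier (UZ D)" for u by (rule lend_endo[OF rho_lend[OF that]])
  have "\<one>\<^bsub>UZ D\<^esub> = qscal D 1" by (simp add: UZ_form qscal_def fscal_one)
  then show "rho \<one>\<^bsub>UZ D\<^esub> = \<one>\<^bsub>EM\<^esub>"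
    using rho_gens(1)[OF Laurent_closed(2)] by (simp add: phi_simps scal_one)
  fix u w assume "u \<in> carrier (UZ D)" "w \<in> carrier (UZ D)"
  then obtain f S g T where R: "Rel f S" "qcls D f = u" "Rel g T" "qcls D g = w" using Rel_ex by metis
  note c = Rel_closed(1)[OF R(1)] Rel_closed(1)[OF R(3)]
  have "u \<otimes>\<^bsub>UZ D\<^esub> w = qcls D (f \<otimes>\<^bsub>Fr\<^esub> g)" "u \<oplus>\<^bsub>UZ D\<^esub> w = qcls D (f \<oplus>\<^bsub>Fr\<^esub> g)"
    using c R by (simp_all add: UZ_form)
  then show "rho (u \<otimes>\<^bsub>UZ D\<^esub> w) = rho u \<otimes>\<^bsub>EM\<^esub> rho w"
    "rho (u \<oplus>\<^bsub>UZ D\<^esub> w) = rho u \<oplus>\<^bsub>EM\<^esub> rho w"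
    using rho_eq[OF Rel.mult[OF R(1,3)]] rho_eq[OF Rel.add[OF R(1,3)]] rho_eq[OF R(1)] rho_eq[OF R(3)] R(2,4) by simp_all
qed

text \<open>Torus binomials are not among the generators of Lusztig's form, so their action on \<open>M\<close> is not prescribed. It is
computed in the highest weight modules.\<close>

lemma rho_fkbin:
  assumes \<alpha>: "\<alpha> \<in> simples D" and \<mu>: "\<mu> \<in> weights D" and x: "x \<in> wt M \<mu>"
  shows "rho (qcls D (fkbin D \<alpha> r)) x = \<phi> (qbinom (dnum D \<alpha>) (pr D \<mu> \<alpha>) r) \<odot> x"
proof -
  let ?b = "qbinom (dnum D \<alpha>) (pr D \<mu> \<alpha>) r"
  have b: "?b \<in> carrier Laurent" by (rule qbinom_Laurent[OF dnum_pos[OF \<alpha>]])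
  have u: "qcls D (fkbin D \<alpha> r) \<in> carrier (UZ D)" using fkbin_BZ[OF \<alpha>] by (simp add: BZ_def)
  obtain f T where R: "Rel f T" and e: "qcls D f = qcls D (fkbin D \<alpha> r)" using Rel_ex[OF u] by blast
  have r: "rho (qcls D (fkbin D \<alpha> r)) = T" unfolding e[symmetric] by (rule rho_eq[OF R])
  have "T x = scal (\<phi> ?b) x"
  proof (rule lend_eq_from_W[OF Rel_closed(2)[OF R] scal_lend[OF phi_closed[OF b]] \<mu> x])
    fix \<kappa> z h y x assume z: "prim \<kappa> z" and w: "W \<kappa> z h \<mu> y x"
    interpret h: hw D \<kappa> by unfold_locales
    have c: "f \<in> carrier Fr" by (rule Rel_closed(1)[OF R])
    have "h.V.ac (f \<ominus>\<^bsub>Fr\<^esub> fkbin D \<alpha> r) y = 0"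
      by (rule h.qideal_act[OF _ W_hw(1)[OF z w]]) (use e c in \<open>simp add: qcls_eq_iff[symmetric]\<close>)
    then have "h.V.ac f y = h.V.ac (fkbin D \<alpha> r) y" using c by (simp add: h.V.act_minus)
    also have "\<dots> = rank1.hop (h.x \<alpha>) (h.K \<alpha>) (h.L \<alpha>) 0 r y" by (rule h.V.act_fkbin[OF h.rank1[OF \<alpha>] \<alpha> UNIV_I])
    also have "\<dots> = sca ?b y"
      using rank1.hop_weight[OF h.rank1[OF \<alpha>] W_hw(3,4)[OF z w \<alpha>], where c = 0 and r = r] by (simp add: qbinom_qchoose del: vop.simps)
    finally have a: "h.V.ac f y = sca ?b y" .
    have "Wtot \<kappa> z (sca ?b y) (T x)" using Wtot_Rel[OF z R Wtot.base[OF w]] unfolding a .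
    from Wtot_unique[OF z this Wtot.base[OF W_sca[OF z b w]]]
    show "T x = scal (\<phi> ?b) x" using W_wt(3)[OF z w] by (simp add: scal_def)
  qed
  then show ?thesis unfolding r using wt_closed(1)[OF \<mu> x] by (simp add: scal_def)
qed

end

section \<open>Module structures on objects of \<open>\<X>\<close>\<close>

lemma abelian_group_transfer:
  assumes "abelian_group M" and e: "carrier N = carrier M" "add N = add M" "ring.zero N = ring.zero M"
  shows "abelian_group N"
proof -
  interpret M: abelian_group M by fact
  show ?thesis
  proof (rule abelian_groupI)
    fix x assume "x \<in> carrier N"
    then show "\<exists>y\<in>carrier N. y \<oplus>\<^bsub>N\<^esub> x = \<zero>\<^bsub>N\<^esub>"
      unfolding e by (intro bexI[of _ "\<ominus>\<^bsub>M\<^esub> x"]) (simp_all add: M.l_neg)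
  qed (simp_all add: e M.a_ac)
qed

lemma abelian_group_with_action: "abelian_group M ==> abelian_group (with_action M act)"
  by (rule abelian_group_transfer) (simp_all add: with_action_def)

text \<open>Module structures are homomorphisms to the ring of additive endomorphisms.\<close>

lemma (in base_change) U_structure_iff:
  assumes M: "abelian_group M"
  shows "U_structure D A \<phi> M h \<longleftrightarrow> h \<in> ring_hom UU (endo_ring M) \<and> h \<in> extensional (carrier UU) \<and>
    (\<forall>a\<in>carrier A. \<forall>x\<in>carrier M. h (usc a) x = a \<odot>\<^bsub>M\<^esub> x)" (is "?L \<longleftrightarrow> ?R")
proof -
  interpret U: ring "UU" by (rule UA_ring)
  interpret M: abelian_group M by (rule M)
  have w: "carrier (with_action M h) = carrier M" "x \<oplus>\<^bsub>with_action M h\<^esub> y = x \<oplus>\<^bsub>M\<^esub> y" "u \<odot>\<^bsub>with_action M h\<^esub> x = h u x"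
    for u x y by (simp_all add: with_action_def)
  show ?thesis
  proof
    assume L: ?L
    then have h: "h \<in> carrier UU \<rightarrow>\<^sub>E (carrier M \<rightarrow>\<^sub>E carrier M)" by (simp add: U_structure_def)
    interpret N: left_module "UU" "with_action M h" using L by (simp add: U_structure_def)
    have c: "h u \<in> carrier (endo_ring M)" if "u \<in> carrier UU" for u
      unfolding endo_carrier using h that N.smult_r_distr[OF that] by (auto simp: w)
    have "h \<in> ring_hom UU (endo_ring M)"
    proof (rule ring_hom_memI)
      show "h \<one>\<^bsub>UU\<^esub> = \<one>\<^bsub>endo_ring M\<^esub>"
        by (rule endo_eqI[where M = M]) (use c N.smult_one endo_ops_closed(3)[OF M] in \<open>simp_all add: w endo_simps\<close>)
      fix u u' assume u: "u \<in> carrier UU" "u' \<in> carrier UU"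
      show "h (u \<otimes>\<^bsub>UU\<^esub> u') = h u \<otimes>\<^bsub>endo_ring M\<^esub> h u'"
        by (rule endo_eqI[where M = M]) (use u c N.smult_assoc endo_ops_closed(1)[OF M] in \<open>simp_all add: w endo_simps\<close>)
      show "h (u \<oplus>\<^bsub>UU\<^esub> u') = h u \<oplus>\<^bsub>endo_ring M\<^esub> h u'"
        by (rule endo_eqI[where M = M]) (use u c N.smult_l_distr endo_ops_closed(2)[OF M] in \<open>simp_all add: w endo_simps\<close>)
    qed (rule c)
    then show ?R using L unfolding U_structure_def PiE_def by blast
  next
    assume R: ?R
    then have h: "h \<in> ring_hom UU (endo_ring M)" by blast
    have c: "h u \<in> carrier (endo_ring M)" if "u \<in> carrier UU" for u by (rule ring_hom_closed[OF h that])
    have "left_module UU (with_action M h)"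
    proof (rule left_module.intro[OF U.ring_axioms abelian_group_with_action[OF M]], rule left_module_axioms.intro)
      show "x \<in> carrier (with_action M h) ==> \<one>\<^bsub>UU\<^esub> \<odot>\<^bsub>with_action M h\<^esub> x = x" for x
        by (simp add: w ring_hom_one[OF h] endo_simps)
    qed (simp_all add: w endo_closed[OF c] endo_add[OF c] ring_hom_mult[OF h] ring_hom_add[OF h] endo_simps)
    moreover have "h \<in> carrier UU \<rightarrow>\<^sub>E (carrier M \<rightarrow>\<^sub>E carrier M)"
      using R c unfolding endo_carrier PiE_def by blast
    ultimately show ?L using R unfolding U_structure_def by blast
  qed
qed

context xobject
begin

lemma scal_hom: "scal \<in> ring_hom A EM"
proof (rule ring_hom_memI)
  note c = lend_endo[OF scal_lend]
  note o = endo_ops_closed[OF Mo.abelian_group_axioms]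
  have ap: "scal a x = a \<odot> x" if "x \<in> carrier M" for a x using that by (simp add: scal_def)
  fix a b assume ab: "a \<in> carrier A" "b \<in> carrier A"
  show "scal (a \<otimes>\<^bsub>A\<^esub> b) = scal a \<otimes>\<^bsub>EM\<^esub> scal b"
    by (rule endo_eqI[where M = M]) (use ab c o in \<open>simp_all add: endo_simps ap Mo.smult_assoc1\<close>)
  show "scal (a \<oplus>\<^bsub>A\<^esub> b) = scal a \<oplus>\<^bsub>EM\<^esub> scal b"
    by (rule endo_eqI[where M = M]) (use ab c o in \<open>simp_all add: endo_simps ap Mo.smult_l_distr\<close>)
qed (rule lend_endo[OF scal_lend], assumption, rule scal_one)

lemma urep_ex:
  "\<exists>h \<in> ring_hom UU EM. \<forall>u\<in>carrier (UZ D). \<forall>a\<in>carrier A.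
     h (tel u a) = rho u \<otimes>\<^bsub>EM\<^esub> scal a"
proof (rule UA_TR_hom[OF endo_ring_ring[OF Mo.abelian_group_axioms] rho_hom scal_hom])
  fix u a assume u: "u \<in> carrier (UZ D)" and a: "a \<in> carrier A"
  note o = endo_ops_closed[OF Mo.abelian_group_axioms]
  note c = rho_lend[OF u] scal_lend[OF a]
  show "rho u \<otimes>\<^bsub>EM\<^esub> scal a = scal a \<otimes>\<^bsub>EM\<^esub> rho u"
    by (rule endo_eqI[where M = M])
      (use lend_smult[OF c(1) a] lend_closed[OF c(1)] o(1) lend_endo[OF c(1)] lend_endo[OF c(2)] in \<open>simp_all add: endo_simps scal_def\<close>)
qed (rule rho_gens(1))

definition urep :: "('v, 'a) ualg => 'm => 'm" where
  "urep = restrict (SOME h. h \<in> ring_hom UU EM \<and> (\<forall>u\<in>carrier (UZ D). \<forall>a\<in>carrier A.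
     h (tel u a) = rho u \<otimes>\<^bsub>EM\<^esub> scal a)) (carrier UU)"

lemma urep_hom: "urep \<in> ring_hom UU EM"
  and urep_elt: "u \<in> carrier (UZ D) ==> a \<in> carrier A ==> urep (tel u a) = rho u \<otimes>\<^bsub>EM\<^esub> scal a"
  and urep_ext: "urep \<in> extensional (carrier UU)"
proof -
  let ?h = "SOME h. h \<in> ring_hom UU EM \<and> (\<forall>u\<in>carrier (UZ D). \<forall>a\<in>carrier A.
     h (tel u a) = rho u \<otimes>\<^bsub>EM\<^esub> scal a)"
  have h: "?h \<in> ring_hom UU EM \<and> (\<forall>u\<in>carrier (UZ D). \<forall>a\<in>carrier A.
     ?h (tel u a) = rho u \<otimes>\<^bsub>EM\<^esub> scal a)"
    by (rule someI_ex[of "\<lambda>h. h \<in> ring_hom UU EM \<and> (\<forall>u\<in>carrier (UZ D). \<forall>a\<in>carrier A.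
     h (tel u a) = rho u \<otimes>\<^bsub>EM\<^esub> scal a)"]) (use urep_ex in blast)
  show "urep \<in> ring_hom UU EM"
    unfolding urep_def by (rule ring.ring_hom_restrict[OF UA_ring]) (use h in simp_all)
  show "u \<in> carrier (UZ D) ==> a \<in> carrier A ==> urep (tel u a) = rho u \<otimes>\<^bsub>EM\<^esub> scal a"
    unfolding urep_def using h by (simp add: UA_tel_closed)
  show "urep \<in> extensional (carrier UU)" unfolding urep_def by simp
qed

lemma urep_one: "u \<in> carrier (UZ D) ==> urep (tel u \<one>\<^bsub>A\<^esub>) = rho u"
proof -
  assume u: "u \<in> carrier (UZ D)"
  interpret E: ring "EM" by (rule endo_ring_ring[OF Mo.abelian_group_axioms])
  show ?thesis using urep_elt[OF u A.one_closed] lend_endo[OF rho_lend[OF u]] by (simp add: scal_one)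
qed

lemma urep_scal: "a \<in> carrier A ==> urep (usc a) = scal a"
proof -
  assume a: "a \<in> carrier A"
  interpret E: ring "EM" by (rule endo_ring_ring[OF Mo.abelian_group_axioms])
  show ?thesis using urep_elt[OF UZ_one_closed a] ring_hom_one[OF rho_hom] lend_endo[OF scal_lend[OF a]]
    by (simp add: ua_scal_def)
qed

lemma urep_structure: "U_structure D A \<phi> M urep"
  unfolding U_structure_iff[OF Mo.abelian_group_axioms]
  using urep_hom urep_ext urep_scal by (simp add: scal_def)

lemma UZ0_UZ: "u \<in> carrier (UZ0 D) ==> u \<in> carrier (UZ D)"
  using UZ0_subset by blast

lemma urep_torus:
  assumes H: "H \<in> carrier UU0" and \<mu>: "\<mu> \<in> weights D"
  shows "\<forall>x\<in>wt M \<mu>. urep (incl0 H) x = ch \<mu> H \<odot> x"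
proof (rule UA0_induct[OF H])
  fix a assume a: "a \<in> carrier A"
  have "incl0 (tel0 \<one>\<^bsub>UZ0 D\<^esub> a) = usc a"
    using ua0_incl(2)[OF UZ0_one_closed a] by (simp add: ua_scal_def UZ_form UZ0_form)
  then show "\<forall>x\<in>wt M \<mu>. urep (incl0 (tel0 \<one>\<^bsub>UZ0 D\<^esub> a)) x = ch \<mu> (tel0 \<one>\<^bsub>UZ0 D\<^esub> a) \<odot> x"
    using urep_scal[OF a] chi(2)[OF a] wt_closed(1)[OF \<mu>] by (simp add: scal_def)
next
  fix s assume s: "s \<in> U0_gens D"
  have sU: "qcls D s \<in> carrier (UZ0 D)" unfolding UZ0_form by (rule form_incl[OF s])
  have e: "urep (incl0 (tel0 (qcls D s) \<one>\<^bsub>A\<^esub>)) = rho (qcls D s)"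
    using ua0_incl(2)[OF sU A.one_closed] urep_one[OF UZ0_UZ[OF sU]] by simp
  consider (K) \<alpha> where "\<alpha> \<in> simples D" "s = fK D \<alpha>" | (L) \<alpha> where "\<alpha> \<in> simples D" "s = fL D \<alpha>"
      | (B) \<alpha> n where "\<alpha> \<in> simples D" "s = fkbin D \<alpha> n"
    using s by (auto simp: U0_gens_def)
  then show "\<forall>x\<in>wt M \<mu>. urep (incl0 (tel0 (qcls D s) \<one>\<^bsub>A\<^esub>)) x = ch \<mu> (tel0 (qcls D s) \<one>\<^bsub>A\<^esub>) \<odot> x"
    unfolding e
  proof cases
    case K then show "\<forall>x\<in>wt M \<mu>. rho (qcls D s) x = ch \<mu> (tel0 (qcls D s) \<one>\<^bsub>A\<^esub>) \<odot> x"
      using Kop(2)[OF \<mu>, of _ \<alpha> 1] by (simp add: rho_gens chi)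
  next
    case L then show "\<forall>x\<in>wt M \<mu>. rho (qcls D s) x = ch \<mu> (tel0 (qcls D s) \<one>\<^bsub>A\<^esub>) \<odot> x"
      using Kop(2)[OF \<mu>, of _ \<alpha> "-1"] by (simp add: rho_gens chi)
  next
    case B then show "\<forall>x\<in>wt M \<mu>. rho (qcls D s) x = ch \<mu> (tel0 (qcls D s) \<one>\<^bsub>A\<^esub>) \<odot> x"
      using rho_fkbin[OF B(1) \<mu>] by (simp add: chi)
  qed
next
  fix H H' assume H: "H \<in> carrier UU0" "H' \<in> carrier UU0"
    and P: "\<forall>x\<in>wt M \<mu>. urep (incl0 H) x = ch \<mu> H \<odot> x"
      "\<forall>x\<in>wt M \<mu>. urep (incl0 H') x = ch \<mu> H' \<odot> x"
  have u: "incl0 H \<in> carrier UU" "incl0 H' \<in> carrier UU"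
    using H by (auto intro: ring_hom_closed[OF ua0_incl(1)])
  have c: "ch \<mu> H \<in> carrier A" "ch \<mu> H' \<in> carrier A"
    using H by (auto intro: ring_hom_closed[OF chi(1)])
  show "\<forall>x\<in>wt M \<mu>. urep (incl0 (H \<oplus>\<^bsub>UU0\<^esub> H')) x = ch \<mu> (H \<oplus>\<^bsub>UU0\<^esub> H') \<odot> x"
    using P wt_closed(1)[OF \<mu>] c
    by (simp add: ring_hom_add[OF ua0_incl(1) H] ring_hom_add[OF urep_hom u] ring_hom_add[OF chi(1) H] endo_simps Mo.smult_l_distr)
  show "\<forall>x\<in>wt M \<mu>. urep (incl0 (H \<otimes>\<^bsub>UU0\<^esub> H')) x = ch \<mu> (H \<otimes>\<^bsub>UU0\<^esub> H') \<odot> x"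
    using P wt_closed(1,4)[OF \<mu>] c
    by (simp add: ring_hom_mult[OF ua0_incl(1) H] ring_hom_mult[OF urep_hom u] ring_hom_mult[OF chi(1) H] endo_simps Mo.smult_assoc1)
qed

lemma dec_urep_torus:
  assumes H: "H \<in> carrier UU0" and \<nu>: "\<nu> \<in> weights D" and x: "x \<in> carrier M"
  shows "dec (urep (incl0 H) x) \<nu> = ch \<nu> H \<odot> dec x \<nu>"
proof -
  have T: "urep (incl0 H) \<in> carrier EM"
    by (rule ring_hom_closed[OF urep_hom ring_hom_closed[OF ua0_incl(1) H]])
  have c: "ch \<kappa> H \<in> carrier A" for \<kappa> by (rule ring_hom_closed[OF chi(1) H])
  have wt: "dec (urep (incl0 H) x) \<nu> = ch \<nu> H \<odot> dec x \<nu>"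
    if \<kappa>: "\<kappa> \<in> weights D" and x: "x \<in> wt M \<kappa>" for \<kappa> x
  proof -
    have "urep (incl0 H) x = ch \<kappa> H \<odot> x" using urep_torus[OF H \<kappa>] x by blast
    then show ?thesis using dec_wt_eq[OF \<kappa> x \<nu>] dec_wt_eq[OF \<kappa> wt_closed(4)[OF \<kappa> c x] \<nu>] c by simp
  qed
  show ?thesis using x
  proof (rule wt_induct)
    fix x y assume "x \<in> carrier M" "y \<in> carrier M"
      "dec (urep (incl0 H) x) \<nu> = ch \<nu> H \<odot> dec x \<nu>" "dec (urep (incl0 H) y) \<nu> = ch \<nu> H \<odot> dec y \<nu>"
    then show "dec (urep (incl0 H) (x \<oplus> y)) \<nu> = ch \<nu> H \<odot> dec (x \<oplus> y) \<nu>"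
      using c dec_carrier[OF _ \<nu>] by (simp add: endo_add[OF T] endo_closed[OF T] dec_add[OF _ _ \<nu>] Mo.smult_r_distr)
  next
    show "dec (urep (incl0 H) \<zero>) \<nu> = ch \<nu> H \<odot> dec \<zero> \<nu>"
      by (rule wt[OF \<nu> wt_closed(5)[OF \<nu>]])
  qed (rule wt)
qed

lemma chi_separates:
  assumes \<mu>: "\<mu> \<in> weights D" and \<nu>: "\<nu> \<in> weights D"
    and e: "\<And>H. H \<in> carrier UU0 ==> ch \<mu> H = ch \<nu> H"
  shows "\<mu> = \<nu>"
proof (rule pr_separates[OF \<mu> \<nu>])
  fix \<alpha> assume \<alpha>: "\<alpha> \<in> simples D"
  show "pr D \<mu> \<alpha> = pr D \<nu> \<alpha>"
  proof (rule qbinom_separates[OF A.domain_axioms phi dnum_pos[OF \<alpha>]])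
    show "\<phi> (qv powi (int (dnum D \<alpha>) * pr D \<mu> \<alpha>)) = \<phi> (qv powi (int (dnum D \<alpha>) * pr D \<nu> \<alpha>))"
      using e[OF UA0_tel_closed[of "qcls D (fK D \<alpha>)" "\<one>\<^bsub>A\<^esub>"]] by (simp only: chi(3)[OF \<alpha>])
    show "\<phi> (qbinom (dnum D \<alpha>) (pr D \<mu> \<alpha>) r) = \<phi> (qbinom (dnum D \<alpha>) (pr D \<nu> \<alpha>) r)" for r
      using e[OF UA0_tel_closed[of "qcls D (fkbin D \<alpha> r)" "\<one>\<^bsub>A\<^esub>"]] by (simp only: chi(5)[OF \<alpha>])
  qed
qed

text \<open>If the torus acts on \<open>x\<close> through \<open>\<chi>\<^sub>\<mu>\<close>, then the difference of \<open>\<chi>\<^sub>\<mu>\<close> and \<open>\<chi>\<^sub>\<nu>\<close> kills the component of \<open>x\<close> of weight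
\<open>\<nu>\<close>; the characters differ and \<open>M\<close> is torsion free, so this component vanishes for \<open>\<nu> \<noteq> \<mu>\<close>.\<close>

lemma uweight_urep:
  assumes \<mu>: "\<mu> \<in> weights D"
  shows "uweight D A \<phi> (with_action M urep) \<mu> = wt M \<mu>"
proof -
  have c: "ch \<mu> H \<in> carrier A" if "H \<in> carrier UU0" for \<mu> H by (rule ring_hom_closed[OF chi(1) that])
  have u: "uweight D A \<phi> (with_action M urep) \<mu>
      = {x \<in> carrier M. \<forall>H\<in>carrier UU0. urep (incl0 H) x = ch \<mu> H \<odot> x}"
    unfolding uweight_def using c by (auto simp: with_action_def urep_scal scal_def)
  show ?thesis unfolding u
  proof (intro equalityI subsetI)
    fix x assume "x \<in> wt M \<mu>"
    then show "x \<in> {x \<in> carrier M. \<forall>H\<in>carrier UU0. urep (incl0 H) x = ch \<mu> H \<odot> x}"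
      using urep_torus[OF _ \<mu>] wt_closed(1)[OF \<mu>] by blast
  next
    fix x assume "x \<in> {x \<in> carrier M. \<forall>H\<in>carrier UU0. urep (incl0 H) x = ch \<mu> H \<odot> x}"
    then have x: "x \<in> carrier M" and H: "\<And>H. H \<in> carrier UU0 ==> urep (incl0 H) x = ch \<mu> H \<odot> x"
      by blast+
    have z: "dec x \<nu> = \<zero>" if \<nu>: "\<nu> \<in> weights D" "\<nu> \<noteq> \<mu>" for \<nu>
    proof (rule ccontr)
      assume nz: "dec x \<nu> \<noteq> \<zero>"
      have d: "dec x \<nu> \<in> carrier M" by (rule dec_carrier[OF x \<nu>(1)])
      have "ch \<mu> K = ch \<nu> K" if K: "K \<in> carrier UU0" for K
      proof (rule ccontr)
        assume ne: "ch \<mu> K \<noteq> ch \<nu> K"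
        have "ch \<mu> K \<odot> dec x \<nu> = ch \<nu> K \<odot> dec x \<nu>"
          using dec_urep_torus[OF K \<nu>(1) x] dec_smult[OF x c[OF K] \<nu>(1), of \<mu>] H[OF K] by simp
        then have "(ch \<mu> K \<ominus>\<^bsub>A\<^esub> ch \<nu> K) \<odot> dec x \<nu> = \<zero>"
          using c[OF K] d by (simp add: a_minus_def Mo.smult_l_distr Mo.smult_l_minus Mo.r_neg)
        then show False
          using torsion_free[OF _ _ d, of "ch \<mu> K \<ominus>\<^bsub>A\<^esub> ch \<nu> K"] c[OF K] ne nz by simp
      qed
      then show False using chi_separates[OF \<mu> \<nu>(1)] \<nu>(2) by blast
    qed
    have "x = finsum M (dec x) {\<mu>}"
      by (rule dec_sum[OF x]) (use \<mu> z in auto)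
    also have "\<dots> = dec x \<mu>" using dec_carrier[OF x \<mu>] by simp
    finally show "x \<in> wt M \<mu>" using dec_wt[OF x \<mu>] by simp
  qed
qed

lemma UZ_fdiv: "g \<in> {GE, GF} ==> \<alpha> \<in> simples D ==> qcls D (fdiv D g \<alpha> n) \<in> carrier (UZ D)"
  unfolding UZ_form by (rule form_incl[OF fdiv_U_gens])

lemma urep_div:
  assumes \<alpha>: "\<alpha> \<in> simples D"
  shows "urep (udiv GE \<alpha> n) = Eop \<alpha> n" "urep (udiv GF \<alpha> n) = Fop \<alpha> n"
  using urep_one[OF UZ_fdiv[OF _ \<alpha>]] by (simp_all add: ua_div_def rho_gens(2,3)[OF \<alpha>])

lemma Eop_Emap: "\<mu> \<in> weights D ==> \<alpha> \<in> simples D ==> n > 0 ==> x \<in> wt M \<mu> ==> Eop \<alpha> n x = Emap M \<mu> \<alpha> n x"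
  by (simp add: Eop(2) Emap0_def)

lemma Fop_Fmap:
  "\<mu> \<in> weights D ==> \<alpha> \<in> simples D ==> n > 0 ==> x \<in> wt M (wshift \<mu> n \<alpha>) ==> Fop \<alpha> n x = Fmap M \<mu> \<alpha> n x"
  using Fop(2)[OF _ weights_shift, of \<alpha> \<mu> \<alpha> x n n] by (simp add: Fmap0_def)

lemma urep_adapted: "adapted D A \<phi> M urep"
  unfolding adapted_def by (simp add: uweight_urep urep_div Eop_Emap Fop_Fmap)

lemma fdiv_0: "qcls D (fdiv D g \<alpha> 0) = \<one>\<^bsub>UZ D\<^esub>"
  by (simp add: fdiv_def qfact_def fscal_one UZ_form)

text \<open>The generators \<open>k\<^sub>\<alpha>\<^sup>\<plusminus>\<^sup>1\<close> act on weight vectors through \<open>\<chi>\<^sub>\<mu>\<close>, and divided powers act by the structure maps.\<close>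

lemma urep_unique:
  assumes s: "U_structure D A \<phi> M h" and ad: "adapted D A \<phi> M h" shows "h = urep"
proof -
  have h: "h \<in> ring_hom UU EM" "h \<in> extensional (carrier UU)"
    and hs: "\<And>a x. a \<in> carrier A ==> x \<in> carrier M ==> h (usc a) x = a \<odot> x"
    using s unfolding U_structure_iff[OF Mo.abelian_group_axioms] by blast+
  have sc: "usc a \<in> carrier UU" if "a \<in> carrier A" for a by (rule ring_hom_closed[OF ua_scal_hom that])
  have l: "h u \<in> lend" if u: "u \<in> carrier UU" for u
    unfolding lend_def
  proof (intro CollectI conjI ballI)
    show c: "h u \<in> carrier EM" by (rule ring_hom_closed[OF h(1) u])
    fix a x assume a: "a \<in> carrier A" and x: "x \<in> carrier M"
    have "(h u \<otimes>\<^bsub>EM\<^esub> h (usc a)) x = (h (usc a) \<otimes>\<^bsub>EM\<^esub> h u) x"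
      unfolding ring_hom_mult[OF h(1) u sc[OF a], symmetric] ring_hom_mult[OF h(1) sc[OF a] u, symmetric]
      by (simp only: ua_scal_central[OF u a])
    then show "h u (a \<odot> x) = a \<odot> h u x" using a x by (simp add: endo_simps hs endo_closed[OF c])
  qed
  have tc: "tel (qcls D s) \<one>\<^bsub>A\<^esub> \<in> carrier UU" if "s \<in> U_gens D" for s
    by (rule UA_tel_closed)
  have torus: "h (tel u \<one>\<^bsub>A\<^esub>) x = ch \<mu> (tel0 u \<one>\<^bsub>A\<^esub>) \<odot> x"
    if u: "u \<in> carrier (UZ0 D)" and \<mu>: "\<mu> \<in> weights D" and x: "x \<in> wt M \<mu>" for u \<mu> x
  proof -
    have H: "tel0 u \<one>\<^bsub>A\<^esub> \<in> carrier UU0" by (rule UA0_tel_closed)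
    have "x \<in> uweight D A \<phi> (with_action M h) \<mu>" using ad \<mu> x by (simp add: adapted_def)
    then have "h (incl0 (tel0 u \<one>\<^bsub>A\<^esub>)) x = h (usc (ch \<mu> (tel0 u \<one>\<^bsub>A\<^esub>))) x"
      using H by (simp add: uweight_def with_action_def)
    then show ?thesis
      using hs[OF ring_hom_closed[OF chi(1) H] wt_closed(1)[OF \<mu> x]] ua0_incl(2)[OF u A.one_closed] by simp
  qed
  have one: "h (tel \<one>\<^bsub>UZ D\<^esub> \<one>\<^bsub>A\<^esub>) = \<one>\<^bsub>EM\<^esub>"
    using UA_tel_one ring_hom_one[OF h(1)] by simp
  have "h x = urep x" if "x \<in> carrier UU" for x
  proof (rule UA_induct[OF that])
    fix a assume a: "a \<in> carrier A"
    show "h (tel \<one>\<^bsub>UZ D\<^esub> a) = urep (tel \<one>\<^bsub>UZ D\<^esub> a)"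
      unfolding ua_scal_def[symmetric] urep_scal[OF a]
      by (rule endo_eqI[where M = M, OF lend_endo[OF l[OF sc[OF a]]] lend_endo[OF scal_lend[OF a]]]) (simp add: hs a scal_def)
  next
    fix s assume s: "s \<in> U_gens D"
    have sU: "qcls D s \<in> carrier (UZ D)" unfolding UZ_form by (rule form_incl[OF s])
    show "h (tel (qcls D s) \<one>\<^bsub>A\<^esub>) = urep (tel (qcls D s) \<one>\<^bsub>A\<^esub>)"
      unfolding urep_one[OF sU]
    proof (rule lend_eqI[OF l[OF tc[OF s]] rho_lend[OF sU]])
      fix \<mu> x assume \<mu>: "\<mu> \<in> weights D" and x: "x \<in> wt M \<mu>"
      have xc: "x \<in> carrier M" by (rule wt_closed(1)[OF \<mu> x])
      consider (K) \<alpha> where "\<alpha> \<in> simples D" "s = fK D \<alpha>" | (L) \<alpha> where "\<alpha> \<in> simples D" "s = fL D \<alpha>"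
        | (E) \<alpha> n where "\<alpha> \<in> simples D" "s = fdiv D GE \<alpha> n" | (F) \<alpha> n where "\<alpha> \<in> simples D" "s = fdiv D GF \<alpha> n"
        using s by (auto simp: U_gens_def)
      then show "h (tel (qcls D s) \<one>\<^bsub>A\<^esub>) x = rho (qcls D s) x"
      proof cases
        case K
        show ?thesis unfolding K(2) torus[OF UZ0_gens(1)[OF K(1)] \<mu> x] rho_gens(4)[OF K(1)] Kop(2)[OF \<mu> x] chi(3)[OF K(1)] by simp
      next
        case L
        show ?thesis unfolding L(2) torus[OF UZ0_gens(2)[OF L(1)] \<mu> x] rho_gens(5)[OF L(1)] Kop(2)[OF \<mu> x] chi(4)[OF L(1)] by simp
      next
        case E
        show ?thesis
        proof (cases "n = 0")
          case True
          show ?thesis unfolding E(2) True fdiv_0 one ring_hom_one[OF rho_hom] ..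
        next
          case False
          then have "Emap M \<mu> \<alpha> n x = h (udiv GE \<alpha> n) x" using ad \<mu> E(1) x by (simp add: adapted_def)
          then show ?thesis
            unfolding E(2) rho_gens(2)[OF E(1)] using Eop_Emap[OF \<mu> E(1) _ x, of n] False by (simp add: ua_div_def)
        qed
      next
        case F
        show ?thesis
        proof (cases "n = 0")
          case True
          show ?thesis unfolding F(2) True fdiv_0 one ring_hom_one[OF rho_hom] ..
        next
          case False
          let ?\<nu> = "\<mu> - real n *\<^sub>R \<alpha>"
          have \<nu>: "?\<nu> \<in> weights D" "x \<in> wt M (wshift ?\<nu> n \<alpha>)" using weights_unshift[OF \<mu> F(1)] x by simp_all
          then have "Fmap M ?\<nu> \<alpha> n x = h (udiv GF \<alpha> n) x" using ad False F(1) unfolding adapted_def by blast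
          then show ?thesis
            unfolding F(2) rho_gens(3)[OF F(1)] using Fop_Fmap[OF \<nu>(1) F(1) _ \<nu>(2)] False by (simp add: ua_div_def)
        qed
      qed
    qed
  next
    fix x y assume "x \<in> carrier UU" "y \<in> carrier UU" "h x = urep x" "h y = urep y"
    then show "h (x \<oplus>\<^bsub>UU\<^esub> y) = urep (x \<oplus>\<^bsub>UU\<^esub> y)" "h (x \<otimes>\<^bsub>UU\<^esub> y) = urep (x \<otimes>\<^bsub>UU\<^esub> y)"
      using h(1) urep_hom by (simp_all add: ring_hom_add ring_hom_mult)
  qed
  then show ?thesis using h(2) urep_ext by (intro extensionalityI[where A = "carrier UU"]) simp_all
qed

end

section \<open>Independence of values outside the domains\<close>

text \<open>Two records can describe the same module although their scalar multiplications differ outside of the domains, where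
the values are arbitrary. All conditions on modules and on objects of \<open>\<X>\<close> are invariant under such changes; for
objects, \<open>xagree\<close> extends the comparison to the structure maps.\<close>

definition agree :: "('a, 'p) ring_scheme => ('a, 'm, 'q) module_scheme => ('a, 'm, 'r) module_scheme => bool" where
  "agree A M N \<longleftrightarrow> carrier N = carrier M \<and> add N = add M \<and> ring.zero N = ring.zero M \<and>
    (\<forall>a\<in>carrier A. \<forall>x\<in>carrier M. a \<odot>\<^bsub>N\<^esub> x = a \<odot>\<^bsub>M\<^esub> x)"

lemma agree_sub: "agree A M N ==> W \<subseteq> carrier M ==> agree A (M\<lparr>carrier := W\<rparr>) (N\<lparr>carrier := W\<rparr>)"
  unfolding agree_def by auto

lemma agree_finsum: "agree A M N ==> finsum N f S = finsum M f S"
  unfolding agree_def by (simp add: finsum_def finprod_def)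

lemma agree_a_inv: "agree A M N ==> \<ominus>\<^bsub>N\<^esub> x = \<ominus>\<^bsub>M\<^esub> x"
  unfolding agree_def by (simp add: a_inv_def m_inv_def)

lemma agree_module:
  assumes M: "module A M" and ag: "agree A M N" shows "module A N"
proof -
  interpret M: module A M by (rule M)
  note e = ag[unfolded agree_def]
  show ?thesis
  proof (rule moduleI)
    show "abelian_group N" by (rule abelian_group_transfer[OF M.abelian_group_axioms]) (use e in simp_all)
  qed (use e M.R.is_cring in \<open>simp_all add: M.smult_l_distr M.smult_r_distr M.smult_assoc1\<close>)
qed

lemma agree_submodule:
  assumes M: "module A M" and ag: "agree A M N" and W: "submodule W A M" shows "submodule W A N"
proof -
  interpret M: module A M by (rule M)
  note e = ag[unfolded agree_def]
  note s = M.submoduleE[OF W]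
  show ?thesis
    by (rule module.submoduleI[OF agree_module[OF M ag]])
      (use e s subgroup.one_closed[OF submodule.axioms(1)[OF W]] in \<open>auto simp: agree_a_inv[OF ag]\<close>)
qed

lemma agree_direct_sum:
  assumes M: "module A M" and ag: "agree A M N" and W: "\<And>i. i \<in> I ==> W' i = W i"
    and ids: "internal_direct_sum A M I W" shows "internal_direct_sum A N I W'"
proof -
  have P: "(\<Pi>\<^sub>E i\<in>I. W' i) = (\<Pi>\<^sub>E i\<in>I. W i)" by (rule PiE_cong) (rule W)
  have z: "ring.zero N = ring.zero M" "carrier N = carrier M" using ag by (simp_all add: agree_def)
  show ?thesis
    using ids agree_submodule[OF M ag]
    unfolding internal_direct_sum_def P z agree_finsum[OF ag] by (simp add: W)
qed

lemma agree_finsum_smult: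
  assumes M: "module A M" and ag: "agree A M N" and S: "S \<subseteq> carrier M" and c: "\<And>s. s \<in> S ==> c s \<in> carrier A"
  shows "finsum N (\<lambda>s. c s \<odot>\<^bsub>N\<^esub> s) S = finsum M (\<lambda>s. c s \<odot>\<^bsub>M\<^esub> s) S"
proof -
  interpret M: module A M by (rule M)
  show ?thesis unfolding agree_finsum[OF ag]
    by (rule M.add.finprod_cong'[OF refl]) (use S c ag in \<open>auto simp: agree_def\<close>)
qed

lemma agree_fg:
  assumes M: "module A M" and ag: "agree A M N" and fg: "fg_module A M" shows "fg_module A N"
proof -
  have z: "carrier N = carrier M" using ag by (simp add: agree_def)
  obtain S where S: "S \<subseteq> carrier M" "finite S"
    "\<forall>x\<in>carrier M. \<exists>c\<in>S \<rightarrow> carrier A. x = finsum M (\<lambda>s. c s \<odot>\<^bsub>M\<^esub> s) S"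
    using fg unfolding fg_module_def by blast
  show ?thesis unfolding fg_module_def z
  proof (intro exI[of _ S] conjI ballI S)
    fix x assume "x \<in> carrier M"
    then obtain c where c: "c \<in> S \<rightarrow> carrier A" "x = finsum M (\<lambda>s. c s \<odot>\<^bsub>M\<^esub> s) S" using S(3) by blast
    have "finsum N (\<lambda>s. c s \<odot>\<^bsub>N\<^esub> s) S = finsum M (\<lambda>s. c s \<odot>\<^bsub>M\<^esub> s) S"
      by (rule agree_finsum_smult[OF M ag S(1)]) (use c(1) in auto)
    then show "\<exists>c\<in>S \<rightarrow> carrier A. x = finsum N (\<lambda>s. c s \<odot>\<^bsub>N\<^esub> s) S"
      using c by (intro bexI[of _ c]) simp_all
  qed
qed

lemma agree_free:
  assumes M: "module A M" and ag: "agree A M N" and fr: "free_module A M" shows "free_module A N"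
proof -
  have z: "carrier N = carrier M" using ag by (simp add: agree_def)
  obtain B where B: "B \<subseteq> carrier M" and u: "\<forall>x\<in>carrier M. \<exists>!c. c \<in> B \<rightarrow>\<^sub>E carrier A \<and> finite {b\<in>B. c b \<noteq> \<zero>\<^bsub>A\<^esub>} \<and>
      x = finsum M (\<lambda>b. c b \<odot>\<^bsub>M\<^esub> b) {b\<in>B. c b \<noteq> \<zero>\<^bsub>A\<^esub>}"
    using fr unfolding free_module_def by blast
  have e: "(c \<in> B \<rightarrow>\<^sub>E carrier A \<and> finite {b\<in>B. c b \<noteq> \<zero>\<^bsub>A\<^esub>} \<and> x = finsum N (\<lambda>b. c b \<odot>\<^bsub>N\<^esub> b) {b\<in>B. c b \<noteq> \<zero>\<^bsub>A\<^esub>})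
    \<longleftrightarrow> (c \<in> B \<rightarrow>\<^sub>E carrier A \<and> finite {b\<in>B. c b \<noteq> \<zero>\<^bsub>A\<^esub>} \<and> x = finsum M (\<lambda>b. c b \<odot>\<^bsub>M\<^esub> b) {b\<in>B. c b \<noteq> \<zero>\<^bsub>A\<^esub>})" for c x
  proof -
    have "finsum N (\<lambda>b. c b \<odot>\<^bsub>N\<^esub> b) {b\<in>B. c b \<noteq> \<zero>\<^bsub>A\<^esub>} = finsum M (\<lambda>b. c b \<odot>\<^bsub>M\<^esub> b) {b\<in>B. c b \<noteq> \<zero>\<^bsub>A\<^esub>}"
      if "c \<in> B \<rightarrow>\<^sub>E carrier A" by (rule agree_finsum_smult[OF M ag]) (use that B in auto)
    then show ?thesis by auto
  qed
  show ?thesis unfolding free_module_def z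
    by (intro exI[of _ B] conjI B, unfold e) (rule u)
qed

lemma agree_torsion: "agree A M N ==> torsion_module A M ==> torsion_module A N"
  unfolding agree_def torsion_module_def by auto

lemma agree_lin_maps:
  assumes "agree A M M'" "agree A N N'" and f: "\<And>x. x \<in> carrier M ==> f' x = f x" and M: "module A M"
    and l: "f \<in> lin_maps A M N" shows "f' \<in> lin_maps A M' N'"
proof -
  interpret M: module A M by (rule M)
  note e = assms(1,2)[unfolded agree_def]
  have c: "f x \<in> carrier N" if "x \<in> carrier M" for x using l that by (auto simp: lin_maps_def)
  show ?thesis using l c unfolding lin_maps_def by (simp add: e f Pi_iff)
qed

lemma agree_quot:
  assumes ag: "agree A P Q" and H: "\<And>h x. h \<in> H ==> x \<in> carrier P ==> h \<oplus>\<^bsub>P\<^esub> x \<in> carrier P"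
  shows "agree A (quot_module P H) (quot_module Q H)"
proof -
  note e = ag[unfolded agree_def]
  have r: "H +>\<^bsub>Q\<^esub> x = H +>\<^bsub>P\<^esub> x" for x by (simp add: a_r_coset_def' e)
  have R: "a_rcosets\<^bsub>Q\<^esub> H = a_rcosets\<^bsub>P\<^esub> H" by (simp add: A_RCOSETS_def' r e)
  have s: "set_add Q = set_add P" by (simp add: set_add_def set_mult_def e fun_eq_iff)
  have m: "(\<Union>x\<in>C. H +>\<^bsub>Q\<^esub> (a \<odot>\<^bsub>Q\<^esub> x)) = (\<Union>x\<in>C. H +>\<^bsub>P\<^esub> (a \<odot>\<^bsub>P\<^esub> x))"
    if a: "a \<in> carrier A" and C: "C \<in> a_rcosets\<^bsub>P\<^esub> H" for a C
  proof (rule SUP_cong[OF refl])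
    fix x assume "x \<in> C"
    then have "x \<in> carrier P" using C H by (auto simp: A_RCOSETS_def' a_r_coset_def')
    then show "H +>\<^bsub>Q\<^esub> (a \<odot>\<^bsub>Q\<^esub> x) = H +>\<^bsub>P\<^esub> (a \<odot>\<^bsub>P\<^esub> x)" using e a by (simp add: r)
  qed
  show ?thesis unfolding agree_def using m by (simp add: quot_module_def R s)
qed

definition xagree :: "'v::real_vector root_datum => 'a ring => ('a, 'm, 'v) xobj => ('a, 'm, 'v) xobj => bool" where
  "xagree D A M N \<longleftrightarrow> agree A M N \<and> (\<forall>\<mu>\<in>weights D. wt N \<mu> = wt M \<mu>) \<and>
    (\<forall>\<mu>\<in>weights D. \<forall>\<alpha>\<in>simples D. \<forall>n>0. (\<forall>x\<in>wt M \<mu>. Emap N \<mu> \<alpha> n x = Emap M \<mu> \<alpha> n x) \<and>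
      (\<forall>x\<in>wt M (wshift \<mu> n \<alpha>). Fmap N \<mu> \<alpha> n x = Fmap M \<mu> \<alpha> n x))"

context xmod
begin

lemma Emap_wt: "\<mu> \<in> weights D ==> \<alpha> \<in> simples D ==> n > 0 ==> x \<in> wt M \<mu> ==> Emap M \<mu> \<alpha> n x \<in> wt M (wshift \<mu> n \<alpha>)"
  using Emap0_props(1)[of \<mu> \<alpha> x n] by (simp add: Emap0_def)

lemma Fmap_wt: "\<mu> \<in> weights D ==> \<alpha> \<in> simples D ==> n > 0 ==> x \<in> wt M (wshift \<mu> n \<alpha>) ==> Fmap M \<mu> \<alpha> n x \<in> wt M \<mu>"
  using Fmap0_props(1)[of \<mu> \<alpha> x n] by (simp add: Fmap0_def)

lemma wspace_module: "\<mu> \<in> weights D ==> module A (wspace M \<mu>)"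
  by (rule submodule.submodule_is_module[OF wt_submodule module_M])

context
  fixes N assumes ag: "xagree D A M N"
begin

lemma ag_mod: "agree A M N"
  and ag_wt: "\<mu> \<in> weights D ==> wt N \<mu> = wt M \<mu>"
  and ag_E: "\<mu> \<in> weights D ==> \<alpha> \<in> simples D ==> n > 0 ==> x \<in> wt M \<mu> ==> Emap N \<mu> \<alpha> n x = Emap M \<mu> \<alpha> n x"
  and ag_F: "\<mu> \<in> weights D ==> \<alpha> \<in> simples D ==> n > 0 ==> x \<in> wt M (wshift \<mu> n \<alpha>) ==> Fmap N \<mu> \<alpha> n x = Fmap M \<mu> \<alpha> n x"
  using ag by (simp_all add: xagree_def)

lemma ag_E0: "\<mu> \<in> weights D ==> \<alpha> \<in> simples D ==> x \<in> wt M \<mu> ==> Emap0 N \<mu> \<alpha> n x = Emap0 M \<mu> \<alpha> n x"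
  and ag_F0: "\<mu> \<in> weights D ==> \<alpha> \<in> simples D ==> x \<in> wt M (wshift \<mu> n \<alpha>) ==> Fmap0 N \<mu> \<alpha> n x = Fmap0 M \<mu> \<alpha> n x"
  using ag_E ag_F by (simp_all add: Emap0_def Fmap0_def)

lemma ag_simps:
  "carrier N = carrier M" "ring.zero N = ring.zero M" "add N = add M"
  "a \<in> carrier A ==> x \<in> carrier M ==> a \<odot>\<^bsub>N\<^esub> x = a \<odot> x"
  using ag_mod by (simp_all add: agree_def)

lemma ag_wspace: "\<mu> \<in> weights D ==> agree A (wspace M \<mu>) (wspace N \<mu>)"
  using agree_sub[OF ag_mod, of "wt M \<mu>"] wt_closed(1)[of \<mu>] by (auto simp: ag_wt)

lemma ag_graded_data: "graded_data D A N"
  unfolding graded_data_def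
proof (intro conjI ballI allI impI)
  show "module A N" by (rule agree_module[OF module_M ag_mod])
  show "internal_direct_sum A N (weights D) (wt N)" by (rule agree_direct_sum[OF module_M ag_mod ag_wt ids])
  fix \<mu> \<alpha> and n :: nat assume \<mu>: "\<mu> \<in> weights D" and \<alpha>: "\<alpha> \<in> simples D" and n: "n > 0"
  note \<nu> = weights_shift[OF \<mu> \<alpha>, of n]
  have l: "Emap M \<mu> \<alpha> n \<in> lin_maps A (wspace M \<mu>) (wspace M (wshift \<mu> n \<alpha>))"
    "Fmap M \<mu> \<alpha> n \<in> lin_maps A (wspace M (wshift \<mu> n \<alpha>)) (wspace M \<mu>)"
    using gd \<mu> \<alpha> n by (simp_all add: graded_data_def)
  show "Emap N \<mu> \<alpha> n \<in> lin_maps A (wspace N \<mu>) (wspace N (wshift \<mu> n \<alpha>))"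
    by (rule agree_lin_maps[OF ag_wspace[OF \<mu>] ag_wspace[OF \<nu>] _ wspace_module[OF \<mu>] l(1)]) (simp add: ag_E[OF \<mu> \<alpha> n])
  show "Fmap N \<mu> \<alpha> n \<in> lin_maps A (wspace N (wshift \<mu> n \<alpha>)) (wspace N \<mu>)"
    by (rule agree_lin_maps[OF ag_wspace[OF \<nu>] ag_wspace[OF \<mu>] _ wspace_module[OF \<nu>] l(2)]) (simp add: ag_F[OF \<mu> \<alpha> n])
qed

lemma ag_X1: "X1 D A N"
proof -
  have "{\<mu>\<in>weights D. wt N \<mu> \<noteq> {\<zero>\<^bsub>N\<^esub>}} = {\<mu>\<in>weights D. wt M \<mu> \<noteq> {\<zero>}}" using ag_wt ag_simps(2) by auto
  then show ?thesis using x1 agree_fg[OF wspace_module ag_wspace] unfolding X1_def by simp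
qed

lemma ag_X2: "X2 D \<phi> N"
  unfolding X2_def
proof (intro ballI allI impI conjI)
  fix \<mu> \<alpha> \<beta> and m n :: nat and x
  assume \<mu>: "\<mu> \<in> weights D" and \<alpha>: "\<alpha> \<in> simples D" and \<beta>: "\<beta> \<in> simples D" and m: "m > 0" and n: "n > 0"
    and xN: "x \<in> wt N (wshift \<mu> n \<beta>)"
  note \<nu> = weights_shift[OF \<mu> \<beta>, of n]
  have x: "x \<in> wt M (wshift \<mu> n \<beta>)" using xN ag_wt[OF \<nu>] by simp
  have F: "Fmap N \<mu> \<beta> n x = Fmap M \<mu> \<beta> n x" by (rule ag_F[OF \<mu> \<beta> n x])
  have EF: "Emap N \<mu> \<alpha> m (Fmap N \<mu> \<beta> n x) = Emap M \<mu> \<alpha> m (Fmap M \<mu> \<beta> n x)"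
    unfolding F by (rule ag_E[OF \<mu> \<alpha> m Fmap_wt[OF \<mu> \<beta> n x]])
  show "Emap N \<mu> \<alpha> m (Fmap N \<mu> \<beta> n x) = Fmap N (wshift \<mu> m \<alpha>) \<beta> n (Emap N (wshift \<mu> n \<beta>) \<alpha> m x)" if "\<alpha> \<noteq> \<beta>"
  proof -
    have w: "wshift (wshift \<mu> n \<beta>) m \<alpha> = wshift (wshift \<mu> m \<alpha>) n \<beta>" by simp
    have E: "Emap N (wshift \<mu> n \<beta>) \<alpha> m x = Emap M (wshift \<mu> n \<beta>) \<alpha> m x" by (rule ag_E[OF \<nu> \<alpha> m x])
    have "Emap M (wshift \<mu> n \<beta>) \<alpha> m x \<in> wt M (wshift (wshift \<mu> m \<alpha>) n \<beta>)" using Emap_wt[OF \<nu> \<alpha> m x] unfolding w .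
    from ag_F[OF weights_shift[OF \<mu> \<alpha>] \<beta> n this] show ?thesis
      unfolding EF E using x2 \<mu> \<alpha> \<beta> m n x that by (simp add: X2_def)
  qed
  assume ab: "\<alpha> = \<beta>"
  show "Emap N \<mu> \<alpha> m (Fmap N \<mu> \<alpha> n x)
          = finsum N (\<lambda>r. \<phi> (qbinom (dnum D \<alpha>) (pr D \<mu> \<alpha> + int m + int n) r) \<odot>\<^bsub>N\<^esub>
                Fmap0 N (wshift \<mu> m \<alpha>) \<alpha> (n - r) (Emap0 N (wshift \<mu> n \<alpha>) \<alpha> (m - r) x)) {0..min m n}"
    (is "_ = finsum N ?f _")
  proof -
    let ?g = "\<lambda>r. \<phi> (qbinom (dnum D \<alpha>) (pr D \<mu> \<alpha> + int m + int n) r) \<odot>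
                Fmap0 M (wshift \<mu> m \<alpha>) \<alpha> (n - r) (Emap0 M (wshift \<mu> n \<alpha>) \<alpha> (m - r) x)"
    have t: "?g r \<in> carrier M \<and> ?f r = ?g r" if r: "r \<in> {0..min m n}" for r
    proof -
      have w: "wshift (wshift \<mu> n \<alpha>) (m - r) \<alpha> = wshift (wshift \<mu> m \<alpha>) (n - r) \<alpha>"
        using r by (simp add: of_nat_diff scaleR_left_diff_distrib)
      have E: "Emap0 N (wshift \<mu> n \<alpha>) \<alpha> (m - r) x = Emap0 M (wshift \<mu> n \<alpha>) \<alpha> (m - r) x"
        using ag_E0[OF \<nu> \<alpha> x] ab by simp
      have Ew: "Emap0 M (wshift \<mu> n \<alpha>) \<alpha> (m - r) x \<in> wt M (wshift (wshift \<mu> m \<alpha>) (n - r) \<alpha>)"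
        using Emap0_props(1)[OF \<nu> \<alpha> x, of "m - r"] unfolding ab[symmetric] w .
      have Fw: "Fmap0 M (wshift \<mu> m \<alpha>) \<alpha> (n - r) (Emap0 M (wshift \<mu> n \<alpha>) \<alpha> (m - r) x) \<in> carrier M"
        by (rule wt_closed(1)[OF weights_shift[OF \<mu> \<alpha>] Fmap0_props(1)[OF weights_shift[OF \<mu> \<alpha>] \<alpha> Ew]])
      show ?thesis unfolding E ag_F0[OF weights_shift[OF \<mu> \<alpha>] \<alpha> Ew]
        using Fw qbinom_Laurent[OF dnum_pos[OF \<alpha>]] by (simp add: ag_simps)
    qed
    have "finsum N ?f {0..min m n} = finsum M ?g {0..min m n}"
      unfolding agree_finsum[OF ag_mod] by (rule Mo.add.finprod_cong'[OF refl]) (use t in auto)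
    then show ?thesis using EF x2 \<mu> \<alpha> m n x unfolding ab[symmetric] X2_def by simp
  qed
qed

lemma ag_imF: assumes \<mu>: "\<mu> \<in> weights D" shows "imF D N \<mu> = imF D M \<mu>"
proof -
  have c: "carrier (Mdelta D N \<mu>) = carrier (Mdelta D M \<mu>)"
  proof -
    have "(\<Pi>\<^sub>E i\<in>didx D. carrier (case i of (\<alpha>, n) => wspace N (wshift \<mu> n \<alpha>)))
        = (\<Pi>\<^sub>E i\<in>didx D. carrier (case i of (\<alpha>, n) => wspace M (wshift \<mu> n \<alpha>)))"
      by (rule PiE_cong) (use ag_wt weights_shift[OF \<mu>] in \<open>auto simp: didx_def\<close>)
    then show ?thesis unfolding Mdelta_def dsum_module_def by (auto simp: ag_simps case_prod_beta')
  qed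
  have "Frow D N \<mu> g = Frow D M \<mu> g" if g: "g \<in> carrier (Mdelta D M \<mu>)" for g
    unfolding Frow_def agree_finsum[OF ag_mod] ag_simps(2)
  proof (rule Mo.add.finprod_cong'[OF refl])
    have gw: "g (\<alpha>, n) \<in> wt M (wshift \<mu> n \<alpha>)" if "\<alpha> \<in> simples D" "n > 0" for \<alpha> n
    proof -
      have "(\<alpha>, n) \<in> didx D" using that by (simp add: didx_def)
      then show ?thesis using g by (auto simp: Mdelta_def dsum_module_def PiE_def Pi_iff)
    qed
    then show "(\<lambda>(\<alpha>, n). Fmap M \<mu> \<alpha> n (g (\<alpha>, n))) \<in> {i \<in> didx D. g i \<noteq> \<zero>} \<rightarrow> carrier M"
      using Fmap_wt[OF \<mu>] wt_closed(1)[OF \<mu>] by (auto simp: didx_def)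
    show "(case i of (\<alpha>, n) => Fmap N \<mu> \<alpha> n (g (\<alpha>, n))) = (case i of (\<alpha>, n) => Fmap M \<mu> \<alpha> n (g (\<alpha>, n)))"
      if "i \<in> {i \<in> didx D. g i \<noteq> \<zero>}" for i
      using that gw ag_F[OF \<mu>] by (auto simp: didx_def)
  qed
  then show ?thesis unfolding imF_def c by (rule image_cong[OF refl])
qed

lemma ag_X3: assumes x3: "X3 D A M" shows "X3 D A N"
  unfolding X3_def
proof (intro ballI conjI)
  fix \<mu> assume \<mu>: "\<mu> \<in> weights D"
  have Ec: "Ecol D N \<mu> x = Ecol D M \<mu> x" if "x \<in> wt M \<mu>" for x
    using that ag_E[OF \<mu>] by (auto simp: Ecol_def didx_def fun_eq_iff)
  have Ei: "Ecol D N \<mu> x = Ecol D M \<mu> x" if "x \<in> imF D M \<mu>" for x by (rule Ec[OF imF_wt[OF \<mu> that]])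
  have "inj_on (Ecol D M \<mu>) (imF D M \<mu>)" using x3 \<mu> by (simp add: X3_def)
  then show "inj_on (Ecol D N \<mu>) (imF D N \<mu>)" unfolding ag_imF[OF \<mu>] using Ei by (simp cong: inj_on_cong)
  show "free_module A (quot_module (wspace N \<mu>) (imF D N \<mu>))"
    unfolding ag_imF[OF \<mu>]
  proof (rule agree_free[OF quot_module_module(1)[OF wspace_module[OF \<mu>] imF_submodule[OF \<mu>]] agree_quot[OF ag_wspace[OF \<mu>]]])
    show "h \<oplus>\<^bsub>wspace M \<mu>\<^esub> x \<in> carrier (wspace M \<mu>)" if "h \<in> imF D M \<mu>" "x \<in> carrier (wspace M \<mu>)" for h x
      using that imF_wt[OF \<mu>] wt_closed(2)[OF \<mu>] by simp
    show "free_module A (quot_module (wspace M \<mu>) (imF D M \<mu>))" using x3 \<mu> by (simp add: X3_def)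
  qed
  \<comment> \<open>The columns of both objects agree as functions, but multiplication of arbitrary columns by scalars may differ.\<close>
  let ?P = "(Mdelta D M \<mu>)\<lparr>carrier := Ecol D M \<mu> ` wt M \<mu>\<rparr>" and ?Q = "(Mdelta D N \<mu>)\<lparr>carrier := Ecol D M \<mu> ` wt M \<mu>\<rparr>"
  have im: "Ecol D N \<mu> ` wt N \<mu> = Ecol D M \<mu> ` wt M \<mu>" "Ecol D N \<mu> ` imF D N \<mu> = Ecol D M \<mu> ` imF D M \<mu>"
    unfolding ag_wt[OF \<mu>] ag_imF[OF \<mu>] using Ec Ei by (auto intro: image_cong)
  have Ew: "Ecol D M \<mu> x (\<alpha>, n) \<in> carrier M" if "x \<in> wt M \<mu>" "(\<alpha>, n) \<in> didx D" for x \<alpha> n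
  proof -
    have an: "\<alpha> \<in> simples D" "n > 0" using that(2) by (simp_all add: didx_def)
    show ?thesis using that wt_closed(1)[OF weights_shift[OF \<mu> an(1)] Emap_wt[OF \<mu> an that(1)]] by (simp add: Ecol_def)
  qed
  have aP: "agree A ?P ?Q"
    unfolding agree_def
  proof (intro conjI ballI)
    fix a g assume a: "a \<in> carrier A" and "g \<in> carrier ?P"
    then obtain x where x: "x \<in> wt M \<mu>" "g = Ecol D M \<mu> x" by auto
    show "a \<odot>\<^bsub>?Q\<^esub> g = a \<odot>\<^bsub>?P\<^esub> g"
      unfolding x(2) Mdelta_def dsum_module_def
      by (rule ext) (use Ew[OF x(1)] a in \<open>auto simp: ag_simps restrict_def\<close>)
  qed (simp_all add: Mdelta_def dsum_module_def ag_simps case_prod_beta')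
  have "Ecol D M \<mu> y \<oplus>\<^bsub>?P\<^esub> Ecol D M \<mu> x = Ecol D M \<mu> (y \<oplus> x)" if x: "x \<in> wt M \<mu>" and y: "y \<in> wt M \<mu>" for x y
  proof (rule ext)
    fix i
    have "Emap M \<mu> \<alpha> n (y \<oplus> x) = Emap M \<mu> \<alpha> n y \<oplus> Emap M \<mu> \<alpha> n x" if "\<alpha> \<in> simples D" "n > 0" for \<alpha> n
      using Emap0_props(2)[OF \<mu> that(1) y x, of n] that(2) by (simp add: Emap0_def)
    then show "(Ecol D M \<mu> y \<oplus>\<^bsub>?P\<^esub> Ecol D M \<mu> x) i = Ecol D M \<mu> (y \<oplus> x) i"
      by (cases i) (simp add: Mdelta_def dsum_module_def Ecol_def didx_def)
  qed
  then have "agree A (quot_module ?P (Ecol D M \<mu> ` imF D M \<mu>)) (quot_module ?Q (Ecol D M \<mu> ` imF D M \<mu>))"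
    by (intro agree_quot[OF aP]) (use imF_wt[OF \<mu>] wt_closed(2)[OF \<mu>] in auto)
  moreover have "torsion_module A (quot_module ?P (Ecol D M \<mu> ` imF D M \<mu>))" using x3 \<mu> by (simp add: X3_def)
  ultimately show "torsion_module A (quot_module ((Mdelta D N \<mu>)\<lparr>carrier := Ecol D N \<mu> ` wt N \<mu>\<rparr>) (Ecol D N \<mu> ` imF D N \<mu>))"
    unfolding im by (rule agree_torsion)
qed

end

end

section \<open>The functor from \<open>\<X>\<close> to \<open>\<O>\<close>\<close>

lemma with_action_simps [simp]:
  "carrier (with_action M h) = carrier M" "ring.zero (with_action M h) = ring.zero M" "add (with_action M h) = add M"
  "u \<odot>\<^bsub>with_action M h\<^esub> x = h u x"
  by (simp_all add: with_action_def)

lemma restr_scal_simps [simp]: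
  "carrier (restr_scal D A \<phi> N) = carrier N" "ring.zero (restr_scal D A \<phi> N) = ring.zero N"
  "add (restr_scal D A \<phi> N) = add N" "a \<odot>\<^bsub>restr_scal D A \<phi> N\<^esub> x = ua_scal D A \<phi> a \<odot>\<^bsub>N\<^esub> x"
  by (simp_all add: restr_scal_def)

lemma S_ob_simps [simp]:
  "carrier (S_ob D A \<phi> N) = carrier N" "ring.zero (S_ob D A \<phi> N) = ring.zero N" "add (S_ob D A \<phi> N) = add N"
  "a \<odot>\<^bsub>S_ob D A \<phi> N\<^esub> x = ua_scal D A \<phi> a \<odot>\<^bsub>N\<^esub> x" "wt (S_ob D A \<phi> N) = uweight D A \<phi> N"
  "Emap (S_ob D A \<phi> N) \<mu> \<alpha> n x = ua_div D A \<phi> GE \<alpha> n \<odot>\<^bsub>N\<^esub> x" "Fmap (S_ob D A \<phi> N) \<mu> \<alpha> n x = ua_div D A \<phi> GF \<alpha> n \<odot>\<^bsub>N\<^esub> x"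
  by (simp_all add: S_ob_def module.defs)

lemma xhomD:
  assumes "f \<in> xhom D A M N"
  shows "f \<in> extensional (carrier M)" "x \<in> carrier M ==> f x \<in> carrier N"
    "x \<in> carrier M ==> y \<in> carrier M ==> f (x \<oplus>\<^bsub>M\<^esub> y) = f x \<oplus>\<^bsub>N\<^esub> f y"
    "a \<in> carrier A ==> x \<in> carrier M ==> f (a \<odot>\<^bsub>M\<^esub> x) = a \<odot>\<^bsub>N\<^esub> f x"
    "\<mu> \<in> weights D ==> x \<in> wt M \<mu> ==> f x \<in> wt N \<mu>"
    "\<mu> \<in> weights D ==> \<alpha> \<in> simples D ==> n > 0 ==> x \<in> wt M \<mu> ==> f (Emap M \<mu> \<alpha> n x) = Emap N \<mu> \<alpha> n (f x)"
    "\<mu> \<in> weights D ==> \<alpha> \<in> simples D ==> n > 0 ==> x \<in> wt M (wshift \<mu> n \<alpha>) ==> f (Fmap M \<mu> \<alpha> n x) = Fmap N \<mu> \<alpha> n (f x)"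
  using assms unfolding xhom_def lin_maps_def by (auto simp: image_subset_iff)

lemma xhomI:
  assumes "f \<in> extensional (carrier M)" "\<And>x. x \<in> carrier M ==> f x \<in> carrier N"
    "\<And>x y. x \<in> carrier M ==> y \<in> carrier M ==> f (x \<oplus>\<^bsub>M\<^esub> y) = f x \<oplus>\<^bsub>N\<^esub> f y"
    "\<And>a x. a \<in> carrier A ==> x \<in> carrier M ==> f (a \<odot>\<^bsub>M\<^esub> x) = a \<odot>\<^bsub>N\<^esub> f x"
    "\<And>\<mu> x. \<mu> \<in> weights D ==> x \<in> wt M \<mu> ==> f x \<in> wt N \<mu>"
    "\<And>\<mu> \<alpha> n x. \<mu> \<in> weights D ==> \<alpha> \<in> simples D ==> n > 0 ==> x \<in> wt M \<mu> ==> f (Emap M \<mu> \<alpha> n x) = Emap N \<mu> \<alpha> n (f x)"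
    "\<And>\<mu> \<alpha> n x. \<mu> \<in> weights D ==> \<alpha> \<in> simples D ==> n > 0 ==> x \<in> wt M (wshift \<mu> n \<alpha>) ==> f (Fmap M \<mu> \<alpha> n x) = Fmap N \<mu> \<alpha> n (f x)"
  shows "f \<in> xhom D A M N"
  using assms unfolding xhom_def lin_maps_def by (auto simp: image_subset_iff)

lemma xagree_refl: "xagree D A M M"
  by (simp add: xagree_def agree_def)

context base_change
begin

lemma xagree_sym: assumes "xagree D A M N" shows "xagree D A N M"
  using assms weights_shift unfolding xagree_def agree_def by auto

lemma xhom_comp:
  assumes L: "xmod D A \<phi> L" and f: "f \<in> xhom D A L M" and g: "g \<in> xhom D A M N"
  shows "compose (carrier L) g f \<in> xhom D A L N"
proof -
  interpret L: xmod D A \<phi> L by (rule L)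
  note F = xhomD[OF f] and G = xhomD[OF g]
  have c: "x \<in> wt L \<mu> ==> \<mu> \<in> weights D ==> x \<in> carrier L" for x \<mu> by (rule L.wt_closed(1))
  show ?thesis
  proof (rule xhomI)
    fix \<mu> \<alpha> n x assume *: "\<mu> \<in> weights D" "\<alpha> \<in> simples D" "(n::nat) > 0"
    { assume x: "x \<in> wt L \<mu>"
      show "compose (carrier L) g f (Emap L \<mu> \<alpha> n x) = Emap N \<mu> \<alpha> n (compose (carrier L) g f x)"
        using * x L.wt_closed(1)[OF *(1) x] L.wt_closed(1)[OF weights_shift L.Emap_wt, OF *(1,2) * x]
        by (simp add: compose_eq F G) }
    { assume x: "x \<in> wt L (wshift \<mu> n \<alpha>)"
      show "compose (carrier L) g f (Fmap L \<mu> \<alpha> n x) = Fmap N \<mu> \<alpha> n (compose (carrier L) g f x)"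
        using * x L.wt_closed(1)[OF weights_shift[OF *(1,2)] x] L.wt_closed(1)[OF *(1) L.Fmap_wt[OF * x]]
        by (simp add: compose_eq F G weights_shift) }
  next
    fix \<mu> x assume "\<mu> \<in> weights D" "x \<in> wt L \<mu>"
    then show "compose (carrier L) g f x \<in> wt N \<mu>" by (simp add: compose_eq c F G)
  qed (simp_all add: compose_eq F G)
qed

lemma xhom_transfer:
  assumes M: "xmod D A \<phi> M" and MM: "xagree D A M M'" and NN: "xagree D A N N'" and f: "f \<in> xhom D A M N"
  shows "f \<in> xhom D A M' N'"
proof -
  interpret M: xmod D A \<phi> M by (rule M)
  note F = xhomD[OF f]
  note m = M.ag_simps[OF MM] M.ag_wt[OF MM] M.ag_E[OF MM] M.ag_F[OF MM]
  have n: "carrier N' = carrier N" "add N' = add N" "\<And>a x. a \<in> carrier A ==> x \<in> carrier N ==> a \<odot>\<^bsub>N'\<^esub> x = a \<odot>\<^bsub>N\<^esub> x"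
    "\<And>\<mu>. \<mu> \<in> weights D ==> wt N' \<mu> = wt N \<mu>"
    "\<And>\<mu> \<alpha> n x. \<mu> \<in> weights D ==> \<alpha> \<in> simples D ==> n > 0 ==> x \<in> wt N \<mu> ==> Emap N' \<mu> \<alpha> n x = Emap N \<mu> \<alpha> n x"
    "\<And>\<mu> \<alpha> n x. \<mu> \<in> weights D ==> \<alpha> \<in> simples D ==> n > 0 ==> x \<in> wt N (wshift \<mu> n \<alpha>) ==> Fmap N' \<mu> \<alpha> n x = Fmap N \<mu> \<alpha> n x"
    using NN by (simp_all add: xagree_def agree_def)
  show ?thesis
    by (rule xhomI) (simp_all add: m n F weights_shift)
qed

lemma xhom_id:
  assumes M: "xmod D A \<phi> M" and MM: "xagree D A M M'"
  shows "(\<lambda>x\<in>carrier M. x) \<in> xhom D A M M'"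
proof -
  interpret M: xmod D A \<phi> M by (rule M)
  have "(\<lambda>x\<in>carrier M. x) \<in> xhom D A M M"
  proof (rule xhomI)
    fix \<mu> \<alpha> n x assume *: "\<mu> \<in> weights D" "\<alpha> \<in> simples D" "(n::nat) > 0"
    show "x \<in> wt M \<mu> ==> (\<lambda>x\<in>carrier M. x) (Emap M \<mu> \<alpha> n x) = Emap M \<mu> \<alpha> n ((\<lambda>x\<in>carrier M. x) x)"
      using M.wt_closed(1)[OF *(1)] M.wt_closed(1)[OF weights_shift[OF *(1,2)] M.Emap_wt[OF *]] by simp
    show "x \<in> wt M (wshift \<mu> n \<alpha>) ==> (\<lambda>x\<in>carrier M. x) (Fmap M \<mu> \<alpha> n x) = Fmap M \<mu> \<alpha> n ((\<lambda>x\<in>carrier M. x) x)"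
      using M.wt_closed(1)[OF weights_shift[OF *(1,2)]] M.wt_closed(1)[OF *(1) M.Fmap_wt[OF *]] by simp
  next
    fix \<mu> x assume "\<mu> \<in> weights D" "x \<in> wt M \<mu>"
    then show "(\<lambda>x\<in>carrier M. x) x \<in> wt M \<mu>" using M.wt_closed(1) by simp
  qed simp_all
  then show ?thesis by (rule xhom_transfer[OF M xagree_refl MM])
qed

abbreviation "XA \<equiv> X_cat D A \<phi>"
abbreviation "OA \<equiv> O_cat D A \<phi>"

lemma X_cat_simps:
  "Ob XA = {M. graded_data D A M \<and> X1 D A M \<and> X2 D \<phi> M \<and> X3 D A M}" "Hom XA = xhom D A"
  "Id_mor XA = (\<lambda>M. \<lambda>x\<in>carrier M. x)" "Comp XA = (\<lambda>L M N g f. compose (carrier L) g f)"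
  by (auto simp: X_cat_def Xpre_cat_def)

lemma X_ob: "M \<in> Ob XA ==> xobject D A \<phi> M" "M \<in> Ob XA ==> xmod D A \<phi> M"
  by (simp_all add: X_cat_simps xobject_def xmod_def xmod_axioms_def xobject_axioms_def base_change_axioms)

lemma X_ob_transfer: assumes "M \<in> Ob XA" "xagree D A M N" shows "N \<in> Ob XA"
proof -
  interpret M: xobject D A \<phi> M by (rule X_ob(1)[OF assms(1)])
  show ?thesis
    using M.ag_graded_data[OF assms(2)] M.ag_X1[OF assms(2)] M.ag_X2[OF assms(2)] M.ag_X3[OF assms(2) M.x3]
    by (simp add: X_cat_simps)
qed

lemma compose_id_right: "f \<in> extensional S ==> compose S f (\<lambda>x\<in>S. x) = f"
  by (rule extensionalityI[where A = S]) (auto simp: compose_eq)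

lemma compose_id_left: "f \<in> extensional S ==> (\<And>x. x \<in> S ==> f x \<in> T) ==> compose S (\<lambda>x\<in>T. x) f = f"
  by (rule extensionalityI[where A = S]) (auto simp: compose_eq)

lemma X_is_cat: "is_cat XA"
  unfolding is_cat_def
proof (intro conjI ballI)
  fix x assume x: "x \<in> Ob XA"
  show "Id_mor XA x \<in> Hom XA x x" using xhom_id[OF X_ob(2)[OF x] xagree_refl] by (simp add: X_cat_simps)
  fix y f assume y: "y \<in> Ob XA" and f: "f \<in> Hom XA x y"
  note F = xhomD[of f D A x y]
  show "Comp XA x x y f (Id_mor XA x) = f" "Comp XA x y y (Id_mor XA y) f = f"
    using f F(1,2) by (simp_all add: X_cat_simps compose_id_right compose_id_left)
next
  fix x y z f g assume "x \<in> Ob XA" "y \<in> Ob XA" "z \<in> Ob XA" "f \<in> Hom XA x y" "g \<in> Hom XA y z"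
  then show "Comp XA x y z g f \<in> Hom XA x z" using xhom_comp[OF X_ob(2)] by (simp add: X_cat_simps)
next
  fix w x y z f g h assume "f \<in> Hom XA w x"
  then have "f \<in> xhom D A w x" by (simp add: X_cat_simps)
  then show "Comp XA w x z (Comp XA x y z h g) f = Comp XA w y z h (Comp XA w x y g f)"
    using xhomD(2) by (fastforce simp: X_cat_simps compose_def restrict_def)
qed

lemma O_cat_simps:
  "Hom OA = (\<lambda>M N. lin_maps UU M N \<inter> extensional (carrier M))"
  "Id_mor OA = (\<lambda>M. \<lambda>x\<in>carrier M. x)" "Comp OA = (\<lambda>L M N g f. compose (carrier L) g f)"
  by (simp_all add: O_cat_def)

lemma O_ob: "N \<in> Ob OA ==> left_module UU N"
  by (simp add: O_cat_def)

lemma lin_maps_comp: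
  assumes L: "left_module R L" and "f \<in> lin_maps R L M" "g \<in> lin_maps R M N"
  shows "compose (carrier L) g f \<in> lin_maps R L N"
proof -
  interpret L: left_module R L by (rule L)
  show ?thesis using assms(2,3) L.smult_closed by (auto simp: lin_maps_def compose_eq Pi_iff)
qed

lemma O_is_cat: "is_cat OA"
  unfolding is_cat_def
proof (intro conjI ballI)
  fix x assume x: "x \<in> Ob OA"
  interpret left_module "UU" x by (rule O_ob[OF x])
  show "Id_mor OA x \<in> Hom OA x x" using smult_closed by (auto simp: O_cat_simps lin_maps_def)
  fix y f assume y: "y \<in> Ob OA" and f: "f \<in> Hom OA x y"
  then have F: "f \<in> extensional (carrier x)" "\<And>u. u \<in> carrier x ==> f u \<in> carrier y" by (auto simp: O_cat_simps lin_maps_def)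
  show "Comp OA x x y f (Id_mor OA x) = f" "Comp OA x y y (Id_mor OA y) f = f"
    using F by (simp_all add: O_cat_simps compose_id_right compose_id_left)
next
  fix x y z f g assume "x \<in> Ob OA" "y \<in> Ob OA" "z \<in> Ob OA" "f \<in> Hom OA x y" "g \<in> Hom OA y z"
  then show "Comp OA x y z g f \<in> Hom OA x z" by (auto simp: O_cat_simps intro: lin_maps_comp[OF O_ob])
next
  fix w x y z f g h assume "f \<in> Hom OA w x"
  then have "f \<in> carrier w \<rightarrow> carrier x" by (simp add: O_cat_simps lin_maps_def)
  then show "Comp OA w x z (Comp OA x y z h g) f = Comp OA w y z h (Comp OA w x y g f)"
    by (fastforce simp: O_cat_simps compose_def restrict_def)
qed

lemma act_ex1: assumes "M \<in> Ob XA" shows "\<exists>!act. U_structure D A \<phi> M act \<and> adapted D A \<phi> M act"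
proof -
  interpret M: xobject D A \<phi> M by (rule X_ob(1)[OF assms])
  show ?thesis using M.urep_structure M.urep_adapted M.urep_unique by blast
qed

definition Ract :: "('a, 'm, 'v) xobj => ('v, 'a) ualg => 'm => 'm" where
  "Ract M = (THE act. U_structure D A \<phi> M act \<and> adapted D A \<phi> M act)"

lemma Ract: "M \<in> Ob XA ==> U_structure D A \<phi> M (Ract M) \<and> adapted D A \<phi> M (Ract M)"
  unfolding Ract_def by (rule theI'[OF act_ex1])

lemma Ract_urep: "M \<in> Ob XA ==> Ract M = xobject.urep D A \<phi> M"
  by (rule xobject.urep_unique[OF X_ob(1)]) (use Ract in auto)

lemma S_agree: assumes "M \<in> Ob XA" shows "xagree D A M (S_ob D A \<phi> (with_action M (Ract M)))"
proof -
  interpret M: xobject D A \<phi> M by (rule X_ob(1)[OF assms])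
  show ?thesis unfolding Ract_urep[OF assms] xagree_def agree_def
    by (simp add: M.uweight_urep M.urep_div M.Eop_Emap M.Fop_Fmap M.urep_scal M.scal_def)
qed

lemma R_ob: assumes M: "M \<in> Ob XA" shows "with_action M (Ract M) \<in> Ob OA"
proof -
  interpret M: xobject D A \<phi> M by (rule X_ob(1)[OF M])
  let ?N = "with_action M M.urep"
  have ag: "agree A M (restr_scal D A \<phi> ?N)"
    by (simp add: agree_def M.urep_scal M.scal_def)
  have w: "uweight D A \<phi> ?N \<mu> = wt M \<mu>" if "\<mu> \<in> weights D" for \<mu> by (rule M.uweight_urep[OF that])
  have ags: "agree A (wspace M \<mu>) ((restr_scal D A \<phi> ?N)\<lparr>carrier := uweight D A \<phi> ?N \<mu>\<rparr>)" if "\<mu> \<in> weights D" for \<mu>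
    using agree_sub[OF ag, of "wt M \<mu>"] M.wt_closed(1)[OF that] w[OF that] by auto
  have "left_module UU ?N" using M.urep_structure by (simp add: U_structure_def)
  moreover have "internal_direct_sum A (restr_scal D A \<phi> ?N) (weights D) (uweight D A \<phi> ?N)"
    by (rule agree_direct_sum[OF M.module_M ag w M.ids])
  moreover have "{\<mu>\<in>weights D. uweight D A \<phi> ?N \<mu> \<noteq> {\<zero>\<^bsub>?N\<^esub>}} = {\<mu>\<in>weights D. wt M \<mu> \<noteq> {\<zero>\<^bsub>M\<^esub>}}"
    using w by auto
  then have "quasi_bounded D {\<mu>\<in>weights D. uweight D A \<phi> ?N \<mu> \<noteq> {\<zero>\<^bsub>?N\<^esub>}}"
    using M.x1 by (simp add: X1_def)
  moreover have "fg_module A ((restr_scal D A \<phi> ?N)\<lparr>carrier := uweight D A \<phi> ?N \<mu>\<rparr>)" if "\<mu> \<in> weights D" for \<mu>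
    by (rule agree_fg[OF M.wspace_module[OF that] ags[OF that]]) (use M.x1 that in \<open>simp add: X1_def\<close>)
  moreover have "torsion_free_module A ((restr_scal D A \<phi> ?N)\<lparr>carrier := uweight D A \<phi> ?N \<mu>\<rparr>)" if "\<mu> \<in> weights D" for \<mu>
    unfolding torsion_free_module_def
    using M.torsion_free M.wt_closed(1)[OF that] by (auto simp: w[OF that] M.urep_scal M.scal_def)
  ultimately show ?thesis unfolding Ract_urep[OF M] by (simp add: O_cat_def)
qed

text \<open>It suffices to test the generators on weight vectors.\<close>

lemma R_hom_intro:
  assumes M: "M \<in> Ob XA" and N: "N \<in> Ob XA" and f: "f \<in> xhom D A M N" and u: "u \<in> carrier UU"
  shows "\<forall>x\<in>carrier M. f (Ract M u x) = Ract N u (f x)"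
proof -
  interpret M: xobject D A \<phi> M by (rule X_ob(1)[OF M])
  interpret N: xobject D A \<phi> N by (rule X_ob(1)[OF N])
  note F = xhomD[OF f]
  have lift: "\<forall>x\<in>carrier M. f (S x) = T (f x)"
    if S: "S \<in> M.lend" and T: "T \<in> N.lend" and w: "\<And>\<mu> x. \<mu> \<in> weights D ==> x \<in> wt M \<mu> ==> f (S x) = T (f x)" for S T
  proof
    fix x assume "x \<in> carrier M"
    then show "f (S x) = T (f x)"
    proof (rule M.wt_induct)
      show "f (S (x \<oplus>\<^bsub>M\<^esub> y)) = T (f (x \<oplus>\<^bsub>M\<^esub> y))" if "x \<in> carrier M" "y \<in> carrier M" "f (S x) = T (f x)" "f (S y) = T (f y)" for x y
        using that by (simp add: M.lend_add[OF S] M.lend_closed[OF S] F(2,3) N.lend_add[OF T])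
      show "f (S \<zero>\<^bsub>M\<^esub>) = T (f \<zero>\<^bsub>M\<^esub>)"
        using F(4)[of "\<zero>\<^bsub>A\<^esub>" "\<zero>\<^bsub>M\<^esub>"] F(2)[of "\<zero>\<^bsub>M\<^esub>"] by (simp add: M.lend_zero[OF S] N.lend_zero[OF T])
    qed (rule w)
  qed
  show ?thesis unfolding Ract_urep[OF M] Ract_urep[OF N]
  proof (rule UA_induct[OF u])
    fix a assume "a \<in> carrier A"
    then show "\<forall>x\<in>carrier M. f (M.urep (tel \<one>\<^bsub>UZ D\<^esub> a) x) = N.urep (tel \<one>\<^bsub>UZ D\<^esub> a) (f x)"
      unfolding ua_scal_def[symmetric] by (simp add: M.urep_scal N.urep_scal M.scal_def N.scal_def F)
  next
    fix s assume s: "s \<in> U_gens D"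
    have sU: "qcls D s \<in> carrier (UZ D)" unfolding UZ_form by (rule form_incl[OF s])
    consider (K) \<alpha> where "\<alpha> \<in> simples D" "s = fK D \<alpha>" | (L) \<alpha> where "\<alpha> \<in> simples D" "s = fL D \<alpha>"
      | (E) \<alpha> n where "\<alpha> \<in> simples D" "s = fdiv D GE \<alpha> n" | (F) \<alpha> n where "\<alpha> \<in> simples D" "s = fdiv D GF \<alpha> n"
      using s by (auto simp: U_gens_def)
    then have "\<forall>x\<in>carrier M. f (M.rho (qcls D s) x) = N.rho (qcls D s) (f x)"
    proof cases
      case K
      show ?thesis unfolding K(2) M.rho_gens(4)[OF K(1)] N.rho_gens(4)[OF K(1)]
        by (rule lift[OF M.Kop(1) N.Kop(1)]) (simp add: M.Kop(2) N.Kop(2) F Laurent_closed M.wt_closed(1))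
    next
      case L
      show ?thesis unfolding L(2) M.rho_gens(5)[OF L(1)] N.rho_gens(5)[OF L(1)]
        by (rule lift[OF M.Kop(1) N.Kop(1)]) (simp add: M.Kop(2) N.Kop(2) F Laurent_closed M.wt_closed(1))
    next
      case E
      show ?thesis unfolding E(2) M.rho_gens(2)[OF E(1)] N.rho_gens(2)[OF E(1)]
      proof (rule lift[OF M.Eop(1)[OF E(1)] N.Eop(1)[OF E(1)]])
        fix \<mu> x assume \<mu>: "\<mu> \<in> weights D" and x: "x \<in> wt M \<mu>"
        show "f (M.Eop \<alpha> n x) = N.Eop \<alpha> n (f x)"
          using M.Eop(2)[OF E(1) \<mu> x] N.Eop(2)[OF E(1) \<mu> F(5)[OF \<mu> x]] F(6)[OF \<mu> E(1) _ x] by (simp add: Emap0_def)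
      qed
    next
      case F
      show ?thesis unfolding F(2) M.rho_gens(3)[OF F(1)] N.rho_gens(3)[OF F(1)]
      proof (rule lift[OF M.Fop(1)[OF F(1)] N.Fop(1)[OF F(1)]])
        fix \<mu> x assume \<mu>: "\<mu> \<in> weights D" and x: "x \<in> wt M \<mu>"
        show "f (M.Fop \<alpha> n x) = N.Fop \<alpha> n (f x)"
          using M.Fop(2)[OF F(1) \<mu> x] N.Fop(2)[OF F(1) \<mu> \<open>\<And>x \<mu>. \<mu> \<in> weights D ==> x \<in> wt M \<mu> ==> f x \<in> wt N \<mu>\<close>[OF \<mu> x]]
            xhomD(7)[OF f weights_unshift[OF \<mu> F(1)] F(1), of n x] x by (simp add: Fmap0_def)
      qed
    qed
    then show "\<forall>x\<in>carrier M. f (M.urep (tel (qcls D s) \<one>\<^bsub>A\<^esub>) x) = N.urep (tel (qcls D s) \<one>\<^bsub>A\<^esub>) (f x)"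
      unfolding M.urep_one[OF sU] N.urep_one[OF sU] .
  next
    fix a b assume ab: "a \<in> carrier UU" "b \<in> carrier UU"
      and P: "\<forall>x\<in>carrier M. f (M.urep a x) = N.urep a (f x)" "\<forall>x\<in>carrier M. f (M.urep b x) = N.urep b (f x)"
    have c: "M.urep a x \<in> carrier M" "M.urep b x \<in> carrier M" if "x \<in> carrier M" for x
      using endo_closed[OF ring_hom_closed[OF M.urep_hom ab(1)] that] endo_closed[OF ring_hom_closed[OF M.urep_hom ab(2)] that] by simp_all
    show "\<forall>x\<in>carrier M. f (M.urep (a \<oplus>\<^bsub>UU\<^esub> b) x) = N.urep (a \<oplus>\<^bsub>UU\<^esub> b) (f x)"
      using P c F(2,3) by (simp add: ring_hom_add[OF M.urep_hom ab] ring_hom_add[OF N.urep_hom ab] endo_simps)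
    show "\<forall>x\<in>carrier M. f (M.urep (a \<otimes>\<^bsub>UU\<^esub> b) x) = N.urep (a \<otimes>\<^bsub>UU\<^esub> b) (f x)"
      using P c F(2) by (simp add: ring_hom_mult[OF M.urep_hom ab] ring_hom_mult[OF N.urep_hom ab] endo_simps)
  qed
qed

text \<open>Conversely, a \<open>U\<^bsub>A\<^esub>\<close>-linear map preserves weight spaces, since these are defined by the action, and commutes with the
structure maps, which are actions of divided powers.\<close>

lemma R_hom:
  assumes M: "M \<in> Ob XA" and N: "N \<in> Ob XA"
  shows "Hom OA (with_action M (Ract M)) (with_action N (Ract N)) = Hom XA M N"
proof (intro equalityI subsetI)
  fix f assume "f \<in> Hom XA M N"
  then have f: "f \<in> xhom D A M N" by (simp add: X_cat_simps)
  show "f \<in> Hom OA (with_action M (Ract M)) (with_action N (Ract N))"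
    using xhomD[OF f] R_hom_intro[OF M N f] by (auto simp: O_cat_simps lin_maps_def)
next
  fix f assume f: "f \<in> Hom OA (with_action M (Ract M)) (with_action N (Ract N))"
  interpret M: xobject D A \<phi> M by (rule X_ob(1)[OF M])
  interpret N: xobject D A \<phi> N by (rule X_ob(1)[OF N])
  have f1: "f \<in> extensional (carrier M)" and f2: "\<And>x. x \<in> carrier M ==> f x \<in> carrier N"
    and f3: "\<And>x y. x \<in> carrier M ==> y \<in> carrier M ==> f (x \<oplus>\<^bsub>M\<^esub> y) = f x \<oplus>\<^bsub>N\<^esub> f y"
    and f4: "\<And>u x. u \<in> carrier UU ==> x \<in> carrier M ==> f (M.urep u x) = N.urep u (f x)"
    using f by (auto simp: O_cat_simps lin_maps_def Ract_urep[OF M] Ract_urep[OF N])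
  have sc: "usc a \<in> carrier UU" if "a \<in> carrier A" for a by (rule ring_hom_closed[OF ua_scal_hom that])
  have dc: "udiv g \<alpha> n \<in> carrier UU" for g \<alpha> n unfolding ua_div_def by (rule UA_tel_closed)
  have w: "f x \<in> wt N \<mu>" if \<mu>: "\<mu> \<in> weights D" and x: "x \<in> wt M \<mu>" for \<mu> x
  proof -
    have xc: "x \<in> carrier M" by (rule M.wt_closed(1)[OF \<mu> x])
    have "x \<in> uweight D A \<phi> (with_action M M.urep) \<mu>" using x M.uweight_urep[OF \<mu>] by simp
    then have "f x \<in> uweight D A \<phi> (with_action N N.urep) \<mu>"
      using f2[OF xc] f4[OF ring_hom_closed[OF ua0_incl(1)] xc] f4[OF sc[OF ring_hom_closed[OF chi(1)]] xc]
      by (auto simp: uweight_def)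
    then show ?thesis using N.uweight_urep[OF \<mu>] by simp
  qed
  have "f \<in> xhom D A M N"
  proof (rule xhomI[OF f1 f2 f3])
    show "f (a \<odot>\<^bsub>M\<^esub> x) = a \<odot>\<^bsub>N\<^esub> f x" if "a \<in> carrier A" "x \<in> carrier M" for a x
      using f4[OF sc[OF that(1)] that(2)] f2[OF that(2)] that by (simp add: M.urep_scal N.urep_scal M.scal_def N.scal_def)
    fix \<mu> \<alpha> n x assume *: "\<mu> \<in> weights D" "\<alpha> \<in> simples D" "(n::nat) > 0"
    { assume x: "x \<in> wt M \<mu>"
      show "f (Emap M \<mu> \<alpha> n x) = Emap N \<mu> \<alpha> n (f x)"
        using f4[OF dc M.wt_closed(1)[OF *(1) x], of GE \<alpha> n] M.Eop_Emap[OF * x] N.Eop_Emap[OF * w[OF *(1) x]]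
        by (simp add: M.urep_div[OF *(2)] N.urep_div[OF *(2)]) }
    { assume x: "x \<in> wt M (wshift \<mu> n \<alpha>)"
      note \<nu> = weights_shift[OF *(1,2), of n]
      show "f (Fmap M \<mu> \<alpha> n x) = Fmap N \<mu> \<alpha> n (f x)"
        using f4[OF dc M.wt_closed(1)[OF \<nu> x], of GF \<alpha> n] M.Fop_Fmap[OF * x] N.Fop_Fmap[OF * w[OF \<nu> x]]
        by (simp add: M.urep_div[OF *(2)] N.urep_div[OF *(2)]) }
  qed (assumption | rule w)+
  then show "f \<in> Hom XA M N" by (simp add: X_cat_simps)
qed

definition R_fun :: "(('a, 'm, 'v) xobj, 'm => 'm, ('v, 'a, 'm) umod, 'm => 'm) fun_data" where
  "R_fun = \<lparr>fob = (\<lambda>M. with_action M (Ract M)), fmor = (\<lambda>M N f. f)\<rparr>"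

lemma R_functor: "is_functor XA OA R_fun"
  unfolding is_functor_def R_fun_def fun_data.select_convs
proof (intro conjI ballI X_is_cat O_is_cat)
  fix M :: "('a, 'm, 'v) xobj" assume M: "M \<in> Ob XA"
  show "with_action M (Ract M) \<in> Ob OA" by (rule R_ob[OF M])
  show "Id_mor XA M = Id_mor OA (with_action M (Ract M))" by (simp add: X_cat_simps O_cat_simps)
  fix N :: "('a, 'm, 'v) xobj" and f assume N: "N \<in> Ob XA" and f: "f \<in> Hom XA M N"
  show "f \<in> Hom OA (with_action M (Ract M)) (with_action N (Ract N))" using f R_hom[OF M N] by simp
qed (simp add: X_cat_simps O_cat_simps)

lemma id_functor: "is_functor XA XA id_fun"
  unfolding is_functor_def id_fun_def using X_is_cat by simp

lemma SR_functor: "is_functor XA XA (comp_fun (S_fun D A \<phi>) R_fun)"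
  unfolding is_functor_def comp_fun_def S_fun_def R_fun_def fun_data.select_convs
proof (intro conjI ballI X_is_cat)
  fix M :: "('a, 'm, 'v) xobj" assume M: "M \<in> Ob XA"
  show "S_ob D A \<phi> (with_action M (Ract M)) \<in> Ob XA" by (rule X_ob_transfer[OF M S_agree[OF M]])
  show "Id_mor XA M = Id_mor XA (S_ob D A \<phi> (with_action M (Ract M)))" by (simp add: X_cat_simps)
  fix N :: "('a, 'm, 'v) xobj" and f assume N: "N \<in> Ob XA" and f: "f \<in> Hom XA M N"
  show "f \<in> Hom XA (S_ob D A \<phi> (with_action M (Ract M))) (S_ob D A \<phi> (with_action N (Ract N)))"
    using f xhom_transfer[OF X_ob(2)[OF M] S_agree[OF M] S_agree[OF N]] by (simp add: X_cat_simps)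
qed (simp add: X_cat_simps)

text \<open>The identity maps form the natural isomorphism.\<close>

lemma SR_iso: "nat_isomorphic XA XA (comp_fun (S_fun D A \<phi>) R_fun) id_fun"
  unfolding nat_isomorphic_def
proof (intro conjI SR_functor id_functor exI[of _ "\<lambda>M. \<lambda>x\<in>carrier M. x"] ballI)
  fix M :: "('a, 'm, 'v) xobj" assume M: "M \<in> Ob XA"
  let ?S = "S_ob D A \<phi> (with_action M (Ract M))"
  have S: "?S \<in> Ob XA" by (rule X_ob_transfer[OF M S_agree[OF M]])
  have i: "(\<lambda>x\<in>carrier M. x) \<in> xhom D A M ?S" by (rule xhom_id[OF X_ob(2)[OF M] S_agree[OF M]])
  have j: "(\<lambda>x\<in>carrier M. x) \<in> xhom D A ?S M"
    using xhom_id[OF X_ob(2)[OF S] xagree_sym[OF S_agree[OF M]]] by simp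
  have "compose (carrier M) (\<lambda>x\<in>carrier M. x) (\<lambda>x\<in>carrier M. x) = (\<lambda>x\<in>carrier M. x)" by (rule compose_id_right) simp
  then show "cat_iso XA (fob (comp_fun (S_fun D A \<phi>) R_fun) M) (fob id_fun M) (\<lambda>x\<in>carrier M. x)"
    unfolding cat_iso_def comp_fun_def S_fun_def R_fun_def id_fun_def fun_data.select_convs
    using i j by (intro conjI bexI[of _ "\<lambda>x\<in>carrier M. x"]) (simp_all add: X_cat_simps)
  fix N :: "('a, 'm, 'v) xobj" and f assume N: "N \<in> Ob XA" and f: "f \<in> Hom XA M N"
  then show "Comp XA (fob (comp_fun (S_fun D A \<phi>) R_fun) M) (fob (comp_fun (S_fun D A \<phi>) R_fun) N) (fob id_fun N)
      (\<lambda>x\<in>carrier N. x) (fmor (comp_fun (S_fun D A \<phi>) R_fun) M N f)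
    = Comp XA (fob (comp_fun (S_fun D A \<phi>) R_fun) M) (fob id_fun M) (fob id_fun N) (fmor id_fun M N f) (\<lambda>x\<in>carrier M. x)"
    using xhomD(1,2)[of f D A M N]
    by (simp add: comp_fun_def S_fun_def R_fun_def id_fun_def X_cat_simps compose_id_left compose_id_right)
qed

end

theorem theorem5p5:
  fixes D :: "'v::real_vector root_datum"
    and A :: "'a ring"
    and \<phi> :: "qrat \<Rightarrow> 'a"
  assumes "root_datum D"
    and "noetherian_domain A"
    and "\<phi> \<in> ring_hom Laurent A"
  shows "(\<forall>M :: ('a, 'm, 'v) xobj. M \<in> Ob (X_cat D A \<phi>) \<longrightarrow>
           (\<exists>!act. U_structure D A \<phi> M act \<and> adapted D A \<phi> M act))
    \<and> (\<exists>R :: (('a, 'm, 'v) xobj, 'm \<Rightarrow> 'm, ('v, 'a, 'm) umod, 'm \<Rightarrow> 'm) fun_data.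
           is_functor (X_cat D A \<phi>) (O_cat D A \<phi>) R
         \<and> (\<forall>M \<in> Ob (X_cat D A \<phi>).
             \<exists>act. U_structure D A \<phi> M act \<and> adapted D A \<phi> M act \<and> fob R M = with_action M act)
         \<and> (\<forall>M \<in> Ob (X_cat D A \<phi>). \<forall>N \<in> Ob (X_cat D A \<phi>).
             \<forall>f \<in> Hom (X_cat D A \<phi>) M N. fmor R M N f = f)
         \<and> fully_faithful (X_cat D A \<phi>) (O_cat D A \<phi>) R
         \<and> nat_isomorphic (X_cat D A \<phi>) (X_cat D A \<phi>) (comp_fun (S_fun D A \<phi>) R) id_fun)"
proof -
  interpret A: domain A using assms(2) by (rule noetherian_domain.axioms(2))
  interpret base_change D A \<phi>
    by unfold_locales (use assms in simp_all)
  show ?thesis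
  proof (intro conjI allI impI exI[of _ R_fun] ballI)
    show "\<exists>!act. U_structure D A \<phi> M act \<and> adapted D A \<phi> M act" if "M \<in> Ob XA" for M :: "('a, 'm, 'v) xobj"
      by (rule act_ex1[OF that])
    show "is_functor XA OA R_fun" by (rule R_functor)
    show "\<exists>act. U_structure D A \<phi> M act \<and> adapted D A \<phi> M act \<and> fob R_fun M = with_action M act" if "M \<in> Ob XA" for M :: "('a, 'm, 'v) xobj"
      using Ract[OF that] by (auto simp: R_fun_def)
    show "fmor R_fun M N f = f" for M N :: "('a, 'm, 'v) xobj" and f by (simp add: R_fun_def)
    show "fully_faithful XA OA R_fun"
      unfolding fully_faithful_def using R_hom by (auto simp: R_fun_def bij_betw_def)
    show "nat_isomorphic XA XA (comp_fun (S_fun D A \<phi>) R_fun) id_fun" by (rule SR_iso)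
  qed
qed

end
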